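(* Let $n\ge5$ be prime, $\mathbb{F}_q$ a finite field with $q\equiv1\pmod n$, and $\psi\in\mathbb{F}_q$ with $\psi\ne0$ and $\psi^n\ne1$. Let $X_\psi\subset\mathbb{P}^{n-1}$ be the hypersurface $x_1^n+\dots+x_n^n-n\psi x_1\cdots x_n=0$. Then \[\#X_\psi(\mathbb{F}_q)=1+q+\dots+q^{n-2}+N_{\mathrm{mirror}}+q^{\frac{n-3}{2}}N_1+q^{\frac{n-5}{2}}N_3+\dots+qN_{n-4},\] where, for each odd $d$ with $1\le d\le n-4$, $N_d$ is a sum (with repetitions allowed) of terms of the form $\#H(\mathbb{F}_q)-(q-1)^{l-1}q^{d+1-l}$, each $H\subset\mathbb{A}^{d+2}$ being an affine variety of dimension $d$ of the form \[\begin{cases} y^n=x_1^{\alpha_1}\cdots x_{d+1}^{\alpha_{d+1}}(1-x_1)^{\beta_1}\cdots(1-x_{l-1})^{\beta_{l-1}}(1-x_l-\dots-x_{d+1})^{\beta_l},\\ \lambda x_1\cdots x_l=1,\end{cases}\] with $\lambda=1/\psi^n$, $2\le l\le d+1$ and integers $\alpha_i,\beta_j\ge1$.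
   Context: $N_{\mathrm{mirror}}=\#Y_\psi(\mathbb{F}_q)-(1+q+\dots+q^{n-2})$, where $Y_\psi$ is the quotient of $X_\psi$ by the group $\{(\zeta_1,\dots,\zeta_n)\in\mathbb{F}_q^n:\zeta_i^n=1,\ \zeta_1\cdots\zeta_n=1\}$ acting by $(x_i)\mapsto(\zeta_ix_i)$ (a model of $Y_\psi$ is $(y_1+\dots+y_n)^n=(n\psi)^ny_1\cdots y_n$). *)

theory Defs
  imports
    "HOL-Algebra.Algebraic_Closure_Type"
    "HOL-Number_Theory.Number_Theory"
    "HOL-Library.Cardinality"
begin

section \<open>Affine and projective space\<close>

text \<open>Coordinates are indexed by \<open>{1..m}\<close>; vectors take the value \<open>undefined\<close> outside
  that range, so that they are determined by their coordinates.\<close>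

definition affine_space :: "nat \<Rightarrow> (nat \<Rightarrow> 'a) set" where
  "affine_space m = ({1..m} \<rightarrow>\<^sub>E UNIV)"

definition nonzero_vectors :: "nat \<Rightarrow> (nat \<Rightarrow> 'a::field) set" where
  "nonzero_vectors m = {x \<in> affine_space m. \<exists>i\<in>{1..m}. x i \<noteq> 0}"

definition proportional :: "nat \<Rightarrow> ((nat \<Rightarrow> 'a::field) \<times> (nat \<Rightarrow> 'a)) set" where
  "proportional m = {(x, y). x \<in> nonzero_vectors m \<and> y \<in> nonzero_vectors m \<and>
     (\<exists>c. c \<noteq> 0 \<and> (\<forall>i\<in>{1..m}. y i = c * x i))}"

text \<open>The rational points of the projective space of dimension \<open>m - 1\<close> over the field \<open>'a\<close>.\<close>

definition proj_space :: "nat \<Rightarrow> (nat \<Rightarrow> 'a::field) set set" where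
  "proj_space m = nonzero_vectors m // proportional m"

section \<open>The Dwork hypersurface and its mirror quotient\<close>

definition dwork_points :: "nat \<Rightarrow> 'a::field \<Rightarrow> (nat \<Rightarrow> 'a) set set" where
  "dwork_points n \<psi> = {P \<in> proj_space n.
     \<forall>x\<in>P. (\<Sum>i=1..n. x i ^ n) - of_nat n * \<psi> * (\<Prod>i=1..n. x i) = 0}"

definition mirror_group :: "nat \<Rightarrow> (nat \<Rightarrow> 'a::field) set" where
  "mirror_group n = {\<zeta> \<in> affine_space n. (\<forall>i\<in>{1..n}. \<zeta> i ^ n = 1) \<and> (\<Prod>i=1..n. \<zeta> i) = 1}"

definition mirror_act ::
    "nat \<Rightarrow> (nat \<Rightarrow> 'a::field) \<Rightarrow> (nat \<Rightarrow> 'a alg_closure) set \<Rightarrow> (nat \<Rightarrow> 'a alg_closure) set" where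
  "mirror_act n \<zeta> P = (\<lambda>x. \<lambda>i\<in>{1..n}. to_ac (\<zeta> i) * x i) ` P"

text \<open>The geometric points of the quotient \<open>Y\<close> are the orbits of the group on the geometric
  points of \<open>X\<close>.\<close>

definition mirror_geometric_points ::
    "nat \<Rightarrow> 'a::field \<Rightarrow> (nat \<Rightarrow> 'a alg_closure) set set set" where
  "mirror_geometric_points n \<psi> =
     (let D = dwork_points n (to_ac \<psi>)
      in D // {(P, Q). P \<in> D \<and> Q \<in> D \<and> (\<exists>\<zeta>\<in>mirror_group n. Q = mirror_act n \<zeta> P)})"

definition frobenius_point ::
    "nat \<Rightarrow> (nat \<Rightarrow> 'a::{field,finite} alg_closure) set \<Rightarrow> (nat \<Rightarrow> 'a alg_closure) set" where
  "frobenius_point n P = (\<lambda>x. \<lambda>i\<in>{1..n}. x i ^ CARD('a)) ` P"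

text \<open>The points of the quotient variety that are rational over the finite field \<open>'a\<close> are its
  geometric points fixed by Frobenius.  Such an orbit need not contain a rational point of \<open>X\<close>,
  so it would be wrong to take the orbits of the group on the rational points of \<open>X\<close>.\<close>

definition mirror_points ::
    "nat \<Rightarrow> 'a::{field,finite} \<Rightarrow> (nat \<Rightarrow> 'a alg_closure) set set set" where
  "mirror_points n \<psi> = {B \<in> mirror_geometric_points n \<psi>. frobenius_point n ` B = B}"

definition N_mirror :: "nat \<Rightarrow> 'a::{field,finite} \<Rightarrow> int" where
  "N_mirror n \<psi> = int (card (mirror_points n \<psi>)) - (\<Sum>i=0..n-2. int CARD('a) ^ i)"

section \<open>Dimension of affine algebraic sets\<close>

inductive_set polynomial_maps :: "nat \<Rightarrow> ((nat \<Rightarrow> 'a::field) \<Rightarrow> 'a) set" for m :: nat where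
  const: "(\<lambda>x. c) \<in> polynomial_maps m"
| coord: "i \<in> {1..m} \<Longrightarrow> (\<lambda>x. x i) \<in> polynomial_maps m"
| add: "F \<in> polynomial_maps m \<Longrightarrow> G \<in> polynomial_maps m \<Longrightarrow> (\<lambda>x. F x + G x) \<in> polynomial_maps m"
| mult: "F \<in> polynomial_maps m \<Longrightarrow> G \<in> polynomial_maps m \<Longrightarrow> (\<lambda>x. F x * G x) \<in> polynomial_maps m"

text \<open>Algebraic independence of the restrictions to \<open>V\<close> of the functions \<open>f 1, \<dots>, f r\<close>.  A
  polynomial \<open>R\<close> in \<open>r\<close> variables is represented by its polynomial map, which determines it because
  the coefficient field, being algebraically closed, is infinite.\<close>

definition algebraically_independent_on ::
    "(nat \<Rightarrow> 'a::alg_closed_field) set \<Rightarrow> nat \<Rightarrow> (nat \<Rightarrow> (nat \<Rightarrow> 'a) \<Rightarrow> 'a) \<Rightarrow> bool" where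
  "algebraically_independent_on V r f \<longleftrightarrow>
     (\<forall>R\<in>polynomial_maps r. (\<forall>z\<in>V. R (\<lambda>i. f i z) = 0) \<longrightarrow> R = (\<lambda>u. 0))"

text \<open>The dimension of a (possibly reducible) algebraic set \<open>V\<close> in affine \<open>m\<close>-space over an
  algebraically closed field is the transcendence degree of its coordinate ring: the largest number
  of algebraically independent elements.\<close>

definition has_dimension :: "nat \<Rightarrow> (nat \<Rightarrow> 'a::alg_closed_field) set \<Rightarrow> nat \<Rightarrow> bool" where
  "has_dimension m V d \<longleftrightarrow>
     (\<exists>f. (\<forall>i\<in>{1..d}. f i \<in> polynomial_maps m) \<and> algebraically_independent_on V d f) \<and>
     (\<forall>r f. (\<forall>i\<in>{1..r}. f i \<in> polynomial_maps m) \<and> algebraically_independent_on V r f \<longrightarrow> r \<le> d)"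

section \<open>The varieties of hypergeometric type\<close>

text \<open>The coordinates of affine space of dimension \<open>d + 2\<close> are \<open>x\<^sub>1, \<dots>, x\<^sub>d\<^sub>+\<^sub>1, y\<close>, that is,
  \<open>y = z (d + 2)\<close>.\<close>

definition H_points ::
    "nat \<Rightarrow> nat \<Rightarrow> nat \<Rightarrow> (nat \<Rightarrow> nat) \<Rightarrow> (nat \<Rightarrow> nat) \<Rightarrow> 'a::field \<Rightarrow> (nat \<Rightarrow> 'a) set" where
  "H_points n d l \<alpha> \<beta> \<mu> = {z \<in> affine_space (d + 2).
     z (d + 2) ^ n =
       (\<Prod>i=1..d+1. z i ^ \<alpha> i) * (\<Prod>j=1..l-1. (1 - z j) ^ \<beta> j) * (1 - (\<Sum>i=l..d+1. z i)) ^ \<beta> l \<and>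
     \<mu> * (\<Prod>i=1..l. z i) = 1}"

definition admissible_data ::
    "nat \<Rightarrow> 'a::field \<Rightarrow> nat \<Rightarrow> nat \<times> (nat \<Rightarrow> nat) \<times> (nat \<Rightarrow> nat) \<Rightarrow> bool" where
  "admissible_data n \<psi> d = (\<lambda>(l, \<alpha>, \<beta>).
     2 \<le> l \<and> l \<le> d + 1 \<and> (\<forall>i\<in>{1..d+1}. 1 \<le> \<alpha> i) \<and> (\<forall>j\<in>{1..l}. 1 \<le> \<beta> j) \<and>
     has_dimension (d + 2) (H_points n d l \<alpha> \<beta> (to_ac (1 / \<psi> ^ n))) d)"

definition H_term ::
    "nat \<Rightarrow> 'a::{field,finite} \<Rightarrow> nat \<Rightarrow> nat \<times> (nat \<Rightarrow> nat) \<times> (nat \<Rightarrow> nat) \<Rightarrow> int" where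
  "H_term n \<psi> d = (\<lambda>(l, \<alpha>, \<beta>).
     int (card (H_points n d l \<alpha> \<beta> (1 / \<psi> ^ n)))
       - (int CARD('a) - 1) ^ (l - 1) * int CARD('a) ^ (d + 1 - l))"

text \<open>A list rather than a set of data, since repetitions are allowed.\<close>

definition is_sum_of_H_terms :: "nat \<Rightarrow> 'a::{field,finite} \<Rightarrow> nat \<Rightarrow> int \<Rightarrow> bool" where
  "is_sum_of_H_terms n \<psi> d N \<longleftrightarrow>
     (\<exists>hs. (\<forall>h\<in>set hs. admissible_data n \<psi> d h) \<and> N = (\<Sum>h\<leftarrow>hs. H_term n \<psi> d h))"

end

theory Submission
  imports Defs "HOL-Analysis.Analysis" "HOL-Algebra.Sylow"
begin

text \<open>
  The difference of the two point counts is expanded in multiplicative characters of order \<open>n\<close>.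
  The terms are indexed by non-constant families \<open>a\<close> of \<open>n\<close> residues modulo \<open>n\<close> with sum \<open>0\<close>.  The Gauss sums
  which occur in the term of \<open>a\<close> are combined by the Hasse--Davenport product formula (proved by counting Frobenius-stable
  multisets in the algebraic closure): values of \<open>a\<close> contribute powers of \<open>q\<close>, while every superfluous occurrence
  \<open>r\<close> of a value is matched with a missing value \<open>v\<close> and yields a Jacobi sum with the factor \<open>gauss (r - v)\<close>.
  A family which is a permutation of all residues contributes \<open>0\<close> because \<open>\<psi> ^ n \<noteq> 1\<close>.

  The matching is chosen, by the Combinatorial Nullstellensatz, so that for many pairs of matched indices the
  differences \<open>r - v\<close> are opposite; the Gauss sums of such a pair multiply to \<open>q\<close>.  The remaining ones
  form a Jacobi sum in several variables.  Adding up over the multiples \<open>\<kappa> a\<close> with \<open>0 < \<kappa> < n\<close>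
  turns character sums into the number of points of a variety \<open>H\<close>.
\<close>

section \<open>Characters and Gauss sums of a finite field\<close>

text \<open>The bound d <= n - 4 is the obstacle that shapes the proof. Let m be the number of
  missing values of a family. Every matched pair yields one Gauss sum and one variable z j, and the
  product of all z j is \<psi>^n. Resolving the Gauss sums that survive N cancelling pairs into a
  Jacobi sum costs m - 2N - 2 further variables. So d + 1 = 2m - 2N - 2, and d is odd; d <= n - 4
  means 2m <= 2N + n - 1, and l = m <= d + 1 means 2N + 2 <= m. A family with few values has m close
  to n and needs many cancelling pairs.

  The mirror count enters because a constant family sees only the product of the coordinates. The
  equation \<open>w ^ n = (\<Prod>i=1..n. u i)\<close> of the quotient produces a Gauss sum at the
  n-th power of a character; only after its expansion into n factors can it cancel against the Gauss
  sums at the values of a.\<close>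

lemma card_field_gt_1: "CARD('a::{field,finite}) > 1"
  using card_mono[of "UNIV::'a set" "{0,1}"] by simp

lemma finite_field_power_card_minus_1:
  fixes x :: "'a::{field,finite}"
  assumes "x \<noteq> 0"
  shows "x ^ (CARD('a) - 1) = 1"
proof -
  have "(\<Prod>y\<in>UNIV-{0}. x * y) = (\<Prod>y\<in>UNIV-{0::'a}. y)"
    by (rule prod.reindex_bij_witness[of _ "\<lambda>y. y / x" "\<lambda>y. x * y"]) (use assms in auto)
  hence "x ^ (CARD('a) - 1) * (\<Prod>y\<in>UNIV-{0::'a}. y) = (\<Prod>y\<in>UNIV-{0::'a}. y)"
    by (simp add: prod.distrib card_Diff_singleton)
  moreover have "(\<Prod>y\<in>UNIV-{0::'a}. y) \<noteq> 0" by simp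
  ultimately show ?thesis by simp
qed

lemma finite_field_power_card:
  fixes x :: "'a::{field,finite}"
  shows "x ^ CARD('a) = x"
proof (cases "x = 0")
  case False
  have "x ^ CARD('a) = x * x ^ (CARD('a) - 1)"
    using card_field_gt_1[where 'a='a] by (cases "CARD('a)") auto
  thus ?thesis using finite_field_power_card_minus_1[OF False] by simp
qed (use card_field_gt_1[where 'a='a] in simp)

section \<open>Primitive elements and discrete logarithms\<close>

lemma primitive_element_exists:
  "\<exists>g::'a::{field,finite}. g \<noteq> 0 \<and> (\<forall>x. x \<noteq> 0 \<longrightarrow> (\<exists>k::nat. x = g ^ k))"
proof -
  define R :: "'a ring" where "R = ring_of_type_algebra"
  interpret R: Ring.field R unfolding R_def by (rule field_from_type_algebra)
  have [simp]: "carrier R = UNIV" "\<one>\<^bsub>R\<^esub> = 1" "\<zero>\<^bsub>R\<^esub> = 0" "x \<otimes>\<^bsub>R\<^esub> y = x * y" for x y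
    by (simp_all add: R_def ring_of_type_algebra_def)
  have pw: "x [^]\<^bsub>R\<^esub> (k::nat) = x ^ k" for x k
    by (induction k) (simp_all add: R.nat_pow_Suc)
  obtain a where "a \<in> carrier (mult_of R)" "carrier (mult_of R) = {a[^]\<^bsub>R\<^esub>i | i::nat . i \<in> UNIV}"
    using R.finite_field_mult_group_has_gen by auto
  hence "a \<noteq> 0" "UNIV - {0} = {a ^ i | i::nat. True}" by (simp_all add: pw)
  thus ?thesis by (intro exI[of _ a]) blast
qed

definition prim_elt :: "'a::{field,finite}" where
  "prim_elt = (SOME g. g \<noteq> 0 \<and> (\<forall>x. x \<noteq> 0 \<longrightarrow> (\<exists>k::nat. x = g ^ k)))"

lemma prim_elt_nonzero [simp]: "prim_elt \<noteq> (0::'a::{field,finite})"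
  using someI_ex[OF primitive_element_exists[where 'a='a]] unfolding prim_elt_def by blast

lemma prim_elt_gen: "x \<noteq> 0 \<Longrightarrow> \<exists>k::nat. (x::'a::{field,finite}) = prim_elt ^ k"
  using someI_ex[OF primitive_element_exists[where 'a='a]] unfolding prim_elt_def by blast

lemma prim_elt_power_mod:
  "(prim_elt :: 'a::{field,finite}) ^ k = prim_elt ^ (k mod (CARD('a) - 1))"
proof -
  have "(prim_elt::'a) ^ k = prim_elt ^ ((CARD('a) - 1) * (k div (CARD('a) - 1)) + k mod (CARD('a) - 1))"
    by simp
  also have "\<dots> = (prim_elt ^ (CARD('a) - 1)) ^ (k div (CARD('a) - 1)) * prim_elt ^ (k mod (CARD('a) - 1))"
    by (simp only: power_add power_mult)
  finally show ?thesis by (simp only: finite_field_power_card_minus_1[OF prim_elt_nonzero] power_one mult_1_left)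
qed

lemma bij_prim_elt_power:
  "bij_betw (\<lambda>k. (prim_elt :: 'a::{field,finite}) ^ k) {..<CARD('a) - 1} (UNIV - {0})"
proof -
  have q: "CARD('a) - 1 > 0" using card_field_gt_1[where 'a='a] by simp
  have im: "(\<lambda>k. (prim_elt :: 'a) ^ k) ` {..<CARD('a) - 1} = UNIV - {0}"
  proof (intro equalityI subsetI)
    fix x :: 'a assume "x \<in> UNIV - {0}"
    then obtain k where "x = prim_elt ^ k" using prim_elt_gen by blast
    hence "x = prim_elt ^ (k mod (CARD('a) - 1))" using prim_elt_power_mod by metis
    thus "x \<in> (\<lambda>k. (prim_elt :: 'a) ^ k) ` {..<CARD('a) - 1}" using q by auto
  qed auto
  have "inj_on (\<lambda>k. (prim_elt :: 'a) ^ k) {..<CARD('a) - 1}"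
  proof (rule eq_card_imp_inj_on)
    show "card ((^) (prim_elt::'a) ` {..<CARD('a) - 1}) = card {..<CARD('a) - 1}"
      by (subst im) (simp add: card_Diff_singleton)
  qed simp
  thus ?thesis using im by (simp add: bij_betw_def)
qed

definition dlog :: "'a::{field,finite} \<Rightarrow> nat" where
  "dlog x = (THE k. k < CARD('a) - 1 \<and> x = prim_elt ^ k)"

lemma dlog:
  assumes "(x::'a::{field,finite}) \<noteq> 0"
  shows "dlog x < CARD('a) - 1" "prim_elt ^ dlog x = x"
proof -
  have "x \<in> (\<lambda>k. prim_elt ^ k) ` {..<CARD('a) - 1}"
    using bij_betw_imp_surj_on[OF bij_prim_elt_power[where 'a='a]] assms by simp
  then obtain k where k: "k \<in> {..<CARD('a) - 1}" "x = prim_elt ^ k" by blast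
  hence "\<exists>!k. k \<in> {..<CARD('a) - 1} \<and> prim_elt ^ k = x"
    by (intro ex1I[of _ k]) (auto dest: inj_onD[OF bij_betw_imp_inj_on[OF bij_prim_elt_power[where 'a='a]]])
  hence "\<exists>!k. k < CARD('a) - 1 \<and> x = prim_elt ^ k"
    by (simp add: eq_commute)
  from theI'[OF this] show "dlog x < CARD('a) - 1" "prim_elt ^ dlog x = x"
    unfolding dlog_def by auto
qed

lemma dlog_power: "dlog ((prim_elt::'a::{field,finite}) ^ k) = k mod (CARD('a) - 1)"
proof -
  have q: "CARD('a) - 1 > 0" using card_field_gt_1[where 'a='a] by simp
  have "(prim_elt::'a) ^ dlog ((prim_elt::'a) ^ k) = prim_elt ^ (k mod (CARD('a) - 1))"
    using dlog(2)[of "(prim_elt::'a) ^ k"] prim_elt_power_mod by simp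
  thus ?thesis
    by (rule inj_onD[OF bij_betw_imp_inj_on[OF bij_prim_elt_power[where 'a='a]]])
       (use dlog(1)[of "(prim_elt::'a) ^ k"] q in simp_all)
qed

section \<open>Multiplicative characters, indexed additively by integers\<close>

definition rho :: "int \<Rightarrow> 'a::{field,finite} \<Rightarrow> complex" where
  "rho k x = (if x = 0 then 0
     else cis (2 * pi * of_int k * real (dlog x) / real (CARD('a) - 1)))"

lemma cis_2pi_int: "cis (2 * pi * of_int k) = 1"
  by (metis cis_multiple_2pi Ints_of_int)

lemma cis_cong:
  assumes "[k = l] (mod int m)" "m > 0"
  shows "cis (2 * pi * of_int k / real m) = cis (2 * pi * of_int l / real m)"
proof -
  obtain j where "k = l + int m * j" using assms(1) by (metis cong_iff_lin cong_sym)
  hence "2 * pi * of_int k / real m = 2 * pi * of_int l / real m + 2 * pi * of_int j"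
    using assms(2) by (simp add: field_simps)
  thus ?thesis by (simp add: cis_mult [symmetric] cis_2pi_int)
qed

lemma cis_eq_1_imp_dvd:
  assumes "cis (2 * pi * of_int k / real m) = 1" "m > 0"
  shows "int m dvd k"
proof -
  have "cos (2 * pi * of_int k / real m) = 1" using assms(1) by (simp add: complex_eq_iff)
  then obtain j :: int where "2 * pi * of_int k / real m = of_int j * 2 * pi"
    using cos_one_2pi_int by auto
  hence "real_of_int k = of_int j * real m" using assms(2) by (simp add: field_simps)
  hence "k = j * int m" by (metis of_int_eq_iff of_int_mult of_int_of_nat_eq)
  thus ?thesis by simp
qed

lemma rho_prim_power:
  "rho k ((prim_elt::'a::{field,finite}) ^ i) = cis (2 * pi * of_int (k * int i) / real (CARD('a) - 1))"
proof -
  have q: "CARD('a) - 1 > 0" using card_field_gt_1[where 'a='a] by simp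
  have "rho k ((prim_elt::'a) ^ i) = cis (2 * pi * of_int (k * int (i mod (CARD('a) - 1))) / real (CARD('a) - 1))"
    by (simp add: rho_def dlog_power mult_ac)
  also have "\<dots> = cis (2 * pi * of_int (k * int i) / real (CARD('a) - 1))"
    by (intro cis_cong q cong_mult cong_refl) (simp add: cong_def zmod_int)
  finally show ?thesis .
qed

lemma rho_0_right [simp]: "rho k 0 = 0" by (simp add: rho_def)

lemma rho_eq_0_iff [simp]: "rho k x = 0 \<longleftrightarrow> x = 0" by (simp add: rho_def)

lemma rho_1_right [simp]: "rho k 1 = 1"
  using rho_prim_power[where i=0] by simp

text \<open>The trivial character vanishes at 0 like all others, so that sums of \<open>rho\<close>
  live on the torus. The variant with value 1 at 0, which counts roots correctly, is
  \<open>ch\<close>.\<close>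

lemma rho_trivial: "rho 0 x = of_bool (x \<noteq> 0)" by (simp add: rho_def)

lemma rho_mult: "rho k (x * y) = rho k x * rho k y"
proof (cases "x = 0 \<or> y = 0")
  case False
  then obtain i j where "x = prim_elt ^ i" "y = prim_elt ^ j" using prim_elt_gen by meson
  thus ?thesis
    by (simp only: power_add[symmetric] rho_prim_power cis_mult)
       (simp add: add_divide_distrib[symmetric] ring_distribs)
qed auto

lemma rho_add: "rho (k + l) x = rho k x * rho l x"
  by (simp add: rho_def cis_mult) (simp add: add_divide_distrib[symmetric] ring_distribs)

lemma rho_minus: "rho (-k) x = inverse (rho k x)"
  by (simp add: rho_def cis_inverse)

lemma rho_inverse: "rho k (inverse x) = rho (-k) x"
proof (cases "x = 0")
  case False
  have "rho k (inverse x) * rho k x = 1" using False by (simp add: rho_mult[symmetric])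
  thus ?thesis using False by (simp add: rho_minus field_simps)
qed auto

lemma rho_power: "x \<noteq> 0 \<Longrightarrow> rho k (x ^ m) = rho (int m * k) x"
  by (induction m) (simp_all add: rho_mult rho_trivial ring_distribs rho_add)

lemma rho_power': "m > 0 \<Longrightarrow> rho k (x ^ m) = rho (int m * k) x"
  by (cases "x = 0") (simp_all add: rho_power)

lemma rho_prod: "rho k (\<Prod>i\<in>A. f i) = (\<Prod>i\<in>A. rho k (f i))"
  by (induction A rule: infinite_finite_induct) (simp_all add: rho_mult)

lemma rho_sum_index: "finite A \<Longrightarrow> x \<noteq> 0 \<Longrightarrow> rho (\<Sum>i\<in>A. f i) x = (\<Prod>i\<in>A. rho (f i) x)"
  by (induction A rule: finite_induct) (simp_all add: rho_add rho_trivial)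

lemma rho_cong:
  assumes "[k = l] (mod int (CARD('a) - 1))"
  shows "rho k (x::'a::{field,finite}) = rho l x"
proof (cases "x = 0")
  case False
  have q: "CARD('a) - 1 > 0" using card_field_gt_1[where 'a='a] by simp
  obtain i where "x = prim_elt ^ i" using prim_elt_gen False by blast
  thus ?thesis using assms q
    by (simp only: rho_prim_power) (intro cis_cong cong_mult cong_refl)
qed auto

lemma rho_sum_eq_0:
  assumes "\<not> int (CARD('a) - 1) dvd k"
  shows "(\<Sum>x\<in>UNIV. rho k (x::'a::{field,finite})) = 0"
proof -
  have q: "CARD('a) - 1 > 0" using card_field_gt_1[where 'a='a] by simp
  have ne: "rho k (prim_elt::'a) \<noteq> 1"
    using rho_prim_power[where i=1 and k=k and 'a='a] cis_eq_1_imp_dvd[of k "CARD('a) - 1"] q assms by auto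
  have "(\<Sum>x\<in>UNIV. rho k (x::'a)) = (\<Sum>x\<in>UNIV. rho k (prim_elt * x :: 'a))"
    by (rule sum.reindex_bij_witness[of _ "\<lambda>y. prim_elt * y" "\<lambda>y. y / prim_elt"]) auto
  also have "\<dots> = rho k (prim_elt::'a) * (\<Sum>x\<in>UNIV. rho k (x::'a))"
    by (simp add: rho_mult sum_distrib_left)
  finally show ?thesis using ne by simp
qed

lemma rho_sum_trivial:
  assumes "int (CARD('a) - 1) dvd k"
  shows "(\<Sum>x\<in>UNIV. rho k (x::'a::{field,finite})) = of_nat CARD('a) - 1"
proof -
  have "(\<Sum>x\<in>UNIV. rho k (x::'a)) = (\<Sum>x\<in>UNIV. of_bool (x \<noteq> (0::'a)))"
    using assms rho_cong[of k 0, where 'a='a] by (intro sum.cong refl) (simp add: cong_0_iff rho_trivial)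
  also have "\<dots> = of_nat (card (UNIV - {0::'a}))"
    by (subst sum.mono_neutral_cong_right[of UNIV "UNIV - {0::'a}" _ "\<lambda>_. 1"]) auto
  finally show ?thesis using card_field_gt_1[where 'a='a] by (simp add: card_Diff_singleton of_nat_diff)
qed

lemma rho_sum_index_eq:
  assumes "(x::'a::{field,finite}) \<noteq> 0"
  shows "(\<Sum>k<CARD('a) - 1. rho (int k) x) = (if x = 1 then of_nat CARD('a) - 1 else 0)"
proof (cases "x = 1")
  case True
  thus ?thesis using card_field_gt_1[where 'a='a] by (simp add: of_nat_diff)
next
  case False
  have q: "CARD('a) - 1 > 0" using card_field_gt_1[where 'a='a] by simp
  obtain i where i: "x = prim_elt ^ i" using prim_elt_gen assms by blast
  have pw: "rho (int k) x = rho 1 x ^ k" for k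
    by (induction k) (simp_all add: rho_add rho_trivial assms)
  have "rho 1 x \<noteq> 1"
  proof
    assume "rho 1 x = 1"
    hence "int (CARD('a) - 1) dvd int i" using cis_eq_1_imp_dvd[of "int i" "CARD('a) - 1"] q i
      by (simp add: rho_prim_power)
    hence "CARD('a) - 1 dvd i" by (simp only: int_dvd_int_iff)
    hence "i mod (CARD('a) - 1) = 0" by (rule dvd_imp_mod_0)
    hence "x = 1" using i prim_elt_power_mod[of i, where 'a='a] by simp
    with False show False by simp
  qed
  moreover have "rho 1 x ^ (CARD('a) - 1) = 1"
  proof -
    have "rho (int (CARD('a) - 1)) x = rho 0 x" by (rule rho_cong) (simp only: cong_0_iff dvd_refl)
    thus ?thesis using pw[of "CARD('a) - 1"] assms by (simp only: rho_trivial) simp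
  qed
  ultimately show ?thesis using False by (simp add: pw geometric_sum)
qed

text \<open>Take an additive subgroup H that is maximal among those avoiding 1. Then every element
  is an integer plus an element of H, the integer being unique modulo p, so the field modulo H is
  the group of integers modulo p. The character is the exponential of this integer. Closure under
  addition is enough to define S, since negatives are (p - 1)-fold sums.\<close>

lemma additive_character_exists:
  "\<exists>e::'a::{field,finite} \<Rightarrow> complex. (\<forall>x y. e (x + y) = e x * e y) \<and> (\<exists>x. e x \<noteq> 1) \<and> e 0 = 1"
proof -
  define p where "p = CHAR('a)"
  have p: "prime p" unfolding p_def by (intro prime_CHAR_semidom finite_imp_CHAR_pos) auto
  hence p0: "p > 0" by (simp add: prime_gt_0_nat)
  define S where "S = {H::'a set. 0 \<in> H \<and> (\<forall>x\<in>H. \<forall>y\<in>H. x + y \<in> H) \<and> 1 \<notin> H}"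
  have ne: "{0} \<in> S" by (simp add: S_def)
  have "Max (card ` S) \<in> card ` S" using ne by (intro Max_in) auto
  then obtain H where H: "H \<in> S" "card H = Max (card ` S)" by auto
  have max: "card K \<le> card H" if "K \<in> S" for K using that H by simp
  have H0: "0 \<in> H" and Hadd: "\<And>x y. x \<in> H \<Longrightarrow> y \<in> H \<Longrightarrow> x + y \<in> H" and H1: "1 \<notin> H"
    using H(1) by (auto simp: S_def)
  have Hmul: "of_nat k * x \<in> H" if "x \<in> H" for k x
    by (induction k) (use that H0 Hadd in \<open>auto simp: ring_distribs\<close>)
  have Hneg: "- x \<in> H" if "x \<in> H" for x
  proof -
    have "of_nat (p - 1) * x = - x" using p0 by (simp add: of_nat_diff p_def)
    thus ?thesis using Hmul[OF that, of "p - 1"] by simp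
  qed
  have inv: "\<exists>k'. of_nat k' * of_nat k = (1::'a)" if "of_nat k \<noteq> (0::'a)" for k :: nat
  proof -
    have "\<not> p dvd k" using that by (simp add: of_nat_eq_0_iff_char_dvd p_def)
    hence "coprime k p" using p prime_imp_coprime coprime_commute by blast
    then obtain k' where "[k * k' = 1] (mod p)" using cong_solve_coprime_nat[of k p] by auto
    hence "of_nat (k * k') = (of_nat 1 :: 'a)" unfolding p_def using of_nat_eq_iff_cong_CHAR by blast
    thus ?thesis by (intro exI[of _ k']) (simp add: mult_ac)
  qed
  have dec: "\<exists>k::nat. \<exists>h\<in>H. y = of_nat k + h" for y
  proof (cases "y \<in> H")
    case False
    \<comment> \<open>K is generated by H and y and is strictly larger than H, so by maximality it
      contains 1. Solving 1 = h + k y for y, with k invertible modulo p, gives the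
      decomposition.\<close>
    define K where "K = {h + of_nat k * y | h k. h \<in> H}"
    have sub: "H \<subseteq> K"
    proof
      fix h assume "h \<in> H" thus "h \<in> K" unfolding K_def by (intro CollectI exI[of _ h] exI[of _ 0]) simp
    qed
    moreover have "y \<in> K" unfolding K_def using H0 by (intro CollectI exI[of _ 0] exI[of _ 1]) simp
    ultimately have "card H < card K" using False by (intro psubset_card_mono) auto
    hence "K \<notin> S" using max[of K] by fastforce
    moreover have "0 \<in> K" using sub H0 by blast
    moreover have "x + x' \<in> K" if "x \<in> K" "x' \<in> K" for x x'
    proof -
      obtain h k h' k' where "x = h + of_nat k * y" "x' = h' + of_nat k' * y" "h \<in> H" "h' \<in> H"
        using \<open>x \<in> K\<close> \<open>x' \<in> K\<close> unfolding K_def by blast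
      thus ?thesis unfolding K_def
        by (intro CollectI exI[of _ "h + h'"] exI[of _ "k + k'"]) (simp add: Hadd ring_distribs)
    qed
    ultimately have "1 \<in> K" by (auto simp: S_def)
    then obtain h k where hk: "1 = h + of_nat k * y" "h \<in> H" unfolding K_def by blast
    have "of_nat k \<noteq> (0::'a)" using hk H1 by auto
    then obtain k' where k': "of_nat k' * of_nat k = (1::'a)" using inv by blast
    have "of_nat k' = of_nat k' * (h + of_nat k * y)" using hk by simp
    also have "\<dots> = of_nat k' * h + of_nat k' * of_nat k * y" by (simp add: ring_distribs)
    finally have "of_nat k' = of_nat k' * h + y" using k' by simp
    hence "y = of_nat k' + - (of_nat k' * h)" by (simp add: algebra_simps)
    thus ?thesis using Hneg[OF Hmul[OF hk(2)]] by blast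
  qed (auto intro!: exI[of _ 0])
  have uniq: "[k = l] (mod p)" if eq: "of_nat k + h = of_nat l + (h'::'a)" "h \<in> H" "h' \<in> H" "k \<le> l" for k l h h'
  proof (rule ccontr)
    assume nc: "\<not> [k = l] (mod p)"
    have "of_nat (l - k) = h + - h'" using eq by (simp add: of_nat_diff algebra_simps)
    hence inH: "of_nat (l - k) \<in> H" using Hadd[OF eq(2) Hneg[OF eq(3)]] by simp
    have "of_nat (l - k) \<noteq> (0::'a)"
    proof
      assume "of_nat (l - k) = (0::'a)"
      hence "of_nat k = (of_nat l :: 'a)" using eq(4) by (simp add: of_nat_diff)
      thus False using nc of_nat_eq_iff_cong_CHAR unfolding p_def by blast
    qed
    then obtain k' where "of_nat k' * of_nat (l - k) = (1::'a)" using inv by blast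
    hence "1 \<in> H" using Hmul[OF inH, of k'] by simp
    thus False using H1 by simp
  qed
  hence uniq: "[k = l] (mod p)" if "of_nat k + h = of_nat l + (h'::'a)" "h \<in> H" "h' \<in> H" for k l h h'
    using that by (metis cong_sym le_cases)
  \<comment> \<open>The choice makes f additive only modulo p, which suffices after passing to p-th
    roots of unity.\<close>
  define f where "f y = (SOME k. \<exists>h\<in>H. y = of_nat k + h)" for y :: 'a
  have f: "\<exists>h\<in>H. y = of_nat (f y) + h" for y unfolding f_def by (rule someI_ex[OF dec])
  have fadd: "[f (x + y) = f x + f y] (mod p)" for x y
  proof -
    obtain h1 h2 h3 where "x = of_nat (f x) + h1" "y = of_nat (f y) + h2" "x + y = of_nat (f (x + y)) + h3"
       "h1 \<in> H" "h2 \<in> H" "h3 \<in> H" using f by metis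
    hence "of_nat (f (x + y)) + h3 = (of_nat (f x) + h1) + (of_nat (f y) + h2)" by simp
    hence "of_nat (f (x + y)) + h3 = of_nat (f x + f y) + (h1 + h2)" by (simp add: algebra_simps)
    thus ?thesis using uniq Hadd \<open>h1 \<in> H\<close> \<open>h2 \<in> H\<close> \<open>h3 \<in> H\<close> by blast
  qed
  define e where "e x = cis (2 * pi * of_int (int (f x)) / real p)" for x
  have "e (x + y) = e x * e y" for x y
  proof -
    have "e (x + y) = cis (2 * pi * of_int (int (f x + f y)) / real p)"
      unfolding e_def using fadd[of x y] p0 by (intro cis_cong) (simp_all only: cong_int_iff)
    thus ?thesis by (simp add: e_def cis_mult add_divide_distrib[symmetric] ring_distribs)
  qed
  moreover have "e 1 \<noteq> 1"
  proof
    assume "e 1 = 1"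
    hence "int p dvd int (f 1)" unfolding e_def by (rule cis_eq_1_imp_dvd) (rule p0)
    hence "of_nat (f 1) = (0::'a)" by (simp add: of_nat_eq_0_iff_char_dvd p_def)
    thus False using f[of 1] H1 by auto
  qed
  moreover have "e 0 = 1"
  proof -
    have "[f 0 = 0] (mod p)" using f[of 0] uniq[of "f 0" _ 0 0] H0 by auto
    hence "e 0 = cis (2 * pi * of_int (int 0) / real p)"
      unfolding e_def using p0 by (intro cis_cong) (simp_all only: cong_int_iff)
    thus ?thesis by simp
  qed
  ultimately show ?thesis by (intro exI[of _ e]) blast
qed

section \<open>Gauss sums and their reflection and Jacobi identities\<close>

definition ech :: "'a::{field,finite} \<Rightarrow> complex" where
  "ech = (SOME e. (\<forall>x y. e (x + y) = e x * e y) \<and> (\<exists>x. e x \<noteq> 1) \<and> e 0 = 1)"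

lemma ech_add: "ech (x + y) = ech x * ech (y::'a::{field,finite})"
  and ech_0 [simp]: "ech (0::'a) = 1"
  and ech_nontrivial: "\<exists>x::'a. ech x \<noteq> 1"
  using someI_ex[OF additive_character_exists[where 'a='a]] unfolding ech_def by blast+

lemma ech_sum: "ech (\<Sum>i\<in>A. f i) = (\<Prod>i\<in>A. ech (f i))"
  by (induction A rule: infinite_finite_induct) (simp_all add: ech_add)

lemma sum_ech:
  "(\<Sum>x\<in>UNIV. ech (x * t)) = (if t = 0 then of_nat CARD('a) else 0)" for t :: "'a::{field,finite}"
proof (cases "t = 0")
  case False
  obtain c :: 'a where c: "ech c \<noteq> 1" using ech_nontrivial by blast
  have "(\<Sum>x\<in>UNIV. ech (x * t)) = (\<Sum>x\<in>UNIV. ech (x::'a))"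
    by (rule sum.reindex_bij_witness[of _ "\<lambda>y. y / t" "\<lambda>y. y * t"]) (use False in auto)
  moreover have "(\<Sum>x\<in>UNIV. ech (x::'a)) = (\<Sum>x\<in>UNIV. ech (x::'a)) * ech c"
  proof -
  have "(\<Sum>x\<in>UNIV. ech (x::'a)) = (\<Sum>x\<in>UNIV. ech (x + c))"
    by (rule sum.reindex_bij_witness[of _ "\<lambda>y. y + c" "\<lambda>y. y - c"]) auto
  also have "\<dots> = (\<Sum>x\<in>UNIV. ech (x::'a)) * ech c"
    by (simp only: ech_add sum_distrib_right)
  finally have "(\<Sum>x\<in>UNIV. ech (x::'a)) = (\<Sum>x\<in>UNIV. ech (x::'a)) * ech c" .
  thus ?thesis .
  qed
  ultimately show ?thesis using c False by simp
qed simp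

definition gauss :: "'a::{field,finite} itself \<Rightarrow> int \<Rightarrow> complex" where
  "gauss T k = (\<Sum>x\<in>UNIV. rho k (x::'a) * ech x)"

lemma gauss_cong:
  "[k = l] (mod int (CARD('a) - 1)) \<Longrightarrow> gauss TYPE('a::{field,finite}) k = gauss TYPE('a) l"
  unfolding gauss_def by (intro sum.cong refl) (metis rho_cong)

lemma gauss_twist:
  fixes t :: "'a::{field,finite}"
  assumes "t \<noteq> 0"
  shows "(\<Sum>x\<in>UNIV. rho k x * ech (x * t)) = rho (-k) t * gauss TYPE('a) k"
proof -
  have "(\<Sum>x\<in>UNIV. rho k x * ech (x * t)) = (\<Sum>x\<in>UNIV. rho k (x * inverse t) * ech x)"
    by (rule sum.reindex_bij_witness[of _ "\<lambda>y. y / t" "\<lambda>y. y * t"]) (use assms in \<open>auto simp: field_simps\<close>)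
  thus ?thesis by (simp add: gauss_def rho_mult rho_inverse sum_distrib_left mult_ac)
qed

lemma sum_nonzero_ech:
  "(\<Sum>x\<in>UNIV. of_bool (x \<noteq> 0) * ech (x * t)) = (if t = 0 then of_nat CARD('a) else 0) - 1" for t :: "'a::{field,finite}"
proof -
  have "(\<Sum>x\<in>UNIV. of_bool (x \<noteq> 0) * ech (x * t)) = (\<Sum>x\<in>UNIV. ech (x * t)) - (\<Sum>x\<in>UNIV. if x = (0::'a) then 1 else 0)"
    unfolding sum_subtractf[symmetric] by (rule sum.cong) auto
  thus ?thesis unfolding sum_ech by simp
qed

lemma gauss_trivial:
  assumes "int (CARD('a) - 1) dvd k"
  shows "gauss TYPE('a::{field,finite}) k = -1"
proof -
  have "gauss TYPE('a) k = gauss TYPE('a) 0" using assms by (intro gauss_cong) (simp add: cong_0_iff)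
  thus ?thesis using sum_nonzero_ech[of "1::'a"] by (simp add: gauss_def rho_trivial)
qed

text \<open>The substitution y = - x z turns the double sum into twisted Gauss sums at 1 - z. Only
  the nontriviality of r - v enters; it kills the term z = 1. A common shift of r and v leaves the
  factor \<open>gauss\<close> at r - v unchanged and multiplies the summand by a character of z
  alone, which is why the identity can later be summed over such shifts.\<close>

lemma gauss_mult_jacobi:
  assumes "\<not> int (CARD('a) - 1) dvd r - v"
  shows "gauss TYPE('a::{field,finite}) r * gauss TYPE('a) (-v) =
    rho (-v) (-1::'a) * gauss TYPE('a) (r - v) * (\<Sum>z\<in>UNIV. rho (-v) z * rho (v - r) (1 - z :: 'a))"
proof -
  have "gauss TYPE('a) r * gauss TYPE('a) (-v) =
     (\<Sum>x\<in>UNIV. \<Sum>y\<in>UNIV. rho r (x::'a) * rho (-v) y * ech (x + y))"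
    by (simp add: gauss_def sum_product ech_add mult_ac)
  also have "\<dots> = (\<Sum>x\<in>UNIV. \<Sum>z\<in>UNIV. rho r (x::'a) * rho (-v) (- x * z) * ech (x * (1 - z)))"
  proof (rule sum.cong[OF refl])
    fix x :: 'a
    show "(\<Sum>y\<in>UNIV. rho r (x::'a) * rho (-v) y * ech (x + y)) =
       (\<Sum>z\<in>UNIV. rho r (x::'a) * rho (-v) (- x * z) * ech (x * (1 - z)))"
    proof (cases "x = 0")
      case False
      thus ?thesis
        by (intro sum.reindex_bij_witness[of _ "\<lambda>z. - x * z" "\<lambda>y. - y / x"]) (auto simp: right_diff_distrib distrib_left)
    qed auto
  qed
  also have "\<dots> = (\<Sum>z\<in>UNIV. \<Sum>x\<in>UNIV. rho r (x::'a) * rho (-v) (- x * z) * ech (x * (1 - z)))"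
    by (rule sum.swap)
  also have "\<dots> = (\<Sum>z\<in>UNIV. rho (-v) (-1::'a) * rho (-v) z * (\<Sum>x\<in>UNIV. rho (r - v) (x::'a) * ech (x * (1 - z))))"
  proof (rule sum.cong[OF refl])
    fix z :: 'a
    have "rho r x * rho (-v) (- x * z) = rho (-v) (-1::'a) * rho (-v) z * rho (r - v) x" for x
    proof -
      have "- x * z = (-1) * (x * z)" by simp
      hence "rho (-v) (- x * z) = rho (-v) (-1::'a) * (rho (-v) x * rho (-v) z)"
        by (simp only: rho_mult)
      moreover have "rho (r - v) x = rho r x * rho (-v) x" using rho_add[of r "-v" x] by simp
      ultimately show ?thesis by simp
    qed
    thus "(\<Sum>x\<in>UNIV. rho r (x::'a) * rho (-v) (- x * z) * ech (x * (1 - z))) =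
      rho (-v) (-1::'a) * rho (-v) z * (\<Sum>x\<in>UNIV. rho (r - v) (x::'a) * ech (x * (1 - z)))"
      by (simp add: sum_distrib_left mult.assoc)
  qed
  also have "\<dots> = (\<Sum>z\<in>UNIV. rho (-v) (-1::'a) * rho (-v) (z::'a) * (rho (v - r) (1 - z) * gauss TYPE('a) (r - v)))"
  proof (rule sum.cong[OF refl])
    fix z :: 'a
    have "(\<Sum>x\<in>UNIV. rho (r - v) (x::'a) * ech (x * (1 - z))) = rho (v - r) (1 - z) * gauss TYPE('a) (r - v)"
    proof (cases "z = 1")
      case True
      thus ?thesis using rho_sum_eq_0[OF assms] by simp
    next
      case False
      hence "1 - z \<noteq> 0" by simp
      from gauss_twist[OF this, of "r - v"] show ?thesis by simp
    qed
    thus "rho (-v) (-1::'a) * rho (-v) z * (\<Sum>x\<in>UNIV. rho (r - v) (x::'a) * ech (x * (1 - z))) =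
       rho (-v) (-1::'a) * rho (-v) z * (rho (v - r) (1 - z) * gauss TYPE('a) (r - v))" by simp
  qed
  finally show ?thesis by (simp add: sum_distrib_left mult_ac)
qed

text \<open>With y = x z the sum over nonzero x of an additive character remains: it is q - 1 at z =
  -1 and -1 elsewhere, and the constant -1 is annihilated by the sum of the nontrivial character
  over z.\<close>

lemma gauss_reflect:
  assumes "\<not> int (CARD('a) - 1) dvd k"
  shows "gauss TYPE('a::{field,finite}) k * gauss TYPE('a) (-k) = rho k (-1::'a) * of_nat CARD('a)"
proof -
  have "gauss TYPE('a) k * gauss TYPE('a) (-k) = gauss TYPE('a) (-k) * gauss TYPE('a) k"
    by (rule mult.commute)
  also have "\<dots> = (\<Sum>x\<in>UNIV. \<Sum>y\<in>UNIV. rho (-k) (x::'a) * rho k y * ech (x + y))"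
    unfolding gauss_def sum_product by (simp add: ech_add mult_ac)
  also have "\<dots> = (\<Sum>x\<in>UNIV. \<Sum>z\<in>UNIV. of_bool (x \<noteq> 0) * rho k (z::'a) * ech (x * (1 + z)))"
  proof (rule sum.cong[OF refl])
    fix x :: 'a
    show "(\<Sum>y\<in>UNIV. rho (-k) (x::'a) * rho k y * ech (x + y)) =
       (\<Sum>z\<in>UNIV. of_bool (x \<noteq> 0) * rho k z * ech (x * (1 + z)))"
    proof (cases "x = 0")
      case False
      have "rho k (y / x) = rho (-k) x * rho k y" for y
        by (simp add: divide_inverse rho_mult rho_inverse)
      thus ?thesis using False
        by (intro sum.reindex_bij_witness[of _ "\<lambda>z. x * z" "\<lambda>y. y / x"]) (auto simp: distrib_left mult.assoc[symmetric])
    qed auto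
  qed
  also have "\<dots> = (\<Sum>z\<in>UNIV. rho k z * (\<Sum>x\<in>UNIV. of_bool (x \<noteq> (0::'a)) * ech (x * (1 + z))))"
    by (subst sum.swap) (simp only: sum_distrib_left mult_ac)
  also have "\<dots> = (\<Sum>z\<in>UNIV. (if z = -1 then of_nat CARD('a) * rho k z else 0) - rho k (z::'a))"
    unfolding sum_nonzero_ech by (intro sum.cong refl) (auto simp: algebra_simps eq_neg_iff_add_eq_0)
  also have "\<dots> = rho k (-1::'a) * of_nat CARD('a)"
    using rho_sum_eq_0[OF assms] by (simp add: sum_subtractf)
  finally show ?thesis .
qed

section \<open>The Frobenius map of the algebraic closure\<close>

text \<open>By Sylow's theorem a prime r dividing q gives a subgroup of order r in the additive
  group, hence a nonzero x with r x = 0. This forces r to be the characteristic, which is thus the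
  only prime factor of q.\<close>

lemma card_field_prime_power:
  "\<exists>m. CARD('a::{field,finite}) = CHAR('a) ^ m"
proof -
  define p where "p = CHAR('a)"
  define R :: "'a ring" where "R = ring_of_type_algebra"
  interpret R: Ring.field R unfolding R_def by (rule field_from_type_algebra)
  have p: "prime p" unfolding p_def by (intro prime_CHAR_semidom finite_imp_CHAR_pos) auto
  have only: "r = p" if r: "prime r" "r dvd CARD('a)" for r
  proof -
    define G where "G = add_monoid R"
    have carr: "carrier G = UNIV" by (simp add: G_def R_def ring_of_type_algebra_def)
    have grp: "Group.group G" unfolding G_def by (rule R.a_group)
    interpret G: Group.group G by (rule grp)
    obtain m where "CARD('a) = r ^ 1 * m" using r(2) by (auto elim: dvdE)
    then obtain H where H: "subgroup H G" "card H = r ^ 1"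
      using sylow_thm[OF r(1) grp, of 1 m] by (auto simp: Coset.order_def carr)
    have "card H > 1" using H(2) prime_gt_1_nat[OF r(1)] by simp
    moreover have fin: "finite H" by simp
    ultimately obtain x where x: "x \<in> H" "x \<noteq> 0"
      by (metis One_nat_def card_1_singleton_iff card_mono finite.emptyI finite.insertI insertI1 less_le_not_le singletonD subsetI card.empty card.insert)
    interpret H: Group.group "G\<lparr>carrier := H\<rparr>" by (rule subgroup.subgroup_is_group[OF H(1) grp])
    have "x [^]\<^bsub>G\<lparr>carrier := H\<rparr>\<^esub> Coset.order (G\<lparr>carrier := H\<rparr>) = \<one>\<^bsub>G\<lparr>carrier := H\<rparr>\<^esub>"
      by (rule H.pow_order_eq_1) (simp_all add: x)
    moreover have "x [^]\<^bsub>G\<lparr>carrier := H\<rparr>\<^esub> k = of_nat k * x" for k :: nat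
      by (induction k) (simp_all add: nat_pow_def G_def R_def ring_of_type_algebra_def ring_distribs)
    ultimately have "of_nat r * x = 0"
      using H(2) by (simp add: Coset.order_def G_def R_def ring_of_type_algebra_def)
    hence "p dvd r" using x(2) by (simp add: of_nat_eq_0_iff_char_dvd p_def)
    thus "r = p" using primes_dvd_imp_eq[OF p r(1)] by simp
  qed
  define m where "m = multiplicity p CARD('a)"
  obtain b where b: "CARD('a) = p ^ m * b" "\<not> p dvd b"
    unfolding m_def using multiplicity_decompose'[of "CARD('a)" p] p by (auto simp: prime_nat_iff)
  have "b = 1"
  proof (rule ccontr)
    assume "b \<noteq> 1"
    then obtain r where "prime r" "r dvd b" using prime_factor_nat by blast
    with b show False using only[of r] by auto
  qed
  thus ?thesis using b p_def by auto
qed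

definition frob :: "nat \<Rightarrow> 'a::{field,finite} alg_closure \<Rightarrow> 'a alg_closure" where
  "frob i x = x ^ (CARD('a) ^ i)"

lemma frob_add: "frob i (x + y) = frob i x + frob i (y :: 'a::{field,finite} alg_closure)"
proof -
  obtain m where m: "CARD('a) = CHAR('a) ^ m" using card_field_prime_power by blast
  have "prime CHAR('a alg_closure)"
    unfolding CHAR_alg_closure by (intro prime_CHAR_semidom finite_imp_CHAR_pos) auto
  from freshmans_dream'[OF this, of "CHAR('a) ^ (m * i)" "m * i" x y]
  show ?thesis by (simp add: frob_def m power_mult[symmetric])
qed

lemma frob_0 [simp]: "frob i 0 = 0"
  using card_field_gt_1[where 'a='a] by (simp add: frob_def power_0_left)

lemma frob_1 [simp]: "frob i 1 = 1" by (simp add: frob_def)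

lemma frob_mult: "frob i (x * y) = frob i x * frob i y" by (simp add: frob_def power_mult_distrib)

lemma frob_power: "frob i (x ^ k) = frob i x ^ k" by (simp add: frob_def power_mult[symmetric] mult.commute)

lemma frob_minus: "frob i (- x) = - frob i x"
  using frob_add[of i x "-x"] by (simp add: add_eq_0_iff)

lemma frob_diff: "frob i (x - y) = frob i x - frob i y"
  using frob_add[of i x "-y"] by (simp add: frob_minus)

lemma frob_frob: "frob i (frob j x) = frob (i + j) x"
  by (simp add: frob_def power_mult[symmetric] power_add mult.commute)

lemma frob_0_left [simp]: "frob 0 x = x" by (simp add: frob_def)

lemma frob_eq_0_iff [simp]: "frob i x = 0 \<longleftrightarrow> x = 0"
  by (auto simp: frob_def)

lemma frob_eq_iff [simp]: "frob i x = frob i y \<longleftrightarrow> x = y"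
proof
  assume "frob i x = frob i y"
  hence "frob i (x - y) = 0" by (simp add: frob_diff)
  thus "x = y" by simp
qed simp

lemma inj_frob: "inj (frob i)" by (simp add: inj_def)

lemma frob_to_ac [simp]: "frob i (to_ac x) = to_ac x"
proof (induction i)
  case (Suc i)
  have "frob (Suc i) (to_ac x) = frob i (frob 1 (to_ac x))" by (simp add: frob_frob)
  also have "frob 1 (to_ac x) = to_ac x"
    by (simp add: frob_def finite_field_power_card flip: to_ac_power)
  finally show ?case using Suc by simp
qed simp

lemma finite_frob_fixed:
  assumes "i > 0"
  shows "finite {x :: 'a::{field,finite} alg_closure. frob i x = x}"
    and "card {x :: 'a alg_closure. frob i x = x} \<le> CARD('a) ^ i"
proof -
  define N where "N = CARD('a) ^ i"
  have N: "N > 1" unfolding N_def by (rule one_less_power[OF card_field_gt_1 assms])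
  define P :: "'a alg_closure poly" where "P = monom 1 N - monom 1 1"
  have "coeff P N = 1" using N by (simp add: P_def)
  hence nz: "P \<noteq> 0" by auto
  have eq: "{x :: 'a alg_closure. frob i x = x} = {x. poly P x = 0}"
    by (simp add: P_def poly_monom frob_def N_def)
  show "finite {x :: 'a alg_closure. frob i x = x}" unfolding eq by (rule poly_roots_finite[OF nz])
  have "degree P \<le> N" unfolding P_def using N by (intro degree_diff_le degree_monom_le[THEN order_trans]) auto
  thus "card {x :: 'a alg_closure. frob i x = x} \<le> CARD('a) ^ i"
    unfolding eq N_def[symmetric] using card_poly_roots_bound[OF nz] by linarith
qed

text \<open>The fixed points are roots of a polynomial of degree q, and the q elements of the base
  field already exhaust that number.\<close>

lemma frob_fixed_iff: "frob 1 x = x \<longleftrightarrow> x \<in> range to_ac"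
proof
  assume x: "frob 1 x = x"
  have "range (to_ac :: 'a \<Rightarrow> _) = {x :: 'a alg_closure. frob 1 x = x}"
  proof (rule card_seteq)
    show "finite {x :: 'a alg_closure. frob 1 x = x}" by (rule finite_frob_fixed) simp
    show "card {x :: 'a alg_closure. frob 1 x = x} \<le> card (range (to_ac :: 'a \<Rightarrow> _))"
      using finite_frob_fixed(2)[of 1, where 'a='a] by (simp add: card_image inj_to_ac)
  qed auto
  thus "x \<in> range to_ac" using x by blast
qed auto

lemma to_ac_of_ac_frob: "frob 1 x = x \<Longrightarrow> to_ac (of_ac x) = x"
  by (simp add: frob_fixed_iff to_ac_of_ac del: One_nat_def)

lemma of_ac_add_frob: "frob 1 x = x \<Longrightarrow> frob 1 y = y \<Longrightarrow> of_ac (x + y) = of_ac x + of_ac y"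
  by (metis frob_fixed_iff of_ac_to_ac rangeE to_ac_add)

lemma of_ac_mult_frob: "frob 1 x = x \<Longrightarrow> frob 1 y = y \<Longrightarrow> of_ac (x * y) = of_ac x * of_ac y"
  by (metis frob_fixed_iff of_ac_to_ac rangeE to_ac_mult)

section \<open>Frobenius-stable multisets\<close>

text \<open>A stable multiset is the multiset of roots of a polynomial over the finite field, or an
  effective divisor of the affine line over it.\<close>

definition stable :: "'a::{field,finite} alg_closure multiset \<Rightarrow> bool" where
  "stable M \<longleftrightarrow> image_mset (frob 1) M = M"

lemma stable_empty [simp]: "stable {#}" by (simp add: stable_def)

lemma stable_add: "stable A \<Longrightarrow> stable B \<Longrightarrow> stable (A + B)" by (simp add: stable_def)

lemma stable_diff: "stable A \<Longrightarrow> stable B \<Longrightarrow> B \<subseteq># A \<Longrightarrow> stable (A - B)"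
  by (simp add: stable_def image_mset_Diff)

lemma count_image_mset_inj:
  assumes "inj f"
  shows "count (image_mset f M) (f x) = count M x"
  by (induction M) (use assms in \<open>auto simp: inj_eq\<close>)

lemma stable_count:
  assumes "stable M"
  shows "count M (frob i x) = count M x"
proof (induction i)
  case (Suc i)
  have "count M (frob 1 (frob i x)) = count (image_mset (frob 1) M) (frob 1 (frob i x))"
    using assms by (simp add: stable_def)
  also have "\<dots> = count M (frob i x)" by (rule count_image_mset_inj[OF inj_frob])
  finally show ?case using Suc by (simp add: frob_frob)
qed simp

text \<open>Used when \<open>frob i x = x\<close>: it is then the Frobenius orbit of x, repeated so
  as to have size i, and its product and sum are the norm and trace of x from the extension of
  degree i.\<close>

definition orb :: "nat \<Rightarrow> 'a::{field,finite} alg_closure \<Rightarrow> 'a alg_closure multiset" where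
  "orb i x = mset (map (\<lambda>j. frob j x) [0..<i])"

lemma size_orb [simp]: "size (orb i x) = i" by (simp add: orb_def)

lemma stable_orb:
  assumes "frob i x = x"
  shows "stable (orb i x)"
proof (cases i)
  case (Suc k)
  have "image_mset (frob 1) (orb i x) = mset (map (\<lambda>j. frob (Suc j) x) [0..<Suc k])"
    by (simp add: orb_def Suc frob_frob image_mset.compositionality comp_def del: upt_Suc)
  also have "map (\<lambda>j. frob (Suc j) x) [0..<Suc k] = map (\<lambda>j. frob j x) [Suc 0..<Suc (Suc k)]"
    by (simp only: map_Suc_upt[symmetric] map_map comp_def)
  also have "mset \<dots> = mset (map (\<lambda>j. frob j x) [Suc 0..<Suc k]) + {#x#}"
    using assms Suc by simp
  also have "\<dots> = orb i x"
    unfolding orb_def Suc by (subst upt_conv_Cons[of 0]) simp_all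
  finally show ?thesis by (simp add: stable_def)
qed (simp add: orb_def)

lemma orb_add: "orb (i + j) x = orb i x + orb j (frob i x)"
proof -
  have "[0..<i + j] = [0..<i] @ map (\<lambda>k. k + i) [0..<j]"
    using upt_add_eq_append[of 0 i j] map_add_upt[of i j] by (simp add: add.commute)
  thus ?thesis by (simp add: orb_def frob_frob comp_def)
qed

lemma orb_mult:
  assumes "frob d x = x"
  shows "frob (d * e) x = x \<and> orb (d * e) x = repeat_mset e (orb d x)"
proof (induction e)
  case (Suc e)
  have "frob (d * Suc e) x = frob d (frob (d * e) x)" by (simp add: frob_frob)
  moreover have "orb (d * e + d) x = orb (d * e) x + orb d (frob (d * e) x)" by (rule orb_add)
  ultimately show ?case using Suc assms by (simp add: add.commute)
qed (simp add: orb_def)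

text \<open>The multiplicity of a point in a stable multiset is recovered from the orbits which the
  multiset contains; this replaces unique factorisation of polynomials over the finite field.\<close>

lemma card_orbits_in_stable:
  assumes M: "stable M" and x: "x \<in># M"
  shows "card {i \<in> {1..size M}. frob i x = x \<and> orb i x \<subseteq># M} = count M x"
proof -
  have inM: "frob j x \<in># M" for j using stable_count[OF M, of j x] x by (metis count_greater_zero_iff)
  have "\<not> inj_on (\<lambda>j. frob j x) (UNIV::nat set)"
  proof
    assume "inj_on (\<lambda>j. frob j x) (UNIV::nat set)"
    hence "infinite (range (\<lambda>j. frob j x))" using finite_imageD infinite_UNIV_nat by blast
    moreover have "range (\<lambda>j. frob j x) \<subseteq> set_mset M" using inM by auto
    ultimately show False using finite_subset by blast
  qed
  then obtain a b :: nat where ab: "a < b" "frob a x = frob b x"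
    unfolding inj_on_def by (metis linorder_neqE_nat)
  have shift: "frob (b - a) x = x" if "a < b" "frob a x = frob b x" for a b
  proof -
    have "frob a (frob (b - a) x) = frob a x" using that by (simp add: frob_frob)
    thus ?thesis by simp
  qed
  \<comment> \<open>d is the exact period of x. The indices to be counted are then d e, and orb (d
    e) x fits into M just when e is at most the multiplicity of x.\<close>
  define d where "d = (LEAST d. d > 0 \<and> frob d x = x)"
  have ex: "b - a > 0 \<and> frob (b - a) x = x" using ab shift by simp
  have d: "d > 0" "frob d x = x" using LeastI[of "\<lambda>d. d > 0 \<and> frob d x = x", OF ex] by (simp_all add: d_def)
  have least: "d \<le> i" if "i > 0" "frob i x = x" for i unfolding d_def using that by (intro Least_le) simp
  have dvd: "d dvd i" if "frob i x = x" for i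
  proof -
    have "frob i x = frob (i mod d) (frob (d * (i div d)) x)" by (simp add: frob_frob)
    hence "frob (i mod d) x = x" using that orb_mult[OF d(2)] by simp
    hence "i mod d = 0" using least[of "i mod d"] d(1) by (meson mod_less_divisor not_gr_zero not_le)
    thus ?thesis by (simp add: dvd_eq_mod_eq_0)
  qed
  have dist: "distinct (map (\<lambda>j. frob j x) [0..<d])"
  proof -
    have "i = j" if ij: "i < d" "j < d" "frob i x = frob j x" for i j
    proof (rule ccontr)
      assume "i \<noteq> j"
      hence "\<exists>a b. a < b \<and> b < d \<and> frob a x = frob b x" using ij by (metis linorder_neqE_nat)
      then obtain a b where "a < b" "b < d" "frob a x = frob b x" by blast
      thus False using shift[of a b] least[of "b - a"] by auto
    qed
    thus ?thesis by (auto simp: distinct_map inj_on_def)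
  qed
  have cnt: "count (orb d x) y = (if \<exists>j<d. y = frob j x then 1 else 0)" for y
    unfolding orb_def using dist by (subst distinct_count_atmost_1[THEN iffD1, rule_format, OF dist]) auto
  have sub: "orb (d * e) x \<subseteq># M \<longleftrightarrow> e \<le> count M x" for e
  proof
    assume "orb (d * e) x \<subseteq># M"
    hence "count (orb (d * e) x) x \<le> count M x" by (simp add: subseteq_mset_def)
    moreover have "\<exists>j<d. x = frob j x" using d(1) by (intro exI[of _ 0]) simp
    ultimately show "e \<le> count M x" using orb_mult[OF d(2), of e] cnt[of x] by simp
  next
    assume e: "e \<le> count M x"
    show "orb (d * e) x \<subseteq># M"
      unfolding subseteq_mset_def using orb_mult[OF d(2), of e] e by (auto simp: cnt stable_count[OF M])
  qed
  have "{i \<in> {1..size M}. frob i x = x \<and> orb i x \<subseteq># M} = (\<lambda>e. d * e) ` {1..count M x}"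
  proof (intro equalityI subsetI)
    fix i assume i: "i \<in> {i \<in> {1..size M}. frob i x = x \<and> orb i x \<subseteq># M}"
    then obtain e where e: "i = d * e" using dvd[of i] by (auto elim: dvdE)
    with i sub[of e] show "i \<in> (\<lambda>e. d * e) ` {1..count M x}" by (auto intro!: image_eqI[of _ _ e])
  next
    fix i assume "i \<in> (\<lambda>e. d * e) ` {1..count M x}"
    then obtain e where "e \<in> {1..count M x}" "i = d * e" by (rule imageE)
    hence e: "i = d * e" "1 \<le> e" "e \<le> count M x" by auto
    have "orb i x \<subseteq># M" using sub e by simp
    moreover from size_mset_mono[OF this] have "i \<le> size M" by simp
    ultimately show "i \<in> {i \<in> {1..size M}. frob i x = x \<and> orb i x \<subseteq># M}"
      using e d orb_mult[OF d(2), of e] by auto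
  qed
  moreover have "inj_on (\<lambda>e. d * e) {1..count M x}" using d(1) by (auto simp: inj_on_def)
  ultimately show ?thesis by (simp add: card_image)
qed

section \<open>Stable multisets as points of an affine space\<close>

definition stables :: "nat \<Rightarrow> 'a::{field,finite} alg_closure multiset set" where
  "stables m = {M. stable M \<and> size M = m \<and> 0 \<notin># M}"

text \<open>Reciprocal roots make the constant coefficient 1, so the coefficients 1, ..., m are free
  coordinates: up to sign they are the elementary symmetric functions. A multiset without 0 is
  recovered from this polynomial.\<close>

definition lin_prod :: "'a::{field,finite} alg_closure multiset \<Rightarrow> 'a alg_closure poly" where
  "lin_prod M = prod_mset (image_mset (\<lambda>x. [:1, -x:]) M)"

lemma lin_prod_add_mset: "lin_prod (add_mset x M) = [:1, -x:] * lin_prod M"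
  by (simp add: lin_prod_def)

lemma lin_prod_empty [simp]: "lin_prod {#} = 1" by (simp add: lin_prod_def)

lemma coeff_lin_prod_add_mset:
  "coeff (lin_prod (add_mset x M)) i = coeff (lin_prod M) i - x * (case i of 0 \<Rightarrow> 0 | Suc j \<Rightarrow> coeff (lin_prod M) j)"
  by (auto simp: lin_prod_add_mset coeff_pCons split: nat.splits)

lemma coeff_0_lin_prod [simp]: "coeff (lin_prod M) 0 = 1"
  by (induction M) (simp_all add: coeff_lin_prod_add_mset)

lemma lin_prod_nz [simp]: "lin_prod M \<noteq> 0"
  using coeff_0_lin_prod[of M] by (metis coeff_0 zero_neq_one)

lemma coeff_lin_prod_ge: "i > size M \<Longrightarrow> coeff (lin_prod M) i = 0"
  by (induction M arbitrary: i) (auto simp: coeff_lin_prod_add_mset split: nat.splits)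

lemma coeff_lin_prod_size: "coeff (lin_prod M) (size M) = (-1) ^ size M * prod_mset M"
  by (induction M) (auto simp: coeff_lin_prod_add_mset coeff_lin_prod_ge)

lemma coeff_1_lin_prod: "coeff (lin_prod M) 1 = - sum_mset M"
  by (induction M) (auto simp: coeff_lin_prod_add_mset)

lemma frob_coeff_lin_prod: "coeff (lin_prod (image_mset (frob k) M)) i = frob k (coeff (lin_prod M) i)"
proof (induction M arbitrary: i)
  case empty
  thus ?case by (cases "i = 0") auto
next
  case (add x M)
  thus ?case by (cases i) (simp_all add: coeff_lin_prod_add_mset frob_diff frob_mult)
qed

lemma proots_lin_prod: "0 \<notin># M \<Longrightarrow> proots (lin_prod M) = image_mset inverse M"
proof (induction M)
  case (add x M)
  have x: "x \<noteq> 0" using add.prems by auto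
  have "[:1, -x:] = smult (-x) [:- inverse x, 1:]" using x by simp
  hence "proots [:1, -x:] = {#inverse x#}" using x by (metis add.inverse_inverse neg_equal_0_iff_equal proots_linear_factor proots_smult)
  moreover have "proots (lin_prod M) = image_mset inverse M" using add by simp
  moreover have "proots (lin_prod (add_mset x M)) = proots [:1, -x:] + proots (lin_prod M)"
    unfolding lin_prod_add_mset by (rule proots_mult) simp_all
  ultimately show ?case by simp
qed simp

lemma lin_prod_inj: "0 \<notin># M \<Longrightarrow> 0 \<notin># N \<Longrightarrow> lin_prod M = lin_prod N \<Longrightarrow> M = N"
  by (metis (no_types, lifting) image_mset.compositionality inverse_inverse_eq multiset.map_ident proots_lin_prod comp_apply image_mset_cong)

lemma stable_iff_coeff:
  assumes "0 \<notin># M"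
  shows "stable M \<longleftrightarrow> (\<forall>i. frob 1 (coeff (lin_prod M) i) = coeff (lin_prod M) i)"
proof
  assume "stable M"
  thus "\<forall>i. frob 1 (coeff (lin_prod M) i) = coeff (lin_prod M) i"
    by (metis frob_coeff_lin_prod stable_def)
next
  assume *: "\<forall>i. frob 1 (coeff (lin_prod M) i) = coeff (lin_prod M) i"
  have "lin_prod (image_mset (frob 1) M) = lin_prod M"
    by (rule poly_eqI) (simp add: frob_coeff_lin_prod * del: One_nat_def)
  thus "stable M" unfolding stable_def using assms by (intro lin_prod_inj) auto
qed

lemma lin_prod_surj:
  fixes P :: "'a::{field,finite} alg_closure poly"
  assumes "coeff P 0 = 1"
  shows "\<exists>M. 0 \<notin># M \<and> size M = degree P \<and> lin_prod M = P"
proof -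
  have nz: "P \<noteq> 0" using assms by auto
  obtain A where A: "size A = degree P" "P = smult (lead_coeff P) (\<Prod>x\<in>#A. [:-x, 1:])"
    using alg_closed_imp_factorization[OF nz] by blast
  have A0: "0 \<notin># A"
  proof
    assume "0 \<in># A"
    then obtain B where "A = add_mset 0 B" by (metis multi_member_split)
    hence "coeff P 0 = 0" by (subst A(2)) simp
    with assms show False by simp
  qed
  define M where "M = image_mset inverse A"
  have "(\<Prod>x\<in>#A. [:-x, 1:]) = smult (\<Prod>x\<in>#A. -x) (lin_prod (image_mset inverse A))"
    using A0
  proof (induction A)
    case (add x A)
    hence 1: "[:-x, 1:] = smult (-x) [:1, - inverse x:]" by auto
    have 2: "(\<Prod>x\<in>#A. [:-x, 1:]) = smult (\<Prod>x\<in>#A. -x) (lin_prod (image_mset inverse A))"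
      using add by simp
    show ?case
      unfolding image_mset_add_mset lin_prod_add_mset prod_mset.add_mset 2
      by (subst 1) (simp only: mult_smult_left mult_smult_right smult_smult mult_ac)
  qed simp
  with A(2) have P: "P = smult (lead_coeff P * (\<Prod>x\<in>#A. -x)) (lin_prod M)" by (simp add: M_def)
  have "coeff P 0 = lead_coeff P * (\<Prod>x\<in>#A. -x)" by (subst P) simp
  hence "P = lin_prod M" using assms P by simp
  moreover have "size M = degree P" "0 \<notin># M" using A(1) A0 by (auto simp: M_def)
  ultimately show ?thesis by metis
qed

definition coords :: "nat \<Rightarrow> 'a::{field,finite} alg_closure multiset \<Rightarrow> nat \<Rightarrow> 'a" where
  "coords m M = (\<lambda>i\<in>{1..m}. of_ac (coeff (lin_prod M) i))"

lemma to_ac_coords: "M \<in> stables m \<Longrightarrow> i \<in> {1..m} \<Longrightarrow> to_ac (coords m M i) = coeff (lin_prod M) i"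
  using to_ac_of_ac_frob[of "coeff (lin_prod M) i"] stable_iff_coeff[of M]
  by (auto simp: coords_def stables_def)

text \<open>Sums over stable multisets become sums over an affine space, where characters of single
  coordinates can be summed independently. The top coefficient is nonzero because 0 is excluded; for
  m = 0 there is only the empty multiset.\<close>

lemma bij_coords:
  "bij_betw (coords m) (stables m) {f \<in> {1..m} \<rightarrow>\<^sub>E (UNIV::'a::{field,finite} set). m > 0 \<longrightarrow> f m \<noteq> 0}"
proof (rule bij_betwI')
  fix M N :: "'a alg_closure multiset" assume MN: "M \<in> stables m" "N \<in> stables m"
  show "(coords m M = coords m N) = (M = N)"
  proof
    assume eq: "coords m M = coords m N"
    have "coeff (lin_prod M) i = coeff (lin_prod N) i" for i
    proof (cases "i \<in> {1..m}")
      case True thus ?thesis using to_ac_coords[OF MN(1)] to_ac_coords[OF MN(2)] eq by metis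
    next
      case False thus ?thesis using MN by (cases "i = 0") (auto simp: stables_def coeff_lin_prod_ge)
    qed
    hence "lin_prod M = lin_prod N" by (rule poly_eqI)
    thus "M = N" using MN by (auto simp: stables_def intro: lin_prod_inj)
  qed simp
next
  fix M :: "'a alg_closure multiset" assume M: "M \<in> stables m"
  have "coords m M m \<noteq> 0" if "m > 0"
  proof -
    have "to_ac (coords m M m) = (-1) ^ m * prod_mset M"
      using to_ac_coords[OF M, of m] that M coeff_lin_prod_size[of M] by (auto simp: stables_def)
    also have "\<dots> \<noteq> 0" using M by (simp add: stables_def)
    finally show ?thesis by auto
  qed
  thus "coords m M \<in> {f \<in> {1..m} \<rightarrow>\<^sub>E UNIV. m > 0 \<longrightarrow> f m \<noteq> 0}" by (auto simp: coords_def)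
next
  fix f assume f: "f \<in> {f \<in> {1..m} \<rightarrow>\<^sub>E (UNIV::'a set). m > 0 \<longrightarrow> f m \<noteq> 0}"
  define P where "P = (\<Sum>i\<le>m. monom (if i = 0 then 1 else to_ac (f i)) i)"
  have cP: "coeff P i = (if i = 0 then 1 else if i \<le> m then to_ac (f i) else 0)" for i
    by (auto simp: P_def coeff_sum)
  have "degree P = m"
  proof (rule antisym)
    show "degree P \<le> m" by (rule degree_le) (simp add: cP)
    show "m \<le> degree P" by (rule le_degree) (use f in \<open>auto simp: cP\<close>)
  qed
  then obtain M where M: "0 \<notin># M" "size M = m" "lin_prod M = P" using lin_prod_surj[of P] cP[of 0] by auto
  have st: "M \<in> stables m" unfolding stables_def using M by (auto simp: stable_iff_coeff cP)
  moreover have "f = coords m M"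
    using f by (intro ext) (auto simp: coords_def M(3) cP PiE_def extensional_def)
  ultimately show "\<exists>M\<in>stables m. f = coords m M" by blast
qed

lemma finite_stables [simp]: "finite (stables m :: 'a::{field,finite} alg_closure multiset set)"
  using bij_betw_finite[OF bij_coords[of m, where 'a='a]]
  by (simp add: finite_PiE)

section \<open>The Hasse--Davenport product formula\<close>

lemma rho_1_eq_1_iff: "rho 1 x = 1 \<longleftrightarrow> x = (1::'a::{field,finite})"
proof
  assume x: "rho 1 x = 1"
  hence "x \<noteq> 0" by auto
  then obtain i where i: "x = prim_elt ^ i" using prim_elt_gen by blast
  have "int (CARD('a) - 1) dvd int i"
    using cis_eq_1_imp_dvd[of "int i" "CARD('a) - 1"] card_field_gt_1[where 'a='a] x i by (simp add: rho_prim_power)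
  hence "CARD('a) - 1 dvd i" by (simp only: int_dvd_int_iff)
  thus "x = 1" using i prim_elt_power_mod[of i, where 'a='a] by (simp add: dvd_imp_mod_0)
qed simp

text \<open>If n were 0 in the field, so would be q - 1 = n t; but q is 0 there, which gives 1 =
  0.\<close>

lemma of_nat_divisor_nonzero:
  assumes nt: "n * t = CARD('a::{field,finite}) - 1"
  shows "of_nat n \<noteq> (0::'a)"
  proof
    assume "of_nat n = (0::'a)"
    hence "of_nat (n * t) = (0::'a)" by simp
    hence "of_nat (CARD('a) - 1) = (0::'a)" by (simp only: nt)
    moreover have "of_nat CARD('a) = (0::'a)"
    proof -
      obtain m where m: "CARD('a) = CHAR('a) ^ m" using card_field_prime_power by blast
      hence "m \<noteq> 0" using card_field_gt_1[where 'a='a] by (intro notI) simp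
      thus ?thesis by (simp add: m)
    qed
    ultimately show False using card_field_gt_1[where 'a='a] by (simp add: of_nat_diff)
  qed

text \<open>The multiples of t index the characters of order dividing n, and
  \<open>y ^ t = 1\<close> expresses that y is an n-th power.\<close>

lemma sum_rho_multiples:
  assumes nt: "n * t = CARD('a::{field,finite}) - 1" and y: "(y::'a) \<noteq> 0"
  shows "(\<Sum>j<n. rho (int j * int t) y) = (if y ^ t = 1 then of_nat n else 0)"
proof -
  define z where "z = rho 1 (y ^ t)"
  have t: "t > 0" using nt card_field_gt_1[where 'a='a] by (cases t) auto
  have *: "rho (int j * int t) y = z ^ j" for j
  proof -
    have "z ^ j = rho (int j) (y ^ t)" unfolding z_def
      by (induction j) (simp_all add: rho_add rho_trivial y)
    thus ?thesis using t by (simp add: rho_power' mult.commute)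
  qed
  have "z ^ n = rho 0 y"
    unfolding *[symmetric] by (rule rho_cong) (simp only: of_nat_mult[symmetric] nt cong_0_iff dvd_refl)
  hence zn: "z ^ n = 1" using y by (simp add: rho_trivial)
  show ?thesis
  proof (cases "y ^ t = 1")
    case True
    thus ?thesis by (simp add: * z_def)
  next
    case False
    hence "z \<noteq> 1" by (simp add: z_def rho_1_eq_1_iff)
    thus ?thesis using False zn by (simp add: * geometric_sum)
  qed
qed

text \<open>The powers of \<open>prim_elt ^ t\<close> supply n roots in the base field, and the
  degree of X^n - 1 allows no more in the closure. All n-th roots of unity are therefore rational,
  which makes the mirror group act transitively on geometric fibres.\<close>

lemma roots_of_unity:
  assumes nt: "n * t = CARD('a::{field,finite}) - 1"
  shows "card {\<zeta>::'a. \<zeta> ^ n = 1} = n"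
    and "{z :: 'a alg_closure. z ^ n = 1} = to_ac ` {\<zeta>. \<zeta> ^ n = 1}"
proof -
  have q: "CARD('a) - 1 > 0" using card_field_gt_1[where 'a='a] by simp
  have n: "n > 0" and t: "t > 0" using nt q by (auto intro: Nat.gr0I)
  define A where "A = (\<lambda>j. (prim_elt::'a) ^ (t * j)) ` {..<n}"
  have "inj_on (\<lambda>j. (prim_elt::'a) ^ (t * j)) {..<n}"
  proof (rule inj_onI)
    fix i j assume ij: "i \<in> {..<n}" "j \<in> {..<n}" "(prim_elt::'a) ^ (t * i) = prim_elt ^ (t * j)"
    have "t * i < CARD('a) - 1" "t * j < CARD('a) - 1" unfolding nt[symmetric] using ij t by (simp_all add: mult.commute)
    hence "t * i = t * j" using ij(3) inj_onD[OF bij_betw_imp_inj_on[OF bij_prim_elt_power[where 'a='a]], of "t * i" "t * j"] by simp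
    thus "i = j" using t by simp
  qed
  hence cA: "card A = n" by (simp add: A_def card_image)
  have "((prim_elt::'a) ^ (t * j)) ^ n = 1" for j
  proof -
    have "((prim_elt::'a) ^ (t * j)) ^ n = (prim_elt ^ (n * t)) ^ j" by (simp add: power_mult[symmetric] mult_ac)
    thus ?thesis unfolding nt by (simp only: finite_field_power_card_minus_1[OF prim_elt_nonzero] power_one)
  qed
  hence sub: "A \<subseteq> {\<zeta>::'a. \<zeta> ^ n = 1}" by (auto simp: A_def)
  define P :: "'a alg_closure poly" where "P = monom 1 n - 1"
  have "coeff P n = 1" using n by (simp add: P_def)
  hence nz: "P \<noteq> 0" by auto
  have eq: "{z :: 'a alg_closure. z ^ n = 1} = {x. poly P x = 0}" by (simp add: P_def poly_monom)
  have fin: "finite {z :: 'a alg_closure. z ^ n = 1}" unfolding eq by (rule poly_roots_finite[OF nz])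
  have "degree P \<le> n" unfolding P_def by (intro degree_diff_le degree_monom_le) auto
  hence le: "card {z :: 'a alg_closure. z ^ n = 1} \<le> n"
    unfolding eq using card_poly_roots_bound[OF nz] by linarith
  have sub2: "to_ac ` {\<zeta>::'a. \<zeta> ^ n = 1} \<subseteq> {z. z ^ n = 1}" by (auto simp flip: to_ac_power)
  have "card (to_ac ` {\<zeta>::'a. \<zeta> ^ n = 1}) = card {\<zeta>::'a. \<zeta> ^ n = 1}"
    by (rule card_image) (metis inj_on_subset inj_to_ac subset_UNIV)
  moreover have "n \<le> card {\<zeta>::'a. \<zeta> ^ n = 1}" using card_mono[OF _ sub] cA by simp
  moreover have "card (to_ac ` {\<zeta>::'a. \<zeta> ^ n = 1}) \<le> card {z :: 'a alg_closure. z ^ n = 1}"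
    by (rule card_mono[OF fin sub2])
  ultimately show "card {\<zeta>::'a. \<zeta> ^ n = 1} = n"
    and "{z :: 'a alg_closure. z ^ n = 1} = to_ac ` {\<zeta>. \<zeta> ^ n = 1}"
    using le card_seteq[OF fin sub2] by auto
qed

lemma prod_mset_orb: "prod_mset (orb i x) = (x :: 'a::{field,finite} alg_closure) ^ (\<Sum>j<i. CARD('a) ^ j)"
  by (induction i) (simp_all add: orb_def frob_def power_add mult.commute)

lemma frob_prod_mset: "frob k (prod_mset M) = prod_mset (image_mset (frob k) M)"
  by (induction M) (simp_all add: frob_mult)

lemma frob_sum_mset: "frob k (sum_mset M) = sum_mset (image_mset (frob k) M)"
  by (induction M) (simp_all add: frob_add)

lemma frob_prod_stable: "stable M \<Longrightarrow> frob 1 (prod_mset M) = prod_mset M"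
  unfolding stable_def using frob_prod_mset[of 1 M] by (simp del: One_nat_def)

lemma frob_sum_stable:
  assumes "stable M"
  shows "frob 1 (\<Sum>x\<in>#M. x ^ r) = (\<Sum>x\<in>#M. x ^ r)"
proof -
  have "frob 1 (\<Sum>x\<in>#M. x ^ r) = (\<Sum>x\<in>#image_mset (frob 1) M. x ^ r)"
    by (simp add: frob_sum_mset image_mset.compositionality comp_def frob_power)
  thus ?thesis using assms by (simp add: stable_def)
qed

section \<open>Norms and n-th roots in the finite extensions\<close>

definition units_fixed :: "nat \<Rightarrow> 'a::{field,finite} alg_closure set" where
  "units_fixed i = {x. x \<noteq> 0 \<and> frob i x = x}"

lemma finite_units_fixed: "i > 0 \<Longrightarrow> finite (units_fixed i)"
  by (rule finite_subset[OF _ finite_frob_fixed(1)[of i]]) (auto simp: units_fixed_def)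

text \<open>\<open>units_fixed i\<close> is the multiplicative group of the extension of degree i,
  and the product of \<open>orb i b\<close> is the norm of b. For any n-th root x of b in the
  closure, Frobenius multiplies x by the t-th power of this norm. So either all n roots lie in the
  extension or none does, and the criterion concerns only an element of the base field.\<close>

lemma card_nth_roots_fixed:
  assumes nt: "n * t = CARD('a::{field,finite}) - 1" and i: "i > 0"
    and b: "(b :: 'a alg_closure) \<in> units_fixed i"
  shows "of_nat (card {x \<in> units_fixed i. x ^ n = b}) =
     (\<Sum>j<n. rho (int j * int t) (of_ac (prod_mset (orb i b))))"
proof -
  have q: "CARD('a) - 1 > 0" using card_field_gt_1[where 'a='a] by simp
  have n: "n > 0" using nt q by (auto intro: Nat.gr0I)
  define y where "y = of_ac (prod_mset (orb i b))"
  have b0: "b \<noteq> 0" "frob i b = b" using b by (simp_all add: units_fixed_def)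
  have y: "to_ac y = prod_mset (orb i b)"
    unfolding y_def by (intro to_ac_of_ac_frob frob_prod_stable stable_orb b0)
  hence "to_ac y \<noteq> 0" using b0 by (simp add: prod_mset_orb)
  hence y0: "y \<noteq> 0" by auto
  \<comment> \<open>The geometric sum is the exponent that occurs in the norm, so q^i - 1 = n t
    times it.\<close>
  have geo: "CARD('a) ^ i = Suc ((CARD('a) - 1) * (\<Sum>j<i. CARD('a) ^ j))"
  proof -
    obtain r where r: "CARD('a) = Suc r" using q by (cases "CARD('a)") auto
    show ?thesis unfolding r by (induction i) (simp_all add: distrib_left)
  qed
  have crit: "x \<in> units_fixed i \<longleftrightarrow> y ^ t = 1" if x: "x ^ n = b" for x
  proof -
    have x0: "x \<noteq> 0" using x b0 n by (auto simp: power_0_left)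
    have "frob i x = x * (x ^ n) ^ (t * (\<Sum>j<i. CARD('a) ^ j))"
      unfolding frob_def geo nt[symmetric] by (simp add: power_mult[symmetric] mult.assoc)
    also have "(x ^ n) ^ (t * (\<Sum>j<i. CARD('a) ^ j)) = to_ac (y ^ t)"
      unfolding x by (simp add: y prod_mset_orb power_mult[symmetric] mult.commute)
    finally have "frob i x = x * to_ac (y ^ t)" .
    hence "frob i x = x \<longleftrightarrow> to_ac (y ^ t) = to_ac 1" using x0 by simp
    thus ?thesis using x0 by (simp only: units_fixed_def to_ac_eq_iff mem_Collect_eq simp_thms)
  qed
  obtain x0 where x0: "x0 ^ n = b" using nth_root_exists[OF n] by blast
  hence x00: "x0 \<noteq> 0" using b0 n by (auto simp: power_0_left)
  have roots: "{x. x ^ n = b} = (\<lambda>z. x0 * z) ` {z. z ^ n = 1}"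
  proof (intro equalityI subsetI)
    fix x assume "x \<in> {x. x ^ n = b}"
    hence "(x / x0) ^ n = 1" using x0 b0 by (simp add: power_divide)
    thus "x \<in> (\<lambda>z. x0 * z) ` {z. z ^ n = 1}" using x00 by (intro image_eqI[of _ _ "x / x0"]) auto
  qed (auto simp: power_mult_distrib x0)
  have "card {x. x ^ n = b} = card {z :: 'a alg_closure. z ^ n = 1}"
    unfolding roots by (rule card_image) (use x00 in \<open>auto simp: inj_on_def\<close>)
  also have "\<dots> = n"
    unfolding roots_of_unity(2)[OF nt] using roots_of_unity(1)[OF nt]
    by (subst card_image) (auto intro: inj_on_subset[OF inj_to_ac])
  finally have "card {x. x ^ n = b} = n" .
  moreover have "{x \<in> units_fixed i. x ^ n = b} = (if y ^ t = 1 then {x. x ^ n = b} else {})"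
    using crit by auto
  ultimately show ?thesis using sum_rho_multiples[OF nt y0] by (simp add: y_def)
qed

text \<open>Gauss sums as coefficients of an \<open>L\<close>-function: the sums \<open>csum\<close> of a multiplicative function over
  the stable multisets of a given size are the coefficients of a power series whose logarithmic
  derivative is given by the sums \<open>ssum\<close>.  For \<open>r = 1\<close> this series is \<open>1 + gauss k T\<close>.  Taking \<open>n\<close>-th powers
  of the roots relates the product of these polynomials over the characters \<open>k + j t\<close> to the series for
  \<open>r = n\<close>, and the formula compares the coefficients of \<open>T ^ n\<close>.\<close>

definition wt :: "int \<Rightarrow> nat \<Rightarrow> 'a::{field,finite} alg_closure multiset \<Rightarrow> complex" where
  "wt k r M = rho k (of_ac (prod_mset M)) * ech (of_ac (\<Sum>x\<in>#M. x ^ r))"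

lemma wt_add:
  assumes "stable A" "stable B"
  shows "wt k r (A + B) = wt k r A * wt k r B"
proof -
  have "of_ac (prod_mset (A + B)) = of_ac (prod_mset A) * of_ac (prod_mset B)"
    by (simp add: of_ac_mult_frob frob_prod_stable assms del: One_nat_def)
  moreover have "of_ac (\<Sum>x\<in>#A + B. x ^ r) = of_ac (\<Sum>x\<in>#A. x ^ r) + of_ac (\<Sum>x\<in>#B. x ^ r)"
    by (simp add: of_ac_add_frob frob_sum_stable assms del: One_nat_def)
  ultimately show ?thesis by (simp add: wt_def rho_mult ech_add)
qed

definition csum :: "'a::{field,finite} itself \<Rightarrow> int \<Rightarrow> nat \<Rightarrow> nat \<Rightarrow> complex" where
  "csum T k r m = (\<Sum>M\<in>(stables m :: 'a alg_closure multiset set). wt k r M)"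

definition ssum :: "'a::{field,finite} itself \<Rightarrow> int \<Rightarrow> nat \<Rightarrow> nat \<Rightarrow> complex" where
  "ssum T k r i = (\<Sum>x\<in>(units_fixed i :: 'a alg_closure set). wt k r (orb i x))"

lemma sum_stables_containing_orb:
  fixes x :: "'a::{field,finite} alg_closure"
  assumes x: "x \<in> units_fixed i" and i: "i \<le> m"
  shows "(\<Sum>M\<in>{M\<in>stables m. orb i x \<subseteq># M}. wt k r M) =
    wt k r (orb i x) * csum TYPE('a) k r (m - i)"
proof -
  have st: "stable (orb i x)" using x by (intro stable_orb) (simp add: units_fixed_def)
  have x0: "0 \<notin># orb i x" using x by (auto simp: orb_def units_fixed_def)
  have "(\<Sum>M\<in>{M\<in>stables m. orb i x \<subseteq># M}. wt k r M) = (\<Sum>M\<in>stables (m - i). wt k r (orb i x + M))"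
  proof (rule sum.reindex_bij_witness[of _ "\<lambda>M. orb i x + M" "\<lambda>M. M - orb i x"])
    fix M assume "M \<in> {M\<in>stables m. orb i x \<subseteq># M}"
    thus "M - orb i x \<in> stables (m - i)" "orb i x + (M - orb i x) = M"
      "wt k r (orb i x + (M - orb i x)) = wt k r M"
      using st by (auto simp: stables_def stable_diff size_Diff_submset dest: in_diffD)
  next
    fix M :: "'a alg_closure multiset" assume "M \<in> stables (m - i)"
    thus "orb i x + M - orb i x = M" "orb i x + M \<in> {M\<in>stables m. orb i x \<subseteq># M}"
      using st x0 i by (auto simp: stables_def stable_add)
  qed
  also have "\<dots> = (\<Sum>M\<in>stables (m - i). wt k r (orb i x) * wt k r (M :: 'a alg_closure multiset))"
    by (intro sum.cong refl wt_add st) (simp add: stables_def)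
  finally show ?thesis by (simp add: csum_def sum_distrib_left)
qed

text \<open>Double counting. By \<open>card_orbits_in_stable\<close> a stable multiset of size m
  contains exactly m of the multisets \<open>orb i x\<close>, counted over all i and x; removing one
  leaves an arbitrary stable multiset of size m - i, and the weight is multiplicative. This is the
  coefficient form of X C' = S C.\<close>

lemma csum_newton:
  "of_nat m * csum TYPE('a::{field,finite}) k r m =
     (\<Sum>i\<in>{1..m}. ssum TYPE('a) k r i * csum TYPE('a) k r (m - i))"
proof -
  have size: "(of_nat m :: complex) = (\<Sum>i\<in>{1..m}. \<Sum>x\<in>units_fixed i. of_bool (orb i x \<subseteq># M))"
    if M: "M \<in> stables m" for M :: "'a alg_closure multiset"
  proof -
    have st: "stable M" "size M = m" "0 \<notin># M" using M by (auto simp: stables_def)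
    have "(of_nat m :: complex) = (\<Sum>x\<in>set_mset M. of_nat (count M x))"
      using st(2) by (simp add: size_multiset_overloaded_eq flip: of_nat_sum)
    also have "\<dots> = (\<Sum>x\<in>set_mset M. \<Sum>i\<in>{1..m}. of_bool (frob i x = x \<and> orb i x \<subseteq># M))"
    proof (rule sum.cong[OF refl])
      fix x assume "x \<in># M"
      from card_orbits_in_stable[OF st(1) this]
      have "of_nat (count M x) = (of_nat (card {i \<in> {1..m}. frob i x = x \<and> orb i x \<subseteq># M}) :: complex)"
        by (simp add: st(2))
      also have "\<dots> = (\<Sum>i\<in>{1..m}. of_bool (frob i x = x \<and> orb i x \<subseteq># M))"
        by (simp add: of_bool_def sum.If_cases Int_def)
      finally show "of_nat (count M x) = \<dots>" .
    qed
    also have "\<dots> = (\<Sum>i\<in>{1..m}. \<Sum>x\<in>set_mset M. of_bool (frob i x = x \<and> orb i x \<subseteq># M))"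
      by (rule sum.swap)
    also have "\<dots> = (\<Sum>i\<in>{1..m}. \<Sum>x\<in>units_fixed i. of_bool (orb i x \<subseteq># M))"
    proof (rule sum.cong[OF refl])
      fix i assume i: "i \<in> {1..m}"
      have "{x \<in> set_mset M. frob i x = x \<and> orb i x \<subseteq># M} = {x \<in> units_fixed i. orb i x \<subseteq># M}"
      proof (intro equalityI subsetI)
        fix x assume "x \<in> {x \<in> units_fixed i. orb i x \<subseteq># M}"
        moreover from this have "x \<in># M" using i
          by (intro mset_subset_eqD[of "orb i x" M]) (auto simp: orb_def intro!: image_eqI[of _ _ 0])
        ultimately show "x \<in> {x \<in> set_mset M. frob i x = x \<and> orb i x \<subseteq># M}" by (simp add: units_fixed_def)
      qed (use st(3) in \<open>auto simp: units_fixed_def\<close>)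
      moreover have "finite (units_fixed i :: 'a alg_closure set)" using i by (intro finite_units_fixed) auto
      ultimately show "(\<Sum>x\<in>set_mset M. of_bool (frob i x = x \<and> orb i x \<subseteq># M)) =
         (\<Sum>x\<in>units_fixed i. of_bool (orb i x \<subseteq># M) :: complex)"
        by (simp add: of_bool_def sum.If_cases Int_def)
    qed
    finally show ?thesis .
  qed
  have "of_nat m * csum TYPE('a) k r m = (\<Sum>M\<in>stables m. of_nat m * wt k r (M :: 'a alg_closure multiset))"
    by (simp add: csum_def sum_distrib_left)
  also have "\<dots> = (\<Sum>M\<in>stables m. (\<Sum>i\<in>{1..m}. \<Sum>x\<in>units_fixed i. of_bool (orb i x \<subseteq># M)) * wt k r (M :: 'a alg_closure multiset))"
    by (intro sum.cong refl arg_cong2[where f="(*)"] size)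
  also have "\<dots> = (\<Sum>M\<in>stables m. \<Sum>i\<in>{1..m}. \<Sum>x\<in>units_fixed i. of_bool (orb i x \<subseteq># M) * wt k r (M :: 'a alg_closure multiset))"
    by (simp only: sum_distrib_right)
  also have "\<dots> = (\<Sum>i\<in>{1..m}. \<Sum>M\<in>stables m. \<Sum>x\<in>units_fixed i. of_bool (orb i x \<subseteq># M) * wt k r (M :: 'a alg_closure multiset))"
    by (rule sum.swap)
  also have "\<dots> = (\<Sum>i\<in>{1..m}. \<Sum>x\<in>units_fixed i. \<Sum>M\<in>stables m. of_bool (orb i x \<subseteq># M) * wt k r (M :: 'a alg_closure multiset))"
    by (intro sum.cong refl sum.swap)
  also have "\<dots> = (\<Sum>i\<in>{1..m}. \<Sum>x\<in>units_fixed i. wt k r (orb i (x :: 'a alg_closure)) * csum TYPE('a) k r (m - i))"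
  proof (intro sum.cong refl)
    fix i and x :: "'a alg_closure" assume ix: "i \<in> {1..m}" "x \<in> units_fixed i"
    have "(\<Sum>M\<in>stables m. of_bool (orb i x \<subseteq># M) * wt k r M) = (\<Sum>M\<in>{M\<in>stables m. orb i x \<subseteq># M}. wt k r M)"
      by (subst sum.inter_filter, simp) (rule sum.cong, auto)
    also have "\<dots> = wt k r (orb i x) * csum TYPE('a) k r (m - i)"
      using ix by (intro sum_stables_containing_orb) auto
    finally show "(\<Sum>M\<in>stables m. of_bool (orb i x \<subseteq># M) * wt k r M) = wt k r (orb i x) * csum TYPE('a) k r (m - i)" .
  qed
  finally show ?thesis by (simp add: ssum_def sum_distrib_right)
qed

lemma orb_power: "orb i (x ^ n) = image_mset (\<lambda>y. y ^ n) (orb i x)"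
  by (simp add: orb_def frob_power image_mset.compositionality comp_def)

text \<open>Group the x by b = x^n. The product of \<open>orb i b\<close> is the n-th power of that
  of \<open>orb i x\<close>, and its sum is the n-th power sum of \<open>orb i x\<close>, so the
  weight depends on b alone. The size of the fibre is a sum over the n characters j t of the norm of
  b, and each of them shifts k by j t.\<close>

lemma ssum_power:
  assumes nt: "n * t = CARD('a::{field,finite}) - 1" and i: "i > 0"
  shows "ssum TYPE('a) (int n * k) n i = (\<Sum>j<n. ssum TYPE('a) (k + int j * int t) 1 i)"
proof -
  have n: "n > 0" using nt card_field_gt_1[where 'a='a] by (auto intro: Nat.gr0I)
  have 1: "wt (int n * k) n (orb i x) = wt k 1 (orb i (x ^ n))" if "x \<in> units_fixed i" for x :: "'a alg_closure"
  proof -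
    define P where "P = prod_mset (orb i x)"
    have "frob 1 P = P" unfolding P_def using that by (intro frob_prod_stable stable_orb) (simp add: units_fixed_def)
    hence P: "to_ac (of_ac P) = P" by (rule to_ac_of_ac_frob)
    have "of_ac (prod_mset (orb i (x ^ n))) = of_ac (P ^ n)"
      by (simp add: prod_mset_orb P_def power_mult[symmetric] mult.commute)
    also have "P ^ n = to_ac (of_ac P ^ n)" using P by simp
    finally have "of_ac (prod_mset (orb i (x ^ n))) = of_ac P ^ n" by (simp only: of_ac_to_ac)
    thus ?thesis
      using n by (simp add: wt_def P_def[symmetric] rho_power' orb_power image_mset.compositionality comp_def)
  qed
  have pw: "x ^ n \<in> units_fixed i" if "x \<in> units_fixed i" for x :: "'a alg_closure"
    using that by (simp add: units_fixed_def frob_power)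
  have "ssum TYPE('a) (int n * k) n i = (\<Sum>x\<in>(units_fixed i :: 'a alg_closure set). wt k 1 (orb i (x ^ n)))"
    unfolding ssum_def by (intro sum.cong refl 1)
  also have "\<dots> = (\<Sum>b\<in>units_fixed i. \<Sum>x\<in>{x\<in>units_fixed i. x ^ n = b}. wt k 1 (orb i ((x :: 'a alg_closure) ^ n)))"
    by (rule sum.group[symmetric]) (use pw i finite_units_fixed in auto)
  also have "\<dots> = (\<Sum>b\<in>units_fixed i. of_nat (card {x\<in>units_fixed i. x ^ n = b}) * wt k 1 (orb i (b :: 'a alg_closure)))"
    by (intro sum.cong refl) simp
  also have "\<dots> = (\<Sum>b\<in>units_fixed i. \<Sum>j<n. wt (k + int j * int t) 1 (orb i (b :: 'a alg_closure)))"
  proof (intro sum.cong refl)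
    fix b :: "'a alg_closure" assume b: "b \<in> units_fixed i"
    show "of_nat (card {x\<in>units_fixed i. x ^ n = b}) * wt k 1 (orb i b) = (\<Sum>j<n. wt (k + int j * int t) 1 (orb i b))"
      unfolding card_nth_roots_fixed[OF nt i b] sum_distrib_right
      by (simp add: wt_def rho_add mult_ac)
  qed
  also have "\<dots> = (\<Sum>j<n. \<Sum>b\<in>units_fixed i. wt (k + int j * int t) 1 (orb i (b :: 'a alg_closure)))"
    by (rule sum.swap)
  finally show ?thesis by (simp add: ssum_def)
qed

lemma stables_0: "stables 0 = {{#}}" by (auto simp: stables_def)

lemma csum_0 [simp]: "csum TYPE('a::{field,finite}) k r 0 = 1"
  by (simp add: csum_def stables_0 wt_def flip: to_ac_1)

lemma of_ac_prod_coords: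
  assumes "M \<in> stables m" "m > 0"
  shows "of_ac (prod_mset M) = (-1) ^ m * coords m M m"
proof (rule of_ac_eqI)
  have "to_ac (coords m M m) = (-1) ^ m * prod_mset M"
    using to_ac_coords[OF assms(1), of m] assms coeff_lin_prod_size[of M] by (auto simp: stables_def)
  moreover have "((-1) ^ m * (-1) ^ m :: 'a alg_closure) = 1" by (simp flip: power_mult_distrib)
  ultimately show "to_ac ((-1) ^ m * coords m M m) = prod_mset M" by (simp add: mult.assoc[symmetric])
qed

text \<open>The weight of a multiset involves only its product and its sum, that is, the last and
  the first coordinate. For m > 1 these are different coordinates, and the free sum of the additive
  character over the first one vanishes. For m = 1 they coincide and give a Gauss sum.\<close>

lemma csum_1:
  assumes "m > 0"
  shows "csum TYPE('a::{field,finite}) k 1 m = (if m = 1 then gauss TYPE('a) k else 0)"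
proof -
  have sumc: "of_ac (sum_mset M) = - coords m M 1" if "M \<in> stables m" for M :: "'a alg_closure multiset"
    by (rule of_ac_eqI) (use to_ac_coords[OF that, of 1] assms in \<open>simp add: coeff_1_lin_prod[of M, simplified]\<close>)
  define h where "h i y = (if i = m then rho k ((-1) ^ m * y) else 1) * (if i = 1 then ech (- y) else 1)" for i and y :: 'a
  have "csum TYPE('a) k 1 m = (\<Sum>M\<in>(stables m :: 'a alg_closure multiset set). rho k ((-1) ^ m * coords m M m) * ech (- coords m M 1))"
    unfolding csum_def by (intro sum.cong refl) (simp add: wt_def of_ac_prod_coords[OF _ assms] sumc del: One_nat_def)
  also have "\<dots> = (\<Sum>f\<in>{f \<in> {1..m} \<rightarrow>\<^sub>E (UNIV::'a set). m > 0 \<longrightarrow> f m \<noteq> 0}. rho k ((-1) ^ m * f m) * ech (- f 1))"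
    by (rule sum.reindex_bij_betw[OF bij_coords])
  also have "\<dots> = (\<Sum>f\<in>{1..m} \<rightarrow>\<^sub>E (UNIV::'a set). rho k ((-1) ^ m * f m) * ech (- f 1))"
    by (rule sum.mono_neutral_left) (auto simp: finite_PiE)
  also have "\<dots> = (\<Sum>f\<in>{1..m} \<rightarrow>\<^sub>E (UNIV::'a set). \<Prod>i\<in>{1..m}. h i (f i))"
  proof (rule sum.cong[OF refl])
    fix f :: "nat \<Rightarrow> 'a"
    show "rho k ((-1) ^ m * f m) * ech (- f 1) = (\<Prod>i\<in>{1..m}. h i (f i))"
      using assms by (simp add: h_def prod.distrib)
  qed
  also have "\<dots> = (\<Prod>i\<in>{1..m}. \<Sum>y\<in>UNIV. h i y)" by (rule prod_sum_PiE[symmetric]) auto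
  also have "\<dots> = (if m = 1 then gauss TYPE('a) k else 0)"
  proof (cases "m = 1")
    case True
    have "(\<Sum>y\<in>UNIV. h 1 y) = (\<Sum>y\<in>UNIV. rho k (y::'a) * ech y)"
      by (rule sum.reindex_bij_witness[of _ uminus uminus]) (auto simp: h_def True)
    thus ?thesis using True by (simp add: gauss_def)
  next
    case False
    hence "(\<Sum>y\<in>UNIV. h 1 y) = (\<Sum>y\<in>UNIV. ech ((y::'a) * (-1)))" by (simp add: h_def)
    hence "(\<Sum>y\<in>UNIV. h 1 y) = 0" unfolding sum_ech by simp
    moreover have "(1::nat) \<in> {1..m}" using assms by simp
    ultimately show ?thesis using False by (metis finite_atLeastAtMost prod_zero)
  qed
  finally show ?thesis .
qed

text \<open>Newton's identities, which express the power sums of a multiset by the coefficients of the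
  polynomial \<open>\<Prod>(1 - x T)\<close>.\<close>

function newton_sum :: "(nat \<Rightarrow> 'a::comm_ring_1) \<Rightarrow> nat \<Rightarrow> 'a" where
  "newton_sum f r = - of_nat r * f r - (\<Sum>j\<in>{1..<r}. f j * newton_sum f (r - j))"
  by auto
termination by (relation "Wellfounded.measure (\<lambda>(f, r). r)") auto

declare newton_sum.simps [simp del]

lemma newton_sum_cong:
  assumes "\<And>j. 1 \<le> j \<Longrightarrow> j \<le> r \<Longrightarrow> f j = g j" "r > 0"
  shows "newton_sum f r = newton_sum g r"
  using assms
proof (induction r rule: less_induct)
  case (less r)
  have "(\<Sum>j\<in>{1..<r}. f j * newton_sum f (r - j)) = (\<Sum>j\<in>{1..<r}. g j * newton_sum g (r - j))"
    by (intro sum.cong refl arg_cong2[where f="(*)"] less.IH less.prems(1)) auto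
  thus ?case using less.prems by (simp add: newton_sum.simps[of _ r])
qed

text \<open>Coefficient form of A G = - A', where A is the product of the factors 1 - x T and G is
  the generating series of the power sums, starting with the first power. Adding a root multiplies A
  by 1 - x T and adds a geometric series to G.\<close>

lemma newton_identity:
  fixes M :: "'a::{field,finite} alg_closure multiset"
  assumes "r > 0"
  shows "(\<Sum>j<r. coeff (lin_prod M) j * (\<Sum>x\<in>#M. x ^ (r - j))) = - of_nat r * coeff (lin_prod M) r"
proof -
  define A where "A M = fps_of_poly (lin_prod M)" for M :: "'a alg_closure multiset"
  define G where "G M = Abs_fps (\<lambda>k. \<Sum>x\<in>#M. x ^ Suc k)" for M :: "'a alg_closure multiset"
  have Gadd: "G (add_mset x M) = Abs_fps (\<lambda>k. x ^ Suc k) + G M" for x M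
    by (rule fps_ext) (simp add: G_def)
  have geo: "(1 - fps_const x * fps_X) * Abs_fps (\<lambda>k. x ^ Suc k) = fps_const x" for x :: "'a alg_closure"
  proof (rule fps_ext)
    fix k
    show "((1 - fps_const x * fps_X) * Abs_fps (\<lambda>k. x ^ Suc k)) $ k = fps_const x $ k"
      by (cases k) (simp_all add: left_diff_distrib mult.assoc fps_X_mult_nth)
  qed
  have Aadd: "A (add_mset x M) = (1 - fps_const x * fps_X) * A M" for x M
    unfolding A_def lin_prod_add_mset fps_of_poly_mult by (simp add: fps_of_poly_linear' fps_const_neg[symmetric] del: fps_const_neg)
  have "A M * G M = - fps_deriv (A M)"
  proof (induction M)
    case empty
    show ?case by (simp add: A_def G_def fps_zero_def[symmetric])
  next
    case (add x M)
    have "A (add_mset x M) * G (add_mset x M) =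
       ((1 - fps_const x * fps_X) * Abs_fps (\<lambda>k. x ^ Suc k)) * A M + (1 - fps_const x * fps_X) * (A M * G M)"
      by (simp add: Aadd Gadd algebra_simps)
    also have "\<dots> = fps_const x * A M - (1 - fps_const x * fps_X) * fps_deriv (A M)"
      unfolding geo add.IH by simp
    also have "\<dots> = - fps_deriv (A (add_mset x M))"
      by (simp add: Aadd algebra_simps)
    finally show ?case .
  qed
  hence "(A M * G M) $ (r - 1) = (- fps_deriv (A M)) $ (r - 1)" by simp
  hence "(\<Sum>j=0..r - 1. coeff (lin_prod M) j * (\<Sum>x\<in>#M. x ^ Suc (r - 1 - j))) = - of_nat r * coeff (lin_prod M) r"
    using assms by (simp add: A_def G_def fps_mult_nth)
  moreover have "(\<Sum>j=0..r - 1. coeff (lin_prod M) j * (\<Sum>x\<in>#M. x ^ Suc (r - 1 - j))) =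
    (\<Sum>j<r. coeff (lin_prod M) j * (\<Sum>x\<in>#M. x ^ (r - j)))"
    by (rule sum.cong) (use assms in \<open>auto simp: Suc_diff_Suc\<close>)
  ultimately show ?thesis by simp
qed

lemma power_sum_stable:
  assumes M: "M \<in> stables m" and r: "1 \<le> r" "r \<le> m"
  shows "(\<Sum>x\<in>#M. x ^ r) = to_ac (newton_sum (coords m M) r)"
  using r
proof (induction r rule: less_induct)
  case (less r)
  have "{..<r} = insert 0 {1..<r}" using less.prems by auto
  hence "(\<Sum>x\<in>#M. x ^ r) = - of_nat r * coeff (lin_prod M) r - (\<Sum>j\<in>{1..<r}. coeff (lin_prod M) j * (\<Sum>x\<in>#M. x ^ (r - j)))"
    using newton_identity[of r M] less.prems by (simp add: algebra_simps)
  also have "(\<Sum>j\<in>{1..<r}. coeff (lin_prod M) j * (\<Sum>x\<in>#M. x ^ (r - j))) =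
     (\<Sum>j\<in>{1..<r}. to_ac (coords m M j) * to_ac (newton_sum (coords m M) (r - j)))"
    using less.prems by (intro sum.cong refl arg_cong2[where f="(*)"] less.IH to_ac_coords[OF M, symmetric]) auto
  also have "coeff (lin_prod M) r = to_ac (coords m M r)" using less.prems by (intro to_ac_coords[OF M, symmetric]) auto
  finally show ?case by (subst newton_sum.simps) (simp add: to_ac_sum)
qed

text \<open>In Newton's formula for the n-th power sum the top coordinate enters linearly, with
  coefficient - n, and the rest Q involves only the lower coordinates. The sum therefore splits into
  a factor K made of the lower coordinates, which is the same for all k, and a Gauss sum twisted by
  n. Oddness of n fixes the sign of the product of the roots.\<close>

lemma csum_top:
  assumes nt: "n * t = CARD('a::{field,finite}) - 1" and odd: "odd n"
  shows "\<exists>K. \<forall>k. csum TYPE('a) (int n * k) n n = K * rho (- (int n * k)) (of_nat n :: 'a) * gauss TYPE('a) (int n * k)"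
proof -
  have q: "CARD('a) - 1 > 0" using card_field_gt_1[where 'a='a] by simp
  have n: "n > 0" using nt q by (auto intro: Nat.gr0I)
  note nz = of_nat_divisor_nonzero[OF nt]
  define Q where "Q f = (\<Sum>j\<in>{1..<n}. f j * newton_sum f (n - j))" for f :: "nat \<Rightarrow> 'a"
  define K where "K = (\<Sum>g\<in>{1..<n} \<rightarrow>\<^sub>E (UNIV::'a set). ech (- Q g))"
  have "csum TYPE('a) (int n * k) n n = K * rho (- (int n * k)) (of_nat n :: 'a) * gauss TYPE('a) (int n * k)" for k
  proof -
    define \<kappa> where "\<kappa> = int n * k"
    have m1: "(-1::'a) ^ n = -1" using odd by simp
    have "csum TYPE('a) \<kappa> n n = (\<Sum>M\<in>(stables n :: 'a alg_closure multiset set).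
        rho \<kappa> (- coords n M n) * ech (newton_sum (coords n M) n))"
      unfolding csum_def
      by (intro sum.cong refl) (use n in \<open>simp add: wt_def of_ac_prod_coords power_sum_stable m1\<close>)
    also have "\<dots> = (\<Sum>f\<in>{f \<in> {1..n} \<rightarrow>\<^sub>E (UNIV::'a set). n > 0 \<longrightarrow> f n \<noteq> 0}. rho \<kappa> (- f n) * ech (newton_sum f n))"
      by (rule sum.reindex_bij_betw[OF bij_coords])
    also have "\<dots> = (\<Sum>f\<in>{1..n} \<rightarrow>\<^sub>E (UNIV::'a set). rho \<kappa> (- f n) * ech (newton_sum f n))"
      by (rule sum.mono_neutral_left) (auto simp: finite_PiE n)
    \<comment> \<open>The n-th coordinate y is split off and reset to \<open>undefined\<close> in g;
      Q does not look at it.\<close>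
    also have "\<dots> = (\<Sum>(y, g)\<in>(UNIV::'a set) \<times> ({1..<n} \<rightarrow>\<^sub>E (UNIV::'a set)). rho \<kappa> (- y) * ech (- of_nat n * y) * ech (- Q g))"
    proof (rule sum.reindex_bij_witness[of _ "\<lambda>(y, g). g(n := y)" "\<lambda>f. (f n, f(n := undefined))"], goal_cases)
      case (1 f)
      thus ?case by simp
    next
      case (2 f)
      thus ?case by (auto simp: PiE_def extensional_def)
    next
      case (3 p)
      thus ?case by (auto simp: PiE_def extensional_def split: prod.splits)
    next
      case (4 p)
      thus ?case using n by (auto simp: PiE_def extensional_def split: prod.splits)
    next
      case (5 f)
      have "Q (f(n := undefined)) = Q f" unfolding Q_def
        by (intro sum.cong refl arg_cong2[where f="(*)"] newton_sum_cong) auto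
      moreover have "newton_sum f n = - of_nat n * f n - Q f" by (simp only: newton_sum.simps[of f n] Q_def)
      ultimately show ?case by (simp add: ech_add[symmetric] mult.assoc)
    qed
    also have "\<dots> = K * (\<Sum>y\<in>UNIV. rho \<kappa> (- y) * ech (- of_nat n * (y::'a)))"
      by (simp add: sum.cartesian_product[symmetric] K_def sum_distrib_left sum_distrib_right mult_ac)
    also have "(\<Sum>y\<in>UNIV. rho \<kappa> (- y) * ech (- of_nat n * (y::'a))) = (\<Sum>y\<in>UNIV. rho \<kappa> y * ech ((y::'a) * of_nat n))"
      by (rule sum.reindex_bij_witness[of _ uminus uminus]) (auto simp: mult.commute)
    also have "\<dots> = rho (- \<kappa>) (of_nat n :: 'a) * gauss TYPE('a) \<kappa>" by (rule gauss_twist[OF nz])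
    finally show ?thesis by (simp add: \<kappa>_def mult_ac)
  qed
  thus ?thesis by blast
qed

text \<open>Since S has no constant term, comparing coefficients expresses m times the m-th
  coefficient by earlier ones, and m can be divided out over the complex numbers.\<close>

lemma fps_log_deriv_unique:
  fixes A B S :: "complex fps"
  assumes "fps_X * fps_deriv A = S * A" "fps_X * fps_deriv B = S * B" "A $ 0 = B $ 0" "S $ 0 = 0"
  shows "A = B"
proof (rule fps_ext)
  fix m
  have rec: "of_nat m * C $ m = (\<Sum>i=0..m. S $ i * C $ (m - i))" if "fps_X * fps_deriv C = S * C" for C m
  proof -
    have "(fps_X * fps_deriv C) $ m = of_nat m * C $ m" by (cases m) simp_all
    thus ?thesis using that by (simp add: fps_mult_nth)
  qed
  show "A $ m = B $ m"
  proof (induction m rule: less_induct)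
    case (less m)
    show ?case
    proof (cases "m = 0")
      case False
      have "of_nat m * A $ m = (\<Sum>i=0..m. S $ i * A $ (m - i))" by (rule rec[OF assms(1)])
      also have "\<dots> = (\<Sum>i=0..m. S $ i * B $ (m - i))"
      proof (rule sum.cong[OF refl])
        fix i assume "i \<in> {0..m}"
        thus "S $ i * A $ (m - i) = S $ i * B $ (m - i)"
          using less[of "m - i"] assms(4) False by (cases "i = 0") auto
      qed
      also have "\<dots> = of_nat m * B $ m" by (rule rec[OF assms(2), symmetric])
      finally show ?thesis using False by simp
    qed (use assms in simp)
  qed
qed

lemma fps_log_deriv_prod:
  fixes c s :: "'i \<Rightarrow> complex fps"
  assumes "finite J" "\<And>j. j \<in> J \<Longrightarrow> fps_X * fps_deriv (c j) = s j * c j"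
  shows "fps_X * fps_deriv (\<Prod>j\<in>J. c j) = (\<Sum>j\<in>J. s j) * (\<Prod>j\<in>J. c j)"
  using assms
proof (induction J rule: finite_induct)
  case (insert j J)
  have "fps_X * fps_deriv (\<Prod>j\<in>insert j J. c j) =
     (fps_X * fps_deriv (c j)) * (\<Prod>j\<in>J. c j) + c j * (fps_X * fps_deriv (\<Prod>j\<in>J. c j))"
    using insert.hyps by (simp add: algebra_simps)
  also have "\<dots> = (\<Sum>j\<in>insert j J. s j) * (\<Prod>j\<in>insert j J. c j)"
    using insert by (simp add: algebra_simps)
  finally show ?case .
qed simp

lemma coeff_prod_linear:
  fixes g :: "nat \<Rightarrow> complex"
  shows "(\<Prod>j<n. 1 + fps_const (g j) * fps_X) $ n = (\<Prod>j<n. g j) \<and>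
    (\<forall>m>n. (\<Prod>j<n. 1 + fps_const (g j) * fps_X) $ m = 0)"
proof (induction n)
  case (Suc n)
  have "((\<Prod>j<n. 1 + fps_const (g j) * fps_X) * (1 + fps_const (g n) * fps_X)) $ m =
     (\<Prod>j<n. 1 + fps_const (g j) * fps_X) $ m + g n * (\<Prod>j<n. 1 + fps_const (g j) * fps_X) $ (m - 1)" if "m > 0" for m
  proof -
    define P where "P = (\<Prod>j<n. 1 + fps_const (g j) * fps_X)"
    have "P * (1 + fps_const (g n) * fps_X) = P + fps_X * (fps_const (g n) * P)"
      by (simp add: algebra_simps)
    thus ?thesis using that by (simp add: P_def[symmetric] fps_X_mult_nth)
  qed
  thus ?case using Suc by simp
qed auto

theorem hasse_davenport_const:
  assumes nt: "n * t = CARD('a::{field,finite}) - 1" and odd: "odd n"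
  shows "\<exists>K. \<forall>k. (\<Prod>j<n. gauss TYPE('a) (k + int j * int t)) =
    K * rho (- (int n * k)) (of_nat n :: 'a) * gauss TYPE('a) (int n * k)"
proof -
  have "(\<Prod>j<n. gauss TYPE('a) (k + int j * int t)) = csum TYPE('a) (int n * k) n n" for k
  proof -
    define C where "C k r = Abs_fps (csum TYPE('a) k r)" for k r
    define S where "S k r = Abs_fps (\<lambda>i. if i = 0 then 0 else ssum TYPE('a) k r i)" for k r
    have log: "fps_X * fps_deriv (C k r) = S k r * C k r" for k r
    proof (rule fps_ext)
      fix m
      have "(S k r * C k r) $ m = (\<Sum>i\<in>{1..m}. ssum TYPE('a) k r i * csum TYPE('a) k r (m - i))"
        unfolding fps_mult_nth by (rule sum.mono_neutral_cong_right) (auto simp: C_def S_def)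
      also have "\<dots> = of_nat m * csum TYPE('a) k r m" by (rule csum_newton[symmetric])
      also have "\<dots> = (fps_X * fps_deriv (C k r)) $ m" by (cases m) (simp_all add: C_def)
      finally show "(fps_X * fps_deriv (C k r)) $ m = (S k r * C k r) $ m" by simp
    qed
    have lin: "C k 1 = 1 + fps_const (gauss TYPE('a) k) * fps_X" for k
    proof (rule fps_ext)
      fix m
      show "C k 1 $ m = (1 + fps_const (gauss TYPE('a) k) * fps_X) $ m"
        using csum_1[of m k, where 'a='a] by (cases "m = 0") (auto simp: C_def fps_X_def)
    qed
    have Ssum: "(\<Sum>j<n. S (k + int j * int t) 1) = S (int n * k) n"
      by (rule fps_ext) (simp add: S_def fps_sum_nth ssum_power[OF nt])
    have "(\<Prod>j<n. C (k + int j * int t) 1) = C (int n * k) n"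
    proof (rule fps_log_deriv_unique)
      show "fps_X * fps_deriv (\<Prod>j<n. C (k + int j * int t) 1) = S (int n * k) n * (\<Prod>j<n. C (k + int j * int t) 1)"
        unfolding Ssum[symmetric] by (rule fps_log_deriv_prod) (simp_all add: log)
      have "(\<Prod>j<m. C (k + int j * int t) 1) $ 0 = 1" for m
        by (induction m) (simp_all add: C_def)
      thus "(\<Prod>j<n. C (k + int j * int t) 1) $ 0 = C (int n * k) n $ 0" by (simp add: C_def)
    qed (simp_all add: log S_def)
    hence "C (int n * k) n $ n = (\<Prod>j<n. 1 + fps_const (gauss TYPE('a) (k + int j * int t)) * fps_X) $ n"
      by (simp add: lin[unfolded One_nat_def])
    also have "\<dots> = (\<Prod>j<n. gauss TYPE('a) (k + int j * int t))" by (rule coeff_prod_linear[THEN conjunct1])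
    finally show ?thesis by (simp add: C_def)
  qed
  thus ?thesis using csum_top[OF nt odd] by simp
qed

text \<open>For odd n, -1 = (-1)^n is an n-th power, on which characters of order dividing n are
  trivial. This removes the signs from most later formulas.\<close>

lemma rho_minus_1:
  assumes nt: "n * t = CARD('a::{field,finite}) - 1" and odd: "odd n"
  shows "rho (k * int t) (-1 :: 'a) = 1"
proof -
  have m1: "(-1::'a) = (-1) ^ n" using odd by simp
  have "rho (k * int t) (-1 :: 'a) = rho (int n * (k * int t)) (-1::'a)"
    by (subst m1) (rule rho_power, simp)
  also have "\<dots> = rho 0 (-1::'a)"
  proof (rule rho_cong)
    have "int n * (k * int t) = k * int (CARD('a) - 1)" unfolding nt[symmetric] by simp
    thus "[int n * (k * int t) = 0] (mod int (CARD('a) - 1))" by (simp only: cong_0_iff dvd_triv_right)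
  qed
  finally show ?thesis by (simp add: rho_trivial)
qed

text \<open>The constant is found at k = 0. There the factor j = 0 equals the Gauss sum on the
  right, and the remaining factors pair up as j and n - j, each pair giving q by reflection.\<close>

theorem hasse_davenport:
  assumes nt: "n * t = CARD('a::{field,finite}) - 1" and odd: "odd n"
  shows "(\<Prod>j<n. gauss TYPE('a) (k + int j * int t)) =
    of_nat CARD('a) ^ ((n - 1) div 2) * rho (- (int n * k)) (of_nat n :: 'a) * gauss TYPE('a) (int n * k)"
proof -
  define q where "q = CARD('a)"
  define G where "G j = gauss TYPE('a) (int j * int t)" for j
  obtain K where K: "\<And>k. (\<Prod>j<n. gauss TYPE('a) (k + int j * int t)) =
    K * rho (- (int n * k)) (of_nat n :: 'a) * gauss TYPE('a) (int n * k)"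
    using hasse_davenport_const[OF nt odd] by blast
  note nz = of_nat_divisor_nonzero[OF nt]
  obtain h where h: "n = 2 * h + 1" using odd by (auto elim: oddE)
  have t: "t > 0" using nt card_field_gt_1[where 'a='a] by (intro Nat.gr0I) auto
  have refl: "G j * G (n - j) = of_nat q" if j: "1 \<le> j" "j < n" for j
  proof -
    have "j * t < n * t" using j t by simp
    hence nd: "\<not> int (CARD('a) - 1) dvd int j * int t"
      using j t unfolding nt of_nat_mult[symmetric] int_dvd_int_iff by (auto dest!: dvd_imp_le)
    have "int (n - j) * int t = - (int j * int t) + int (CARD('a) - 1)"
      unfolding nt[symmetric] using j by (simp add: of_nat_diff algebra_simps)
    hence "G (n - j) = gauss TYPE('a) (- (int j * int t))"
      unfolding G_def by (intro gauss_cong) (simp only: Cong.cong_def mod_add_self2)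
    thus ?thesis using gauss_reflect[OF nd] rho_minus_1[OF nt odd, of "int j"] by (simp add: G_def q_def)
  qed
  have "(\<Prod>j\<in>{1..2*h}. G j) = (\<Prod>j\<in>{1..h}. G j) * (\<Prod>j\<in>{h+1..2*h}. G j)"
    by (subst prod.union_disjoint[symmetric]) (auto intro!: prod.cong)
  also have "(\<Prod>j\<in>{h+1..2*h}. G j) = (\<Prod>j\<in>{1..h}. G (n - j))"
    by (rule prod.reindex_bij_witness[of _ "\<lambda>j. n - j" "\<lambda>j. n - j"]) (auto simp: h)
  also have "(\<Prod>j\<in>{1..h}. G j) * (\<Prod>j\<in>{1..h}. G (n - j)) = (\<Prod>j\<in>{1..h}. of_nat q)"
    unfolding prod.distrib[symmetric] by (intro prod.cong refl refl) (auto simp: h)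
  finally have P: "(\<Prod>j\<in>{1..2*h}. G j) = of_nat q ^ h" by simp
  have "{..<n} = insert 0 {1..2*h}" by (auto simp: h)
  hence "(\<Prod>j<n. G j) = G 0 * of_nat q ^ h" by (simp add: P[unfolded One_nat_def])
  hence "K * gauss TYPE('a) 0 = gauss TYPE('a) 0 * of_nat q ^ h"
    using K[of 0] nz by (auto simp: G_def rho_trivial)
  moreover have "gauss TYPE('a) 0 \<noteq> 0" by (simp add: gauss_trivial)
  ultimately have "K = of_nat q ^ h" by simp
  thus ?thesis using K[of k] by (simp add: h q_def)
qed

section \<open>Disjoint reflected pairs of residues\<close>

text \<open>Polynomial functions in \<open>v 0, \<dots>, v (N - 1)\<close> of degree strictly below the bound.\<close>

inductive deg_less :: "nat \<Rightarrow> nat \<Rightarrow> ((nat \<Rightarrow> int) \<Rightarrow> int) \<Rightarrow> bool" for N where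
  zero: "deg_less N D (\<lambda>v. 0)"
| mono: "(\<Sum>i<N. e i) < D \<Longrightarrow> deg_less N D (\<lambda>v. c * (\<Prod>i<N. v i ^ e i))"
| add: "deg_less N D f \<Longrightarrow> deg_less N D g \<Longrightarrow> deg_less N D (\<lambda>v. f v + g v)"

lemma deg_less_weaken: "deg_less N D f \<Longrightarrow> D \<le> D' \<Longrightarrow> deg_less N D' f"
proof (induction rule: deg_less.induct)
  case (mono e D c)
  thus ?case by (intro deg_less.mono) simp
qed (auto intro: deg_less.intros)

text \<open>The first factor has degree at most D1 and the second degree below D2; this asymmetric
  form loses nothing when strict bounds are added.\<close>

lemma deg_less_mult:
  assumes "deg_less N (Suc D1) f" "deg_less N D2 g"
  shows "deg_less N (D1 + D2) (\<lambda>v. f v * g v)"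
proof -
  have "deg_less N (D1 + D2) (\<lambda>v. f v * g v)" if "deg_less N D f" "D = Suc D1" for D
    using that
  proof (induction rule: deg_less.induct)
    case (mono e D c)
    hence e: "(\<Sum>i<N. e i) \<le> D1" by simp
    show ?case using assms(2)
    proof (induction rule: deg_less.induct)
      case (mono e' D2 c')
      have "deg_less N (D1 + D2) (\<lambda>v. (c * c') * (\<Prod>i<N. v i ^ (e i + e' i)))"
        by (rule deg_less.mono) (use e mono in \<open>simp add: sum.distrib\<close>)
      thus ?case by (simp add: power_add prod.distrib mult_ac)
    next
      case (add D2 f g)
      have "deg_less N (D1 + D2) (\<lambda>v. c * (\<Prod>i<N. v i ^ e i) * f v + c * (\<Prod>i<N. v i ^ e i) * g v)"
        by (rule deg_less.add) (rule add.IH)+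
      thus ?case by (simp only: distrib_left)
    qed (simp add: deg_less.zero)
  next
    case (add D f h)
    have "deg_less N (D1 + D2) (\<lambda>v. f v * g v + h v * g v)"
      by (rule deg_less.add) (rule add.IH, rule add.prems)+
    thus ?case by (simp only: distrib_right)
  qed (simp add: deg_less.zero)
  thus ?thesis using assms(1) by blast
qed

lemma deg_less_const: "D > 0 \<Longrightarrow> deg_less N D (\<lambda>v. c)"
  using deg_less.mono[of "\<lambda>_. 0" N D c] by simp

lemma deg_less_var: "i < N \<Longrightarrow> D > 1 \<Longrightarrow> deg_less N D (\<lambda>v. c * v i)"
proof -
  assume i: "i < N" and D: "D > 1"
  have "deg_less N D (\<lambda>v. c * (\<Prod>j<N. v j ^ (if j = i then 1 else 0)))"
    by (rule deg_less.mono) (use i D in simp)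
  moreover have "(\<Prod>j<N. v j ^ (if j = i then 1 else 0)) = v i" for v :: "nat \<Rightarrow> int"
  proof -
    have "(\<Prod>j<N. v j ^ (if j = i then 1 else 0)) = (\<Prod>j<N. if j = i then v j else 1)"
      by (rule prod.cong) auto
    thus ?thesis using i by simp
  qed
  ultimately show ?thesis by simp
qed

text \<open>Expresses that f and g have the same part of degree D and nothing above it, without
  introducing homogeneous components; lower terms of g are unrestricted.\<close>

definition same_top :: "nat \<Rightarrow> nat \<Rightarrow> ((nat \<Rightarrow> int) \<Rightarrow> int) \<Rightarrow> ((nat \<Rightarrow> int) \<Rightarrow> int) \<Rightarrow> bool" where
  "same_top N D f g \<longleftrightarrow> deg_less N (Suc D) g \<and> deg_less N D (\<lambda>v. f v - g v)"

lemma same_top_mult: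
  assumes "same_top N D1 f1 g1" "same_top N D2 f2 g2"
  shows "same_top N (D1 + D2) (\<lambda>v. f1 v * f2 v) (\<lambda>v. g1 v * g2 v)"
proof -
  have 1: "deg_less N (Suc D1) g1" "deg_less N D1 (\<lambda>v. f1 v - g1 v)"
    "deg_less N (Suc D2) g2" "deg_less N D2 (\<lambda>v. f2 v - g2 v)" using assms by (auto simp: same_top_def)
  have "deg_less N (D2 + D1) (\<lambda>v. g2 v * (f1 v - g1 v))" by (rule deg_less_mult) fact+
  moreover have "deg_less N (D1 + D2) (\<lambda>v. g1 v * (f2 v - g2 v))" by (rule deg_less_mult) fact+
  moreover have "deg_less N (D1 + D2) (\<lambda>v. (f1 v - g1 v) * (f2 v - g2 v))"
    by (rule deg_less_mult) (use 1 in \<open>auto intro: deg_less_weaken\<close>)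
  ultimately have "deg_less N (D1 + D2) (\<lambda>v. g2 v * (f1 v - g1 v) + (g1 v * (f2 v - g2 v) + (f1 v - g1 v) * (f2 v - g2 v)))"
    by (intro deg_less.add) (simp_all add: add.commute)
  hence "deg_less N (D1 + D2) (\<lambda>v. f1 v * f2 v - g1 v * g2 v)" by (simp add: algebra_simps)
  moreover have "deg_less N (D1 + Suc D2) (\<lambda>v. g1 v * g2 v)" by (rule deg_less_mult) fact+
  ultimately show ?thesis by (simp add: same_top_def)
qed

lemma same_top_prod:
  assumes "finite S" "\<And>s. s \<in> S \<Longrightarrow> same_top N d (f s) (g s)"
  shows "same_top N (d * card S) (\<lambda>v. \<Prod>s\<in>S. f s v) (\<lambda>v. \<Prod>s\<in>S. g s v)"
  using assms
proof (induction S rule: finite_induct)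
  case empty
  show ?case by (simp add: same_top_def deg_less_const deg_less.zero)
next
  case (insert s S)
  have "same_top N (d + d * card S) (\<lambda>v. f s v * (\<Prod>s\<in>S. f s v)) (\<lambda>v. g s v * (\<Prod>s\<in>S. g s v))"
    by (rule same_top_mult) (use insert in auto)
  thus ?case using insert.hyps by simp
qed

lemma same_top_linear:
  assumes "i < N" "j < N"
  shows "same_top N 1 (\<lambda>v. v i + c * v j + b) (\<lambda>v. v i + c * v j)"
  using deg_less.add[OF deg_less_var[of i N 2 1] deg_less_var[of j N 2 c]] assms
  by (simp add: same_top_def deg_less_const numeral_2_eq_2)

lemma residues_not_dvd_diff:
  fixes x y m :: int
  assumes "x \<in> {0..<m}" "y \<in> {0..<m}" "x \<noteq> y"
  shows "\<not> m dvd x - y"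
  using assms by (simp add: mod_eq_dvd_iff[symmetric])

text \<open>A linear functional supported on a finite set which, modulo \<open>n\<close>, reads off the
  coefficient of the top power, as in the Combinatorial Nullstellensatz.\<close>

lemma coefficient_functional:
  fixes A :: "int set"
  assumes n: "prime n" and A: "finite A" "A \<noteq> {}" "A \<subseteq> {0..<int n}"
  shows "\<exists>c. \<forall>j<card A. [(\<Sum>v\<in>A. c v * v ^ j) = (if Suc j = card A then 1 else 0)] (mod int n)"
  using A
proof (induction A rule: finite_ne_induct)
  case (singleton a)
  show ?case by (rule exI[of _ "\<lambda>_. 1"]) simp
next
  case (insert b A)
  then obtain c where c: "\<And>j. j < card A \<Longrightarrow> [(\<Sum>v\<in>A. c v * v ^ j) = (if Suc j = card A then 1 else 0)] (mod int n)"
    by auto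
  have "\<exists>i. [(v - b) * i = 1] (mod int n)" if "v \<in> A" for v
  proof -
    have "v \<noteq> b" "v \<in> {0..<int n}" "b \<in> {0..<int n}" using that insert by auto
    hence "\<not> int n dvd v - b" by (intro residues_not_dvd_diff)
    hence "coprime (v - b) (int n)" using n prime_imp_coprime[of "int n" "v - b"] by (simp add: coprime_commute)
    thus ?thesis by (rule cong_solve_coprime_int)
  qed
  then obtain i where i: "\<And>v. v \<in> A \<Longrightarrow> [(v - b) * i v = 1] (mod int n)" by metis
  \<comment> \<open>Divided differences: the old weights are divided by v - b modulo n, and the
    weight at b is chosen so that all weights add up to 0. Multiplying by v then reproduces the old
    functional up to b times the new one.\<close>
  define c' where "c' v = (if v = b then - (\<Sum>u\<in>A. c u * i u) else c v * i v)" for v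
  have split: "(\<Sum>v\<in>insert b A. c' v * h v) = c' b * h b + (\<Sum>v\<in>A. c v * i v * h v)" for h
  proof -
    have "(\<Sum>v\<in>A. c' v * h v) = (\<Sum>v\<in>A. c v * i v * h v)"
      using insert.hyps by (intro sum.cong) (auto simp: c'_def)
    thus ?thesis using insert.hyps by simp
  qed
  have step: "[(\<Sum>v\<in>insert b A. c' v * v ^ Suc j) = b * (\<Sum>v\<in>insert b A. c' v * v ^ j) + (\<Sum>v\<in>A. c v * v ^ j)] (mod int n)" for j
  proof -
    have 1: "(\<Sum>v\<in>insert b A. c' v * v ^ Suc j) = b * (\<Sum>v\<in>insert b A. c' v * v ^ j) + (\<Sum>v\<in>A. c v * v ^ j * ((v - b) * i v))"
      unfolding split by (simp add: sum_distrib_left sum.distrib[symmetric] algebra_simps sum_subtractf)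
    have "[b * (\<Sum>v\<in>insert b A. c' v * v ^ j) + (\<Sum>v\<in>A. c v * v ^ j * ((v - b) * i v)) =
        b * (\<Sum>v\<in>insert b A. c' v * v ^ j) + (\<Sum>v\<in>A. c v * v ^ j * 1)] (mod int n)"
      by (intro cong_add cong_refl cong_sum cong_mult i)
    thus ?thesis unfolding 1 by simp
  qed
  have "[(\<Sum>v\<in>insert b A. c' v * v ^ j) = (if j = card A then 1 else 0)] (mod int n)" if "j \<le> card A" for j
    using that
  proof (induction j)
    case 0
    have "card A \<noteq> 0" using insert.hyps by auto
    moreover have "(\<Sum>v\<in>insert b A. c' v * v ^ 0) = 0" unfolding split by (simp add: c'_def)
    ultimately show ?case by simp
  next
    case (Suc j)
    have "[(\<Sum>v\<in>insert b A. c' v * v ^ Suc j) = b * (if j = card A then 1 else 0) + (if Suc j = card A then 1 else 0)] (mod int n)"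
      by (rule cong_trans[OF step]) (intro cong_add cong_mult cong_refl Suc.IH c; use Suc.prems in simp)
    thus ?case using Suc.prems by simp
  qed
  thus ?case using insert.hyps by (intro exI[of _ c']) auto
qed

section \<open>Extraction of top coefficients by weighted sums over a box\<close>

definition box_sum :: "nat \<Rightarrow> (nat \<Rightarrow> int set) \<Rightarrow> (nat \<Rightarrow> int \<Rightarrow> int) \<Rightarrow> ((nat \<Rightarrow> int) \<Rightarrow> int) \<Rightarrow> int" where
  "box_sum N A c f = (\<Sum>v\<in>PiE {..<N} A. (\<Prod>i<N. c i (v i)) * f v)"

lemma box_sum_mono:
  assumes "\<And>i. i < N \<Longrightarrow> finite (A i)"
  shows "box_sum N A c (\<lambda>v. b * (\<Prod>i<N. v i ^ e i)) = b * (\<Prod>i<N. \<Sum>x\<in>A i. c i x * x ^ e i)"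
proof -
  have "(\<Prod>i<N. \<Sum>x\<in>A i. c i x * x ^ e i) = (\<Sum>v\<in>PiE {..<N} A. \<Prod>i<N. c i (v i) * v i ^ e i)"
    by (rule prod_sum_PiE) (use assms in auto)
  thus ?thesis by (simp add: box_sum_def sum_distrib_left prod.distrib mult_ac)
qed

lemma box_sum_add: "box_sum N A c (\<lambda>v. f v + g v) = box_sum N A c f + box_sum N A c g"
  by (simp add: box_sum_def distrib_left sum.distrib)

lemma box_sum_low:
  assumes A: "\<And>i. i < N \<Longrightarrow> finite (A i)"
    and c: "\<And>i j. i < N \<Longrightarrow> j < r \<Longrightarrow> [(\<Sum>x\<in>A i. c i x * x ^ j) = 0] (mod m)"
    and f: "deg_less N (N * r) f"
  shows "[box_sum N A c f = 0] (mod m)"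
proof -
  have "[box_sum N A c f = 0] (mod m)" if "deg_less N D f" "D = N * r" for D
    using that
  proof (induction rule: deg_less.induct)
    case (mono e D b)
    have "\<exists>i<N. e i < r"
    proof (rule ccontr)
      assume "\<not> (\<exists>i<N. e i < r)"
      hence "(\<Sum>i<N. r) \<le> (\<Sum>i<N. e i)" by (intro sum_mono) auto
      thus False using mono by simp
    qed
    then obtain i where i: "i < N" "e i < r" by blast
    hence "m dvd (\<Sum>x\<in>A i. c i x * x ^ e i)" using c by (simp add: cong_0_iff)
    hence "m dvd (\<Prod>i<N. \<Sum>x\<in>A i. c i x * x ^ e i)"
      using i by (intro dvd_trans[OF _ dvd_prodI[of "{..<N}" i]]) auto
    thus ?case by (simp add: box_sum_mono A cong_0_iff)
  next
    case (add D f g)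
    thus ?case unfolding box_sum_add using cong_add[of _ 0 m _ 0] by fastforce
  qed (simp add: box_sum_def)
  thus ?thesis using f by blast
qed

text \<open>Modulo m both sides read off the coefficient of the product of all
  \<open>v i ^ r\<close> in f. Squaring the variables doubles exponents, so weights that detect 2r
  on the left correspond to weights that detect r on the right. The degree bound leaves no monomial
  with all exponents at least r except this one.\<close>

lemma box_sum_squares:
  assumes A: "\<And>i. i < N \<Longrightarrow> finite (A i)" "\<And>i. i < N \<Longrightarrow> finite (B i)"
    and c: "\<And>i j. i < N \<Longrightarrow> j \<le> 2 * r \<Longrightarrow> [(\<Sum>x\<in>A i. c i x * x ^ j) = (if j = 2 * r then 1 else 0)] (mod m)"
    and d: "\<And>i j. i < N \<Longrightarrow> j \<le> r \<Longrightarrow> [(\<Sum>x\<in>B i. d i x * x ^ j) = (if j = r then 1 else 0)] (mod m)"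
    and f: "deg_less N (Suc (N * r)) f"
  shows "[box_sum N A c (\<lambda>v. f (\<lambda>i. v i ^ 2)) = box_sum N B d f] (mod m)"
proof -
  have "[box_sum N A c (\<lambda>v. f (\<lambda>i. v i ^ 2)) = box_sum N B d f] (mod m)" if "deg_less N D f" "D = Suc (N * r)" for D
    using that
  proof (induction rule: deg_less.induct)
    case (mono e D b)
    have 1: "box_sum N A c (\<lambda>v. b * (\<Prod>i<N. (v i ^ 2) ^ e i)) = b * (\<Prod>i<N. \<Sum>x\<in>A i. c i x * x ^ (2 * e i))"
      unfolding power_mult[symmetric] by (rule box_sum_mono[OF A(1)])
    have 2: "box_sum N B d (\<lambda>v. b * (\<Prod>i<N. v i ^ e i)) = b * (\<Prod>i<N. \<Sum>x\<in>B i. d i x * x ^ e i)"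
      by (rule box_sum_mono[OF A(2)])
    show ?case
    proof (cases "\<exists>i<N. e i < r")
      case True
      then obtain i where i: "i < N" "e i < r" by blast
      have "m dvd (\<Sum>x\<in>A i. c i x * x ^ (2 * e i))" using c[of i "2 * e i"] i by (simp add: cong_0_iff)
      hence "m dvd (\<Prod>i<N. \<Sum>x\<in>A i. c i x * x ^ (2 * e i))"
        using i by (intro dvd_trans[OF _ dvd_prodI[of "{..<N}" i]]) auto
      moreover have "m dvd (\<Sum>x\<in>B i. d i x * x ^ e i)" using d[of i "e i"] i by (simp add: cong_0_iff)
      hence "m dvd (\<Prod>i<N. \<Sum>x\<in>B i. d i x * x ^ e i)"
        using i by (intro dvd_trans[OF _ dvd_prodI[of "{..<N}" i]]) auto
      ultimately have "m dvd b * (\<Prod>i<N. \<Sum>x\<in>A i. c i x * x ^ (2 * e i)) - b * (\<Prod>i<N. \<Sum>x\<in>B i. d i x * x ^ e i)"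
        by (intro dvd_diff dvd_mult)
      thus ?thesis unfolding 1 2 cong_iff_dvd_diff .
    next
      case False
      have "e i = r" if "i < N" for i
      proof (rule ccontr)
        assume "e i \<noteq> r"
        hence "(\<Sum>i<N. r) < (\<Sum>i<N. e i)" using False that
          by (intro sum_strict_mono_ex1) (auto intro!: bexI[of _ i])
        thus False using mono by simp
      qed
      hence "[(\<Prod>i<N. \<Sum>x\<in>A i. c i x * x ^ (2 * e i)) = (\<Prod>i<N. 1)] (mod m)"
        "[(\<Prod>i<N. \<Sum>x\<in>B i. d i x * x ^ e i) = (\<Prod>i<N. 1)] (mod m)"
        by (intro cong_prod; use c[of _ "2 * r"] d[of _ r] in simp)+
      hence "[(\<Prod>i<N. \<Sum>x\<in>A i. c i x * x ^ (2 * e i)) = (\<Prod>i<N. \<Sum>x\<in>B i. d i x * x ^ e i)] (mod m)"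
        using cong_trans cong_sym by blast
      thus ?thesis unfolding 1 2 by (rule cong_mult[OF cong_refl])
    qed
  next
    case (add D f g)
    thus ?case unfolding box_sum_add by (intro cong_add) auto
  qed (simp add: box_sum_def)
  thus ?thesis using f by blast
qed

text \<open>Ordered pairs, so that each unordered pair carries two factors; together the two
  accommodate all coincidences which have to be excluded.\<close>

definition off_diag :: "nat \<Rightarrow> (nat \<times> nat) set" where
  "off_diag N = {(i, j). i < N \<and> j < N \<and> i \<noteq> j}"

lemma off_diag: "finite (off_diag N)" "2 * card (off_diag N) = N * (2 * N - 2)"
proof -
  have eq: "off_diag N = {..<N} \<times> {..<N} - (\<lambda>i. (i, i)) ` {..<N}" by (auto simp: off_diag_def)
  show "finite (off_diag N)" unfolding eq by simp
  have "card (off_diag N) = N * N - N"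
    unfolding eq by (subst card_Diff_subset) (auto simp: card_cartesian_product card_image inj_on_def)
  thus "2 * card (off_diag N) = N * (2 * N - 2)" by (simp add: diff_mult_distrib2)
qed

text \<open>The top coefficient of \<open>\<Prod>\<^sub>i\<^sub>\<noteq>\<^sub>j (s i - s j)\<close> is \<open>N!\<close> up to sign: evaluated on the box
  \<open>{0..<N}\<^sup>N\<close>, only permutations contribute, and they all contribute equally.\<close>

lemma box_sum_discriminant:
  assumes n: "prime n" "N < n" "N > 0"
    and d: "\<And>j. j < N \<Longrightarrow> [(\<Sum>x\<in>{0..<int N}. d x * x ^ j) = (if Suc j = N then 1 else 0)] (mod int n)"
  shows "\<not> [box_sum N (\<lambda>_. {0..<int N}) (\<lambda>_. d) (\<lambda>s. \<Prod>(i,j)\<in>off_diag N. s i - s j) = 0] (mod int n)"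
proof -
  define B where "B = {0..<int N}"
  define S where "S = {s \<in> {..<N} \<rightarrow>\<^sub>E B. inj_on s {..<N}}"
  define \<kappa> where "\<kappa> = (\<Prod>x\<in>B. d x)"
  define \<gamma> where "\<gamma> = (\<Prod>(x,y)\<in>{(x,y). x \<in> B \<and> y \<in> B \<and> x \<noteq> y}. x - y)"
  have pn: "prime (int n)" using n by simp
  have bij: "bij_betw s {..<N} B" if "s \<in> S" for s
  proof -
    have "s ` {..<N} = B"
      by (rule card_subset_eq) (use that in \<open>auto simp: S_def B_def card_image\<close>)
    thus ?thesis using that by (simp add: S_def bij_betw_def)
  qed
  have "box_sum N (\<lambda>_. B) (\<lambda>_. d) (\<lambda>s. \<Prod>(i,j)\<in>off_diag N. s i - s j) =
     (\<Sum>s\<in>S. (\<Prod>i<N. d (s i)) * (\<Prod>(i,j)\<in>off_diag N. s i - s j))"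
    unfolding box_sum_def
  proof (rule sum.mono_neutral_right)
    show "finite ({..<N} \<rightarrow>\<^sub>E B)" by (intro finite_PiE) (auto simp: B_def)
    show "\<forall>s\<in>({..<N} \<rightarrow>\<^sub>E B) - S. (\<Prod>i<N. d (s i)) * (\<Prod>(i,j)\<in>off_diag N. s i - s j) = 0"
    proof
      fix s assume "s \<in> ({..<N} \<rightarrow>\<^sub>E B) - S"
      then obtain i j where "(i, j) \<in> off_diag N" "s i = s j" by (auto simp: S_def inj_on_def off_diag_def)
      hence "(\<Prod>(i,j)\<in>off_diag N. s i - s j) = 0"
        by (intro prod_zero off_diag bexI[of _ "(i,j)"]) auto
      thus "(\<Prod>i<N. d (s i)) * (\<Prod>(i,j)\<in>off_diag N. s i - s j) = 0" by simp
    qed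
  qed (auto simp: S_def)
  also have "\<dots> = (\<Sum>s\<in>S. \<kappa> * \<gamma>)"
  proof (intro sum.cong refl arg_cong2[where f="(*)"])
    fix s assume s: "s \<in> S"
    note b = bij[OF s]
    show "(\<Prod>i<N. d (s i)) = \<kappa>" unfolding \<kappa>_def by (rule prod.reindex_bij_betw[OF b])
    have "bij_betw (\<lambda>(i,j). (s i, s j)) (off_diag N) {(x,y). x \<in> B \<and> y \<in> B \<and> x \<noteq> y}"
    proof (rule bij_betw_byWitness[of _ "\<lambda>(x,y). (inv_into {..<N} s x, inv_into {..<N} s y)"])
      show "\<forall>a\<in>off_diag N. (\<lambda>(x,y). (inv_into {..<N} s x, inv_into {..<N} s y)) ((\<lambda>(i,j). (s i, s j)) a) = a"
        using b by (auto simp: off_diag_def bij_betw_def inv_into_f_f)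
      show "\<forall>a'\<in>{(x,y). x \<in> B \<and> y \<in> B \<and> x \<noteq> y}. (\<lambda>(i,j). (s i, s j)) ((\<lambda>(x,y). (inv_into {..<N} s x, inv_into {..<N} s y)) a') = a'"
        using b by (auto simp: bij_betw_inv_into_right)
      show "(\<lambda>(i,j). (s i, s j)) ` off_diag N \<subseteq> {(x,y). x \<in> B \<and> y \<in> B \<and> x \<noteq> y}"
        using b by (auto simp: off_diag_def bij_betw_def inj_on_def)
      have "inv_into {..<N} s x < N" if "x \<in> B" for x
        using bij_betwE[OF bij_betw_inv_into[OF b]] that by auto
      moreover have "inv_into {..<N} s x \<noteq> inv_into {..<N} s y" if "x \<in> B" "y \<in> B" "x \<noteq> y" for x y
        using that b by (metis bij_betw_inv_into_right)
      ultimately show "(\<lambda>(x,y). (inv_into {..<N} s x, inv_into {..<N} s y)) ` {(x,y). x \<in> B \<and> y \<in> B \<and> x \<noteq> y} \<subseteq> off_diag N"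
        by (auto simp: off_diag_def)
    qed
    from prod.reindex_bij_betw[OF this, of "\<lambda>(x,y). x - y"]
    show "(\<Prod>(i,j)\<in>off_diag N. s i - s j) = \<gamma>" unfolding \<gamma>_def by (simp add: case_prod_beta)
  qed
  also have "\<dots> = fact N * (\<kappa> * \<gamma>)"
  proof -
    \<comment> \<open>The two sides have different values outside the index set:
      \<open>undefined\<close> for points of the box, i itself for permutations.\<close>
    have "bij_betw (\<lambda>p. \<lambda>i\<in>{..<N}. int (p i)) {p. p permutes {..<N}} S"
    proof (rule bij_betw_byWitness[of _ "\<lambda>s i. if i < N then nat (s i) else i"])
      show "\<forall>p\<in>{p. p permutes {..<N}}. (\<lambda>i. if i < N then nat ((\<lambda>i\<in>{..<N}. int (p i)) i) else i) = p"
        by (auto simp: fun_eq_iff permutes_not_in)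
      show "\<forall>s\<in>S. (\<lambda>i\<in>{..<N}. int (if i < N then nat (s i) else i)) = s"
        by (auto simp: fun_eq_iff S_def B_def PiE_def extensional_def restrict_def)
      show "(\<lambda>p. \<lambda>i\<in>{..<N}. int (p i)) ` {p. p permutes {..<N}} \<subseteq> S"
      proof (intro image_subsetI)
        fix p assume "p \<in> {p. p permutes {..<N}}"
        hence p: "p permutes {..<N}" by simp
        have "p i < N" if "i < N" for i using permutes_in_image[OF p, of i] that by simp
        moreover have "inj_on (\<lambda>i\<in>{..<N}. int (p i)) {..<N}"
          using permutes_inj_on[OF p] by (auto simp: inj_on_def)
        ultimately show "(\<lambda>i\<in>{..<N}. int (p i)) \<in> S" by (auto simp: S_def B_def)
      qed
      show "(\<lambda>s i. if i < N then nat (s i) else i) ` S \<subseteq> {p. p permutes {..<N}}"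
      proof (intro image_subsetI CollectI bij_imp_permutes)
        fix s assume s: "s \<in> S"
        have "bij_betw nat B {..<N}"
          by (rule bij_betw_byWitness[of _ int]) (auto simp: B_def)
        hence "bij_betw (nat \<circ> s) {..<N} {..<N}" using bij[OF s] bij_betw_trans by blast
        moreover have "bij_betw (nat \<circ> s) {..<N} {..<N} \<longleftrightarrow> bij_betw (\<lambda>i. if i < N then nat (s i) else i) {..<N} {..<N}"
          by (rule bij_betw_cong) simp
        ultimately show "bij_betw (\<lambda>i. if i < N then nat (s i) else i) {..<N} {..<N}" by simp
      qed auto
    qed
    from bij_betw_same_card[OF this] have "card S = fact N" by (simp add: card_permutations)
    thus ?thesis by simp
  qed
  finally have eq: "box_sum N (\<lambda>_. B) (\<lambda>_. d) (\<lambda>s. \<Prod>(i,j)\<in>off_diag N. s i - s j) = fact N * (\<kappa> * \<gamma>)" .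
  have small: "\<not> int n dvd x - y" if "x \<in> B" "y \<in> B" "x \<noteq> y" for x y
    using that n(2) by (intro residues_not_dvd_diff) (auto simp: B_def)
  have "\<not> int n dvd \<gamma>" unfolding \<gamma>_def
  proof (subst prime_dvd_prod_iff[OF _ pn])
    show "finite {(x, y). x \<in> B \<and> y \<in> B \<and> x \<noteq> y}"
      by (rule finite_subset[of _ "B \<times> B"]) (auto simp: B_def)
  qed (use small in auto)
  moreover have "\<not> int n dvd \<kappa>"
  proof
    assume "int n dvd \<kappa>"
    then obtain b where b: "b \<in> B" "int n dvd d b"
      unfolding \<kappa>_def by (subst (asm) prime_dvd_prod_iff[OF _ pn]) (auto simp: B_def)
    \<comment> \<open>If the weight at b vanished modulo n, the functional would send this
      polynomial to 0, since it is zero on the other points; but it is monic of degree N - 1, so it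
      is sent to 1.\<close>
    define p :: "int poly" where "p = (\<Prod>x\<in>B - {b}. [:-x, 1:])"
    have deg: "degree p = N - 1" using b n(3)
      by (simp add: p_def degree_prod_eq_sum_degree B_def card_Diff_singleton)
    have lc: "coeff p (N - 1) = 1"
    proof -
      have "lead_coeff p = (\<Prod>x\<in>B - {b}. lead_coeff [:-x, 1:])" unfolding p_def by (rule lead_coeff_prod)
      thus ?thesis by (simp add: deg)
    qed
    have "(\<Sum>x\<in>B. d x * poly p x) = d b * poly p b"
    proof -
      have "(\<Sum>x\<in>B. d x * poly p x) = (\<Sum>x\<in>{b}. d x * poly p x)"
      proof (rule sum.mono_neutral_right)
        show "\<forall>x\<in>B - {b}. d x * poly p x = 0"
        proof
          fix x assume "x \<in> B - {b}"
          hence "poly p x = 0" unfolding p_def poly_prod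
            by (intro prod_zero) (auto simp: B_def intro!: bexI[of _ x])
          thus "d x * poly p x = 0" by simp
        qed
      qed (use b in \<open>auto simp: B_def\<close>)
      thus ?thesis by simp
    qed
    moreover have "(\<Sum>x\<in>B. d x * poly p x) = (\<Sum>k\<le>N - 1. coeff p k * (\<Sum>x\<in>B. d x * x ^ k))"
      unfolding poly_altdef deg sum_distrib_left by (subst sum.swap) (simp add: mult_ac)
    moreover have "[(\<Sum>k\<le>N - 1. coeff p k * (\<Sum>x\<in>B. d x * x ^ k)) = (\<Sum>k\<le>N - 1. coeff p k * (if Suc k = N then 1 else 0))] (mod int n)"
      unfolding B_def using n(3) by (intro cong_sum cong_mult cong_refl d) auto
    moreover have "(\<Sum>k\<le>N - 1. coeff p k * (if Suc k = N then 1 else 0)) = 1"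
    proof -
      have "(\<Sum>k\<le>N - 1. coeff p k * (if Suc k = N then 1 else 0)) = (\<Sum>k\<le>N - 1. if k = N - 1 then coeff p k else 0)"
        using n(3) by (intro sum.cong) auto
      thus ?thesis using lc by simp
    qed
    ultimately have "[d b * poly p b = 1] (mod int n)" by simp
    moreover have "[d b * poly p b = 0] (mod int n)" using b(2) by (simp add: cong_0_iff)
    ultimately have "[1 = 0] (mod int n)" by (metis cong_sym cong_trans)
    thus False using prime_gt_1_nat[OF n(1)] by (simp add: cong_0_iff)
  qed
  moreover have "\<not> int n dvd fact N"
    using n by (metis int_dvd_int_iff not_le of_nat_fact prime_dvd_fact_iff)
  ultimately show ?thesis
    unfolding B_def[symmetric] eq cong_0_iff using pn by (simp add: prime_dvd_mult_iff)
qed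

text \<open>The excluded coincidences are the zeros of a product of linear factors over ordered
  pairs. Its top form is the product of the \<open>v i ^ 2 - v j ^ 2\<close>, the off-diagonal
  product of differences evaluated at squares. The coefficient of the product of all
  \<open>v i ^ (2 * N - 2)\<close> is thus N! up to sign, nonzero modulo n because N < n. Each
  variable has exponent 2N - 2 there, so 2N - 1 candidates per variable suffice.\<close>

lemma disjoint_reflections:
  fixes w :: "nat \<Rightarrow> int"
  assumes n: "prime n" "N < n"
    and A: "\<And>i. i < N \<Longrightarrow> A i \<subseteq> {0..<int n}" "\<And>i. i < N \<Longrightarrow> card (A i) \<ge> 2 * N - 1"
  shows "\<exists>v. (\<forall>i<N. v i \<in> A i) \<and> (\<forall>i<N. \<forall>j<N. i \<noteq> j \<longrightarrow>
     \<not> [v i = v j] (mod int n) \<and> \<not> [v i = 2 * w j - v j] (mod int n) \<and>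
     \<not> [2 * w i - v i = 2 * w j - v j] (mod int n))"
proof (cases "N = 0")
  case False
  have "\<exists>A'\<subseteq>A i. card A' = 2 * N - 1" if "i < N" for i
    using A(2)[OF that] obtain_subset_with_card_n by metis
  then obtain A' where A': "\<And>i. i < N \<Longrightarrow> A' i \<subseteq> A i" "\<And>i. i < N \<Longrightarrow> card (A' i) = 2 * N - 1" by metis
  have fin: "finite (A' i)" if "i < N" for i
    using A'(1)[OF that] A(1)[OF that] finite_subset[of _ "{0..<int n}"] by blast
  have "\<exists>c. \<forall>j<2 * N - 1. [(\<Sum>v\<in>A' i. c v * v ^ j) = (if Suc j = 2 * N - 1 then 1 else 0)] (mod int n)" if i: "i < N" for i
  proof -
    have "A' i \<noteq> {}" using A'(2)[OF i] False by auto
    moreover have "A' i \<subseteq> {0..<int n}" using A' A i by blast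
    ultimately show ?thesis using coefficient_functional[OF n(1) fin[OF i]] A'(2)[OF i] by simp
  qed
  hence "\<forall>i. \<exists>c. i < N \<longrightarrow> (\<forall>j<2 * N - 1. [(\<Sum>v\<in>A' i. c v * v ^ j) = (if Suc j = 2 * N - 1 then 1 else 0)] (mod int n))"
    by blast
  from choice[OF this] obtain c where
    c: "\<And>i j. i < N \<Longrightarrow> j < 2 * N - 1 \<Longrightarrow> [(\<Sum>v\<in>A' i. c i v * v ^ j) = (if Suc j = 2 * N - 1 then 1 else 0)] (mod int n)"
    by blast
  obtain d where d: "\<And>j. j < N \<Longrightarrow> [(\<Sum>v\<in>{0..<int N}. d v * v ^ j) = (if Suc j = N then 1 else 0)] (mod int n)"
    using coefficient_functional[OF n(1), of "{0..<int N}"] False n(2) by auto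
  have c0: "[(\<Sum>v\<in>A' i. c i v * v ^ j) = (if j = 2 * (N - 1) then 1 else 0)] (mod int n)"
    if "i < N" "j \<le> 2 * (N - 1)" for i j
  proof -
    have "(Suc j = 2 * N - 1) = (j = 2 * (N - 1))" using False by auto
    moreover have "j < 2 * N - 1" using that False by simp
    ultimately show ?thesis using c[OF that(1), of j] by (simp only:)
  qed
  have d0: "[(\<Sum>v\<in>{0..<int N}. d v * v ^ j) = (if j = N - 1 then 1 else 0)] (mod int n)" if "j \<le> N - 1" for j
  proof -
    have "(Suc j = N) = (j = N - 1)" using False by auto
    thus ?thesis using d[of j] that False by (simp only:)
  qed
  \<comment> \<open>For i < j the first linear factor of the pair (i, j) excludes equality of v i
    and v j, while that of (j, i) excludes equality of the two reflections. The second linear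
    factors exclude that one point is the reflection of the other.\<close>
  define b where "b i j = (if i < j then 0 else 2 * w j - 2 * w i)" for i j :: nat
  define F where "F = (\<lambda>(i::nat,j::nat) v. (v i + (-1) * v j + b i j) * (v i + 1 * v j + - (2 * w j)) :: int)"
  define F0 where "F0 = (\<lambda>(i::nat,j::nat) v. (v i + (-1) * v j) * (v i + 1 * v j) :: int)"
  define f where "f v = (\<Prod>p\<in>off_diag N. F p v)" for v
  define f0 where "f0 v = (\<Prod>p\<in>off_diag N. F0 p v)" for v
  define g where "g = (\<lambda>s :: nat \<Rightarrow> int. \<Prod>(i,j)\<in>off_diag N. s i - s j)"
  have "same_top N (2 * card (off_diag N)) (\<lambda>v. \<Prod>p\<in>off_diag N. F p v) (\<lambda>v. \<Prod>p\<in>off_diag N. F0 p v)"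
  proof (rule same_top_prod[OF off_diag(1)])
    fix p assume "p \<in> off_diag N"
    then obtain i j where p: "p = (i,j)" "i < N" "j < N" by (auto simp: off_diag_def)
    show "same_top N 2 (F p) (F0 p)"
      using same_top_mult[OF same_top_linear[OF p(2,3), of "-1" "b i j"] same_top_linear[OF p(2,3), of 1 "- (2 * w j)"]]
      by (simp add: F_def F0_def p(1) numeral_2_eq_2)
  qed
  hence "deg_less N (N * (2 * N - 2)) (\<lambda>v. f v - f0 v)"
    unfolding same_top_def off_diag(2) f_def f0_def by blast
  hence low: "[box_sum N A' c (\<lambda>v. f v - f0 v) = 0] (mod int n)"
  proof (intro box_sum_low[where r="2 * N - 2"])
    show "[(\<Sum>x\<in>A' i. c i x * x ^ j) = 0] (mod int n)" if "i < N" "j < 2 * N - 2" for i j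
      using c0[OF that(1), of j] that(2) by (simp add: diff_mult_distrib2)
  qed (use fin in auto)
  have "f = (\<lambda>v. (f v - f0 v) + f0 v)" by simp
  hence "box_sum N A' c f = box_sum N A' c (\<lambda>v. f v - f0 v) + box_sum N A' c f0"
    by (metis box_sum_add)
  hence 1: "[box_sum N A' c f = box_sum N A' c f0] (mod int n)"
    using cong_add[OF low cong_refl[of "box_sum N A' c f0"]] by simp
  have f0g: "f0 = (\<lambda>v. g (\<lambda>i. v i ^ 2))"
    unfolding f0_def g_def F0_def by (intro ext prod.cong refl) (auto simp: power2_eq_square algebra_simps)
  have "deg_less N (Suc (N * (N - 1))) g"
  proof -
    have "same_top N (1 * card (off_diag N)) (\<lambda>v. \<Prod>p\<in>off_diag N. (case p of (i,j) \<Rightarrow> \<lambda>v. v i + (-1) * v j + 0) v) (\<lambda>v. \<Prod>p\<in>off_diag N. (case p of (i,j) \<Rightarrow> \<lambda>v. v i + (-1) * v j) v)"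
      by (rule same_top_prod[OF off_diag(1)]) (auto simp: off_diag_def intro!: same_top_linear[of _ _ _ "-1" 0, simplified])
    moreover have "card (off_diag N) = N * (N - 1)" using off_diag(2)[of N] by (simp add: algebra_simps)
    moreover have "g = (\<lambda>v. \<Prod>p\<in>off_diag N. (case p of (i,j) \<Rightarrow> \<lambda>v. v i + (-1) * v j) v)"
      unfolding g_def by (intro ext prod.cong) auto
    ultimately show ?thesis unfolding same_top_def by simp
  qed
  hence 2: "[box_sum N A' c f0 = box_sum N (\<lambda>_. {0..<int N}) (\<lambda>_. d) g] (mod int n)"
    unfolding f0g
  proof (rule box_sum_squares[rotated -1])
    show "[(\<Sum>x\<in>A' i. c i x * x ^ j) = (if j = 2 * (N - 1) then 1 else 0)] (mod int n)" if "i < N" "j \<le> 2 * (N - 1)" for i j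
      by (rule c0[OF that])
    show "[(\<Sum>x\<in>{0..<int N}. d x * x ^ j) = (if j = N - 1 then 1 else 0)] (mod int n)" if "i < N" "j \<le> N - 1" for i j
      by (rule d0[OF that(2)])
  qed (use fin in auto)
  have "\<not> [box_sum N (\<lambda>_. {0..<int N}) (\<lambda>_. d) g = 0] (mod int n)"
    unfolding g_def by (rule box_sum_discriminant) (use n False d in auto)
  hence ne: "\<not> [box_sum N A' c f = 0] (mod int n)" using 1 2 by (meson cong_sym cong_trans)
  have "\<exists>v\<in>PiE {..<N} A'. \<not> int n dvd f v"
  proof (rule ccontr)
    assume "\<not> ?thesis"
    hence "int n dvd box_sum N A' c f" unfolding box_sum_def by (intro dvd_sum dvd_mult) auto
    thus False using ne by (simp add: cong_0_iff)
  qed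
  then obtain v where v: "v \<in> PiE {..<N} A'" "\<not> int n dvd f v" by blast
  have Fnd: "\<not> int n dvd F (i,j) v" if "i < N" "j < N" "i \<noteq> j" for i j
  proof
    assume "int n dvd F (i,j) v"
    hence "int n dvd f v" unfolding f_def
      using that by (intro dvd_trans[OF _ dvd_prodI[of _ "(i,j)"]] off_diag) (auto simp: off_diag_def)
    thus False using v by simp
  qed
  have nd: "\<not> int n dvd v i - v j + b i j" "\<not> int n dvd v i + v j - 2 * w j" if "i < N" "j < N" "i \<noteq> j" for i j
    using Fnd[OF that] by (auto simp: F_def)
  have "\<not> [v i = v j] (mod int n) \<and> \<not> [v i = 2 * w j - v j] (mod int n) \<and>
     \<not> [2 * w i - v i = 2 * w j - v j] (mod int n)" if ij: "i < N" "j < N" "i \<noteq> j" for i j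
  proof (intro conjI notI)
    assume "[v i = 2 * w j - v j] (mod int n)"
    thus False using nd(2)[OF ij] by (simp add: cong_iff_dvd_diff algebra_simps)
  next
    assume "[v i = v j] (mod int n)"
    hence *: "int n dvd v i - v j" "int n dvd v j - v i" by (simp_all add: cong_iff_dvd_diff dvd_diff_commute)
    show False
    proof (cases "i < j")
      case True thus False using nd(1)[OF ij] * by (simp add: b_def)
    next
      case False
      hence "j < i" using ij by simp
      thus False using nd(1)[OF ij(2,1)] ij(3) * by (simp add: b_def)
    qed
  next
    assume "[2 * w i - v i = 2 * w j - v j] (mod int n)"
    hence *: "int n dvd v j - v i + (2 * w i - 2 * w j)" "int n dvd v i - v j + (2 * w j - 2 * w i)"
    proof -
      assume "[2 * w i - v i = 2 * w j - v j] (mod int n)"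
      hence "int n dvd (2 * w i - v i) - (2 * w j - v j)" by (simp only: cong_iff_dvd_diff)
      moreover from this have "int n dvd (2 * w j - v j) - (2 * w i - v i)" by (simp only: dvd_diff_commute)
      ultimately show "int n dvd v j - v i + (2 * w i - 2 * w j)" "int n dvd v i - v j + (2 * w j - 2 * w i)"
        by (simp_all add: algebra_simps)
    qed
    show False
    proof (cases "i < j")
      case True thus False using nd(1)[OF ij(2,1)] ij(3) * by (simp add: b_def)
    next
      case False
      thus False using nd(1)[OF ij] * by (simp add: b_def)
    qed
  qed
  moreover have "\<forall>i<N. v i \<in> A i" using v(1) A'(1) by auto
  ultimately show ?thesis by blast
qed auto

lemma half_multiset:
  "\<exists>H. H + H \<subseteq># R \<and> size R \<le> 2 * size H + card (set_mset R)"
proof -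
  define H where "H = (\<Sum>w\<in>set_mset R. replicate_mset (count R w div 2) w)"
  have cH: "count H x = (if x \<in># R then count R x div 2 else 0)" for x
    by (simp add: H_def count_sum)
  have "H + H \<subseteq># R" by (auto simp: subseteq_mset_def cH)
  moreover have "size R \<le> 2 * size H + card (set_mset R)"
  proof -
    have "size R = (\<Sum>w\<in>set_mset R. count R w)" by (simp add: size_multiset_overloaded_eq)
    also have "\<dots> \<le> (\<Sum>w\<in>set_mset R. 2 * (count R w div 2) + 1)" by (intro sum_mono) auto
    also have "\<dots> = 2 * size H + card (set_mset R)"
      by (simp only: sum.distrib sum_distrib_left[symmetric]) (simp add: H_def)
    finally show ?thesis .
  qed
  ultimately show ?thesis by blast
qed

lemma mset_map_div2:
  "mset (map (\<lambda>j. f (j div 2)) [0..<2 * N]) = image_mset f (mset [0..<N]) + image_mset f (mset [0..<N])"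
  by (induction N) (simp_all add: upt_add_eq_append)

text \<open>The values missing from a zero-sum family \<open>A\<close> of \<open>n\<close> residues are matched with the
  repeated values so that in all but few of the pairs the differences cancel two by two.\<close>

lemma pairing_exists:
  fixes A :: "nat multiset"
  assumes n: "prime n" "odd n" and A: "size A = n" "set_mset A \<subseteq> {0..<n}" "n dvd sum_mset A"
    and nonconst: "card (set_mset A) \<noteq> 1" and nonperm: "card (set_mset A) \<noteq> n"
  shows "\<exists>rs vs N. A = mset_set (set_mset A) + mset rs \<and> distinct vs \<and> set vs = {0..<n} - set_mset A \<and>
     length vs = length rs \<and> 2 * N + 2 \<le> length rs \<and> 2 * length rs \<le> 2 * N + n - 1 \<and>
     (\<forall>s<N. [rs ! (2 * s) + rs ! (2 * s+1) = vs ! (2 * s) + vs ! (2 * s+1)] (mod n))"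
proof -
  define V where "V = set_mset A"
  define k where "k = card V"
  define R where "R = A - mset_set V"
  define M where "M = {0..<n} - V"
  have n1: "n > 1" using prime_gt_1_nat[OF n(1)] .
  have finV: "finite V" by (simp add: V_def)
  have Vsub: "V \<subseteq> {0..<n}" using A by (simp add: V_def)
  have VA: "mset_set V \<subseteq># A"
    by (auto simp: V_def subseteq_mset_def count_mset_set')
  hence AR: "A = mset_set V + R" by (simp add: R_def)
  have kn: "k \<le> n" unfolding k_def using card_mono[OF _ Vsub] by simp
  have sizeR: "size R = n - k" unfolding R_def using VA A(1) by (simp add: size_Diff_submset k_def)
  have cardM: "card M = n - k" unfolding M_def k_def using Vsub finV by (simp add: card_Diff_subset)
  have RV: "set_mset R \<subseteq> V" unfolding R_def V_def using in_diffD by fastforce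
  have modeq: "x = y" if "x < n" "y < n" "[x = y] (mod n)" for x y
    using that by (simp add: Cong.cong_def)
  have "A \<noteq> {#}" using A(1) n1 by auto
  hence k0: "k \<noteq> 0" by (simp add: k_def V_def)
  have k1: "k \<noteq> 1" using nonconst by (simp add: k_def V_def)
  have kn': "k \<noteq> n" using nonperm by (simp add: k_def V_def)
  \<comment> \<open>With only two values x and y the sum is congruent to the multiplicity of x times
    x - y, and neither factor is divisible by n.\<close>
  have k2: "k \<noteq> 2"
  proof
    assume "k = 2"
    then obtain x y where xy: "V = {x, y}" "x \<noteq> y" unfolding k_def by (meson card_2_iff)
    have sz: "n = count A x + count A y"
      using A(1) xy by (simp add: size_multiset_overloaded_eq flip: V_def)
    have A2: "A = replicate_mset (count A x) x + replicate_mset (count A y) y"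
    proof (rule multiset_eqI)
      fix z show "count A z = count (replicate_mset (count A x) x + replicate_mset (count A y) y) z"
        using xy V_def not_in_iff[of z A] by auto
    qed
    have "sum_mset A = count A x * x + count A y * y"
      by (subst A2) simp
    hence "int n dvd int (count A x) * int x + int (count A y) * int y" using A(3) by (metis int_dvd_int_iff of_nat_add of_nat_mult)
    moreover have "int (count A x) * int x + int (count A y) * int y = int (count A x) * (int x - int y) + int n * int y"
      using sz by (simp add: algebra_simps)
    ultimately have "int n dvd int (count A x) * (int x - int y)" by (simp add: dvd_add_left_iff)
    hence "int n dvd int (count A x) \<or> int n dvd int x - int y" using n(1) by (simp add: prime_dvd_mult_iff)
    moreover have "0 < count A x" "0 < count A y" using xy V_def by auto
    hence "\<not> n dvd count A x" using sz nat_dvd_not_less[of "count A x" n] by simp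
    moreover have "\<not> int n dvd int x - int y"
      using xy Vsub by (intro residues_not_dvd_diff) auto
    ultimately show False by simp
  qed
  obtain p where p: "n = 2 * p + 1" using n(2) by (auto elim: oddE)
  have kn1: "k \<noteq> n - 1"
  proof
    assume "k = n - 1"
    hence "size R = 1" "card M = 1" using sizeR cardM n1 by auto
    then obtain r v where r: "R = {#r#}" and v: "M = {v}" by (meson size_1_singleton_mset card_1_singletonE)
    have sA: "sum_mset A = (\<Sum>x\<in>V. x) + r" by (subst AR) (simp add: r sum_unfold_sum_mset)
    have sV: "(\<Sum>x\<in>V. x) + v = (\<Sum>x\<in>{0..<n}. x)"
    proof -
      have "{0..<n} = V \<union> M" "V \<inter> M = {}" using Vsub by (auto simp: M_def)
      thus ?thesis using finV v by (simp add: sum.union_disjoint)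
    qed
    have sn: "n dvd (\<Sum>x\<in>{0..<n}. x)"
    proof -
      have "{0..<n} = {0..2 * p}" using p by auto
      hence "(\<Sum>x\<in>{0..<n}. x) = n * p" using gauss_sum_nat[of "2 * p"] p by simp
      thus ?thesis by simp
    qed
    have "[(\<Sum>x\<in>V. x) + r = (\<Sum>x\<in>V. x) + v] (mod n)"
      unfolding Cong.cong_def using A(3) sn unfolding sA sV[symmetric] by (simp only: dvd_imp_mod_0)
    hence "[r = v] (mod n)" by (simp add: cong_add_lcancel_nat)
    moreover have "r \<in> V" using RV r by simp
    moreover have "v \<in> M" using v by simp
    ultimately show False using modeq[of r v] Vsub by (auto simp: M_def)
  qed
  have k3: "3 \<le> k" "k + 2 \<le> n" using k0 k1 k2 kn kn' kn1 by auto
  have finM: "finite M" by (simp add: M_def)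
  show ?thesis
  proof (cases "k \<le> p")
    \<comment> \<open>More than half of the residues occur, so 2 (n - k) <= n - 1 and any matching
      works with N = 0.\<close>
    case False
    obtain rs where rs: "mset rs = R" using ex_mset by blast
    obtain vs where vs: "set vs = M" "distinct vs" using finite_distinct_list[OF finM] by blast
    have len: "length rs = n - k" "length vs = n - k"
      using rs sizeR vs cardM by (metis size_mset) (metis distinct_card vs(1) vs(2) cardM)
    show ?thesis
      by (rule exI[of _ rs], rule exI[of _ vs], rule exI[of _ 0])
         (use AR rs vs len k3 False p in \<open>auto simp: V_def M_def\<close>)
  next
    case True
    \<comment> \<open>The least N with 2 (n - k) <= 2 N + n - 1.\<close>
    define N where "N = p + 1 - k"
    have N: "2 * N + 2 * k = n + 1" "0 < N" using True p by (auto simp: N_def)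
    \<comment> \<open>Each element of H occurs at least twice as often in R and is the centre of a
      reflected pair. Halving loses at most one element per value, hence at most k in all, which
      leaves at least N centres.\<close>
    obtain H where H: "H + H \<subseteq># R" "size R \<le> 2 * size H + card (set_mset R)" using half_multiset by blast
    have "card (set_mset R) \<le> k" unfolding k_def by (rule card_mono[OF finV RV])
    hence HN: "N \<le> size H" using H(2) sizeR N p by linarith
    obtain hs where hs: "mset hs = H" using ex_mset by blast
    define ws where "ws = take N hs"
    have lws: "length ws = N" using HN hs by (auto simp: ws_def)
    have wsH: "mset ws \<subseteq># H" unfolding ws_def hs[symmetric] by (metis append_take_drop_id mset_append mset_subset_eq_add_left)
    have wsR: "mset ws + mset ws \<subseteq># R" using subset_mset.add_mono[OF wsH wsH] H(1) by (rule subset_mset.order_trans)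
    have wsV: "ws ! i \<in> V" if "i < N" for i
    proof -
      have "ws ! i \<in># mset ws" using that lws by simp
      hence "ws ! i \<in># R" using mset_subset_eqD[OF wsR, of "ws ! i"] by simp
      thus ?thesis using RV by blast
    qed
    define w where "w i = int (ws ! i)" for i
    define B where "B = int ` V"
    \<comment> \<open>E i is the reflection of the set of values in w i. A point of Av i is a
      missing residue whose reflection is missing too. As w i is itself a value and fixed by the
      reflection, B and E i overlap, so their union has at most 2k - 1 elements.\<close>
    define E where "E i = {x \<in> {0..<int n}. (2 * w i - x) mod int n \<in> B}" for i
    define Av where "Av i = {0..<int n} - (B \<union> E i)" for i
    have Bsub: "B \<subseteq> {0..<int n}" using Vsub by (auto simp: B_def)
    have cardB: "card B = k" by (simp add: B_def k_def card_image)
    have Xcard: "card (Av i) \<ge> 2 * N - 1" if "i < N" for i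
    proof -
      have "bij_betw (\<lambda>x. (2 * w i - x) mod int n) (E i) B"
      proof (rule bij_betw_byWitness[of _ "\<lambda>x. (2 * w i - x) mod int n"])
        show "\<forall>a\<in>E i. (2 * w i - (2 * w i - a) mod int n) mod int n = a"
          by (auto simp: E_def mod_diff_right_eq)
        show "\<forall>a\<in>B. (2 * w i - (2 * w i - a) mod int n) mod int n = a"
          using Bsub by (auto simp: mod_diff_right_eq)
        show "(\<lambda>x. (2 * w i - x) mod int n) ` B \<subseteq> E i"
        proof
          fix y assume "y \<in> (\<lambda>x. (2 * w i - x) mod int n) ` B"
          then obtain x where "x \<in> B" "y = (2 * w i - x) mod int n" by auto
          thus "y \<in> E i" using Bsub n1 by (auto simp: E_def mod_diff_right_eq)
        qed
      qed (auto simp: E_def)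
      hence cE: "card (E i) = k" using cardB by (simp add: bij_betw_same_card)
      have finE: "finite (E i)" "finite B" using finV by (auto simp: E_def B_def intro: finite_subset[of _ "{0..<int n}"])
      have wB: "w i \<in> B" using wsV[OF that] by (simp add: w_def B_def)
      hence "w i \<in> E i" using Bsub by (auto simp: E_def)
      hence "1 \<le> card (B \<inter> E i)" using wB finE by (metis IntI One_nat_def Suc_leI card_gt_0_iff empty_iff finite_Int)
      hence "card (B \<union> E i) + 1 \<le> 2 * k" using card_Un_Int[OF finE(2,1)] cE cardB by linarith
      moreover have "card (Av i) = n - card (B \<union> E i)"
        unfolding Av_def using finE Bsub by (subst card_Diff_subset) (auto simp: E_def)
      ultimately show ?thesis using N by linarith
    qed
    have "N < n" using N k3 by linarith
    moreover have "Av i \<subseteq> {0..<int n}" for i by (simp add: Av_def Diff_subset)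
    ultimately obtain v where v0: "\<forall>i<N. v i \<in> Av i" and vd0: "\<forall>i<N. \<forall>j<N. i \<noteq> j \<longrightarrow>
         \<not> [v i = v j] (mod int n) \<and> \<not> [v i = 2 * w j - v j] (mod int n) \<and>
         \<not> [2 * w i - v i = 2 * w j - v j] (mod int n)"
      using disjoint_reflections[OF n(1), of N Av w] Xcard by blast
    have v: "v i \<in> Av i" if "i < N" for i using v0 that by blast
    have vd: "\<not> [v i = v j] (mod int n) \<and> \<not> [v i = 2 * w j - v j] (mod int n) \<and>
         \<not> [2 * w i - v i = 2 * w j - v j] (mod int n)" if "i < N" "j < N" "i \<noteq> j" for i j
      using vd0 that by blast
    define v' where "v' i = (2 * w i - v i) mod int n" for i
    \<comment> \<open>Positions 2s and 2s + 1 hold v s and its reflection; they face two copies of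
      the centre \<open>ws ! s\<close>, so both sums are 2 w s modulo n.\<close>
    define u where "u j = nat (if even j then v (j div 2) else v' (j div 2))" for j :: nat
    have range: "v i \<in> {0..<int n}" "v i \<notin> B" "v' i \<in> {0..<int n}" "v' i \<notin> B" if "i < N" for i
      using v[OF that] n1 by (auto simp: Av_def E_def v'_def)
    \<comment> \<open>2 is invertible modulo n, so the reflection fixes only its centre, which is a
      value and hence not among the candidates.\<close>
    have self: "v i \<noteq> v' i" if i: "i < N" for i
    proof
      assume "v i = v' i"
      hence "[v i = 2 * w i - v i] (mod int n)" using range(1)[OF i] by (simp add: v'_def Cong.cong_def)
      hence "int n dvd 2 * (v i - w i)" by (simp add: cong_iff_dvd_diff algebra_simps)
      hence "int n dvd 2 \<or> int n dvd v i - w i" using n(1) prime_dvd_mult_iff[of "int n" 2 "v i - w i"] by simp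
      moreover have "\<not> int n dvd 2" using n1 n(2) p k3 by (auto dest!: zdvd_imp_le)
      moreover have wB: "w i \<in> B" using wsV[OF i] by (simp add: w_def B_def)
      moreover have "\<not> int n dvd v i - w i"
        using range(1,2)[OF i] wB Bsub by (intro residues_not_dvd_diff) auto
      ultimately show False by blast
    qed
    have dist: "a = b" if ab: "a < 2 * N" "b < 2 * N" "u a = u b" for a b
    proof (rule ccontr)
      assume ne: "a \<noteq> b"
      define i j where "i = a div 2" and "j = b div 2"
      have ij: "i < N" "j < N" using ab by (auto simp: i_def j_def)
      have eq: "(if even a then v i else v' i) = (if even b then v j else v' j)"
        using ab(3) range[OF ij(1)] range[OF ij(2)] by (auto simp: u_def i_def j_def eq_nat_nat_iff split: if_splits)
      show False
      proof (cases "i = j")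
        case True
        hence "even a \<noteq> even b" using ne unfolding i_def j_def by (metis even_two_times_div_two odd_two_times_div_two_succ)
        thus False using eq self[OF ij(1)] True by (auto split: if_splits)
      next
        case False
        have "[v j = 2 * w i - v i] (mod int n)" if "v j = v' i"
          using that range(1)[OF ij(2)] by (simp add: v'_def Cong.cong_def)
        moreover have "[v i = 2 * w j - v j] (mod int n)" if "v i = v' j"
          using that range(1)[OF ij(1)] by (simp add: v'_def Cong.cong_def)
        moreover have "[2 * w i - v i = 2 * w j - v j] (mod int n)" if "v' i = v' j"
          using that by (simp add: v'_def Cong.cong_def)
        ultimately show False using eq vd[OF ij False] vd[OF ij(2,1)] False by (auto split: if_splits)
      qed
    qed
    have uM: "u a \<in> M" if "a < 2 * N" for a
    proof -
      have i: "a div 2 < N" using that by auto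
      define x where "x = (if even a then v (a div 2) else v' (a div 2))"
      have x: "x \<in> {0..<int n}" "x \<notin> B" using range[OF i] by (auto simp: x_def)
      have "u a = nat x" by (simp add: u_def x_def)
      thus ?thesis using x by (auto simp: M_def B_def nat_less_iff image_iff)
    qed
    define us where "us = map u [0..<2 * N]"
    have us: "distinct us" "set us \<subseteq> M" "length us = 2 * N"
      using dist uM by (auto simp: us_def distinct_map inj_on_def)
    obtain vs' where vs': "set vs' = M - set us" "distinct vs'" using finite_distinct_list[of "M - set us"] finM by blast
    define rr where "rr = map (\<lambda>j. ws ! (j div 2)) [0..<2 * N]"
    have mrr: "mset rr = mset ws + mset ws"
    proof -
      have "image_mset ((!) ws) (mset [0..<N]) = mset ws"
        using lws by (metis map_nth mset_map)
      thus ?thesis unfolding rr_def mset_map_div2[of "\<lambda>i. ws ! i"] by simp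
    qed
    obtain rs' where rs': "mset rs' = R - (mset ws + mset ws)" using ex_mset by blast
    define rs vs where "rs = rr @ rs'" and "vs = us @ vs'"
    have mrs: "mset rs = R" using wsR by (simp add: rs_def mrr rs')
    have vsM: "set vs = M" "distinct vs" using us vs' by (auto simp: vs_def)
    have lrs: "length rs = n - k" using mrs sizeR by (metis size_mset)
    have lvs: "length vs = n - k" using vsM cardM distinct_card[OF vsM(2)] by simp
    have cong: "[rs ! (2 * s) + rs ! (2 * s+1) = vs ! (2 * s) + vs ! (2 * s+1)] (mod n)" if s: "s < N" for s
    proof -
      have l: "length rr = 2 * N" by (simp add: rr_def)
      have e: "rs ! (2 * s) = ws ! s" "rs ! (2 * s+1) = ws ! s" "vs ! (2 * s) = u (2 * s)" "vs ! (2 * s+1) = u (2 * s+1)"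
        using s l us(3) by (auto simp: rs_def vs_def nth_append rr_def us_def)
      have "int (u (2 * s) + u (2 * s+1)) = v s + v' s" using range[OF s] by (simp add: u_def)
      also have "[v s + v' s = v s + (2 * w s - v s)] (mod int n)"
        unfolding v'_def by (intro cong_add cong_refl) simp
      finally have "[int (u (2 * s) + u (2 * s+1)) = int (ws ! s + ws ! s)] (mod int n)" by (simp add: w_def)
      thus ?thesis unfolding e cong_int_iff by (rule cong_sym)
    qed
    have "A = mset_set (set_mset A) + mset rs" using AR mrs by (simp add: V_def)
    moreover have "set vs = {0..<n} - set_mset A" using vsM by (simp add: M_def V_def)
    moreover have "length vs = length rs" "2 * N + 2 \<le> length rs" "2 * length rs \<le> 2 * N + n - 1"
      using lvs lrs N k3 by linarith+
    ultimately show ?thesis using vsM(2) cong by blast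
  qed
qed

section \<open>The dimension of the varieties of hypergeometric type\<close>

lemma infinite_alg_closed: "infinite (UNIV :: 'a::alg_closed_field set)"
proof
  assume fin: "finite (UNIV :: 'a set)"
  define P where "P = 1 + (\<Prod>x\<in>(UNIV :: 'a set). [:-x, 1:])"
  have "degree (\<Prod>x\<in>(UNIV :: 'a set). [:-x, 1:]) = CARD('a)"
    by (simp add: degree_prod_eq_sum_degree)
  moreover have "CARD('a) > 0" using fin by (simp add: card_gt_0_iff)
  ultimately have "degree P = CARD('a)" unfolding P_def by (subst degree_add_eq_right) auto
  hence "degree P > 0" using \<open>CARD('a) > 0\<close> by simp
  then obtain x where "poly P x = 0" using alg_closed_imp_poly_has_root by blast
  moreover have "poly (\<Prod>x\<in>(UNIV :: 'a set). [:-x, 1:]) x = 0"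
    unfolding poly_prod using fin by (intro prod_zero) (auto intro!: bexI[of _ x])
  ultimately show False by (simp add: P_def)
qed

text \<open>Gaussian elimination: each equation with a nonzero coefficient removes one unknown
  i0.\<close>

lemma homogeneous_system:
  fixes M :: "'i \<Rightarrow> 'b \<Rightarrow> 'a::field"
  assumes "finite B" "finite I" "card B < card I"
  shows "\<exists>c. (\<exists>i\<in>I. c i \<noteq> 0) \<and> (\<forall>b\<in>B. (\<Sum>i\<in>I. c i * M i b) = 0)"
  using assms
proof (induction B arbitrary: I M rule: finite_induct)
  case empty
  then obtain i where "i \<in> I" by (metis all_not_in_conv card.empty less_irrefl)
  thus ?case by (intro exI[of _ "\<lambda>_. 1"]) auto
next
  case (insert b B)
  show ?case
  proof (cases "\<forall>i\<in>I. M i b = 0")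
    case True
    have "card B < card I" using insert.hyps insert.prems by simp
    from insert.IH[OF insert.prems(1) this, of M]
    obtain c where "\<exists>i\<in>I. c i \<noteq> 0" "\<forall>b\<in>B. (\<Sum>i\<in>I. c i * M i b) = 0" by blast
    thus ?thesis using True by (intro exI[of _ c]) auto
  next
    case False
    then obtain i0 where i0: "i0 \<in> I" "M i0 b \<noteq> 0" by blast
    define M' where "M' i b' = M i b' - M i b / M i0 b * M i0 b'" for i b'
    have "card B < card (I - {i0})" using insert i0 by simp
    then obtain c where c: "\<exists>i\<in>I - {i0}. c i \<noteq> 0" "\<forall>b'\<in>B. (\<Sum>i\<in>I - {i0}. c i * M' i b') = 0"
      using insert.IH[of "I - {i0}" M'] insert.prems by auto
    define s where "s = - (\<Sum>i\<in>I - {i0}. c i * (M i b / M i0 b))"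
    define c' where "c' = c(i0 := s)"
    have eq: "(\<Sum>i\<in>I. c' i * M i b') = (\<Sum>i\<in>I - {i0}. c i * M' i b')" for b'
    proof -
      have "(\<Sum>i\<in>I. c' i * M i b') = s * M i0 b' + (\<Sum>i\<in>I - {i0}. c i * M i b')"
        using insert.prems(1) i0(1) by (subst sum.remove[of _ i0]) (auto simp: c'_def intro!: sum.cong)
      thus ?thesis by (simp add: s_def M'_def algebra_simps sum_subtractf sum_distrib_left sum_distrib_right)
    qed
    have "(\<Sum>i\<in>I. c' i * M i b) = 0" unfolding eq using i0 by (simp add: M'_def)
    moreover have "\<exists>i\<in>I. c' i \<noteq> 0" using c(1) by (auto simp: c'_def)
    ultimately show ?thesis using c(2) eq by (intro exI[of _ c']) auto
  qed
qed

lemma monomials_independent: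
  fixes c :: "(nat \<Rightarrow> nat) \<Rightarrow> 'a::alg_closed_field"
  assumes "finite S" "\<And>u. (\<Sum>k\<in>PiE S (\<lambda>_. {..D}). c k * (\<Prod>i\<in>S. u i ^ k i)) = 0" "k \<in> PiE S (\<lambda>_. {..D})"
  shows "c k = 0"
  using assms
proof (induction S arbitrary: c k rule: finite_induct)
  case empty
  thus ?case by simp
next
  case (insert x S)
  define C where "C t k' = (\<Sum>a\<le>D. c (k'(x := a)) * t ^ a)" for t :: 'a and k'
  have "C t k' = 0" if k': "k' \<in> PiE S (\<lambda>_. {..D})" for t k'
  proof (rule insert.IH[OF _ k'])
    fix u :: "nat \<Rightarrow> 'a"
    define v where "v = u(x := t)"
    have "(\<Sum>k\<in>PiE (insert x S) (\<lambda>_. {..D}). c k * (\<Prod>i\<in>insert x S. v i ^ k i)) =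
      (\<Sum>(k', a)\<in>PiE S (\<lambda>_. {..D}) \<times> {..D}. c (k'(x := a)) * t ^ a * (\<Prod>i\<in>S. u i ^ k' i))"
    proof (rule sum.reindex_bij_witness[of _ "\<lambda>(k', a). k'(x := a)" "\<lambda>k. (k(x := undefined), k x)"], goal_cases)
      case (1 k) thus ?case by simp
    next
      case (2 k) thus ?case using insert.hyps by (auto simp: PiE_def Pi_def extensional_def)
    next
      case (3 p) thus ?case using insert.hyps by (auto simp: PiE_def extensional_def split: prod.splits)
    next
      case (4 p) thus ?case using insert.hyps by (auto simp: PiE_def extensional_def split: prod.splits)
    next
      case (5 k)
      have "(\<Prod>i\<in>S. u i ^ (k(x := undefined)) i) = (\<Prod>i\<in>S. v i ^ k i)"
        using insert.hyps by (intro prod.cong) (auto simp: v_def)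
      thus ?case using insert.hyps by (simp add: v_def mult.assoc)
    qed
    also have "\<dots> = (\<Sum>k'\<in>PiE S (\<lambda>_. {..D}). C t k' * (\<Prod>i\<in>S. u i ^ k' i))"
      by (simp add: sum.cartesian_product[symmetric] C_def sum_distrib_right)
    finally show "(\<Sum>k'\<in>PiE S (\<lambda>_. {..D}). C t k' * (\<Prod>i\<in>S. u i ^ k' i)) = 0"
      using insert.prems(1)[of v] by simp
  qed
  hence zero: "(\<Sum>a\<le>D. c ((k(x := undefined))(x := a)) * t ^ a) = 0" for t
  proof -
    have "k(x := undefined) \<in> PiE S (\<lambda>_. {..D})"
      using insert.prems(2) insert.hyps by (auto simp: PiE_def Pi_def extensional_def)
    from \<open>\<And>k' t. k' \<in> PiE S (\<lambda>_. {..D}) \<Longrightarrow> C t k' = 0\<close>[OF this, of t] show ?thesis by (simp add: C_def)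
  qed
  define p where "p = (\<Sum>a\<le>D. monom (c (k(x := a))) a)"
  have "poly p t = 0" for t using zero[of t] by (simp add: p_def poly_sum poly_monom)
  hence "p = 0" using poly_roots_finite[of p] infinite_alg_closed[where 'a='a] by auto
  moreover have "coeff p (k x) = c k"
    using insert.prems(2) by (auto simp: p_def coeff_sum)
  ultimately show ?case by simp
qed

section \<open>Polynomial maps and their degrees in each variable\<close>

lemma polynomial_map_cong:
  assumes "R \<in> polynomial_maps m" "\<And>i. i \<in> {1..m} \<Longrightarrow> u i = v i"
  shows "R u = R v"
  using assms by (induction rule: polynomial_maps.induct) auto

lemma polynomial_map_univariate:
  assumes "R \<in> polynomial_maps m"
  shows "\<exists>p. \<forall>t. R (u(i := t)) = poly p t"
  using assms
proof (induction rule: polynomial_maps.induct)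
  case (const c)
  thus ?case by (intro exI[of _ "[:c:]"]) simp
next
  case (coord j)
  thus ?case by (cases "j = i") (auto intro: exI[of _ "[:0, 1:]"] exI[of _ "[:u j:]"])
next
  case (add F G)
  thus ?case by (metis poly_add)
next
  case (mult F G)
  thus ?case by (metis poly_mult)
qed

text \<open>Density of the torus, one coordinate at a time: as a function of a single coordinate the
  map is a polynomial with infinitely many zeros.\<close>

lemma polynomial_map_zero:
  fixes R :: "(nat \<Rightarrow> 'a::alg_closed_field) \<Rightarrow> 'a"
  assumes "finite S" "R \<in> polynomial_maps m" "\<And>u. (\<forall>i\<in>S. u i \<noteq> 0) \<Longrightarrow> R u = 0"
  shows "R u = 0"
  using assms
proof (induction S arbitrary: u rule: finite_induct)
  case (insert i S)
  have "R u = 0" if u: "\<forall>j\<in>S. u j \<noteq> 0" for u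
  proof -
    obtain p where p: "\<And>t. R (u(i := t)) = poly p t" using polynomial_map_univariate[OF insert.prems(1)] by blast
    have "poly p t = 0" if "t \<noteq> 0" for t
      unfolding p[symmetric] using that u by (intro insert.prems(2)) auto
    hence "UNIV - {0} \<subseteq> {t. poly p t = 0}" by auto
    hence "p = 0" using poly_roots_finite[of p] infinite_alg_closed[where 'a='a] finite_subset by fastforce
    thus ?thesis using p[of "u i"] by simp
  qed
  thus ?case using insert.IH insert.prems(1) by blast
qed auto

lemma polynomial_maps_sum:
  "(\<And>k. k \<in> I \<Longrightarrow> f k \<in> polynomial_maps m) \<Longrightarrow> (\<lambda>x. \<Sum>k\<in>I. f k x) \<in> polynomial_maps m"
  by (induction I rule: infinite_finite_induct) (auto intro: polynomial_maps.intros)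

lemma polynomial_maps_prod:
  "(\<And>k. k \<in> I \<Longrightarrow> f k \<in> polynomial_maps m) \<Longrightarrow> (\<lambda>x. \<Prod>k\<in>I. f k x) \<in> polynomial_maps m"
  by (induction I rule: infinite_finite_induct) (auto intro: polynomial_maps.intros)

lemma polynomial_maps_power:
  "f \<in> polynomial_maps m \<Longrightarrow> (\<lambda>x. f x ^ k) \<in> polynomial_maps m"
  by (induction k) (auto intro: polynomial_maps.intros)

text \<open>The degree is bounded in every variable separately rather than in total, so the
  exponents form a box whose size is a plain power.\<close>

inductive pdeg :: "nat \<Rightarrow> nat \<Rightarrow> ((nat \<Rightarrow> 'a::field) \<Rightarrow> 'a) \<Rightarrow> bool" for m D where
  zero: "pdeg m D (\<lambda>z. 0)"
| mono: "(\<And>i. i \<in> {1..m} \<Longrightarrow> e i \<le> D) \<Longrightarrow> pdeg m D (\<lambda>z. c * (\<Prod>i\<in>{1..m}. z i ^ e i))"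
| add: "pdeg m D f \<Longrightarrow> pdeg m D g \<Longrightarrow> pdeg m D (\<lambda>z. f z + g z)"

lemma pdeg_weaken: "pdeg m D f \<Longrightarrow> D \<le> D' \<Longrightarrow> pdeg m D' f"
proof (induction rule: pdeg.induct)
  case (mono e c)
  thus ?case by (intro pdeg.mono) (meson order_trans)
qed (auto intro: pdeg.intros)

lemma pdeg_mult:
  assumes "pdeg m D1 f" "pdeg m D2 g"
  shows "pdeg m (D1 + D2) (\<lambda>z. f z * g z)"
  using assms(1)
proof (induction rule: pdeg.induct)
  case (mono e c)
  note e = mono
  show ?case using assms(2)
  proof (induction rule: pdeg.induct)
    case (mono e' c')
    have "pdeg m (D1 + D2) (\<lambda>z. (c * c') * (\<Prod>i\<in>{1..m}. z i ^ (e i + e' i)))"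
      by (rule pdeg.mono) (use e mono in \<open>simp add: add_mono\<close>)
    thus ?case by (simp add: power_add prod.distrib mult_ac)
  next
    case (add f g)
    have "pdeg m (D1 + D2) (\<lambda>v. c * (\<Prod>i\<in>{1..m}. v i ^ e i) * f v + c * (\<Prod>i\<in>{1..m}. v i ^ e i) * g v)"
      by (rule pdeg.add) (rule add.IH)+
    thus ?case by (simp only: distrib_left)
  qed (simp add: pdeg.zero)
next
  case (add f h)
  have "pdeg m (D1 + D2) (\<lambda>v. f v * g v + h v * g v)"
    by (rule pdeg.add) (rule add.IH)+
  thus ?case by (simp only: distrib_right)
qed (simp add: pdeg.zero)

lemma pdeg_const: "pdeg m D (\<lambda>z. c)"
  using pdeg.mono[of m "\<lambda>_. 0" D c] by simp

lemma pdeg_power: "pdeg m D f \<Longrightarrow> pdeg m (D * k) (\<lambda>z. f z ^ k)"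
proof (induction k)
  case (Suc k)
  thus ?case using pdeg_mult[of m D f "D * k" "\<lambda>z. f z ^ k"] by simp
qed (simp add: pdeg_const)

lemma pdeg_prod:
  "finite I \<Longrightarrow> (\<And>i. i \<in> I \<Longrightarrow> pdeg m D (f i)) \<Longrightarrow> pdeg m (card I * D) (\<lambda>z. \<Prod>i\<in>I. f i z)"
proof (induction I rule: finite_induct)
  case (insert i I)
  thus ?case using pdeg_mult[of m D "f i" "card I * D" "\<lambda>z. \<Prod>i\<in>I. f i z"] by simp
qed (simp add: pdeg_const)

lemma polynomial_map_pdeg:
  fixes f :: "(nat \<Rightarrow> 'a::field) \<Rightarrow> 'a"
  shows "f \<in> polynomial_maps m \<Longrightarrow> \<exists>D. pdeg m D f"
proof (induction rule: polynomial_maps.induct)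
  case (coord i)
  have "pdeg m 1 (\<lambda>z :: nat \<Rightarrow> 'a. 1 * (\<Prod>j\<in>{1..m}. z j ^ (if j = i then 1 else 0)))"
    by (rule pdeg.mono) simp
  moreover have "(\<Prod>j\<in>{1..m}. z j ^ (if j = i then 1 else 0)) = z i" for z :: "nat \<Rightarrow> 'a"
  proof -
    have "(\<Prod>j\<in>{1..m}. z j ^ (if j = i then 1 else 0)) = (\<Prod>j\<in>{1..m}. if j = i then z j else 1)"
      by (rule prod.cong) auto
    thus ?thesis using coord by simp
  qed
  ultimately have "pdeg m 1 (\<lambda>z :: nat \<Rightarrow> 'a. z i)" by (simp only: mult_1_left)
  thus ?case by blast
next
  case (add F G)
  then obtain D1 D2 where "pdeg m D1 F" "pdeg m D2 G" by blast
  hence "pdeg m (max D1 D2) F" "pdeg m (max D1 D2) G" by (auto intro: pdeg_weaken)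
  thus ?case by (blast intro: pdeg.add)
qed (use pdeg_const pdeg_mult in blast)+

definition spanned :: "(nat \<Rightarrow> 'a::field) set \<Rightarrow> 'b set \<Rightarrow> ('b \<Rightarrow> (nat \<Rightarrow> 'a) \<Rightarrow> 'a) \<Rightarrow> ((nat \<Rightarrow> 'a) \<Rightarrow> 'a) \<Rightarrow> bool" where
  "spanned V B G f \<longleftrightarrow> (\<exists>c. \<forall>z\<in>V. f z = (\<Sum>b\<in>B. c b * G b z))"

lemma spanned_zero: "spanned V B G (\<lambda>z. 0)"
  unfolding spanned_def by (intro exI[of _ "\<lambda>_. 0"]) simp

lemma spanned_add:
  assumes "spanned V B G f" "spanned V B G g"
  shows "spanned V B G (\<lambda>z. f z + g z)"
proof -
  obtain c d where "\<forall>z\<in>V. f z = (\<Sum>b\<in>B. c b * G b z)" "\<forall>z\<in>V. g z = (\<Sum>b\<in>B. d b * G b z)"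
    using assms by (auto simp: spanned_def)
  thus ?thesis unfolding spanned_def
    by (intro exI[of _ "\<lambda>b. c b + d b"]) (auto simp: ring_distribs sum.distrib)
qed

lemma spanned_generator:
  assumes "finite B" "b \<in> B" "\<And>z. z \<in> V \<Longrightarrow> f z = c * G b z"
  shows "spanned V B G f"
  unfolding spanned_def
proof (intro exI ballI)
  fix z assume z: "z \<in> V"
  have "(\<Sum>b'\<in>B. (if b' = b then c else 0) * G b' z) = (\<Sum>b'\<in>B. if b' = b then c * G b z else 0)"
    by (rule sum.cong) auto
  thus "f z = (\<Sum>b'\<in>B. (if b' = b then c else 0) * G b' z)" using assms z by simp
qed

text \<open>On \<open>H\<close> the coordinate \<open>x 1\<close> is the inverse of \<open>\<mu> x 2 \<dots> x l\<close> and \<open>y\<close> is integral of degree \<open>n\<close>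
  over the other coordinates.  Hence, after multiplication by a power of \<open>x 2 \<dots> x l\<close>, the
  polynomials of bounded degree lie in a space whose dimension grows like the \<open>d\<close>-th power of the degree.\<close>

lemma has_dimension_H_points:
  fixes \<mu> :: "'a::alg_closed_field"
  assumes n: "n > 0" and l: "2 \<le> l" "l \<le> d + 1" and \<mu>: "\<mu> \<noteq> 0"
  shows "has_dimension (d + 2) (H_points n d l \<alpha> \<beta> \<mu>) d"
proof -
  define V where "V = H_points n d l \<alpha> \<beta> \<mu>"
  define P where "P z = (\<Prod>i=1..d+1. z i ^ \<alpha> i) * (\<Prod>j=1..l-1. (1 - z j) ^ \<beta> j) * (1 - (\<Sum>i=l..d+1. z i)) ^ \<beta> l"
    for z :: "nat \<Rightarrow> 'a"
  define w where "w z = (\<Prod>i=2..l. z i)" for z :: "nat \<Rightarrow> 'a"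
  have prod1: "(\<Prod>i=1..l. z i) = z 1 * w z" for z :: "nat \<Rightarrow> 'a"
  proof -
    have "{1..l} = insert 1 {2..l}" using l by auto
    thus ?thesis by (simp add: w_def)
  qed
  have V: "z \<in> V \<longleftrightarrow> z \<in> affine_space (d + 2) \<and> z (d + 2) ^ n = P z \<and> \<mu> * (z 1 * w z) = 1" for z
    by (simp only: V_def H_points_def P_def prod1 mem_Collect_eq)
  have "\<exists>f. (\<forall>i\<in>{1..d}. f i \<in> polynomial_maps (d + 2)) \<and> algebraically_independent_on V d f"
  proof (intro exI conjI ballI)
    show "(\<lambda>z. z (i + 1)) \<in> polynomial_maps (d + 2)" if "i \<in> {1..d}" for i
      using that by (intro polynomial_maps.coord) auto
    show "algebraically_independent_on V d (\<lambda>i z. z (i + 1))"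
      unfolding algebraically_independent_on_def
    proof (intro ballI impI ext)
      fix R :: "(nat \<Rightarrow> 'a) \<Rightarrow> 'a" and u
      assume R: "R \<in> polynomial_maps d" and van: "\<forall>z\<in>V. R (\<lambda>i. z (i + 1)) = 0"
      show "R u = 0"
      proof (rule polynomial_map_zero[of "{1..l-1}", OF _ R])
        fix u :: "nat \<Rightarrow> 'a" assume u: "\<forall>i\<in>{1..l-1}. u i \<noteq> 0"
        \<comment> \<open>A point of H over prescribed \<open>x 2, \<dots>, x (d + 1)\<close>: x 1
          is solved from the product equation, and y is an n-th root in the algebraically closed
          field.\<close>
        define x where "x i = (if i = 1 then inverse (\<mu> * (\<Prod>i=2..l. u (i - 1))) else u (i - 1))" for i :: nat
        obtain y where y: "y ^ n = P x" using nth_root_exists[OF n] by blast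
        define z where "z = (\<lambda>i\<in>{1..d+2}. if i = d + 2 then y else x i)"
        have zx: "z i = x i" if "i \<in> {1..d+1}" for i using that by (auto simp: z_def)
        have "P z = P x" unfolding P_def using l by (intro arg_cong2[where f="(*)"] arg_cong2[where f="(^)"] arg_cong2[where f="(-)"] prod.cong sum.cong refl) (auto simp: zx)
        moreover have "z (d + 2) = y" by (simp add: z_def)
        moreover have "\<mu> * (z 1 * w z) = 1"
        proof -
          have "w z = (\<Prod>i=2..l. u (i - 1))" unfolding w_def
            by (rule prod.cong) (use l in \<open>auto simp: zx x_def\<close>)
          moreover have "u (i - 1) \<noteq> 0" if "i \<in> {2..l}" for i
          proof -
            have "i - 1 \<in> {1..l-1}" using that unfolding atLeastAtMost_iff by linarith
            thus ?thesis using u by blast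
          qed
          hence "(\<Prod>i=2..l. u (i - 1)) \<noteq> 0" by (simp add: prod_zero_iff)
          moreover have "z 1 = x 1" by (rule zx) simp
          ultimately show ?thesis using \<mu> by (simp add: x_def field_simps)
        qed
        moreover have "z \<in> affine_space (d + 2)" by (simp add: z_def affine_space_def)
        ultimately have "z \<in> V" using y V by simp
        hence "R (\<lambda>i. z (i + 1)) = 0" using van by blast
        moreover have "R (\<lambda>i. z (i + 1)) = R u"
          by (rule polynomial_map_cong[OF R]) (auto simp: z_def x_def)
        ultimately show "R u = 0" by simp
      qed simp
    qed
  qed
  moreover have "r \<le> d" if f: "\<forall>i\<in>{1..r}. f i \<in> polynomial_maps (d + 2)" and ind: "algebraically_independent_on V r f" for r f
  proof (rule ccontr)
    assume rd: "\<not> r \<le> d"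
    have "\<exists>D. \<forall>i\<in>{1..r}. pdeg (d + 2) D (f i)"
    proof -
      have "\<forall>i\<in>{1..r}. \<exists>D. pdeg (d + 2) D (f i)" using f polynomial_map_pdeg by blast
      then obtain D where D: "\<And>i. i \<in> {1..r} \<Longrightarrow> pdeg (d + 2) (D i) (f i)" by metis
      have "pdeg (d + 2) (\<Sum>i\<in>{1..r}. D i) (f i)" if "i \<in> {1..r}" for i
        by (rule pdeg_weaken[OF D[OF that]]) (use that in \<open>auto intro: member_le_sum\<close>)
      thus ?thesis by blast
    qed
    then obtain \<delta> where \<delta>: "\<And>i. i \<in> {1..r} \<Longrightarrow> pdeg (d + 2) \<delta> (f i)" by blast
    have "P \<in> polynomial_maps (d + 1)"
    proof -
      have m1: "(\<lambda>z. 1 - F z) \<in> polynomial_maps (d + 1)" if "F \<in> polynomial_maps (d + 1)" for F :: "(nat \<Rightarrow> 'a) \<Rightarrow> 'a"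
      proof -
        have "(\<lambda>z. 1 + (-1) * F z) \<in> polynomial_maps (d + 1)"
          by (intro polynomial_maps.add polynomial_maps.mult polynomial_maps.const that)
        thus ?thesis by simp
      qed
      show ?thesis unfolding P_def
        by (intro polynomial_maps.mult polynomial_maps_prod polynomial_maps_power m1 polynomial_maps_sum polynomial_maps.coord) (use l in auto)
    qed
    then obtain \<pi> where \<pi>: "pdeg (d + 1) \<pi> P" using polynomial_map_pdeg by blast
    \<comment> \<open>E bounds the exponents in a product of powers up to D of the f i, and E' those
      after every \<open>y ^ n\<close> has been replaced by P. The choice of c gives 2 E' + 1 <= c
      (D + 1), and that of D absorbs the constants: n (c (D + 1))^d = D (D + 1)^d.\<close>
    define c where "c = 2 * (r * \<delta> + \<pi> * (r * \<delta>)) + 1"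
    define D where "D = n * c ^ d"
    define E where "E = r * (\<delta> * D)"
    define E' where "E' = E + \<pi> * E"
    define B where "B = ({2..d+1} \<rightarrow>\<^sub>E {..2 * E'}) \<times> {..<n}"
    define G where "G = (\<lambda>(e, j) z. (\<Prod>i=2..d+1. z i ^ e i) * z (d + 2) ^ j :: 'a)"
    have finB: "finite B" by (simp add: B_def finite_PiE)
    have w0: "w z \<noteq> 0" if "z \<in> V" for z using that V by auto
    have span1: "spanned V B G (\<lambda>z. w z ^ E' * g z * z (d + 2) ^ j)" if "pdeg (d + 1) E' g" "j < n" for g j
      using that
    proof (induction rule: pdeg.induct)
      case zero
      show ?case using spanned_zero by simp
    next
      case (add f g)
      thus ?case using spanned_add[of V B G "\<lambda>z. w z ^ E' * f z * z (d + 2) ^ j" "\<lambda>z. w z ^ E' * g z * z (d + 2) ^ j"]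
        by (simp add: ring_distribs)
    next
      case (mono e c)
      \<comment> \<open>On V the power \<open>z 1 ^ e 1\<close> becomes a constant after
        multiplication by \<open>w z ^ e 1\<close>; the remaining E' - e 1 factors w add to the
        exponents of the coordinates 2, ..., l, which explains the bound 2 E' in B.\<close>
      define e' where "e' = (\<lambda>i\<in>{2..d+1}. e i + (if i \<le> l then E' - e 1 else 0))"
      have e: "e i \<le> E'" if "i \<in> {1..d+1}" for i by (rule mono.hyps[OF that])
      have e1: "e 1 \<le> E'" by (rule e) simp
      show ?case
      proof (rule spanned_generator[OF finB, of "(e', j)" _ _ "c * inverse \<mu> ^ e 1"])
        have "e' \<in> {2..d+1} \<rightarrow>\<^sub>E {..2 * E'}" unfolding e'_def
        proof (intro PiE_I)
          fix i assume i: "i \<in> {2..d+1}"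
          have "e i \<le> E'" by (rule e) (use i in auto)
          thus "(\<lambda>i\<in>{2..d+1}. e i + (if i \<le> l then E' - e 1 else 0)) i \<in> {..2 * E'}" using i by auto
        qed auto
        thus "(e', j) \<in> B" using mono.prems by (simp add: B_def)
        fix z assume z: "z \<in> V"
        have "w z * z 1 = inverse \<mu>" using z V \<mu> by (simp add: field_simps)
        hence "inverse \<mu> ^ e 1 = w z ^ e 1 * z 1 ^ e 1" by (metis power_mult_distrib)
        moreover have "w z ^ E' = w z ^ e 1 * w z ^ (E' - e 1)" using e1 by (simp flip: power_add)
        moreover have "w z ^ (E' - e 1) = (\<Prod>i=2..d+1. z i ^ (if i \<le> l then E' - e 1 else 0))"
        proof -
          have "w z ^ (E' - e 1) = (\<Prod>i=2..l. z i ^ (if i \<le> l then E' - e 1 else 0))"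
            unfolding w_def prod_power_distrib by (rule prod.cong) auto
          also have "\<dots> = (\<Prod>i=2..d+1. z i ^ (if i \<le> l then E' - e 1 else 0))"
            by (rule prod.mono_neutral_left) (use l in auto)
          finally show ?thesis .
        qed
        moreover have "(\<Prod>i\<in>{1..d+1}. z i ^ e i) = z 1 ^ e 1 * (\<Prod>i=2..d+1. z i ^ e i)"
        proof -
          have "{1..d+1} = insert 1 {2..d+1}" by auto
          thus ?thesis by simp
        qed
        moreover have "(\<Prod>i=2..d+1. z i ^ e' i) = (\<Prod>i=2..d+1. z i ^ e i) * (\<Prod>i=2..d+1. z i ^ (if i \<le> l then E' - e 1 else 0))"
          unfolding prod.distrib[symmetric] by (rule prod.cong) (auto simp: e'_def power_add)
        ultimately show "w z ^ E' * (c * (\<Prod>i\<in>{1..d+1}. z i ^ e i)) * z (d + 2) ^ j = c * inverse \<mu> ^ e 1 * G (e', j) z"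
          by (simp only: G_def prod.case mult_ac)
      qed
    qed
    have span2: "spanned V B G (\<lambda>z. w z ^ E' * g z)" if "pdeg (d + 2) E g" for g
      using that
    proof (induction rule: pdeg.induct)
      case zero
      show ?case using spanned_zero by simp
    next
      case (add f g)
      thus ?case using spanned_add[of V B G "\<lambda>z. w z ^ E' * f z" "\<lambda>z. w z ^ E' * g z"]
        by (simp add: ring_distribs)
    next
      case (mono e c)
      define j where "j = e (d + 2)"
      have j: "j \<le> E" unfolding j_def by (rule mono) simp
      define h where "h z = (c * (\<Prod>i\<in>{1..d+1}. z i ^ e i)) * P z ^ (j div n)" for z
      have "pdeg (d + 1) (E + \<pi> * (j div n)) h" unfolding h_def
        by (intro pdeg_mult pdeg.mono pdeg_power \<pi> mono) auto
      moreover have "j div n \<le> E" using j div_le_dividend order_trans by blast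
      hence "E + \<pi> * (j div n) \<le> E'" by (simp add: E'_def)
      ultimately have "pdeg (d + 1) E' h" by (rule pdeg_weaken)
      hence "spanned V B G (\<lambda>z. w z ^ E' * h z * z (d + 2) ^ (j mod n))" by (rule span1) (use n in simp)
      moreover have "w z ^ E' * h z * z (d + 2) ^ (j mod n) = w z ^ E' * (c * (\<Prod>i\<in>{1..d+2}. z i ^ e i))" if z: "z \<in> V" for z
      proof -
        have "z (d + 2) ^ j = (z (d + 2) ^ n) ^ (j div n) * z (d + 2) ^ (j mod n)"
          by (simp flip: power_mult power_add)
        also have "z (d + 2) ^ n = P z" using z V by blast
        finally have "z (d + 2) ^ j = P z ^ (j div n) * z (d + 2) ^ (j mod n)" .
        moreover have "(\<Prod>i\<in>{1..d+2}. z i ^ e i) = z (d + 2) ^ j * (\<Prod>i\<in>{1..d+1}. z i ^ e i)"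
        proof -
          have "{1..d+2} = insert (d + 2) {1..d+1}" by auto
          thus ?thesis by (simp only: j_def) simp
        qed
        ultimately show ?thesis by (simp only: h_def mult_ac)
      qed
      ultimately show ?case unfolding spanned_def by (auto simp only: ball_simps cong: ball_cong)
    qed
    define I where "I = {1..r} \<rightarrow>\<^sub>E {..D}"
    have FI: "pdeg (d + 2) E (\<lambda>z. \<Prod>i\<in>{1..r}. f i z ^ k i)" if k: "k \<in> I" for k
    proof -
      have "pdeg (d + 2) (card {1..r} * (\<delta> * D)) (\<lambda>z. \<Prod>i\<in>{1..r}. f i z ^ k i)"
      proof (rule pdeg_prod)
        fix i assume i: "i \<in> {1..r}"
        have "k i \<le> D" using k i by (auto simp: I_def)
        thus "pdeg (d + 2) (\<delta> * D) (\<lambda>z. f i z ^ k i)"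
          by (intro pdeg_weaken[OF pdeg_power[OF \<delta>[OF i]]]) simp
      qed simp
      thus ?thesis by (simp add: E_def)
    qed
    have "\<forall>k\<in>I. \<exists>M. \<forall>z\<in>V. w z ^ E' * (\<Prod>i\<in>{1..r}. f i z ^ k i) = (\<Sum>b\<in>B. M b * G b z)"
      using span2[OF FI] unfolding spanned_def by blast
    from bchoice[OF this] obtain M where "\<forall>k\<in>I. \<forall>z\<in>V. w z ^ E' * (\<Prod>i\<in>{1..r}. f i z ^ k i) = (\<Sum>b\<in>B. M k b * G b z)"
      by blast
    hence M: "\<And>k z. k \<in> I \<Longrightarrow> z \<in> V \<Longrightarrow> w z ^ E' * (\<Prod>i\<in>{1..r}. f i z ^ k i) = (\<Sum>b\<in>B. M k b * G b z)"
      by blast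
    \<comment> \<open>With r > d there are more power products of the f i than spanning functions. A
      linear relation between them holds on V, as w has no zero there, and it contradicts
      independence.\<close>
    have "card B < card I"
    proof -
      have cB: "card B = (2 * E' + 1) ^ d * n" by (simp add: B_def card_cartesian_product card_funcsetE)
      have cI: "card I = (D + 1) ^ r" by (simp add: I_def card_funcsetE)
      have "2 * E' + 1 \<le> c * (D + 1)" by (simp add: E'_def E_def c_def algebra_simps)
      hence "card B \<le> (c * (D + 1)) ^ d * n" unfolding cB by (intro mult_right_mono power_mono) auto
      also have "\<dots> = D * (D + 1) ^ d" by (simp only: D_def power_mult_distrib mult_ac)
      also have "\<dots> < (D + 1) ^ (d + 1)" by simp
      also have "\<dots> \<le> card I" unfolding cI using rd by (intro power_increasing) auto
      finally show ?thesis .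
    qed
    then obtain a where a: "\<exists>k\<in>I. a k \<noteq> 0" "\<And>b. b \<in> B \<Longrightarrow> (\<Sum>k\<in>I. a k * M k b) = 0"
      using homogeneous_system[OF finB, of I M] by (auto simp: I_def finite_PiE)
    define R where "R u = (\<Sum>k\<in>I. a k * (\<Prod>i\<in>{1..r}. u i ^ k i))" for u :: "nat \<Rightarrow> 'a"
    have "R \<in> polynomial_maps r" unfolding R_def
      by (intro polynomial_maps_sum polynomial_maps.mult polynomial_maps.const polynomial_maps_prod polynomial_maps_power polynomial_maps.coord)
    moreover have "R (\<lambda>i. f i z) = 0" if z: "z \<in> V" for z
    proof -
      have "w z ^ E' * R (\<lambda>i. f i z) = (\<Sum>k\<in>I. a k * (w z ^ E' * (\<Prod>i\<in>{1..r}. f i z ^ k i)))"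
        by (simp add: R_def sum_distrib_left mult_ac)
      also have "\<dots> = (\<Sum>k\<in>I. a k * (\<Sum>b\<in>B. M k b * G b z))"
        by (intro sum.cong refl arg_cong2[where f="(*)"] M z)
      also have "\<dots> = (\<Sum>b\<in>B. (\<Sum>k\<in>I. a k * M k b) * G b z)"
        unfolding sum_distrib_left sum_distrib_right by (subst sum.swap) (simp add: mult_ac)
      also have "\<dots> = 0" by (simp add: a(2))
      finally show ?thesis using w0[OF z] by simp
    qed
    ultimately have R0: "R = (\<lambda>u. 0)" using ind unfolding algebraically_independent_on_def by blast
    have "a k = 0" if "k \<in> I" for k
    proof (rule monomials_independent[where S="{1..r}" and D=D and c=a and k=k])
      fix u :: "nat \<Rightarrow> 'a"
      show "(\<Sum>k\<in>{1..r} \<rightarrow>\<^sub>E {..D}. a k * (\<Prod>i\<in>{1..r}. u i ^ k i)) = 0"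
        using fun_cong[OF R0, of u] by (simp add: R_def I_def)
    qed (use that in \<open>auto simp: I_def\<close>)
    with a(1) show False by blast
  qed
  ultimately show ?thesis unfolding has_dimension_def V_def by blast
qed

section \<open>Counting points of the hypersurface and of its mirror quotient\<close>

lemma equiv_proportional: "equiv (nonzero_vectors m) (proportional m)"
proof (rule equivI)
  show "proportional m \<subseteq> nonzero_vectors m \<times> nonzero_vectors m" by (auto simp: proportional_def)
  show "refl_on (nonzero_vectors m) (proportional m)"
    by (auto simp: refl_on_def proportional_def intro: exI[of _ 1])
  show "sym (proportional m)"
  proof (rule symI)
    fix x y assume "(x, y) \<in> proportional m"
    then obtain c where c: "c \<noteq> 0" "\<forall>i\<in>{1..m}. y i = c * x i" and xy: "x \<in> nonzero_vectors m" "y \<in> nonzero_vectors m"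
      by (auto simp: proportional_def)
    have "\<forall>i\<in>{1..m}. x i = inverse c * y i" using c by simp
    thus "(y, x) \<in> proportional m" unfolding proportional_def using c(1) xy
      by (auto intro!: exI[of _ "inverse c"])
  qed
  show "trans (proportional m)"
  proof (rule transI)
    fix x y z assume "(x, y) \<in> proportional m" "(y, z) \<in> proportional m"
    then obtain c d where "c \<noteq> 0" "\<forall>i\<in>{1..m}. y i = c * x i" "d \<noteq> 0" "\<forall>i\<in>{1..m}. z i = d * y i"
      and xz: "x \<in> nonzero_vectors m" "z \<in> nonzero_vectors m"
      unfolding proportional_def by blast
    hence "d * c \<noteq> 0" "\<forall>i\<in>{1..m}. z i = (d * c) * x i" by simp_all
    thus "(x, z) \<in> proportional m" using xz unfolding proportional_def by blast
  qed
qed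

definition scale :: "nat \<Rightarrow> 'a::field \<Rightarrow> (nat \<Rightarrow> 'a) \<Rightarrow> nat \<Rightarrow> 'a" where
  "scale m c x = (\<lambda>i\<in>{1..m}. c * x i)"

lemma scale_nonzero: "x \<in> nonzero_vectors m \<Longrightarrow> c \<noteq> 0 \<Longrightarrow> scale m c x \<in> nonzero_vectors m"
  by (auto simp: nonzero_vectors_def scale_def affine_space_def)

lemma proportional_class:
  assumes "x \<in> nonzero_vectors m"
  shows "proportional m `` {x} = (\<lambda>c. scale m c x) ` (UNIV - {0})"
proof (intro equalityI subsetI)
  fix y assume "y \<in> proportional m `` {x}"
  then obtain c where c: "c \<noteq> 0" "\<forall>i\<in>{1..m}. y i = c * x i" "y \<in> affine_space m"
    by (auto simp: proportional_def nonzero_vectors_def)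
  hence "y = scale m c x" by (auto simp: scale_def affine_space_def PiE_def extensional_def fun_eq_iff)
  thus "y \<in> (\<lambda>c. scale m c x) ` (UNIV - {0})" using c by blast
next
  fix y assume "y \<in> (\<lambda>c. scale m c x) ` (UNIV - {0})"
  then obtain c where "c \<noteq> 0" "y = scale m c x" by blast
  thus "y \<in> proportional m `` {x}" using assms scale_nonzero[OF assms]
    by (auto simp: proportional_def scale_def intro!: exI[of _ c])
qed

definition dwork_form :: "nat \<Rightarrow> 'a::field \<Rightarrow> (nat \<Rightarrow> 'a) \<Rightarrow> 'a" where
  "dwork_form n \<psi> x = (\<Sum>i=1..n. x i ^ n) - of_nat n * \<psi> * (\<Prod>i=1..n. x i)"

definition cone :: "nat \<Rightarrow> 'a::field \<Rightarrow> (nat \<Rightarrow> 'a) set" where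
  "cone n \<psi> = {x \<in> nonzero_vectors n. dwork_form n \<psi> x = 0}"

lemma dwork_form_scale: "dwork_form n \<psi> (scale n c x) = c ^ n * dwork_form n \<psi> x"
proof -
  have "(\<Sum>i=1..n. scale n c x i ^ n) = (\<Sum>i=1..n. c ^ n * x i ^ n)"
    by (rule sum.cong) (auto simp: scale_def power_mult_distrib)
  moreover have "(\<Prod>i=1..n. scale n c x i) = (\<Prod>i=1..n. c * x i)"
    by (rule prod.cong) (auto simp: scale_def)
  ultimately show ?thesis
    by (simp add: dwork_form_def prod.distrib sum_distrib_left right_diff_distrib mult_ac)
qed

lemma dwork_points_eq: "dwork_points n \<psi> = (\<lambda>x. proportional n `` {x}) ` cone n \<psi>"
proof (intro equalityI subsetI)
  fix P assume P: "P \<in> dwork_points n \<psi>"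
  then obtain x where x: "x \<in> nonzero_vectors n" "P = proportional n `` {x}"
    by (auto simp: dwork_points_def proj_space_def elim: quotientE)
  have "x \<in> P" using x equiv_class_self[OF equiv_proportional] by blast
  hence "x \<in> cone n \<psi>" using P x by (simp add: dwork_points_def cone_def dwork_form_def)
  thus "P \<in> (\<lambda>x. proportional n `` {x}) ` cone n \<psi>" using x by blast
next
  fix P assume "P \<in> (\<lambda>x. proportional n `` {x}) ` cone n \<psi>"
  then obtain x where x: "x \<in> nonzero_vectors n" "dwork_form n \<psi> x = 0" "P = proportional n `` {x}"
    by (auto simp: cone_def)
  have "P \<in> proj_space n" unfolding proj_space_def x(3) by (rule quotientI[OF x(1)])
  moreover have "dwork_form n \<psi> y = 0" if "y \<in> P" for y
    using that x(2) unfolding x(3) proportional_class[OF x(1)] by (auto simp: dwork_form_scale)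
  ultimately show "P \<in> dwork_points n \<psi>" unfolding dwork_points_def dwork_form_def by blast
qed

lemma class_eq_iff:
  "x \<in> nonzero_vectors m \<Longrightarrow> y \<in> nonzero_vectors m \<Longrightarrow>
    proportional m `` {x} = proportional m `` {y} \<longleftrightarrow> (\<exists>c. c \<noteq> 0 \<and> y = scale m c x)"
  by (subst eq_equiv_class_iff[OF equiv_proportional]) (use proportional_class in blast)+

lemma finite_affine_space: "finite (affine_space m :: (nat \<Rightarrow> 'a::finite) set)"
  by (simp add: affine_space_def finite_PiE)

lemma card_fibres:
  assumes "finite S" "\<And>s. s \<in> S \<Longrightarrow> card {s' \<in> S. f s' = f s} = k"
  shows "card S = k * card (f ` S)"
proof -
  have "card S = (\<Sum>s\<in>S. 1)" by simp
  also have "\<dots> = (\<Sum>b\<in>f ` S. \<Sum>s\<in>{s \<in> S. f s = b}. 1)"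
    by (rule sum.image_gen[OF assms(1)])
  also have "\<dots> = (\<Sum>b\<in>f ` S. k)" by (intro sum.cong refl) (auto simp: assms(2))
  finally show ?thesis by simp
qed

lemma inj_on_scale:
  assumes "x \<in> nonzero_vectors m"
  shows "inj (\<lambda>c. scale m c x)"
proof (rule injI)
  fix c d assume eq: "scale m c x = scale m d x"
  obtain i where "i \<in> {1..m}" "x i \<noteq> 0" using assms by (auto simp: nonzero_vectors_def)
  thus "c = d" using fun_cong[OF eq, of i] by (simp add: scale_def)
qed

lemma card_cone:
  fixes \<psi> :: "'a::{field,finite}"
  shows "card (cone n \<psi>) = (CARD('a) - 1) * card (dwork_points n \<psi>)"
  unfolding dwork_points_eq
proof (rule card_fibres)
  show "finite (cone n \<psi>)"
    by (rule finite_subset[OF _ finite_affine_space[of n]]) (auto simp: cone_def nonzero_vectors_def)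
  fix x assume x: "x \<in> cone n \<psi>"
  hence xn: "x \<in> nonzero_vectors n" by (simp add: cone_def)
  have "{y \<in> cone n \<psi>. proportional n `` {y} = proportional n `` {x}} = (\<lambda>c. scale n c x) ` (UNIV - {0})"
  proof (intro equalityI subsetI)
    fix y assume "y \<in> {y \<in> cone n \<psi>. proportional n `` {y} = proportional n `` {x}}"
    hence "y \<in> nonzero_vectors n" "proportional n `` {x} = proportional n `` {y}" by (auto simp: cone_def)
    thus "y \<in> (\<lambda>c. scale n c x) ` (UNIV - {0})" using class_eq_iff[OF xn, of y] by blast
  next
    fix y assume "y \<in> (\<lambda>c. scale n c x) ` (UNIV - {0})"
    then obtain c where c: "c \<noteq> 0" "y = scale n c x" by blast
    have "y \<in> cone n \<psi>" using x scale_nonzero[OF xn c(1)] by (simp add: c(2) cone_def dwork_form_scale)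
    moreover from this have "proportional n `` {x} = proportional n `` {y}"
      using class_eq_iff[OF xn, of y] c by (auto simp: cone_def)
    ultimately show "y \<in> {y \<in> cone n \<psi>. proportional n `` {y} = proportional n `` {x}}" by simp
  qed
  thus "card {y \<in> cone n \<psi>. proportional n `` {y} = proportional n `` {x}} = CARD('a) - 1"
    using inj_on_subset[OF inj_on_scale[OF xn]] by (simp add: card_image card_Diff_singleton)
qed

text \<open>The quotient is embedded by the invariants \<open>u i = x i ^ n\<close> and \<open>w = \<Prod> x i\<close>.\<close>

definition mirror_cone :: "nat \<Rightarrow> 'a::field \<Rightarrow> ((nat \<Rightarrow> 'a) \<times> 'a) set" where
  "mirror_cone n \<psi> = {(u, w). u \<in> nonzero_vectors n \<and> w ^ n = (\<Prod>i=1..n. u i) \<and> (\<Sum>i=1..n. u i) = of_nat n * \<psi> * w}"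

text \<open>The geometric points over given invariants. They are nonempty by
  \<open>lifts_exists\<close> and form one orbit of the group by
  \<open>lifts_transitive\<close>.\<close>

definition lifts :: "nat \<Rightarrow> (nat \<Rightarrow> 'a::field) \<times> 'a \<Rightarrow> (nat \<Rightarrow> 'a alg_closure) set" where
  "lifts n = (\<lambda>(u, w). {x \<in> affine_space n. (\<forall>i\<in>{1..n}. x i ^ n = to_ac (u i)) \<and> (\<Prod>i=1..n. x i) = to_ac w})"

definition twist :: "nat \<Rightarrow> (nat \<Rightarrow> 'a::field) \<Rightarrow> (nat \<Rightarrow> 'a alg_closure) \<Rightarrow> nat \<Rightarrow> 'a alg_closure" where
  "twist n \<zeta> x = (\<lambda>i\<in>{1..n}. to_ac (\<zeta> i) * x i)"

lemma lifts_cone: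
  assumes "s \<in> mirror_cone n \<psi>" "x \<in> lifts n s"
  shows "x \<in> cone n (to_ac \<psi>)"
proof -
  obtain u w where s: "s = (u, w)" by force
  have x: "x \<in> affine_space n" "\<And>i. i \<in> {1..n} \<Longrightarrow> x i ^ n = to_ac (u i)" "(\<Prod>i=1..n. x i) = to_ac w"
    using assms(2) by (auto simp: s lifts_def)
  have u: "u \<in> nonzero_vectors n" "(\<Sum>i=1..n. u i) = of_nat n * \<psi> * w" using assms(1) by (auto simp: s mirror_cone_def)
  obtain i where i: "i \<in> {1..n}" "u i \<noteq> 0" using u by (auto simp: nonzero_vectors_def)
  have "x i \<noteq> 0"
  proof
    assume "x i = 0"
    hence "to_ac (u i) = 0" using x(2)[OF i(1)] i(1) by (auto simp: power_0_left)
    thus False using i by simp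
  qed
  moreover have "(\<Sum>i=1..n. x i ^ n) = to_ac (\<Sum>i=1..n. u i)" unfolding to_ac_sum by (intro sum.cong refl x(2))
  ultimately show ?thesis using i x u(2) by (auto simp: cone_def nonzero_vectors_def dwork_form_def)
qed

lemma lifts_exists:
  assumes n: "n > 0" and s: "(u, w) \<in> mirror_cone n \<psi>"
  shows "\<exists>x. x \<in> lifts n (u, w)"
proof -
  have "\<forall>i. \<exists>y. y ^ n = to_ac (u i)" using nth_root_exists[OF n] by blast
  then obtain y where y: "\<And>i. y i ^ n = to_ac (u i)" by metis
  have w: "w ^ n = (\<Prod>i=1..n. u i)" using s by (simp add: mirror_cone_def)
  have pn: "(\<Prod>i=1..n. y i) ^ n = to_ac w ^ n"
    by (simp only: prod_power_distrib y to_ac_prod[symmetric] w[symmetric] to_ac_power)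
  have one: "1 \<in> {1..n}" using n by simp
  show ?thesis
  proof (cases "w = 0")
    case True
    hence "(\<Prod>i=1..n. y i) = 0" using pn n by (simp add: power_0_left)
    thus ?thesis using True y by (intro exI[of _ "restrict y {1..n}"]) (auto simp: lifts_def affine_space_def)
  next
    case False
    have P0: "(\<Prod>i=1..n. y i) \<noteq> 0"
    proof
      assume 0: "(\<Prod>i=1..n. y i) = 0"
      have "to_ac w ^ n = 0" unfolding pn[symmetric] 0 using n by (simp only: zero_power)
      thus False using False by simp
    qed
    \<comment> \<open>The product of arbitrary roots y i agrees with w up to an n-th root of unity,
      which one coordinate absorbs.\<close>
    define \<epsilon> where "\<epsilon> = to_ac w / (\<Prod>i=1..n. y i)"
    have \<epsilon>: "\<epsilon> ^ n = 1" using pn P0 False by (simp add: \<epsilon>_def power_divide)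
    define x where "x = (\<lambda>i\<in>{1..n}. if i = 1 then \<epsilon> * y i else y i)"
    have "(\<Prod>i=1..n. x i) = (\<Prod>i=1..n. (if i = 1 then \<epsilon> else 1) * y i)"
      by (rule prod.cong) (auto simp: x_def)
    also have "\<dots> = to_ac w" unfolding prod.distrib using P0 one by (simp add: \<epsilon>_def)
    finally show ?thesis using y \<epsilon>
      by (intro exI[of _ x]) (auto simp: lifts_def affine_space_def x_def power_mult_distrib)
  qed
qed

text \<open>The quotients of corresponding coordinates are n-th roots of unity, rational because n
  divides q - 1. For w nonzero their product is 1. For w = 0 some coordinate vanishes, and the
  factor at this coordinate is free to make the product 1.\<close>

lemma lifts_transitive:
  assumes nt: "n * t = CARD('a::{field,finite}) - 1" and s: "(u, w) \<in> mirror_cone n (\<psi>::'a)"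
    and x: "x \<in> lifts n (u, w)" and y: "y \<in> lifts n (u, w)"
  shows "\<exists>\<zeta>\<in>mirror_group n. y = twist n \<zeta> x"
proof -
  have xp: "\<And>i. i \<in> {1..n} \<Longrightarrow> x i ^ n = to_ac (u i)" "(\<Prod>i=1..n. x i) = to_ac w"
   and yp: "\<And>i. i \<in> {1..n} \<Longrightarrow> y i ^ n = to_ac (u i)" "(\<Prod>i=1..n. y i) = to_ac w" "y \<in> affine_space n"
    using x y by (auto simp: lifts_def)
  have "\<exists>\<zeta>. \<zeta> ^ n = 1 \<and> y i = to_ac \<zeta> * x i" if i: "i \<in> {1..n}" for i
  proof (cases "x i = 0")
    case True
    hence "y i ^ n = 0" using xp(1)[OF i] yp(1)[OF i] i by (auto simp: power_0_left)
    thus ?thesis using True by (intro exI[of _ 1]) simp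
  next
    case False
    hence "(y i / x i) ^ n = 1" using xp(1)[OF i] yp(1)[OF i] by (metis divide_self power_divide power_not_zero)
    hence "y i / x i \<in> to_ac ` {\<zeta>. \<zeta> ^ n = 1}" using roots_of_unity(2)[OF nt] by blast
    then obtain \<zeta> where "\<zeta> ^ n = 1" "y i / x i = to_ac \<zeta>" by blast
    thus ?thesis using False by (intro exI[of _ \<zeta>]) (simp add: field_simps)
  qed
  then obtain \<zeta> where \<zeta>: "\<And>i. i \<in> {1..n} \<Longrightarrow> \<zeta> i ^ n = 1 \<and> y i = to_ac (\<zeta> i) * x i" by metis
  show ?thesis
  proof (cases "w = 0")
    case False
    have "(\<Prod>i=1..n. y i) = (\<Prod>i=1..n. to_ac (\<zeta> i)) * (\<Prod>i=1..n. x i)"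
      unfolding prod.distrib[symmetric] by (intro prod.cong) (use \<zeta> in auto)
    hence "to_ac (\<Prod>i=1..n. \<zeta> i) = to_ac 1" using xp(2) yp(2) False by (simp add: to_ac_prod)
    hence p1: "(\<Prod>i=1..n. \<zeta> i) = 1" by (simp only: to_ac_eq_iff)
    have "restrict \<zeta> {1..n} \<in> mirror_group n"
      using \<zeta> p1 by (auto simp: mirror_group_def affine_space_def)
    moreover have "y = twist n (restrict \<zeta> {1..n}) x"
      using \<zeta> yp(3) by (auto simp: twist_def affine_space_def PiE_def extensional_def fun_eq_iff)
    ultimately show ?thesis by blast
  next
    case True
    hence "(\<Prod>i=1..n. x i) = 0" using xp(2) by simp
    then obtain k where k: "k \<in> {1..n}" "x k = 0" by (auto simp: prod_zero_iff)
    define \<eta> where "\<eta> = (\<lambda>i\<in>{1..n}. if i = k then inverse (\<Prod>i\<in>{1..n}-{k}. \<zeta> i) else \<zeta> i)"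
    have pr: "(\<Prod>i\<in>{1..n}-{k}. \<zeta> i) ^ n = 1" unfolding prod_power_distrib
      by (rule prod.neutral) (use \<zeta> in auto)
    have pr0: "(\<Prod>i\<in>{1..n}-{k}. \<zeta> i) \<noteq> 0"
    proof
      assume 0: "(\<Prod>i\<in>{1..n}-{k}. \<zeta> i) = 0"
      have "n > 0" using k by simp
      thus False using pr unfolding 0 by (simp add: zero_power)
    qed
    have "(\<Prod>i=1..n. \<eta> i) = \<eta> k * (\<Prod>i\<in>{1..n}-{k}. \<eta> i)" using k by (intro prod.remove) auto
    also have "(\<Prod>i\<in>{1..n}-{k}. \<eta> i) = (\<Prod>i\<in>{1..n}-{k}. \<zeta> i)" by (rule prod.cong) (auto simp: \<eta>_def)
    finally have "(\<Prod>i=1..n. \<eta> i) = 1" using k pr0 by (simp add: \<eta>_def)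
    moreover have "\<eta> i ^ n = 1" if "i \<in> {1..n}" for i
      using \<zeta>[OF that] that pr by (auto simp: \<eta>_def power_inverse)
    ultimately have "\<eta> \<in> mirror_group n" by (auto simp: mirror_group_def affine_space_def \<eta>_def)
    moreover have "y = twist n \<eta> x"
    proof
      fix i show "y i = twist n \<eta> x i"
      proof (cases "i \<in> {1..n}")
        case True
        show ?thesis using \<zeta>[OF True] \<zeta>[OF k(1)] k True by (cases "i = k") (auto simp: twist_def \<eta>_def)
      next
        case False
        thus ?thesis using yp(3) by (simp only: twist_def affine_space_def PiE_def extensional_def) auto
      qed
    qed
    ultimately show ?thesis by blast
  qed
qed

section \<open>Orbits of geometric points and Frobenius descent\<close>

definition mirror_rel :: "nat \<Rightarrow> 'a::field \<Rightarrow> ((nat \<Rightarrow> 'a alg_closure) set \<times> (nat \<Rightarrow> 'a alg_closure) set) set" where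
  "mirror_rel n \<psi> = {(P, Q). P \<in> dwork_points n (to_ac \<psi>) \<and> Q \<in> dwork_points n (to_ac \<psi>) \<and>
     (\<exists>\<zeta>\<in>mirror_group n. Q = mirror_act n \<zeta> P)}"

lemma mirror_points_alt:
  "mirror_points n \<psi> = {B \<in> dwork_points n (to_ac \<psi>) // mirror_rel n \<psi>. frobenius_point n ` B = B}"
  by (simp add: mirror_points_def mirror_geometric_points_def mirror_rel_def Let_def)

abbreviation pt :: "nat \<Rightarrow> (nat \<Rightarrow> 'a::field) \<Rightarrow> (nat \<Rightarrow> 'a) set" where
  "pt n x \<equiv> proportional n `` {x}"

lemma mirror_group_nonzero:
  assumes "\<zeta> \<in> mirror_group n" "i \<in> {1..n}"
  shows "\<zeta> i \<noteq> 0"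
proof
  assume "\<zeta> i = 0"
  moreover have "\<zeta> i ^ n = 1" "n > 0" using assms by (auto simp: mirror_group_def)
  ultimately show False by (simp add: zero_power)
qed

lemma twist_nonzero: "x \<in> nonzero_vectors n \<Longrightarrow> \<zeta> \<in> mirror_group n \<Longrightarrow> twist n \<zeta> x \<in> nonzero_vectors n"
  using mirror_group_nonzero by (fastforce simp: nonzero_vectors_def twist_def affine_space_def)

lemma mirror_act_pt:
  assumes "x \<in> nonzero_vectors n" "\<zeta> \<in> mirror_group n"
  shows "mirror_act n \<zeta> (pt n x) = pt n (twist n \<zeta> x)"
proof -
  have fs: "(\<lambda>i\<in>{1..n}. to_ac (\<zeta> i) * scale n c x i) = scale n c (twist n \<zeta> x)" for c
    by (auto simp: twist_def scale_def fun_eq_iff)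
  show ?thesis
    unfolding proportional_class[OF assms(1)] proportional_class[OF twist_nonzero[OF assms]]
      mirror_act_def image_image fs ..
qed

lemma twist_cone:
  assumes "x \<in> cone n (to_ac \<psi>)" "\<zeta> \<in> mirror_group n"
  shows "twist n \<zeta> x \<in> cone n (to_ac \<psi>)"
proof -
  have z: "\<And>i. i \<in> {1..n} \<Longrightarrow> \<zeta> i ^ n = 1" "(\<Prod>i=1..n. \<zeta> i) = 1" using assms(2) by (auto simp: mirror_group_def)
  have "(\<Sum>i=1..n. twist n \<zeta> x i ^ n) = (\<Sum>i=1..n. x i ^ n)"
  proof (rule sum.cong[OF refl])
    fix i assume i: "i \<in> {1..n}"
    have "to_ac (\<zeta> i) ^ n = to_ac (\<zeta> i ^ n)" by simp
    thus "twist n \<zeta> x i ^ n = x i ^ n" using i z(1)[OF i] by (simp add: twist_def power_mult_distrib)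
  qed
  moreover have "(\<Prod>i=1..n. twist n \<zeta> x i) = (\<Prod>i=1..n. to_ac (\<zeta> i)) * (\<Prod>i=1..n. x i)"
    unfolding prod.distrib[symmetric] by (rule prod.cong) (auto simp: twist_def)
  hence "(\<Prod>i=1..n. twist n \<zeta> x i) = (\<Prod>i=1..n. x i)" using z(2) by (simp flip: to_ac_prod)
  ultimately show ?thesis using assms twist_nonzero by (auto simp: cone_def dwork_form_def)
qed

lemma pt_dwork: "x \<in> cone n \<psi> \<Longrightarrow> pt n x \<in> dwork_points n \<psi>"
  by (simp add: dwork_points_eq)

definition assoc :: "nat \<Rightarrow> (nat \<Rightarrow> 'a::field alg_closure) \<Rightarrow> (nat \<Rightarrow> 'a alg_closure) \<Rightarrow> bool" where
  "assoc n x y \<longleftrightarrow> (\<exists>c. c \<noteq> 0 \<and> (\<exists>\<zeta>\<in>mirror_group n. y = scale n c (twist n \<zeta> x)))"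

lemma mirror_rel_iff:
  assumes x: "x \<in> cone n (to_ac \<psi>)" and y: "y \<in> cone n (to_ac \<psi>)"
  shows "(pt n x, pt n y) \<in> mirror_rel n \<psi> \<longleftrightarrow> assoc n x y"
proof -
  have nz: "x \<in> nonzero_vectors n" "y \<in> nonzero_vectors n" using x y by (auto simp: cone_def)
  have "(pt n x, pt n y) \<in> mirror_rel n \<psi> \<longleftrightarrow> (\<exists>\<zeta>\<in>mirror_group n. pt n y = pt n (twist n \<zeta> x))"
    unfolding mirror_rel_def using pt_dwork[OF x] pt_dwork[OF y] mirror_act_pt[OF nz(1)] by auto
  also have "\<dots> \<longleftrightarrow> assoc n x y"
    unfolding assoc_def using class_eq_iff[OF twist_nonzero[OF nz(1)] nz(2)] by metis
  finally show ?thesis .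
qed

lemma equiv_mirror_rel: "equiv (dwork_points n (to_ac \<psi>)) (mirror_rel n \<psi>)"
proof (rule equivI)
  show "mirror_rel n \<psi> \<subseteq> dwork_points n (to_ac \<psi>) \<times> dwork_points n (to_ac \<psi>)" by (auto simp: mirror_rel_def)
  have one: "(\<lambda>i\<in>{1..n}. 1) \<in> mirror_group n" by (auto simp: mirror_group_def affine_space_def)
  have id1: "mirror_act n (\<lambda>i\<in>{1..n}. 1) P = P" if "P \<in> dwork_points n (to_ac \<psi>)" for P
  proof -
    obtain x where x: "x \<in> nonzero_vectors n" "P = pt n x" using \<open>P \<in> _\<close> by (auto simp: dwork_points_eq cone_def)
    have "twist n (\<lambda>i\<in>{1..n}. 1) x = x" using x(1)
      by (auto simp: twist_def nonzero_vectors_def affine_space_def PiE_def extensional_def fun_eq_iff)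
    thus ?thesis using mirror_act_pt[OF x(1) one] x(2) by simp
  qed
  show "refl_on (dwork_points n (to_ac \<psi>)) (mirror_rel n \<psi>)"
    using one id1 unfolding refl_on_def mirror_rel_def by force
  have mul: "mirror_act n \<zeta> (mirror_act n \<eta> P) = mirror_act n (\<lambda>i\<in>{1..n}. \<zeta> i * \<eta> i) P" for \<zeta> \<eta> P
    unfolding mirror_act_def image_image by (rule image_cong) (auto simp: fun_eq_iff)
  show "sym (mirror_rel n \<psi>)"
  proof (rule symI)
    fix P Q assume PQ: "(P, Q) \<in> mirror_rel n \<psi>"
    then obtain \<zeta> where z: "\<zeta> \<in> mirror_group n" "Q = mirror_act n \<zeta> P" "P \<in> dwork_points n (to_ac \<psi>)" by (auto simp: mirror_rel_def)
    define \<eta> where "\<eta> = (\<lambda>i\<in>{1..n}. inverse (\<zeta> i))"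
    have "(\<Prod>i=1..n. \<eta> i) = inverse (\<Prod>i=1..n. \<zeta> i)" unfolding prod_inversef[symmetric] \<eta>_def by (rule prod.cong) (auto simp: comp_def)
    hence "\<eta> \<in> mirror_group n" using z(1) by (auto simp: mirror_group_def affine_space_def \<eta>_def power_inverse)
    moreover have "mirror_act n \<eta> Q = P"
    proof -
      have "(\<lambda>i\<in>{1..n}. \<eta> i * \<zeta> i) = (\<lambda>i\<in>{1..n}. 1)" using mirror_group_nonzero[OF z(1)] by (auto simp: \<eta>_def fun_eq_iff)
      thus ?thesis unfolding z(2) mul using id1[OF z(3)] by simp
    qed
    ultimately show "(Q, P) \<in> mirror_rel n \<psi>" using PQ by (auto simp: mirror_rel_def)
  qed
  show "trans (mirror_rel n \<psi>)"
  proof (rule transI)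
    fix P Q R assume PQ: "(P, Q) \<in> mirror_rel n \<psi>" and QR: "(Q, R) \<in> mirror_rel n \<psi>"
    then obtain \<zeta> \<eta> where z: "\<zeta> \<in> mirror_group n" "Q = mirror_act n \<zeta> P" "\<eta> \<in> mirror_group n" "R = mirror_act n \<eta> Q"
      by (auto simp: mirror_rel_def)
    have "(\<lambda>i\<in>{1..n}. \<eta> i * \<zeta> i) \<in> mirror_group n" using z(1,3)
      by (auto simp: mirror_group_def affine_space_def power_mult_distrib prod.distrib)
    moreover have "R = mirror_act n (\<lambda>i\<in>{1..n}. \<eta> i * \<zeta> i) P" using z mul by simp
    ultimately show "(P, R) \<in> mirror_rel n \<psi>" using PQ QR by (auto simp: mirror_rel_def)
  qed
qed

definition frob_vec :: "nat \<Rightarrow> (nat \<Rightarrow> 'a::{field,finite} alg_closure) \<Rightarrow> nat \<Rightarrow> 'a alg_closure" where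
  "frob_vec n x = (\<lambda>i\<in>{1..n}. frob 1 (x i))"

lemma frob_sum: "frob k (\<Sum>i\<in>A. f i) = (\<Sum>i\<in>A. frob k (f i))"
  by (induction A rule: infinite_finite_induct) (simp_all add: frob_add)

lemma frob_prod: "frob k (\<Prod>i\<in>A. f i) = (\<Prod>i\<in>A. frob k (f i))"
  by (induction A rule: infinite_finite_induct) (simp_all add: frob_mult)

lemma frob_vec_cone:
  assumes "x \<in> cone n (to_ac \<psi>)"
  shows "frob_vec n x \<in> cone n (to_ac \<psi>)"
proof -
  have "dwork_form n (to_ac \<psi>) (frob_vec n x) = frob 1 (dwork_form n (to_ac \<psi>) x)"
  proof -
    have 1: "(\<Sum>i=1..n. frob_vec n x i ^ n) = frob 1 (\<Sum>i=1..n. x i ^ n)"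
      unfolding frob_sum by (rule sum.cong) (auto simp: frob_vec_def frob_power)
    have 2: "(\<Prod>i=1..n. frob_vec n x i) = frob 1 (\<Prod>i=1..n. x i)"
      unfolding frob_prod by (rule prod.cong) (auto simp: frob_vec_def)
    have 3: "frob 1 (of_nat n * to_ac \<psi>) = of_nat n * to_ac \<psi>"
      using frob_to_ac[of 1 "of_nat n * \<psi>"] by (simp del: One_nat_def frob_to_ac)
    show ?thesis unfolding dwork_form_def 1 2 frob_diff frob_mult[of 1 "of_nat n * to_ac \<psi>"] 3 ..
  qed
  thus ?thesis using assms by (auto simp: cone_def nonzero_vectors_def frob_vec_def affine_space_def)
qed

lemma frob_surj: "\<exists>y. frob 1 y = x"
  using nth_root_exists[of "CARD('a)" x] unfolding frob_def by (auto simp: zero_less_card_finite)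

lemma frobenius_point_pt:
  fixes x :: "nat \<Rightarrow> 'a::{field,finite} alg_closure"
  assumes "x \<in> nonzero_vectors n"
  shows "frobenius_point n (pt n x) = pt n (frob_vec n x)"
proof -
  have nz: "frob_vec n x \<in> nonzero_vectors n"
    using assms by (auto simp: nonzero_vectors_def frob_vec_def affine_space_def)
  have fs: "(\<lambda>i\<in>{1..n}. scale n c x i ^ CARD('a)) = scale n (frob 1 c) (frob_vec n x)" for c
    by (auto simp: scale_def frob_vec_def frob_def power_mult_distrib)
  show ?thesis
    unfolding proportional_class[OF assms] proportional_class[OF nz] frobenius_point_def image_image fs
  proof (intro equalityI subsetI)
    fix y assume "y \<in> (\<lambda>c. scale n c (frob_vec n x)) ` (UNIV - {0})"
    then obtain c where c: "c \<noteq> 0" "y = scale n c (frob_vec n x)" by blast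
    obtain b where "frob 1 b = c" using frob_surj by blast
    thus "y \<in> (\<lambda>c. scale n (frob 1 c) (frob_vec n x)) ` (UNIV - {0})" using c by (intro image_eqI[of _ _ b]) auto
  qed (auto simp del: One_nat_def)
qed

lemma frob_vec_assoc:
  assumes "assoc n x y"
  shows "assoc n (frob_vec n x) (frob_vec n y)"
proof -
  obtain c \<zeta> where c: "c \<noteq> 0" "\<zeta> \<in> mirror_group n" "y = scale n c (twist n \<zeta> x)" using assms by (auto simp: assoc_def)
  have "frob_vec n y = scale n (frob 1 c) (twist n \<zeta> (frob_vec n x))"
    by (auto simp: c(3) frob_vec_def scale_def twist_def frob_mult)
  thus ?thesis using c unfolding assoc_def by (intro exI[of _ "frob 1 c"]) auto
qed

lemma mirror_class:
  assumes x: "x \<in> cone n (to_ac \<psi>)"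
  shows "mirror_rel n \<psi> `` {pt n x} = pt n ` {y \<in> cone n (to_ac \<psi>). assoc n x y}"
proof (intro equalityI subsetI)
  fix Q assume Q: "Q \<in> mirror_rel n \<psi> `` {pt n x}"
  then obtain y where "y \<in> cone n (to_ac \<psi>)" "Q = pt n y" by (auto simp: mirror_rel_def dwork_points_eq)
  thus "Q \<in> pt n ` {y \<in> cone n (to_ac \<psi>). assoc n x y}" using Q mirror_rel_iff[OF x] by auto
next
  fix Q assume "Q \<in> pt n ` {y \<in> cone n (to_ac \<psi>). assoc n x y}"
  thus "Q \<in> mirror_rel n \<psi> `` {pt n x}" using mirror_rel_iff[OF x] by auto
qed

text \<open>Frobenius maps the orbit of x into the orbit of its image, because the group is
  rational. Equality of the image with that whole orbit uses that every scalar is a Frobenius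
  image.\<close>

lemma mirror_point_iff:
  assumes x: "x \<in> cone n (to_ac (\<psi> :: 'a::{field,finite}))"
  shows "frobenius_point n ` (mirror_rel n \<psi> `` {pt n x}) = mirror_rel n \<psi> `` {pt n x} \<longleftrightarrow> assoc n x (frob_vec n x)"
proof
  have xx: "pt n x \<in> mirror_rel n \<psi> `` {pt n x}"
    using equiv_class_self[OF equiv_mirror_rel pt_dwork[OF x]] .
  have fx: "frobenius_point n (pt n x) = pt n (frob_vec n x)" using x by (intro frobenius_point_pt) (simp add: cone_def)
  note cf = frob_vec_cone[OF x]
  {
    assume "frobenius_point n ` (mirror_rel n \<psi> `` {pt n x}) = mirror_rel n \<psi> `` {pt n x}"
    hence "pt n (frob_vec n x) \<in> mirror_rel n \<psi> `` {pt n x}" using xx fx by (metis imageI)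
    thus "assoc n x (frob_vec n x)" using mirror_rel_iff[OF x cf] by simp
  }
  {
    assume a: "assoc n x (frob_vec n x)"
    hence same: "mirror_rel n \<psi> `` {pt n x} = mirror_rel n \<psi> `` {pt n (frob_vec n x)}"
      using mirror_rel_iff[OF x cf] equiv_class_eq[OF equiv_mirror_rel] by blast
    have fp: "frobenius_point n (pt n y) = pt n (frob_vec n y)" if "y \<in> cone n (to_ac \<psi>)" for y
      using that by (intro frobenius_point_pt) (simp add: cone_def)
    have sub: "frobenius_point n ` (mirror_rel n \<psi> `` {pt n x}) \<subseteq> mirror_rel n \<psi> `` {pt n (frob_vec n x)}"
      unfolding mirror_class[OF x] mirror_class[OF cf] image_image
      using fp frob_vec_cone frob_vec_assoc by fastforce
    have sup: "mirror_rel n \<psi> `` {pt n (frob_vec n x)} \<subseteq> frobenius_point n ` (mirror_rel n \<psi> `` {pt n x})"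
    proof
      fix Q assume "Q \<in> mirror_rel n \<psi> `` {pt n (frob_vec n x)}"
      then obtain y where y: "y \<in> cone n (to_ac \<psi>)" "assoc n (frob_vec n x) y" "Q = pt n y"
        unfolding mirror_class[OF cf] by blast
      then obtain c \<zeta> where c: "c \<noteq> 0" "\<zeta> \<in> mirror_group n" "y = scale n c (twist n \<zeta> (frob_vec n x))" by (auto simp: assoc_def)
      obtain b where b: "frob 1 b = c" using frob_surj by blast
      hence b0: "b \<noteq> 0" using c by auto
      define z where "z = scale n b (twist n \<zeta> x)"
      have z: "z \<in> cone n (to_ac \<psi>)"
        using twist_cone[OF x c(2)] scale_nonzero b0 by (auto simp: z_def cone_def dwork_form_scale)
      have "assoc n x z" using b0 c(2) by (auto simp: assoc_def z_def)
      moreover have "frob_vec n z = y"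
        by (auto simp: c(3) z_def frob_vec_def scale_def twist_def frob_mult b simp del: One_nat_def)
      ultimately show "Q \<in> frobenius_point n ` (mirror_rel n \<psi> `` {pt n x})"
        unfolding mirror_class[OF x] using y(3) z fp[OF z] by (intro image_eqI[of _ _ "pt n z"]) auto
    qed
    show "frobenius_point n ` (mirror_rel n \<psi> `` {pt n x}) = mirror_rel n \<psi> `` {pt n x}"
      using sub sup same by simp
  }
qed

lemma lifts_frob:
  assumes "x \<in> lifts n s"
  shows "frob_vec n x \<in> lifts n s"
proof -
  obtain u w where s: "s = (u, w)" by force
  have x: "\<And>i. i \<in> {1..n} \<Longrightarrow> x i ^ n = to_ac (u i)" "(\<Prod>i=1..n. x i) = to_ac w"
    using assms by (auto simp: s lifts_def)
  have "(\<Prod>i=1..n. frob_vec n x i) = frob 1 (\<Prod>i=1..n. x i)"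
    unfolding frob_prod by (rule prod.cong) (auto simp: frob_vec_def)
  thus ?thesis using x by (auto simp: s lifts_def affine_space_def frob_vec_def simp flip: frob_power)
qed

text \<open>A descent in the style of Hilbert 90. If Frobenius multiplies x by a scalar c and a
  group element, rescaling by b with \<open>b ^ (CARD('a) - 1) = inverse c\<close> removes the
  scalar. Frobenius then acts on y by the group element alone, so the invariants of y are fixed and
  hence rational.\<close>

lemma lift_of_mirror_point:
  fixes \<psi> :: "'a::{field,finite}"
  assumes n: "n > 0" and x: "x \<in> cone n (to_ac \<psi>)" and a: "assoc n x (frob_vec n x)"
  shows "\<exists>s\<in>mirror_cone n \<psi>. \<exists>y\<in>lifts n s. pt n y = pt n x"
proof -
  have q: "CARD('a) - 1 > 0" using card_field_gt_1[where 'a='a] by simp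
  obtain c \<zeta> where c: "c \<noteq> 0" "\<zeta> \<in> mirror_group n" "frob_vec n x = scale n c (twist n \<zeta> x)"
    using a by (auto simp: assoc_def)
  obtain b where b: "b ^ (CARD('a) - 1) = inverse c" using nth_root_exists[OF q] by blast
  have b0: "b \<noteq> 0" using b c(1) q by (auto simp: power_0_left)
  define y where "y = scale n b x"
  have xn: "x \<in> nonzero_vectors n" using x by (simp add: cone_def)
  have yc: "y \<in> cone n (to_ac \<psi>)" using x scale_nonzero[OF xn b0] by (auto simp: y_def cone_def dwork_form_scale)
  have "frob 1 b = inverse c * b"
    unfolding frob_def using b q by (cases "CARD('a)") (auto simp: mult.commute)
  hence fy: "frob 1 (y i) = to_ac (\<zeta> i) * y i" if "i \<in> {1..n}" for i
    using fun_cong[OF c(3), of i] that c(1)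
    by (simp add: y_def scale_def twist_def frob_vec_def frob_mult del: One_nat_def)
  have z: "\<And>i. i \<in> {1..n} \<Longrightarrow> \<zeta> i ^ n = 1" "(\<Prod>i=1..n. \<zeta> i) = 1" using c(2) by (auto simp: mirror_group_def)
  have "y i ^ n \<in> range to_ac" if i: "i \<in> {1..n}" for i
  proof -
    have "frob 1 (y i ^ n) = to_ac (\<zeta> i ^ n) * y i ^ n" by (simp add: frob_power fy[OF i] power_mult_distrib del: One_nat_def)
    thus ?thesis using z(1)[OF i] unfolding frob_fixed_iff[symmetric] by (simp del: One_nat_def)
  qed
  hence "\<exists>v. y i ^ n = to_ac v" if "i \<in> {1..n}" for i using that by blast
  then obtain v where v: "\<And>i. i \<in> {1..n} \<Longrightarrow> y i ^ n = to_ac (v i)" by metis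
  have "frob 1 (\<Prod>i=1..n. y i) = (\<Prod>i=1..n. to_ac (\<zeta> i) * y i)"
    unfolding frob_prod by (rule prod.cong) (use fy in auto)
  also have "\<dots> = to_ac (\<Prod>i=1..n. \<zeta> i) * (\<Prod>i=1..n. y i)" by (simp add: prod.distrib to_ac_prod)
  finally have "frob 1 (\<Prod>i=1..n. y i) = (\<Prod>i=1..n. y i)" using z(2) by simp
  then obtain w where w: "(\<Prod>i=1..n. y i) = to_ac w" unfolding frob_fixed_iff by blast
  define u where "u = restrict v {1..n}"
  have yu: "y i ^ n = to_ac (u i)" if "i \<in> {1..n}" for i using v[OF that] that by (simp add: u_def)
  have ya: "y \<in> affine_space n" "\<exists>i\<in>{1..n}. y i \<noteq> 0" using yc by (auto simp: cone_def nonzero_vectors_def)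
  have lift: "y \<in> lifts n (u, w)" using yu w ya by (simp add: lifts_def)
  have "u i \<noteq> 0" if "i \<in> {1..n}" "y i \<noteq> 0" for i using yu[OF that(1)] that(2) by (metis power_not_zero to_ac_0)
  moreover have "u \<in> affine_space n" by (simp add: u_def affine_space_def)
  ultimately have un: "u \<in> nonzero_vectors n" using ya(2) unfolding nonzero_vectors_def by blast
  have "to_ac (w ^ n) = to_ac (\<Prod>i=1..n. u i)"
    unfolding to_ac_power w[symmetric] to_ac_prod prod_power_distrib by (intro prod.cong refl yu)
  hence wn: "w ^ n = (\<Prod>i=1..n. u i)" by (simp only: to_ac_eq_iff)
  have "to_ac (\<Sum>i=1..n. u i) = (\<Sum>i=1..n. y i ^ n)" unfolding to_ac_sum by (intro sum.cong refl yu[symmetric])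
  also have "\<dots> = of_nat n * to_ac \<psi> * (\<Prod>i=1..n. y i)" using yc by (simp add: cone_def dwork_form_def)
  also have "\<dots> = to_ac (of_nat n * \<psi> * w)" by (simp only: w to_ac_mult to_ac_of_nat)
  finally have "(\<Sum>i=1..n. u i) = of_nat n * \<psi> * w" by (simp only: to_ac_eq_iff)
  hence "(u, w) \<in> mirror_cone n \<psi>" using un wn by (simp add: mirror_cone_def)
  moreover have "pt n y = pt n x" using class_eq_iff[of y n x] class_eq_iff[OF xn, of y] scale_nonzero[OF xn b0] b0 unfolding y_def by blast
  ultimately show ?thesis using lift by blast
qed

text \<open>Scaling x by c multiplies every u i and w by the same factor c^n, so the quotient is the
  ordinary projectivisation of \<open>mirror_cone\<close>, and every fibre is a free orbit of the
  nonzero rational scalars.\<close>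

lemma card_mirror_cone:
  fixes \<psi> :: "'a::{field,finite}"
  assumes nt: "n * t = CARD('a) - 1"
  shows "card (mirror_cone n \<psi>) = (CARD('a) - 1) * card (mirror_points n \<psi>)"
proof -
  have q: "CARD('a) - 1 > 0" using card_field_gt_1[where 'a='a] by simp
  have n: "n > 0" using nt q by (auto intro: Nat.gr0I)
  define L where "L s = (SOME x. x \<in> lifts n s)" for s :: "(nat \<Rightarrow> 'a) \<times> 'a"
  have L: "L s \<in> lifts n s" if "s \<in> mirror_cone n \<psi>" for s
  proof -
    obtain u w where s: "s = (u, w)" by force
    have "\<exists>x. x \<in> lifts n s" using lifts_exists[OF n, of u w \<psi>] that unfolding s by blast
    thus ?thesis unfolding L_def by (rule someI_ex)
  qed
  define \<Phi> where "\<Phi> s = mirror_rel n \<psi> `` {pt n (L s)}" for s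
  have Lc: "L s \<in> cone n (to_ac \<psi>)" if "s \<in> mirror_cone n \<psi>" for s using lifts_cone[OF that L[OF that]] .
  have lift_assoc: "assoc n x y" if sl: "s \<in> mirror_cone n \<psi>" "x \<in> lifts n s" "y \<in> lifts n s" for s x y
  proof -
    obtain u w where s: "s = (u, w)" by force
    obtain \<zeta> where z: "\<zeta> \<in> mirror_group n" "y = twist n \<zeta> x" using lifts_transitive[OF nt, of u w \<psi> x y] sl unfolding s by blast
    have "y = scale n 1 (twist n \<zeta> x)" unfolding z(2) by (auto simp: scale_def twist_def)
    thus ?thesis unfolding assoc_def using z(1) by (intro exI[of _ 1]) auto
  qed
  have eqI: "mirror_rel n \<psi> `` {pt n x} = mirror_rel n \<psi> `` {pt n y}"
    if "x \<in> cone n (to_ac \<psi>)" "y \<in> cone n (to_ac \<psi>)" "assoc n x y" for x y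
    using mirror_rel_iff[OF that(1,2)] that(3) equiv_class_eq[OF equiv_mirror_rel] by blast
  have img: "\<Phi> ` mirror_cone n \<psi> = mirror_points n \<psi>"
  proof (intro equalityI subsetI)
    fix B assume "B \<in> \<Phi> ` mirror_cone n \<psi>"
    then obtain s where s: "s \<in> mirror_cone n \<psi>" "B = \<Phi> s" by blast
    have "B \<in> dwork_points n (to_ac \<psi>) // mirror_rel n \<psi>"
      unfolding s(2) \<Phi>_def by (rule quotientI[OF pt_dwork[OF Lc[OF s(1)]]])
    moreover have "frobenius_point n ` B = B"
      unfolding s(2) \<Phi>_def mirror_point_iff[OF Lc[OF s(1)]]
      by (rule lift_assoc[OF s(1) L[OF s(1)] lifts_frob[OF L[OF s(1)]]])
    ultimately show "B \<in> mirror_points n \<psi>" by (simp add: mirror_points_alt)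
  next
    fix B assume B: "B \<in> mirror_points n \<psi>"
    then obtain x where x: "x \<in> cone n (to_ac \<psi>)" "B = mirror_rel n \<psi> `` {pt n x}"
      by (auto simp: mirror_points_alt dwork_points_eq elim!: quotientE)
    hence "assoc n x (frob_vec n x)" using B mirror_point_iff[OF x(1)] by (simp add: mirror_points_alt)
    then obtain s y where sy: "s \<in> mirror_cone n \<psi>" "y \<in> lifts n s" "pt n y = pt n x"
      using lift_of_mirror_point[OF n x(1)] by blast
    have "B = mirror_rel n \<psi> `` {pt n y}" using x(2) sy(3) by simp
    also have "\<dots> = \<Phi> s" unfolding \<Phi>_def
      by (rule eqI[OF lifts_cone[OF sy(1,2)] Lc[OF sy(1)] lift_assoc[OF sy(1,2) L[OF sy(1)]]])
    finally show "B \<in> \<Phi> ` mirror_cone n \<psi>" using sy(1) by blast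
  qed
  have "card (mirror_cone n \<psi>) = (CARD('a) - 1) * card (\<Phi> ` mirror_cone n \<psi>)"
  proof (rule card_fibres)
    show "finite (mirror_cone n \<psi>)"
      by (rule finite_subset[of _ "affine_space n \<times> UNIV"])
         (auto simp: mirror_cone_def nonzero_vectors_def finite_affine_space)
    fix s assume s: "s \<in> mirror_cone n \<psi>"
    obtain u w where uw: "s = (u, w)" by force
    have u: "u \<in> nonzero_vectors n" using s uw by (simp add: mirror_cone_def)
    have "{s' \<in> mirror_cone n \<psi>. \<Phi> s' = \<Phi> s} = (\<lambda>c. (scale n c u, c * w)) ` (UNIV - {0})"
    proof (intro equalityI subsetI)
      fix s' assume "s' \<in> {s' \<in> mirror_cone n \<psi>. \<Phi> s' = \<Phi> s}"
      hence s': "s' \<in> mirror_cone n \<psi>" "\<Phi> s' = \<Phi> s" by auto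
      obtain u' w' where uw': "s' = (u', w')" by force
      have "(pt n (L s), pt n (L s')) \<in> mirror_rel n \<psi>"
        using s'(2) eq_equiv_class[OF _ equiv_mirror_rel pt_dwork[OF Lc[OF s'(1)]], of "pt n (L s)"]
        unfolding \<Phi>_def by simp
      hence "assoc n (L s) (L s')" using mirror_rel_iff[OF Lc[OF s] Lc[OF s'(1)]] by simp
      then obtain c \<zeta> where c: "c \<noteq> 0" "\<zeta> \<in> mirror_group n" "L s' = scale n c (twist n \<zeta> (L s))" by (auto simp: assoc_def)
      have z: "\<And>i. i \<in> {1..n} \<Longrightarrow> \<zeta> i ^ n = 1" "(\<Prod>i=1..n. \<zeta> i) = 1" using c(2) by (auto simp: mirror_group_def)
      have Ls: "\<And>i. i \<in> {1..n} \<Longrightarrow> L s i ^ n = to_ac (u i)" "(\<Prod>i=1..n. L s i) = to_ac w"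
        using L[OF s] by (auto simp: uw lifts_def)
      have Ls': "\<And>i. i \<in> {1..n} \<Longrightarrow> L s' i ^ n = to_ac (u' i)" "(\<Prod>i=1..n. L s' i) = to_ac w'"
        using L[OF s'(1)] by (auto simp: uw' lifts_def)
      have u'i: "to_ac (u' i) = c ^ n * to_ac (u i)" if i: "i \<in> {1..n}" for i
      proof -
        have "L s' i = c * (to_ac (\<zeta> i) * L s i)" using i by (simp add: c(3) scale_def twist_def)
        hence "L s' i ^ n = c ^ n * (to_ac (\<zeta> i ^ n) * L s i ^ n)" by (simp add: power_mult_distrib)
        thus ?thesis using z(1)[OF i] Ls(1)[OF i] Ls'(1)[OF i] by simp
      qed
      have "(\<Prod>i=1..n. L s' i) = (\<Prod>i=1..n. c * (to_ac (\<zeta> i) * L s i))"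
        by (rule prod.cong) (auto simp: c(3) scale_def twist_def)
      also have "\<dots> = c ^ n * (to_ac (\<Prod>i=1..n. \<zeta> i) * (\<Prod>i=1..n. L s i))"
        by (simp add: prod.distrib to_ac_prod)
      finally have w': "to_ac w' = c ^ n * to_ac w" using z(2) Ls(2) Ls'(2) by simp
      obtain i where i: "i \<in> {1..n}" "u i \<noteq> 0" using u by (auto simp: nonzero_vectors_def)
      \<comment> \<open>c lies only in the closure, but c^n is a quotient of two rational
        coordinates and is therefore a rational scalar.\<close>
      define b where "b = u' i / u i"
      have b: "to_ac b = c ^ n" using u'i[OF i(1)] i(2) by (simp add: b_def)
      hence b0: "b \<noteq> 0" using c(1) by (metis power_not_zero to_ac_0)
      have "u' i = b * u i" if "i \<in> {1..n}" for i
        using u'i[OF that] unfolding b[symmetric] to_ac_mult[symmetric] by (simp only: to_ac_eq_iff)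
      moreover have "u' \<in> affine_space n" using s'(1) uw' by (simp add: mirror_cone_def nonzero_vectors_def)
      ultimately have "u' = scale n b u" by (auto simp: scale_def affine_space_def PiE_def extensional_def fun_eq_iff)
      moreover have "w' = b * w" using w' unfolding b[symmetric] to_ac_mult[symmetric] by (simp only: to_ac_eq_iff)
      ultimately show "s' \<in> (\<lambda>c. (scale n c u, c * w)) ` (UNIV - {0})" using b0 uw' by blast
    next
      fix s' assume "s' \<in> (\<lambda>c. (scale n c u, c * w)) ` (UNIV - {0})"
      then obtain b where b: "b \<noteq> 0" "s' = (scale n b u, b * w)" by blast
      have sm: "(\<Sum>i=1..n. scale n b u i) = b * (\<Sum>i=1..n. u i)" unfolding sum_distrib_left
        by (rule sum.cong) (auto simp: scale_def)
      have pm: "(\<Prod>i=1..n. scale n b u i) = (\<Prod>i=1..n. b * u i)"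
        by (rule prod.cong) (auto simp: scale_def)
      have s': "s' \<in> mirror_cone n \<psi>"
        using s uw b scale_nonzero[OF u b(1)] by (auto simp: mirror_cone_def sm[unfolded One_nat_def] pm[unfolded One_nat_def] prod.distrib power_mult_distrib)
      obtain c where c: "c ^ n = to_ac b" using nth_root_exists[OF n] by blast
      have c0: "c \<noteq> 0" using c b(1) n by (auto simp: power_0_left)
      define x where "x = scale n c (L s)"
      have Ls: "\<And>i. i \<in> {1..n} \<Longrightarrow> L s i ^ n = to_ac (u i)" "(\<Prod>i=1..n. L s i) = to_ac w"
        using L[OF s] by (auto simp: uw lifts_def)
      have "(\<Prod>i=1..n. x i) = (\<Prod>i=1..n. c * L s i)" by (rule prod.cong) (auto simp: x_def scale_def)
      hence "(\<Prod>i=1..n. x i) = to_ac (b * w)" by (simp add: prod.distrib Ls(2)[unfolded One_nat_def] c)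
      hence xl: "x \<in> lifts n s'" using Ls(1) c
        by (auto simp: b(2) lifts_def x_def scale_def affine_space_def power_mult_distrib)
      have xp: "pt n x = pt n (L s)"
        using class_eq_iff[of "L s" n x] Lc[OF s] scale_nonzero[OF _ c0] c0 unfolding x_def cone_def by blast
      have "\<Phi> s' = mirror_rel n \<psi> `` {pt n x}" unfolding \<Phi>_def
        by (rule eqI[OF Lc[OF s'] lifts_cone[OF s' xl] lift_assoc[OF s' L[OF s'] xl]])
      hence "\<Phi> s' = \<Phi> s" by (simp add: \<Phi>_def xp)
      thus "s' \<in> {s' \<in> mirror_cone n \<psi>. \<Phi> s' = \<Phi> s}" using s' by simp
    qed
    moreover have "inj (\<lambda>c. (scale n c u, c * w))" using inj_on_scale[OF u] by (auto simp: inj_def)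
    ultimately show "card {s' \<in> mirror_cone n \<psi>. \<Phi> s' = \<Phi> s} = CARD('a) - 1"
      by (simp add: card_image inj_on_subset card_Diff_singleton)
  qed
  thus ?thesis unfolding img .
qed

section \<open>Character sums over the hypersurface and its quotient\<close>

text \<open>Orthogonality of additive characters detects the linear constraint and separates the
  variables.\<close>

lemma sum_constrained_ech:
  fixes f :: "'i \<Rightarrow> 'a::{field,finite} \<Rightarrow> complex"
  assumes I: "finite I"
  shows "(\<Sum>u | u \<in> I \<rightarrow>\<^sub>E UNIV \<and> (\<Sum>i\<in>I. u i) = y. \<Prod>i\<in>I. f i (u i)) =
    (\<Sum>s\<in>UNIV. ech (- (s * y)) * (\<Prod>i\<in>I. \<Sum>v\<in>UNIV. f i v * ech (v * s))) / of_nat CARD('a)"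
proof -
  have fin: "finite (I \<rightarrow>\<^sub>E (UNIV :: 'a set))" using I by (simp add: finite_PiE)
  have q: "(of_nat CARD('a) :: complex) \<noteq> 0" using card_field_gt_1[where 'a='a] by auto
  have "(\<Sum>s\<in>UNIV. ech (- (s * y)) * (\<Prod>i\<in>I. \<Sum>v\<in>UNIV. f i v * ech (v * s))) =
      (\<Sum>s\<in>UNIV. ech (- (s * y)) * (\<Sum>u\<in>I \<rightarrow>\<^sub>E UNIV. \<Prod>i\<in>I. f i (u i) * ech (u i * s)))"
    by (subst prod_sum_PiE) (use I in auto)
  also have "\<dots> = (\<Sum>s\<in>UNIV. \<Sum>u\<in>I \<rightarrow>\<^sub>E UNIV. (\<Prod>i\<in>I. f i (u i)) * ech (s * ((\<Sum>i\<in>I. u i) - y)))"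
  proof (rule sum.cong[OF refl])
    fix s :: 'a
    have 1: "ech (- (s * y)) * (\<Prod>i\<in>I. ech (u i * s)) = ech (s * ((\<Sum>i\<in>I. u i) - y))" for u
      unfolding ech_sum[symmetric] ech_add[symmetric]
      by (simp add: right_diff_distrib sum_distrib_left mult.commute)
    show "ech (- (s * y)) * (\<Sum>u\<in>I \<rightarrow>\<^sub>E UNIV. \<Prod>i\<in>I. f i (u i) * ech (u i * s)) =
      (\<Sum>u\<in>I \<rightarrow>\<^sub>E UNIV. (\<Prod>i\<in>I. f i (u i)) * ech (s * ((\<Sum>i\<in>I. u i) - y)))"
      by (simp only: sum_distrib_left prod.distrib mult.left_commute[of "ech _"] 1)
  qed
  also have "\<dots> = (\<Sum>u\<in>I \<rightarrow>\<^sub>E UNIV. (\<Prod>i\<in>I. f i (u i)) * (\<Sum>s\<in>UNIV. ech (s * ((\<Sum>i\<in>I. u i) - y))))"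
    by (subst sum.swap) (simp add: sum_distrib_left)
  also have "\<dots> = (\<Sum>u\<in>I \<rightarrow>\<^sub>E UNIV. if (\<Sum>i\<in>I. u i) = y then of_nat CARD('a) * (\<Prod>i\<in>I. f i (u i)) else 0)"
    unfolding sum_ech by (intro sum.cong refl) auto
  also have "\<dots> = of_nat CARD('a) * (\<Sum>u | u \<in> I \<rightarrow>\<^sub>E UNIV \<and> (\<Sum>i\<in>I. u i) = y. \<Prod>i\<in>I. f i (u i))"
    by (simp add: sum.inter_filter[OF fin, symmetric] sum_distrib_left)
  finally show ?thesis using q by simp
qed

text \<open>For nonzero s each factor is a twisted Gauss sum. The nontrivial index makes the product
  vanish at s = 0, in agreement with the value of \<open>rho\<close> at 0, so that the sum over s is
  again a Gauss sum, or a character sum when y = 0.\<close>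

lemma sum_constrained_rho:
  fixes \<kappa> :: "'i \<Rightarrow> int" and y :: "'a::{field,finite}"
  assumes I: "finite I" and nt: "\<exists>i\<in>I. \<not> int (CARD('a) - 1) dvd \<kappa> i"
  shows "(\<Sum>u | u \<in> I \<rightarrow>\<^sub>E UNIV \<and> (\<Sum>i\<in>I. u i) = y. \<Prod>i\<in>I. rho (\<kappa> i) (u i)) =
    (\<Prod>i\<in>I. gauss TYPE('a) (\<kappa> i)) *
    (if y = 0 then (if int (CARD('a) - 1) dvd (\<Sum>i\<in>I. \<kappa> i) then of_nat CARD('a) - 1 else 0)
     else rho (\<Sum>i\<in>I. \<kappa> i) (- y) * gauss TYPE('a) (- (\<Sum>i\<in>I. \<kappa> i))) / of_nat CARD('a)"
proof -
  define \<sigma> where "\<sigma> = (\<Sum>i\<in>I. \<kappa> i)"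
  have "(\<Prod>i\<in>I. \<Sum>v\<in>UNIV. rho (\<kappa> i) v * ech (v * s)) = rho (- \<sigma>) s * (\<Prod>i\<in>I. gauss TYPE('a) (\<kappa> i))" for s :: 'a
  proof (cases "s = 0")
    case True
    obtain i where i: "i \<in> I" "\<not> int (CARD('a) - 1) dvd \<kappa> i" using nt by blast
    have "(\<Sum>v\<in>UNIV. rho (\<kappa> i) (v::'a) * ech (v * s)) = 0" using rho_sum_eq_0[OF i(2)] True by simp
    thus ?thesis using True I i(1) by (metis (no_types, lifting) mult_zero_left prod_zero rho_0_right)
  next
    case False
    have "rho (- \<sigma>) s = (\<Prod>i\<in>I. rho (- \<kappa> i) s)"
      unfolding \<sigma>_def sum_negf[symmetric] by (rule rho_sum_index[OF I False])
    thus ?thesis by (simp add: gauss_twist[OF False] prod.distrib)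
  qed
  hence "(\<Sum>s\<in>UNIV. ech (- (s * y)) * (\<Prod>i\<in>I. \<Sum>v\<in>UNIV. rho (\<kappa> i) v * ech (v * s))) =
     (\<Prod>i\<in>I. gauss TYPE('a) (\<kappa> i)) * (\<Sum>s\<in>UNIV. rho (- \<sigma>) s * ech (s * (- y)))"
    by (simp add: sum_distrib_left mult_ac)
  also have "(\<Sum>s\<in>UNIV. rho (- \<sigma>) s * ech (s * (- y))) =
    (if y = 0 then (if int (CARD('a) - 1) dvd \<sigma> then of_nat CARD('a) - 1 else 0)
     else rho \<sigma> (- y) * gauss TYPE('a) (- \<sigma>))"
  proof (cases "y = 0")
    case True
    thus ?thesis using rho_sum_trivial[of "- \<sigma>", where 'a='a] rho_sum_eq_0[of "- \<sigma>", where 'a='a] by simp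
  next
    case False
    thus ?thesis using gauss_twist[of "- y" "- \<sigma>"] by simp
  qed
  finally have 1: "(\<Sum>s\<in>UNIV. ech (- (s * y)) * (\<Prod>i\<in>I. \<Sum>v\<in>UNIV. rho (\<kappa> i) v * ech (v * s))) =
     (\<Prod>i\<in>I. gauss TYPE('a) (\<kappa> i)) * (if y = 0 then (if int (CARD('a) - 1) dvd \<sigma> then of_nat CARD('a) - 1 else 0)
     else rho \<sigma> (- y) * gauss TYPE('a) (- \<sigma>))" .
  show ?thesis unfolding sum_constrained_ech[OF I, of "\<lambda>i. rho (\<kappa> i)" y] by (simp only: 1 \<sigma>_def)
qed

text \<open>A Jacobi sum in several variables; the left-hand side is the sum over the auxiliary
  variables \<open>x\<^sub>l\<^sub>+\<^sub>1, \<dots>, x\<^sub>d\<^sub>+\<^sub>1\<close> of a variety \<open>H\<close>.\<close>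

lemma jacobi_sum_several:
  fixes \<gamma> :: "nat \<Rightarrow> int" and s :: "'a::{field,finite}"
  assumes I: "finite I" "j \<notin> I" and nt: "\<not> int (CARD('a) - 1) dvd (\<Sum>i\<in>insert j I. \<gamma> i)"
    and m1: "rho (\<Sum>i\<in>insert j I. \<gamma> i) (-1 :: 'a) = 1"
  shows "of_nat CARD('a) * (\<Sum>y\<in>I \<rightarrow>\<^sub>E UNIV. rho (\<gamma> j) (s - (\<Sum>i\<in>I. y i)) * (\<Prod>i\<in>I. rho (\<gamma> i) (y i))) =
    (\<Prod>i\<in>insert j I. gauss TYPE('a) (\<gamma> i)) * gauss TYPE('a) (- (\<Sum>i\<in>insert j I. \<gamma> i)) * rho (\<Sum>i\<in>insert j I. \<gamma> i) s"
proof -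
  define \<sigma> where "\<sigma> = (\<Sum>i\<in>insert j I. \<gamma> i)"
  have q: "(of_nat CARD('a) :: complex) \<noteq> 0" using card_field_gt_1[where 'a='a] by auto
  have "\<exists>i\<in>insert j I. \<not> int (CARD('a) - 1) dvd \<gamma> i" using nt by (meson dvd_sum)
  hence L: "(\<Sum>u | u \<in> insert j I \<rightarrow>\<^sub>E UNIV \<and> (\<Sum>i\<in>insert j I. u i) = s. \<Prod>i\<in>insert j I. rho (\<gamma> i) (u i)) =
    (\<Prod>i\<in>insert j I. gauss TYPE('a) (\<gamma> i)) * (if s = 0 then 0 else rho \<sigma> (- s) * gauss TYPE('a) (- \<sigma>)) / of_nat CARD('a)"
    using sum_constrained_rho[of "insert j I" \<gamma> s] I nt by (simp add: \<sigma>_def)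
  have "(\<Sum>y\<in>I \<rightarrow>\<^sub>E UNIV. rho (\<gamma> j) (s - (\<Sum>i\<in>I. y i)) * (\<Prod>i\<in>I. rho (\<gamma> i) (y i))) =
     (\<Sum>u | u \<in> insert j I \<rightarrow>\<^sub>E UNIV \<and> (\<Sum>i\<in>insert j I. u i) = s. \<Prod>i\<in>insert j I. rho (\<gamma> i) (u i))"
  proof (rule sum.reindex_bij_witness[of _ "\<lambda>u. u(j := undefined)" "\<lambda>y. y(j := s - (\<Sum>i\<in>I. y i))"], goal_cases)
    case (1 y)
    thus ?case using I by (auto simp: PiE_def extensional_def)
  next
    case (2 y)
    have "(\<Sum>i\<in>I. (y(j := s - (\<Sum>i\<in>I. y i))) i) = (\<Sum>i\<in>I. y i)" by (rule sum.cong) (use I in auto)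
    thus ?case using I 2 by (auto simp: PiE_def extensional_def)
  next
    case (3 u)
    have "(\<Sum>i\<in>I. (u(j := undefined)) i) = (\<Sum>i\<in>I. u i)" by (rule sum.cong) (use I in auto)
    moreover have "s - (\<Sum>i\<in>I. u i) = u j" using 3 I by (auto simp: algebra_simps)
    ultimately show ?case by (simp add: fun_upd_idem)
  next
    case (4 u)
    thus ?case using I by (auto simp: PiE_def extensional_def)
  next
    case (5 y)
    have "(\<Prod>i\<in>I. rho (\<gamma> i) ((y(j := s - (\<Sum>i\<in>I. y i))) i)) = (\<Prod>i\<in>I. rho (\<gamma> i) (y i))" by (rule prod.cong) (use I in auto)
    thus ?case using I by simp
  qed
  also note L
  also have "(if s = 0 then 0 else rho \<sigma> (- s) * gauss TYPE('a) (- \<sigma>)) = gauss TYPE('a) (- \<sigma>) * rho \<sigma> s"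
    using rho_mult[of \<sigma> "-1" s] m1 by (simp add: \<sigma>_def)
  finally show ?thesis using q by (simp add: \<sigma>_def mult_ac)
qed

text \<open>With t = (q - 1)/n the characters of order dividing n have the indices a t, and a
  matters only modulo n.\<close>

locale dwork =
  fixes n t :: nat and \<psi> :: "'a::{field,finite}"
  assumes nt: "n * t = CARD('a) - 1" and oddn: "odd n" and \<psi>0: "\<psi> \<noteq> 0"
begin

lemma n_pos: "n > 0" and t_pos: "t > 0" and q1_pos: "CARD('a) - 1 > 0"
  using nt card_field_gt_1[where 'a='a] by (auto intro!: Nat.gr0I)

lemma dvd_mult_t: "int (CARD('a) - 1) dvd a * int t \<longleftrightarrow> int n dvd a"
  unfolding nt[symmetric] of_nat_mult using t_pos by simp

lemma cong_mult_t: "[a = b] (mod int n) \<Longrightarrow> [a * int t = b * int t] (mod int (CARD('a) - 1))"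
  unfolding cong_iff_dvd_diff left_diff_distrib[symmetric] dvd_mult_t .

section \<open>Expansion of the point counts over families of characters\<close>

definition idx :: "(nat \<Rightarrow> nat) set" where "idx = {1..n} \<rightarrow>\<^sub>E {..<n}"

text \<open>For these families the product of the characters depends only on the product of the u i,
  an n-th power on the torus of the quotient. They account for the points of the quotient and are
  removed from the difference.\<close>

definition const_idx :: "(nat \<Rightarrow> nat) set" where "const_idx = (\<lambda>c. \<lambda>i\<in>{1..n}. c) ` {..<n}"

lemma const_idxI:
  assumes "a \<in> idx" "\<And>i. i \<in> {1..n} \<Longrightarrow> a i = a 1"
  shows "a \<in> const_idx"
proof -
  have "a = (\<lambda>i\<in>{1..n}. a 1)"
    using assms PiE_arb[of a "{1..n}" "\<lambda>_. {..<n}"] unfolding idx_def by (intro ext) (metis restrict_apply)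
  moreover have "a 1 < n" using assms(1) n_pos by (auto simp: idx_def)
  ultimately show ?thesis unfolding const_idx_def by blast
qed

text \<open>The trivial character takes the value 1 at 0 here, since 0 has exactly one n-th
  root.\<close>

definition ch :: "nat \<Rightarrow> 'a \<Rightarrow> complex" where
  "ch a v = (if a = 0 then 1 else rho (int a * int t) v)"

lemma card_nth_roots: "of_nat (card {x::'a. x ^ n = v}) = (\<Sum>a<n. ch a v)"
proof (cases "v = 0")
  case True
  have "{x::'a. x ^ n = 0} = {0}" using n_pos by auto
  moreover have "(\<Sum>a<n. ch a 0) = (\<Sum>a<n. if a = 0 then 1 else 0)" by (rule sum.cong) (auto simp: ch_def)
  ultimately show ?thesis using True n_pos by simp
next
  case False
  hence v: "to_ac v \<in> units_fixed 1" by (simp add: units_fixed_def del: One_nat_def)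
  have "{x \<in> units_fixed 1. x ^ n = to_ac v} = to_ac ` {x::'a. x ^ n = v}"
  proof (intro equalityI subsetI)
    fix x assume "x \<in> {x \<in> units_fixed 1. x ^ n = to_ac v}"
    hence "frob 1 x = x" "x ^ n = to_ac v" by (auto simp: units_fixed_def)
    then obtain y where "x = to_ac y" unfolding frob_fixed_iff by blast
    moreover from this have "to_ac (y ^ n) = to_ac v" using \<open>x ^ n = to_ac v\<close> by simp
    hence "y ^ n = v" by (simp only: to_ac_eq_iff)
    ultimately show "x \<in> to_ac ` {x::'a. x ^ n = v}" by blast
  next
    fix x assume "x \<in> to_ac ` {x::'a. x ^ n = v}"
    then obtain y where "x = to_ac y" "y ^ n = v" by blast
    moreover from this have "y \<noteq> 0" using False n_pos by (auto simp: zero_power)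
    ultimately show "x \<in> {x \<in> units_fixed 1. x ^ n = to_ac v}" by (auto simp: units_fixed_def simp del: One_nat_def)
  qed
  hence "card {x \<in> units_fixed 1. x ^ n = to_ac v} = card {x::'a. x ^ n = v}"
    by (simp add: card_image inj_on_subset[OF inj_to_ac])
  moreover have "orb 1 (to_ac v) = {#to_ac v#}" by (simp add: orb_def)
  ultimately have "of_nat (card {x::'a. x ^ n = v}) = (\<Sum>j<n. rho (int j * int t) v)"
    using card_nth_roots_fixed[OF nt _ v] by simp
  also have "\<dots> = (\<Sum>a<n. ch a v)" by (intro sum.cong refl) (simp add: ch_def rho_trivial False)
  finally show ?thesis .
qed

lemma sum_over_roots:
  fixes S :: "(nat \<Rightarrow> 'a) set"
  assumes "S \<subseteq> {1..n} \<rightarrow>\<^sub>E UNIV"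
  shows "of_nat (card {x \<in> {1..n} \<rightarrow>\<^sub>E UNIV. (\<lambda>i\<in>{1..n}. x i ^ n) \<in> S}) =
     (\<Sum>a\<in>idx. \<Sum>u\<in>S. \<Prod>i=1..n. ch (a i) (u i))"
proof -
  have fin: "finite ({1..n} \<rightarrow>\<^sub>E (UNIV :: 'a set))" by (simp add: finite_PiE)
  hence finS: "finite S" using assms finite_subset by blast
  define XS where "XS = {x \<in> {1..n} \<rightarrow>\<^sub>E (UNIV :: 'a set). (\<lambda>i\<in>{1..n}. x i ^ n) \<in> S}"
  have "card XS = (\<Sum>x\<in>XS. 1)" by simp
  also have "\<dots> = (\<Sum>u\<in>S. \<Sum>x\<in>{x \<in> XS. (\<lambda>i\<in>{1..n}. x i ^ n) = u}. 1)"
    by (rule sum.group[symmetric]) (use fin finS in \<open>auto simp: XS_def\<close>)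
  also have "\<dots> = (\<Sum>u\<in>S. card {x \<in> XS. (\<lambda>i\<in>{1..n}. x i ^ n) = u})" by simp
  also have "\<dots> = (\<Sum>u\<in>S. \<Prod>i=1..n. card {x::'a. x ^ n = u i})"
  proof (rule sum.cong[OF refl])
    fix u assume u: "u \<in> S"
    hence ue: "u \<in> {1..n} \<rightarrow>\<^sub>E UNIV" using assms by blast
    have "{x \<in> XS. (\<lambda>i\<in>{1..n}. x i ^ n) = u} = PiE {1..n} (\<lambda>i. {x::'a. x ^ n = u i})"
    proof (intro equalityI subsetI)
      fix x assume "x \<in> {x \<in> XS. (\<lambda>i\<in>{1..n}. x i ^ n) = u}"
      hence x: "x \<in> {1..n} \<rightarrow>\<^sub>E UNIV" "(\<lambda>i\<in>{1..n}. x i ^ n) = u" by (auto simp: XS_def)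
      show "x \<in> PiE {1..n} (\<lambda>i. {x::'a. x ^ n = u i})"
      proof (rule PiE_I)
        fix i assume "i \<in> {1..n}"
        thus "x i \<in> {x. x ^ n = u i}" using fun_cong[OF x(2), of i] by simp
      next
        fix i assume "i \<notin> {1..n}"
        thus "x i = undefined" by (rule PiE_arb[OF x(1)])
      qed
    next
      fix x assume x: "x \<in> PiE {1..n} (\<lambda>i. {x::'a. x ^ n = u i})"
      have "(\<lambda>i\<in>{1..n}. x i ^ n) = u"
      proof
        fix i show "(\<lambda>i\<in>{1..n}. x i ^ n) i = u i"
          using PiE_mem[OF x, of i] PiE_arb[OF ue, of i] by (cases "i \<in> {1..n}") auto
      qed
      moreover have "x \<in> {1..n} \<rightarrow>\<^sub>E UNIV" using x by auto
      ultimately show "x \<in> {x \<in> XS. (\<lambda>i\<in>{1..n}. x i ^ n) = u}" using u by (simp add: XS_def)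
    qed
    thus "card {x \<in> XS. (\<lambda>i\<in>{1..n}. x i ^ n) = u} = (\<Prod>i=1..n. card {x::'a. x ^ n = u i})"
      by (simp add: card_PiE)
  qed
  finally have "of_nat (card XS) = (\<Sum>u\<in>S. \<Prod>i=1..n. \<Sum>a<n. ch a (u i))"
    by (simp add: card_nth_roots[symmetric])
  also have "\<dots> = (\<Sum>u\<in>S. \<Sum>a\<in>idx. \<Prod>i=1..n. ch (a i) (u i))"
    unfolding idx_def by (intro sum.cong refl prod_sum_PiE) auto
  also have "\<dots> = (\<Sum>a\<in>idx. \<Sum>u\<in>S. \<Prod>i=1..n. ch (a i) (u i))" by (rule sum.swap)
  finally show ?thesis by (simp add: XS_def)
qed

text \<open>A Jacobi sum on the hyperplane of vanishing coordinate sum; since \<open>rho\<close>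
  vanishes at 0, only points with all coordinates nonzero contribute.\<close>

definition jac :: "(nat \<Rightarrow> nat) \<Rightarrow> complex" where
  "jac a = (\<Sum>u | u \<in> {1..n} \<rightarrow>\<^sub>E (UNIV :: 'a set) \<and> (\<Sum>i=1..n. u i) = 0. \<Prod>i=1..n. rho (int (a i) * int t) (u i))"

definition tor :: "(nat \<Rightarrow> nat) \<Rightarrow> complex" where
  "tor a = (\<Sum>(u, w) | u \<in> {1..n} \<rightarrow>\<^sub>E (UNIV :: 'a set) \<and> w \<noteq> 0 \<and> w ^ n = (\<Prod>i=1..n. u i) \<and> (\<Sum>i=1..n. u i) = of_nat n * \<psi> * w.
      \<Prod>i=1..n. rho (int (a i) * int t) (u i))"

text \<open>A family without the value 0 contributes nothing, as some coordinate vanishes; the zero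
  family counts the points of the quotient. If both zero and nonzero values occur, the sum of the
  \<open>ch\<close> over the whole hyperplane is 0: at the additive frequency 0 by a nontrivial
  character, elsewhere by a trivial one. The part on the coordinate hyperplanes is then minus the
  part on the torus, which is \<open>jac\<close>.\<close>

lemma boundary_count:
  "of_nat (card {x \<in> {1..n} \<rightarrow>\<^sub>E (UNIV :: 'a set). (\<Sum>i=1..n. x i ^ n) = 0 \<and> (\<Prod>i=1..n. x i) = 0})
   - of_nat (card {u \<in> {1..n} \<rightarrow>\<^sub>E (UNIV :: 'a set). (\<Sum>i=1..n. u i) = 0 \<and> (\<Prod>i=1..n. u i) = 0})
   = - (\<Sum>a\<in>idx - const_idx. if \<exists>i\<in>{1..n}. a i = 0 then jac a else 0)"
proof -
  define E where "E = {1..n} \<rightarrow>\<^sub>E (UNIV :: 'a set)"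
  define S where "S = {u \<in> E. (\<Sum>i=1..n. u i) = 0 \<and> (\<Prod>i=1..n. u i) = 0}"
  define B where "B a = (\<Sum>u\<in>S. \<Prod>i=1..n. ch (a i) (u i))" for a :: "nat \<Rightarrow> nat"
  have finE: "finite E" by (simp add: E_def finite_PiE)
  have finI: "finite idx" by (simp add: idx_def finite_PiE)
  have "{x \<in> E. (\<Sum>i=1..n. x i ^ n) = 0 \<and> (\<Prod>i=1..n. x i) = 0} = {x \<in> E. (\<lambda>i\<in>{1..n}. x i ^ n) \<in> S}"
  proof -
    have "((\<Prod>i=1..n. x i ^ n) = 0) = ((\<Prod>i=1..n. x i) = 0)" for x :: "nat \<Rightarrow> 'a"
      using n_pos by (auto simp: prod_zero_iff)
    thus ?thesis by (auto simp: S_def E_def)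
  qed
  hence X: "of_nat (card {x \<in> E. (\<Sum>i=1..n. x i ^ n) = 0 \<and> (\<Prod>i=1..n. x i) = 0}) = (\<Sum>a\<in>idx. B a)"
    unfolding B_def using sum_over_roots[of S] by (simp add: S_def E_def)
  have Bzero: "B a = 0" if "\<not> (\<exists>i\<in>{1..n}. a i = 0)" for a
    unfolding B_def
  proof (rule sum.neutral, rule ballI)
    fix u assume "u \<in> S"
    then obtain i where "i \<in> {1..n}" "u i = 0" by (auto simp: S_def prod_zero_iff)
    thus "(\<Prod>i=1..n. ch (a i) (u i)) = 0" using that by (intro prod_zero bexI[of _ i]) (auto simp: ch_def)
  qed
  have B0: "B a = of_nat (card S)" if "\<forall>i\<in>{1..n}. a i = 0" for a
    using that by (simp add: B_def ch_def)
  have Bjac: "B a = - jac a" if a: "a \<in> idx" "i0 \<in> {1..n}" "a i0 = 0" "i1 \<in> {1..n}" "a i1 \<noteq> 0" for a i0 i1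
  proof -
    have all0: "(\<Sum>u | u \<in> {1..n} \<rightarrow>\<^sub>E UNIV \<and> (\<Sum>i\<in>{1..n}. u i) = (0::'a). \<Prod>i\<in>{1..n}. ch (a i) (u i)) = 0"
    proof (subst sum_constrained_ech)
      have z: "(\<Prod>i\<in>{1..n}. \<Sum>v\<in>UNIV. ch (a i) v * ech (v * s)) = 0" for s :: 'a
      proof (cases "s = 0")
        case True
        have "a i1 < n" using a by (auto simp: idx_def)
        hence "\<not> int n dvd int (a i1)" using a(5) by (auto dest!: dvd_imp_le)
        hence "\<not> int (CARD('a) - 1) dvd int (a i1) * int t" using dvd_mult_t by blast
        hence "(\<Sum>v\<in>UNIV. ch (a i1) v * ech (v * s)) = 0"
          using True a(5) rho_sum_eq_0[of "int (a i1) * int t", where 'a='a] by (simp add: ch_def)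
        thus ?thesis using a(4) by (intro prod_zero) auto
      next
        case False
        hence "(\<Sum>v\<in>UNIV. ch (a i0) v * ech (v * s)) = 0" using a(3) by (simp add: ch_def sum_ech)
        thus ?thesis using a(2) by (intro prod_zero) auto
      qed
      show "(\<Sum>s\<in>UNIV. ech (- (s * 0)) * (\<Prod>i = 1..n. \<Sum>v\<in>UNIV. ch (a i) v * ech (v * s))) / complex_of_nat CARD('a) = 0"
        by (simp only: z) simp
    qed simp
    define U where "U = {u \<in> E. (\<Sum>i=1..n. u i) = 0}"
    have finU: "finite U" using finE by (simp add: U_def)
    have SU: "S \<subseteq> U" by (auto simp: S_def U_def)
    have "0 = (\<Sum>u\<in>U. \<Prod>i=1..n. ch (a i) (u i))" using all0 by (simp add: U_def E_def)
    also have "\<dots> = B a + (\<Sum>u\<in>U - S. \<Prod>i=1..n. ch (a i) (u i))"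
      unfolding B_def using sum.subset_diff[OF SU finU] by (simp add: add.commute)
    also have "(\<Sum>u\<in>U - S. \<Prod>i=1..n. ch (a i) (u i)) = (\<Sum>u\<in>U - S. \<Prod>i=1..n. rho (int (a i) * int t) (u i))"
    proof (intro sum.cong prod.cong refl)
      fix u i assume "u \<in> U - S" "i \<in> {1..n}"
      hence "u i \<noteq> 0" by (auto simp: U_def S_def prod_zero_iff)
      thus "ch (a i) (u i) = rho (int (a i) * int t) (u i)" by (simp add: ch_def rho_trivial)
    qed
    also have "\<dots> = (\<Sum>u\<in>U. \<Prod>i=1..n. rho (int (a i) * int t) (u i))"
    proof (rule sum.mono_neutral_left[OF finU])
      show "\<forall>u\<in>U - (U - S). (\<Prod>i=1..n. rho (int (a i) * int t) (u i)) = 0"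
      proof
        fix u assume "u \<in> U - (U - S)"
        then obtain i where "i \<in> {1..n}" "u i = 0" by (auto simp: S_def prod_zero_iff)
        thus "(\<Prod>i=1..n. rho (int (a i) * int t) (u i)) = 0" by (intro prod_zero bexI[of _ i]) auto
      qed
    qed auto
    also have "\<dots> = jac a" by (simp add: jac_def U_def E_def)
    finally show ?thesis by (simp add: eq_neg_iff_add_eq_0)
  qed
  define z where "z = (\<lambda>i\<in>{1..n}. 0::nat)"
  have zI: "z \<in> idx" using n_pos by (auto simp: z_def idx_def)
  have "(\<Sum>a\<in>idx. B a) = B z + (\<Sum>a\<in>idx - {z}. B a)" by (rule sum.remove[OF finI zI])
  also have "B z = of_nat (card S)" by (rule B0) (simp add: z_def)
  also have "(\<Sum>a\<in>idx - {z}. B a) = (\<Sum>a\<in>idx - const_idx. B a)"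
  proof (rule sum.mono_neutral_right)
    show "idx - const_idx \<subseteq> idx - {z}" using n_pos by (auto simp: const_idx_def z_def)
    show "\<forall>a\<in>idx - {z} - (idx - const_idx). B a = 0"
    proof
      fix a assume "a \<in> idx - {z} - (idx - const_idx)"
      then obtain c where c: "a = (\<lambda>i\<in>{1..n}. c)" "a \<noteq> z" by (auto simp: const_idx_def)
      hence "c \<noteq> 0" by (auto simp: z_def)
      thus "B a = 0" by (intro Bzero) (simp add: c(1))
    qed
  qed (use finI in simp)
  also have "\<dots> = (\<Sum>a\<in>idx - const_idx. if \<exists>i\<in>{1..n}. a i = 0 then - jac a else 0)"
  proof (rule sum.cong[OF refl])
    fix a assume a: "a \<in> idx - const_idx"
    show "B a = (if \<exists>i\<in>{1..n}. a i = 0 then - jac a else 0)"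
    proof (cases "\<exists>i\<in>{1..n}. a i = 0")
      case True
      then obtain i0 where i0: "i0 \<in> {1..n}" "a i0 = 0" by blast
      have "\<exists>i1\<in>{1..n}. a i1 \<noteq> 0"
      proof (rule ccontr)
        assume "\<not> (\<exists>i1\<in>{1..n}. a i1 \<noteq> 0)"
        hence "a = (\<lambda>i\<in>{1..n}. 0)" using a by (auto simp: idx_def PiE_def extensional_def fun_eq_iff)
        thus False using a n_pos by (auto simp: const_idx_def)
      qed
      thus ?thesis using Bjac[of a i0] a i0 True by auto
    next
      case False
      show ?thesis by (simp only: False if_False Bzero[OF False])
    qed
  qed
  finally show ?thesis
    unfolding E_def[symmetric] X S_def[symmetric] by (simp add: sum_negf[symmetric] if_distrib cong: if_cong)
qed

text \<open>The factor n allows the product of the x i to be replaced by an independent w with the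
  same n-th power, so that the condition depends only on the n-th powers of the coordinates. Each of
  the n constant families contributes the count of the quotient, because its product of characters
  is a character of order dividing n at \<open>w ^ n\<close>.\<close>

lemma torus_count:
  "of_nat n * (of_nat (card {x \<in> {1..n} \<rightarrow>\<^sub>E (UNIV :: 'a set). (\<Sum>i=1..n. x i ^ n) = of_nat n * \<psi> * (\<Prod>i=1..n. x i) \<and> (\<Prod>i=1..n. x i) \<noteq> 0})
   - of_nat (card {(u, w). u \<in> {1..n} \<rightarrow>\<^sub>E (UNIV :: 'a set) \<and> w \<noteq> 0 \<and> w ^ n = (\<Prod>i=1..n. u i) \<and> (\<Sum>i=1..n. u i) = of_nat n * \<psi> * w}))
   = (\<Sum>a\<in>idx - const_idx. tor a)"
proof -
  define E where "E = {1..n} \<rightarrow>\<^sub>E (UNIV :: 'a set)"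
  define X1 where "X1 = {x \<in> E. (\<Sum>i=1..n. x i ^ n) = of_nat n * \<psi> * (\<Prod>i=1..n. x i) \<and> (\<Prod>i=1..n. x i) \<noteq> 0}"
  define Y1 where "Y1 = {(u, w). u \<in> E \<and> w \<noteq> 0 \<and> w ^ n = (\<Prod>i=1..n. u i) \<and> (\<Sum>i=1..n. u i) = of_nat n * \<psi> * w}"
  define Uw where "Uw w = {u \<in> E. w ^ n = (\<Prod>i=1..n. u i) \<and> (\<Sum>i=1..n. u i) = of_nat n * \<psi> * w}" for w
  define XW where "XW w = {x \<in> E. (\<lambda>i\<in>{1..n}. x i ^ n) \<in> Uw w}" for w
  have finE: "finite E" by (simp add: E_def finite_PiE)
  have finI: "finite idx" by (simp add: idx_def finite_PiE)
  have one: "1 \<in> {1..n}" using n_pos by simp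
  have Y1: "Y1 = (SIGMA w:UNIV-{0}. Uw w)\<inverse>" by (auto simp: Y1_def Uw_def)
  have torS: "tor a = (\<Sum>w\<in>UNIV-{0}. \<Sum>u\<in>Uw w. \<Prod>i=1..n. rho (int (a i) * int t) (u i))" for a
  proof -
    have "tor a = (\<Sum>(u, w)\<in>Y1. \<Prod>i=1..n. rho (int (a i) * int t) (u i))"
      unfolding tor_def Y1_def E_def ..
    also have "\<dots> = (\<Sum>(w, u)\<in>(SIGMA w:UNIV-{0}. Uw w). \<Prod>i=1..n. rho (int (a i) * int t) (u i))"
      by (rule sum.reindex_bij_witness[of _ "\<lambda>(w, u). (u, w)" "\<lambda>(u, w). (w, u)"]) (auto simp: Y1)
    also have "\<dots> = (\<Sum>w\<in>UNIV-{0}. \<Sum>u\<in>Uw w. \<Prod>i=1..n. rho (int (a i) * int t) (u i))"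
      by (rule sum.Sigma[symmetric]) (auto simp: Uw_def finE)
    finally show ?thesis .
  qed
  have XWc: "of_nat (card (XW w)) = (\<Sum>a\<in>idx. \<Sum>u\<in>Uw w. \<Prod>i=1..n. rho (int (a i) * int t) (u i))" if w: "w \<noteq> 0" for w
  proof -
    have "of_nat (card (XW w)) = (\<Sum>a\<in>idx. \<Sum>u\<in>Uw w. \<Prod>i=1..n. ch (a i) (u i))"
      unfolding XW_def E_def by (rule sum_over_roots) (auto simp: Uw_def E_def)
    also have "\<dots> = (\<Sum>a\<in>idx. \<Sum>u\<in>Uw w. \<Prod>i=1..n. rho (int (a i) * int t) (u i))"
    proof (intro sum.cong prod.cong refl)
      fix a u i assume ui: "u \<in> Uw w" "i \<in> {1..n}"
      hence "w ^ n = (\<Prod>i=1..n. u i)" by (simp only: Uw_def mem_Collect_eq)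
      moreover have "w ^ n \<noteq> 0" using w by simp
      ultimately have "(\<Prod>i=1..n. u i) \<noteq> 0" by metis
      hence "u i \<noteq> 0" using ui(2) by (auto simp: prod_zero_iff)
      thus "ch (a i) (u i) = rho (int (a i) * int t) (u i)" by (simp add: ch_def rho_trivial)
    qed
    finally show ?thesis .
  qed
  have const: "tor a = of_nat (card Y1)" if a: "a \<in> const_idx" for a
  proof -
    obtain c where c: "a = (\<lambda>i\<in>{1..n}. c)" using a by (auto simp: const_idx_def)
    have "(\<Prod>i=1..n. rho (int (a i) * int t) (u i)) = 1" if "u \<in> Uw w" "w \<noteq> 0" for u w
    proof -
      have "(\<Prod>i=1..n. rho (int (a i) * int t) (u i)) = rho (int c * int t) (w ^ n)"
        using that by (simp add: c Uw_def rho_prod)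
      also have "\<dots> = rho (int n * (int c * int t)) w" using that(2) by (rule rho_power)
      also have "\<dots> = rho 0 w"
      proof (rule rho_cong)
        have "int n * (int c * int t) = int n * int c * int t" by simp
        thus "[int n * (int c * int t) = 0] (mod int (CARD('a) - 1))"
          unfolding cong_0_iff by (simp only: dvd_mult_t dvd_triv_left)
      qed
      finally show ?thesis using that(2) by (simp add: rho_trivial)
    qed
    hence "tor a = (\<Sum>w\<in>UNIV-{0}. \<Sum>u\<in>Uw w. 1)" unfolding torS by (intro sum.cong refl) auto
    also have "\<dots> = (\<Sum>p\<in>(SIGMA w:UNIV-{0}. Uw w). 1)" by (subst sum.Sigma) (auto simp: Uw_def finE)
    also have "\<dots> = of_nat (card Y1)" unfolding Y1 by (simp add: card_inverse)
    finally show ?thesis .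
  qed
  \<comment> \<open>w records the product of the original point. Dividing one coordinate by \<zeta>
    leaves the n-th powers unchanged, and \<zeta> is recovered as w divided by the new
    product.\<close>
  have "bij_betw (\<lambda>(\<zeta>, x). (\<Prod>i=1..n. x i, x(1 := x 1 / \<zeta>))) ({\<zeta>::'a. \<zeta> ^ n = 1} \<times> X1) (SIGMA w:UNIV-{0}. XW w)"
  proof (rule bij_betw_byWitness[of _ "\<lambda>(w, x). (w / (\<Prod>i=1..n. x i), x(1 := x 1 * (w / (\<Prod>i=1..n. x i))))"])
    have upd: "(\<Prod>i=1..n. (x(1 := b)) i) = b * (\<Prod>i\<in>{1..n}-{1}. x i)"
      and spl: "(\<Prod>i=1..n. x i) = x 1 * (\<Prod>i\<in>{1..n}-{1}. x i)" for x :: "nat \<Rightarrow> 'a" and b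
    proof -
      have rem: "(\<Prod>i=1..n. f i) = f 1 * (\<Prod>i\<in>{1..n}-{1}. f i)" for f :: "nat \<Rightarrow> 'a"
        by (rule prod.remove) (use one in auto)
      show "(\<Prod>i=1..n. x i) = x 1 * (\<Prod>i\<in>{1..n}-{1}. x i)" by (rule rem)
      have "(\<Prod>i\<in>{1..n}-{1}. (x(1 := b)) i) = (\<Prod>i\<in>{1..n}-{1}. x i)" by (rule prod.cong) auto
      thus "(\<Prod>i=1..n. (x(1 := b)) i) = b * (\<Prod>i\<in>{1..n}-{1}. x i)" using rem[of "x(1 := b)"] by simp
    qed
    have updn: "(\<Sum>i=1..n. (x(1 := x 1 * b)) i ^ n) = (\<Sum>i=1..n. x i ^ n)"
      "(\<Prod>i=1..n. (x(1 := x 1 * b)) i ^ n) = (\<Prod>i=1..n. x i ^ n)" if "b ^ n = 1" for x :: "nat \<Rightarrow> 'a" and b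
      using that by (auto intro!: sum.cong prod.cong simp: power_mult_distrib)
    have restr: "(\<Sum>i=1..n. (\<lambda>i\<in>{1..n}. x i ^ n) i) = (\<Sum>i=1..n. x i ^ n)"
      "(\<Prod>i=1..n. (\<lambda>i\<in>{1..n}. x i ^ n) i) = (\<Prod>i=1..n. x i) ^ n" for x :: "nat \<Rightarrow> 'a"
      by (auto simp: prod_power_distrib)
    have XWiff: "x \<in> XW w \<longleftrightarrow> x \<in> E \<and> w ^ n = (\<Prod>i=1..n. x i) ^ n \<and> (\<Sum>i=1..n. x i ^ n) = of_nat n * \<psi> * w" for x w
      unfolding XW_def Uw_def mem_Collect_eq restr by (auto simp: E_def)
    show "\<forall>p\<in>{\<zeta>::'a. \<zeta> ^ n = 1} \<times> X1. (\<lambda>(w, x). (w / (\<Prod>i=1..n. x i), x(1 := x 1 * (w / (\<Prod>i=1..n. x i))))) ((\<lambda>(\<zeta>, x). (\<Prod>i=1..n. x i, x(1 := x 1 / \<zeta>))) p) = p"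
    proof (intro ballI)
      fix p assume "p \<in> {\<zeta>::'a. \<zeta> ^ n = 1} \<times> X1"
      then obtain \<zeta> x where p: "p = (\<zeta>, x)" "\<zeta> ^ n = 1" "x \<in> X1" by blast
      have z0: "\<zeta> \<noteq> 0" using p(2) n_pos by (auto simp: zero_power)
      have P0: "(\<Prod>i=1..n. x i) \<noteq> 0" using p(3) by (simp add: X1_def)
      have "(\<Prod>i=1..n. x i) / (\<Prod>i=1..n. (x(1 := x 1 / \<zeta>)) i) = \<zeta>"
        using P0 z0 unfolding upd unfolding spl[of x] by (simp add: field_simps)
      thus "(\<lambda>(w, x). (w / (\<Prod>i=1..n. x i), x(1 := x 1 * (w / (\<Prod>i=1..n. x i))))) ((\<lambda>(\<zeta>, x). (\<Prod>i=1..n. x i, x(1 := x 1 / \<zeta>))) p) = p"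
        using z0 by (simp only: p(1) prod.case) simp
    qed
    show "\<forall>p\<in>(SIGMA w:UNIV-{0}. XW w). (\<lambda>(\<zeta>, x). (\<Prod>i=1..n. x i, x(1 := x 1 / \<zeta>))) ((\<lambda>(w, x). (w / (\<Prod>i=1..n. x i), x(1 := x 1 * (w / (\<Prod>i=1..n. x i))))) p) = p"
    proof (intro ballI)
      fix p assume "p \<in> (SIGMA w:UNIV-{0}. XW w)"
      then obtain w x where p: "p = (w, x)" "w \<noteq> 0" "x \<in> XW w" by blast
      have P0: "(\<Prod>i=1..n. x i) \<noteq> 0"
      proof
        assume 0: "(\<Prod>i=1..n. x i) = 0"
        have "w ^ n = 0" using p(3) n_pos unfolding XWiff 0 by (simp add: zero_power)
        thus False using p(2) by simp
      qed
      have "(\<Prod>i=1..n. (x(1 := x 1 * (w / (\<Prod>i=1..n. x i)))) i) = w"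
        using P0 unfolding upd unfolding spl[of x] by (simp add: field_simps)
      thus "(\<lambda>(\<zeta>, x). (\<Prod>i=1..n. x i, x(1 := x 1 / \<zeta>))) ((\<lambda>(w, x). (w / (\<Prod>i=1..n. x i), x(1 := x 1 * (w / (\<Prod>i=1..n. x i))))) p) = p"
        using P0 p(2) by (simp only: p(1) prod.case) simp
    qed
    show "(\<lambda>(\<zeta>, x). (\<Prod>i=1..n. x i, x(1 := x 1 / \<zeta>))) ` ({\<zeta>::'a. \<zeta> ^ n = 1} \<times> X1) \<subseteq> (SIGMA w:UNIV-{0}. XW w)"
    proof (rule image_subsetI)
      fix p assume "p \<in> {\<zeta>::'a. \<zeta> ^ n = 1} \<times> X1"
      then obtain \<zeta> x where p: "p = (\<zeta>, x)" "\<zeta> ^ n = 1" "x \<in> X1" by blast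
      have i1: "inverse \<zeta> ^ n = 1" using p(2) by (simp add: power_inverse)
      have xE: "x(1 := x 1 * inverse \<zeta>) \<in> E" using p(3) one by (auto simp: X1_def E_def PiE_def extensional_def)
      have "(\<Prod>i=1..n. (x(1 := x 1 * inverse \<zeta>)) i) ^ n = (\<Prod>i=1..n. x i) ^ n"
        using updn(2)[OF i1, of x] by (simp only: prod_power_distrib)
      hence "x(1 := x 1 * inverse \<zeta>) \<in> XW (\<Prod>i=1..n. x i)"
        unfolding XWiff using updn(1)[OF i1, of x] p(3) xE by (simp add: X1_def)
      moreover have "(\<Prod>i=1..n. x i) \<noteq> 0" using p(3) by (simp add: X1_def)
      ultimately show "(\<lambda>(\<zeta>, x). (\<Prod>i=1..n. x i, x(1 := x 1 / \<zeta>))) p \<in> (SIGMA w:UNIV-{0}. XW w)"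
        by (simp only: p(1) prod.case divide_inverse) blast
    qed
    show "(\<lambda>(w, x). (w / (\<Prod>i=1..n. x i), x(1 := x 1 * (w / (\<Prod>i=1..n. x i))))) ` (SIGMA w:UNIV-{0}. XW w) \<subseteq> {\<zeta>::'a. \<zeta> ^ n = 1} \<times> X1"
    proof (rule image_subsetI)
      fix p assume "p \<in> (SIGMA w:UNIV-{0}. XW w)"
      then obtain w x where p: "p = (w, x)" "w \<noteq> 0" "x \<in> XW w" by blast
      have P0: "(\<Prod>i=1..n. x i) \<noteq> 0"
      proof
        assume 0: "(\<Prod>i=1..n. x i) = 0"
        have "w ^ n = 0" using p(3) n_pos unfolding XWiff 0 by (simp add: zero_power)
        thus False using p(2) by simp
      qed
      define b where "b = w / (\<Prod>i=1..n. x i)"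
      have b: "b ^ n = 1" using p(3) P0 p(2) by (simp add: XWiff b_def power_divide)
      have Pw: "(\<Prod>i=1..n. (x(1 := x 1 * b)) i) = w"
        using P0 unfolding upd b_def unfolding spl[of x] by (simp add: field_simps)
      have "x(1 := x 1 * b) \<in> E" using p(3) one by (auto simp: XWiff E_def PiE_def extensional_def)
      hence "x(1 := x 1 * b) \<in> X1"
        unfolding X1_def mem_Collect_eq updn(1)[OF b] Pw using p XWiff by blast
      thus "(\<lambda>(w, x). (w / (\<Prod>i=1..n. x i), x(1 := x 1 * (w / (\<Prod>i=1..n. x i))))) p \<in> {\<zeta>::'a. \<zeta> ^ n = 1} \<times> X1"
        using b by (simp only: p(1) prod.case b_def[symmetric]) blast
    qed
  qed
  from bij_betw_same_card[OF this] have "n * card X1 = (\<Sum>w\<in>UNIV-{0}. card (XW w))"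
    by (simp add: card_cartesian_product roots_of_unity(1)[OF nt] card_SigmaI XW_def finE)
  hence "of_nat n * of_nat (card X1) = (\<Sum>w\<in>UNIV-{0}. (of_nat (card (XW w)) :: complex))"
    by (metis of_nat_mult of_nat_sum)
  also have "\<dots> = (\<Sum>w\<in>UNIV-{0}. \<Sum>a\<in>idx. \<Sum>u\<in>Uw w. \<Prod>i=1..n. rho (int (a i) * int t) (u i))"
    by (intro sum.cong refl) (simp add: XWc)
  also have "\<dots> = (\<Sum>a\<in>idx. tor a)" unfolding torS by (rule sum.swap)
  also have "\<dots> = (\<Sum>a\<in>idx - const_idx. tor a) + (\<Sum>a\<in>const_idx. tor a)"
    by (rule sum.subset_diff[OF _ finI]) (auto simp: const_idx_def idx_def)
  also have "(\<Sum>a\<in>const_idx. tor a) = of_nat n * of_nat (card Y1)"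
  proof -
    have "inj_on (\<lambda>c. \<lambda>i\<in>{1..n}. c :: nat) {..<n}" using one by (auto simp: inj_on_def fun_eq_iff restrict_def split: if_splits)
    hence "card const_idx = n" by (simp add: const_idx_def card_image)
    thus ?thesis by (simp add: const)
  qed
  finally show ?thesis unfolding E_def[symmetric] X1_def[symmetric] Y1_def[symmetric] by (simp add: right_diff_distrib)
qed

definition gs :: "int \<Rightarrow> complex" where "gs k = gauss TYPE('a) k"

lemma q_nonzero: "(of_nat CARD('a) :: complex) \<noteq> 0" using q1_pos by auto

lemma gs_cong: "[k = l] (mod int (CARD('a) - 1)) \<Longrightarrow> gs k = gs l"
  unfolding gs_def by (rule gauss_cong)

lemma gs_trivial: "int (CARD('a) - 1) dvd k \<Longrightarrow> gs k = -1"
  unfolding gs_def by (rule gauss_trivial)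

lemma rho_m1: "rho (k * int t) (-1 :: 'a) = 1"
  by (rule rho_minus_1[OF nt oddn])

lemma gs_reflect: "\<not> int n dvd k \<Longrightarrow> gs (k * int t) * gs (- (k * int t)) = of_nat CARD('a)"
  using gauss_reflect[of "k * int t", where 'a='a] rho_m1[of k] by (simp only: dvd_mult_t gs_def mult_1_left simp_thms True_implies_equals)

lemma gauss_product: "(\<Prod>j<n. gs (- k + int j * int t)) = of_nat CARD('a) ^ ((n - 1) div 2) * rho (int n * k) (of_nat n :: 'a) * gs (- (int n * k))"
  using hasse_davenport[OF nt oddn, of "- k"] by (simp add: gs_def)

text \<open>Makes \<open>sum_constrained_rho\<close> applicable to a non-constant family for every
  k, including those where some of the characters are trivial.\<close>

lemma nonconst_index:
  assumes a: "a \<in> idx - const_idx"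
  shows "\<exists>i\<in>{1..n}. \<not> int (CARD('a) - 1) dvd k + int (a i) * int t"
proof (rule ccontr)
  assume "\<not> ?thesis"
  hence d: "int (CARD('a) - 1) dvd k + int (a i) * int t" if "i \<in> {1..n}" for i using that by blast
  have lt: "a i < n" if "i \<in> {1..n}" for i using a that by (auto simp: idx_def)
  have one: "1 \<in> {1..n}" using n_pos by simp
  have "a i = a 1" if i: "i \<in> {1..n}" for i
  proof (rule ccontr)
    assume ne: "a i \<noteq> a 1"
    have "int (CARD('a) - 1) dvd (k + int (a i) * int t) - (k + int (a 1) * int t)" by (intro dvd_diff d i one)
    hence "int (CARD('a) - 1) dvd (int (a i) - int (a 1)) * int t" by (simp add: algebra_simps)
    hence "int n dvd int (a i) - int (a 1)" by (simp only: dvd_mult_t)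
    moreover have "\<not> int n dvd int (a i) - int (a 1)"
      using lt[OF i] lt[OF one] ne by (intro residues_not_dvd_diff) auto
    ultimately show False by blast
  qed
  hence "a \<in> const_idx" using a by (intro const_idxI) blast+
  thus False using a by simp
qed

lemma sum_idx_t: "(\<Sum>i=1..n. k + int (a i) * int t) = int n * k + int (\<Sum>i=1..n. a i) * int t"
  by (simp add: sum.distrib sum_distrib_right)

lemma jac_eq:
  assumes "\<exists>i\<in>{1..n}. \<not> n dvd b i"
  shows "of_nat CARD('a) * jac b = (if n dvd (\<Sum>i=1..n. b i) then (of_nat CARD('a) - 1) * (\<Prod>i=1..n. gs (int (b i) * int t)) else 0)"
proof -
  have "\<exists>i\<in>{1..n}. \<not> int (CARD('a) - 1) dvd int (b i) * int t"
    using assms unfolding dvd_mult_t int_dvd_int_iff .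
  from sum_constrained_rho[OF _ this, of 0]
  have "jac b = (\<Prod>i=1..n. gs (int (b i) * int t)) *
    (if int (CARD('a) - 1) dvd (\<Sum>i=1..n. int (b i) * int t) then of_nat CARD('a) - 1 else 0) / of_nat CARD('a)"
    unfolding jac_def gs_def by (simp del: of_nat_diff)
  moreover have "int (CARD('a) - 1) dvd (\<Sum>i=1..n. int (b i) * int t) \<longleftrightarrow> n dvd (\<Sum>i=1..n. b i)"
    unfolding sum_distrib_right[symmetric] dvd_mult_t of_nat_sum[symmetric] int_dvd_int_iff ..
  ultimately show ?thesis using q_nonzero by (simp add: mult.commute)
qed

text \<open>The condition \<open>w ^ n = \<Prod> u i\<close> is expanded in characters.  By the Hasse--Davenport formula, the
  Gauss sum of the \<open>n\<close>-th power of a character arising from the sum over \<open>w\<close> is turned into the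
  second product.\<close>

definition trm :: "(nat \<Rightarrow> nat) \<Rightarrow> int \<Rightarrow> complex" where
  "trm a k = (\<Prod>i=1..n. gs (k + int (a i) * int t)) * (\<Prod>j<n. gs (- k + int j * int t)) * rho k (-1 :: 'a) * rho k (\<psi> ^ n)"

lemma tor_eq:
  assumes a: "a \<in> idx - const_idx"
  shows "of_nat CARD('a) * of_nat CARD('a) ^ ((n - 1) div 2) * tor a = (if n dvd (\<Sum>i=1..n. a i) then (\<Sum>k<CARD('a) - 1. trm a (int k)) else 0)"
proof -
  define E where "E = {1..n} \<rightarrow>\<^sub>E (UNIV :: 'a set)"
  define \<sigma> where "\<sigma> k = int n * k + int (\<Sum>i=1..n. a i) * int t" for k
  define P where "P k = (\<Prod>i=1..n. gs (k + int (a i) * int t))" for k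
  have finE: "finite E" by (simp add: E_def finite_PiE)
  have nz: "of_nat n * \<psi> \<noteq> 0" using of_nat_divisor_nonzero[OF nt] \<psi>0 by simp
  have q1: "(of_nat (CARD('a) - 1) :: complex) \<noteq> 0" using q1_pos by simp
  have q1': "(of_nat (CARD('a) - 1) :: complex) = of_nat CARD('a) - 1" using card_field_gt_1[where 'a='a] by (simp add: of_nat_diff)
  define Ew where "Ew w = {u \<in> E. (\<Sum>i=1..n. u i) = of_nat n * \<psi> * w}" for w
  have step1: "tor a = (\<Sum>w\<in>UNIV-{0}. \<Sum>u\<in>Ew w. if w ^ n = (\<Prod>i=1..n. u i) then (\<Prod>i=1..n. rho (int (a i) * int t) (u i)) else 0)"
  proof -
    have "tor a = (\<Sum>(w, u)\<in>(SIGMA w:UNIV-{0}. {u \<in> Ew w. w ^ n = (\<Prod>i=1..n. u i)}). \<Prod>i=1..n. rho (int (a i) * int t) (u i))"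
      unfolding tor_def
      by (rule sum.reindex_bij_witness[of _ "\<lambda>(w, u). (u, w)" "\<lambda>(u, w). (w, u)"]) (auto simp: Ew_def E_def)
    also have "\<dots> = (\<Sum>w\<in>UNIV-{0}. \<Sum>u\<in>{u \<in> Ew w. w ^ n = (\<Prod>i=1..n. u i)}. \<Prod>i=1..n. rho (int (a i) * int t) (u i))"
      by (rule sum.Sigma[symmetric]) (auto simp: Ew_def finE)
    also have "\<dots> = (\<Sum>w\<in>UNIV-{0}. \<Sum>u\<in>Ew w. if w ^ n = (\<Prod>i=1..n. u i) then (\<Prod>i=1..n. rho (int (a i) * int t) (u i)) else 0)"
      by (intro sum.cong refl sum.inter_filter) (auto simp: Ew_def finE)
    finally show ?thesis .
  qed
  \<comment> \<open>Orthogonality over all characters k of the quotient of the product of the u i by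
    \<open>w ^ n\<close>.\<close>
  have step2: "(of_nat CARD('a) - 1) * (if w ^ n = (\<Prod>i=1..n. u i) then (\<Prod>i=1..n. rho (int (a i) * int t) (u i)) else 0)
     = (\<Sum>k<CARD('a) - 1. rho (- (int n * int k)) w * (\<Prod>i=1..n. rho (int k + int (a i) * int t) (u i)))"
    if w: "w \<noteq> 0" for w :: 'a and u
  proof -
    have "(\<Sum>k<CARD('a) - 1. rho (- (int n * int k)) w * (\<Prod>i=1..n. rho (int k + int (a i) * int t) (u i)))
      = (\<Sum>k<CARD('a) - 1. rho (int k) ((\<Prod>i=1..n. u i) / w ^ n)) * (\<Prod>i=1..n. rho (int (a i) * int t) (u i))"
      unfolding sum_distrib_right
    proof (rule sum.cong[OF refl])
      fix k
      have "rho (int k) ((\<Prod>i=1..n. u i) / w ^ n) = (\<Prod>i=1..n. rho (int k) (u i)) * rho (- (int n * int k)) w"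
        using w by (simp add: divide_inverse rho_mult rho_inverse rho_power rho_prod)
      thus "rho (- (int n * int k)) w * (\<Prod>i=1..n. rho (int k + int (a i) * int t) (u i)) =
        rho (int k) ((\<Prod>i=1..n. u i) / w ^ n) * (\<Prod>i=1..n. rho (int (a i) * int t) (u i))"
        by (simp add: rho_add prod.distrib mult_ac)
    qed
    also have "\<dots> = (of_nat CARD('a) - 1) * (if w ^ n = (\<Prod>i=1..n. u i) then (\<Prod>i=1..n. rho (int (a i) * int t) (u i)) else 0)"
    proof (cases "(\<Prod>i=1..n. u i) = 0")
      case True
      hence "(\<Prod>i=1..n. rho (int (a i) * int t) (u i)) = 0" by (auto simp: prod_zero_iff)
      thus ?thesis by simp
    next
      case False
      hence "(\<Prod>i=1..n. u i) / w ^ n \<noteq> 0" using w by simp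
      from rho_sum_index_eq[OF this]
      have s: "(\<Sum>k<CARD('a) - 1. rho (int k) ((\<Prod>i=1..n. u i) / w ^ n)) = (if (\<Prod>i=1..n. u i) / w ^ n = 1 then of_nat CARD('a) - 1 else 0)" .
      have e: "(\<Prod>i=1..n. u i) / w ^ n = 1 \<longleftrightarrow> w ^ n = (\<Prod>i=1..n. u i)"
        using w by (metis divide_eq_1_iff power_not_zero)
      show ?thesis unfolding s e
        by (simp only: if_distrib[of "\<lambda>x. x * _"] if_distrib[of "\<lambda>x. _ * x"] mult_zero_left mult_zero_right cong: if_cong)
    qed
    finally show ?thesis by simp
  qed
  have inner: "of_nat CARD('a) * (\<Sum>u\<in>Ew w. \<Prod>i=1..n. rho (k + int (a i) * int t) (u i)) =
     P k * (rho (\<sigma> k) (- (of_nat n * \<psi> * w)) * gs (- \<sigma> k))" if w: "w \<noteq> 0" for w k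
  proof -
    have "of_nat n * \<psi> * w \<noteq> 0" using nz w by simp
    thus ?thesis
      using sum_constrained_rho[OF finite_atLeastAtMost nonconst_index[OF a], of k "of_nat n * \<psi> * w"]
      unfolding sum_idx_t Ew_def E_def P_def gs_def \<sigma>_def
      by (simp only: if_False times_divide_eq_right nonzero_mult_div_cancel_left[OF q_nonzero] mem_Collect_eq)
  qed
  have "of_nat CARD('a) * ((of_nat CARD('a) - 1) * tor a) = (\<Sum>w\<in>UNIV-{0}. \<Sum>u\<in>Ew w. \<Sum>k<CARD('a) - 1. rho (- (int n * int k)) w * (of_nat CARD('a) * (\<Prod>i=1..n. rho (int k + int (a i) * int t) (u i))))"
  proof -
    have "(of_nat CARD('a) - 1) * tor a = (\<Sum>w\<in>UNIV-{0}. \<Sum>u\<in>Ew w. \<Sum>k<CARD('a) - 1. rho (- (int n * int k)) w * (\<Prod>i=1..n. rho (int k + int (a i) * int t) (u i)))"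
      unfolding step1 sum_distrib_left by (intro sum.cong refl step2) simp
    thus ?thesis by (simp add: sum_distrib_left mult_ac)
  qed
  also have "\<dots> = (\<Sum>w\<in>UNIV-{0}. \<Sum>k<CARD('a) - 1. rho (- (int n * int k)) w * (of_nat CARD('a) * (\<Sum>u\<in>Ew w. \<Prod>i=1..n. rho (int k + int (a i) * int t) (u i))))"
    by (rule sum.cong[OF refl], subst sum.swap) (simp add: sum_distrib_left)
  also have "\<dots> = (\<Sum>w\<in>UNIV-{0}. \<Sum>k<CARD('a) - 1. rho (int (\<Sum>i=1..n. a i) * int t) (w::'a) * (P (int k) * rho (\<sigma> (int k)) (- (of_nat n * \<psi>)) * gs (- \<sigma> (int k))))"
  proof (rule sum.cong[OF refl], rule sum.cong[OF refl])
    fix w :: 'a and k assume "w \<in> UNIV - {0}"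
    hence w: "w \<noteq> 0" by simp
    have "- (of_nat n * \<psi> * w) = - (of_nat n * \<psi>) * w" by simp
    hence "rho (\<sigma> (int k)) (- (of_nat n * \<psi> * w)) = rho (\<sigma> (int k)) (- (of_nat n * \<psi>)) * (rho (int n * int k) w * rho (int (\<Sum>i=1..n. a i) * int t) w)"
      by (simp only: rho_mult \<sigma>_def rho_add)
    moreover have "rho (- (int n * int k)) w * rho (int n * int k) w = 1" using w by (simp add: rho_minus)
    ultimately show "rho (- (int n * int k)) w * (of_nat CARD('a) * (\<Sum>u\<in>Ew w. \<Prod>i=1..n. rho (int k + int (a i) * int t) (u i))) =
       rho (int (\<Sum>i=1..n. a i) * int t) w * (P (int k) * rho (\<sigma> (int k)) (- (of_nat n * \<psi>)) * gs (- \<sigma> (int k)))"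
      unfolding inner[OF w] by (simp add: mult_ac)
  qed
  \<comment> \<open>After the u i have been summed, w remains only in the character of index t times
    the sum of a, so the sum over w vanishes unless n divides that sum.\<close>
  also have "\<dots> = (\<Sum>w\<in>UNIV. rho (int (\<Sum>i=1..n. a i) * int t) (w::'a)) * (\<Sum>k<CARD('a) - 1. P (int k) * rho (\<sigma> (int k)) (- (of_nat n * \<psi>)) * gs (- \<sigma> (int k)))"
  proof -
    have e: "(\<Sum>w\<in>UNIV. rho (int (\<Sum>i=1..n. a i) * int t) (w::'a)) = (\<Sum>w\<in>UNIV-{0}. rho (int (\<Sum>i=1..n. a i) * int t) (w::'a))"
      by (rule sum.mono_neutral_right) auto
    show ?thesis unfolding e by (rule sum_product[symmetric])
  qed
  also have "(\<Sum>w\<in>UNIV. rho (int (\<Sum>i=1..n. a i) * int t) (w::'a)) = (if n dvd (\<Sum>i=1..n. a i) then of_nat CARD('a) - 1 else 0)"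
    using rho_sum_trivial[of "int (\<Sum>i=1..n. a i) * int t", where 'a='a] rho_sum_eq_0[of "int (\<Sum>i=1..n. a i) * int t", where 'a='a]
    unfolding dvd_mult_t int_dvd_int_iff by simp
  finally have main: "of_nat CARD('a) * tor a = (if n dvd (\<Sum>i=1..n. a i) then (\<Sum>k<CARD('a) - 1. P (int k) * rho (\<sigma> (int k)) (- (of_nat n * \<psi>)) * gs (- \<sigma> (int k))) else 0)"
    using q1 unfolding q1' by (auto split: if_splits)
  show ?thesis
  proof (cases "n dvd (\<Sum>i=1..n. a i)")
    case False
    thus ?thesis using main q_nonzero by simp
  next
    case True
    \<comment> \<open>The power of q is the constant of \<open>gauss_product\<close>, and so is the
      character at n: both are absorbed when the Gauss sum of index - n k is replaced by n Gauss
      sums.\<close>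
    have termeq: "of_nat CARD('a) ^ ((n - 1) div 2) * (P (int k) * rho (\<sigma> (int k)) (- (of_nat n * \<psi>)) * gs (- \<sigma> (int k))) = trm a (int k)" for k
    proof -
      have c: "[\<sigma> (int k) = int n * int k] (mod int (CARD('a) - 1))"
      proof -
        have "int (CARD('a) - 1) dvd int (\<Sum>i=1..n. a i) * int t" unfolding dvd_mult_t int_dvd_int_iff by (rule True)
        thus ?thesis by (simp only: \<sigma>_def cong_iff_dvd_diff add_diff_cancel_left')
      qed
      hence "gs (- \<sigma> (int k)) = gs (- (int n * int k))" by (intro gs_cong) (simp only: cong_minus_minus_iff)
      moreover have "rho (\<sigma> (int k)) (- (of_nat n * \<psi>)) = rho (int n * int k) (of_nat n :: 'a) * (rho (int k) (-1 :: 'a) * rho (int k) (\<psi> ^ n))"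
      proof -
        have "rho (\<sigma> (int k)) (- (of_nat n * \<psi>)) = rho (int n * int k) (of_nat n * ((-1) * \<psi>))"
          unfolding rho_cong[OF c] by simp
        also have "rho (int n * int k) (of_nat n * ((-1) * \<psi>)) = rho (int n * int k) (of_nat n :: 'a) * (rho (int n * int k) (-1::'a) * rho (int n * int k) \<psi>)"
          by (simp only: rho_mult)
        also have "rho (int n * int k) (-1::'a) = rho (int k) ((-1 :: 'a) ^ n)" by (rule rho_power[symmetric]) simp
        also have "(-1 :: 'a) ^ n = -1" using oddn by simp
        also have "rho (int n * int k) \<psi> = rho (int k) (\<psi> ^ n)" by (rule rho_power[symmetric, OF \<psi>0])
        finally show ?thesis .
      qed
      ultimately show ?thesis unfolding trm_def gauss_product P_def by (simp only: mult_ac)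
    qed
    have "of_nat CARD('a) * of_nat CARD('a) ^ ((n - 1) div 2) * tor a = of_nat CARD('a) ^ ((n - 1) div 2) * (of_nat CARD('a) * tor a)" by (simp only: mult_ac)
    also have "\<dots> = (\<Sum>k<CARD('a) - 1. trm a (int k))" unfolding main by (simp only: True if_True sum_distrib_left termeq)
    finally show ?thesis using True by simp
  qed
qed

section \<open>Boundary corrections and isotypic parts\<close>

definition shift :: "nat \<Rightarrow> (nat \<Rightarrow> nat) \<Rightarrow> nat \<Rightarrow> nat" where
  "shift c a = (\<lambda>i\<in>{1..n}. (a i + c) mod n)"

definition bdry :: "(nat \<Rightarrow> nat) \<Rightarrow> complex" where
  "bdry a = (if \<exists>i\<in>{1..n}. a i = 0 then jac a else 0)"

text \<open>The boundary contributions of all the shifts of \<open>a\<close> by a constant are collected because these shifts are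
  the reparametrisations \<open>k \<mapsto> k + c t\<close> of the sum over characters: they only change the summands in which
  a Gauss sum is degenerate.\<close>

definition isotypic :: "(nat \<Rightarrow> nat) \<Rightarrow> complex" where
  "isotypic a = tor a - (\<Sum>c<n. bdry (shift c a))"

text \<open>At k = c t the character n k is trivial. Its Gauss sum is -1 and the characters at n and
  \<psi> disappear, so the second product of \<open>trm\<close> is a pure power of q up to
  sign.\<close>

lemma trm_exceptional:
  "trm a (int c * int t) = - (of_nat CARD('a) ^ ((n - 1) div 2)) * (\<Prod>i=1..n. gs (int ((a i + c) mod n) * int t))"
proof -
  have d: "int (CARD('a) - 1) dvd int n * (int c * int t)"
  proof -
    have "int n * (int c * int t) = (int n * int c) * int t" by simp
    thus ?thesis by (simp only: dvd_mult_t dvd_triv_left)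
  qed
  hence triv: "rho (int n * (int c * int t)) x = 1" if "x \<noteq> 0" for x :: 'a
    using rho_cong[of "int n * (int c * int t)" 0 x] that by (simp add: cong_0_iff rho_trivial del: of_nat_diff)
  have "gs (- (int n * (int c * int t))) = -1" by (rule gs_trivial) (use d in \<open>simp only: dvd_minus_iff\<close>)
  moreover have "rho (int c * int t) (\<psi> ^ n) = 1" using rho_power[OF \<psi>0, of "int c * int t" n] triv[OF \<psi>0] by simp
  moreover have "gs (int c * int t + int (a i) * int t) = gs (int ((a i + c) mod n) * int t)" for i
  proof (rule gs_cong)
    have "[int (a i + c) = int ((a i + c) mod n)] (mod int n)" by (simp add: zmod_int)
    hence "[int (a i + c) * int t = int ((a i + c) mod n) * int t] (mod int (CARD('a) - 1))" by (rule cong_mult_t)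
    thus "[int c * int t + int (a i) * int t = int ((a i + c) mod n) * int t] (mod int (CARD('a) - 1))"
      by (simp only: of_nat_add distrib_right add.commute)
  qed
  ultimately show ?thesis
    unfolding trm_def gauss_product using rho_m1 triv[OF of_nat_divisor_nonzero[OF nt]] by simp
qed

lemma shift_mod: "[(\<Sum>i=1..n. shift c a i) = (\<Sum>i=1..n. a i)] (mod n)"
proof -
  have "[(\<Sum>i=1..n. shift c a i) = (\<Sum>i=1..n. a i + c)] (mod n)"
    by (rule cong_sum) (auto simp: shift_def)
  also have "(\<Sum>i=1..n. a i + c) = (\<Sum>i=1..n. a i) + n * c" by (simp add: sum.distrib)
  finally show ?thesis by (simp add: Cong.cong_def)
qed

text \<open>Each boundary term is 1 - q times a summand of the torus sum, taken at an index k = c t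
  for which some Gauss sum in the first product is trivial. Subtracting it raises the weight of this
  summand from 1 to q. That is just what makes up for the trivial pair in
  \<open>diagonal_part\<close>.\<close>

lemma isotypic_eq:
  assumes a: "a \<in> idx - const_idx"
  shows "of_nat CARD('a) * of_nat CARD('a) ^ ((n - 1) div 2) * isotypic a = (if n dvd (\<Sum>i=1..n. a i) then
    (\<Sum>k<CARD('a) - 1. trm a (int k) * (if \<exists>i\<in>{1..n}. int (CARD('a) - 1) dvd int k + int (a i) * int t then of_nat CARD('a) else 1)) else 0)"
proof -
  define C :: complex where "C = of_nat CARD('a) ^ ((n - 1) div 2)"
  \<comment> \<open>The shifts after which some entry becomes 0; under c |-> c t they are the
    indices k with a trivial Gauss sum in the first product.\<close>
  define Z where "Z = {c. c < n \<and> (\<exists>i\<in>{1..n}. (a i + c) mod n = 0)}"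
  have nd: "\<exists>i\<in>{1..n}. \<not> n dvd shift c a i" for c
  proof -
    obtain i where i: "i \<in> {1..n}" "\<not> int (CARD('a) - 1) dvd int c * int t + int (a i) * int t"
      using nonconst_index[OF a] by blast
    have "\<not> int n dvd int c + int (a i)"
      using i(2) unfolding distrib_right[symmetric] dvd_mult_t .
    hence "\<not> n dvd a i + c" by (metis add.commute int_dvd_int_iff of_nat_add)
    thus ?thesis using i(1) by (intro bexI[of _ i]) (auto simp: shift_def mod_eq_0_iff_dvd dvd_mod_iff)
  qed
  have b: "of_nat CARD('a) * C * bdry (shift c a) = (if n dvd (\<Sum>i=1..n. a i) \<and> c \<in> Z then - ((of_nat CARD('a) - 1) * trm a (int c * int t)) else 0)" if c: "c < n" for c
  proof (cases "c \<in> Z")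
    case True
    hence "bdry (shift c a) = jac (shift c a)" by (auto simp: bdry_def Z_def shift_def)
    hence "of_nat CARD('a) * C * bdry (shift c a) = C * (of_nat CARD('a) * jac (shift c a))" by simp
    also have "\<dots> = C * (if n dvd (\<Sum>i=1..n. shift c a i) then (of_nat CARD('a) - 1) * (\<Prod>i=1..n. gs (int (shift c a i) * int t)) else 0)"
      by (simp only: jac_eq[OF nd])
    also have "n dvd (\<Sum>i=1..n. shift c a i) \<longleftrightarrow> n dvd (\<Sum>i=1..n. a i)" by (rule cong_dvd_iff[OF shift_mod])
    also have "(\<Prod>i=1..n. gs (int (shift c a i) * int t)) = (\<Prod>i=1..n. gs (int ((a i + c) mod n) * int t))"
      by (rule prod.cong) (auto simp: shift_def)
    finally show ?thesis using True by (cases "n dvd (\<Sum>i=1..n. a i)") (simp_all add: trm_exceptional C_def)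
  next
    case False
    hence "bdry (shift c a) = 0" using c by (auto simp: bdry_def Z_def shift_def)
    thus ?thesis using False by simp
  qed
  have main: "of_nat CARD('a) * C * isotypic a = of_nat CARD('a) * C * tor a - (\<Sum>c<n. of_nat CARD('a) * C * bdry (shift c a))"
    by (simp add: isotypic_def right_diff_distrib sum_distrib_left)
  show ?thesis
  proof (cases "n dvd (\<Sum>i=1..n. a i)")
    case False
    have "(\<Sum>c<n. of_nat CARD('a) * C * bdry (shift c a)) = 0"
      by (intro sum.neutral ballI) (simp only: b False lessThan_iff simp_thms if_False)
    thus ?thesis using main tor_eq[OF a] False by (simp add: C_def)
  next
    case True
    define \<delta> where "\<delta> k = (\<exists>i\<in>{1..n}. int (CARD('a) - 1) dvd int k + int (a i) * int t)" for k
    have "(\<Sum>c<n. of_nat CARD('a) * C * bdry (shift c a)) = (\<Sum>c<n. if c \<in> Z then - ((of_nat CARD('a) - 1) * trm a (int c * int t)) else 0)"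
      by (intro sum.cong refl) (simp only: b True lessThan_iff simp_thms)
    also have "\<dots> = (\<Sum>c\<in>Z. - ((of_nat CARD('a) - 1) * trm a (int c * int t)))"
    proof -
      have "{c \<in> {..<n}. c \<in> Z} = Z" by (auto simp: Z_def)
      thus ?thesis by (simp only: sum.inter_filter[OF finite_lessThan, symmetric])
    qed
    also have "\<dots> = (\<Sum>k\<in>{k. k < CARD('a) - 1 \<and> \<delta> k}. - ((of_nat CARD('a) - 1) * trm a (int k)))"
    proof (rule sum.reindex_bij_witness[of _ "\<lambda>k. k div t" "\<lambda>c. c * t"], goal_cases)
      case (1 c)
      thus ?case using t_pos by simp
    next
      case (2 c)
      then obtain i where i: "i \<in> {1..n}" "n dvd a i + c" and c: "c < n" by (auto simp: Z_def mod_eq_0_iff_dvd)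
      have "int (CARD('a) - 1) dvd int (c * t) + int (a i) * int t"
      proof -
        have "int (c * t) + int (a i) * int t = int (a i + c) * int t" by (simp add: algebra_simps)
        thus ?thesis using i(2) by (simp only: dvd_mult_t int_dvd_int_iff)
      qed
      moreover have "c * t < CARD('a) - 1" unfolding nt[symmetric] using c t_pos by simp
      ultimately show ?case using i(1) by (auto simp: \<delta>_def)
    next
      case (3 k)
      then obtain i where i: "i \<in> {1..n}" "int (CARD('a) - 1) dvd int k + int (a i) * int t" by (auto simp: \<delta>_def)
      have "int t dvd int k + int (a i) * int t" using i(2) unfolding nt[symmetric] by (rule dvd_trans[rotated]) simp
      hence "t dvd k" by (simp add: dvd_add_left_iff)
      thus ?case by simp
    next
      case (4 k)
      then obtain i where i: "i \<in> {1..n}" "int (CARD('a) - 1) dvd int k + int (a i) * int t" and k: "k < CARD('a) - 1"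
        by (auto simp: \<delta>_def)
      have "int t dvd int k + int (a i) * int t" using i(2) unfolding nt[symmetric] by (rule dvd_trans[rotated]) simp
      hence "t dvd k" by (simp add: dvd_add_left_iff)
      then obtain c where c: "k = c * t" by (metis dvdE mult.commute)
      have "int k + int (a i) * int t = int (a i + c) * int t" by (simp add: c algebra_simps)
      hence "n dvd a i + c" using i(2) by (simp only: dvd_mult_t int_dvd_int_iff)
      moreover have "c < n" using k unfolding c nt[symmetric] by simp
      ultimately show ?case using i(1) t_pos by (auto simp: Z_def c mod_eq_0_iff_dvd)
    next
      case (5 c)
      show ?case by simp
    qed
    also have "\<dots> = (\<Sum>k<CARD('a) - 1. if \<delta> k then - ((of_nat CARD('a) - 1) * trm a (int k)) else 0)"
      by (subst sum.inter_filter[symmetric]) (auto intro: sum.cong)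
    finally have "of_nat CARD('a) * C * isotypic a = (\<Sum>k<CARD('a) - 1. trm a (int k)) - (\<Sum>k<CARD('a) - 1. if \<delta> k then - ((of_nat CARD('a) - 1) * trm a (int k)) else 0)"
      using main tor_eq[OF a] True by (simp add: C_def)
    also have "\<dots> = (\<Sum>k<CARD('a) - 1. trm a (int k) * (if \<delta> k then of_nat CARD('a) else 1))"
      unfolding sum_subtractf[symmetric] by (intro sum.cong refl) (auto simp: algebra_simps)
    finally show ?thesis using True by (simp add: C_def \<delta>_def)
  qed
qed

text \<open>The factor q - 1 passes from projective points to cones, and n comes from
  \<open>torus_count\<close>. On the boundary n is matched by the n shifts, each of which permutes
  the non-constant families.\<close>

lemma count_difference:
  "of_nat n * ((of_nat CARD('a) - 1) * (of_nat (card (dwork_points n \<psi>)) - of_nat (card (mirror_points n \<psi>)))) =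
    (\<Sum>a\<in>idx - const_idx. isotypic a)"
proof -
  define E where "E = {1..n} \<rightarrow>\<^sub>E (UNIV :: 'a set)"
  have finE: "finite E" by (simp add: E_def finite_PiE)
  have EA: "affine_space n = E" by (simp add: E_def affine_space_def)
  have finI: "finite (idx - const_idx)" by (simp add: idx_def finite_PiE)
  define z where "z = (\<lambda>i\<in>{1..n}. 0 :: 'a)"
  have zE: "z \<in> E" by (simp add: z_def E_def)
  have nz: "nonzero_vectors n = E - {z}"
    unfolding nonzero_vectors_def EA by (auto simp: z_def E_def PiE_def extensional_def fun_eq_iff)
  have z0: "(\<Sum>i=1..n. z i) = 0" "(\<Prod>i=1..n. z i) = 0" "(\<Sum>i=1..n. z i ^ n) = 0"
    using n_pos by (auto simp: z_def zero_power prod_zero_iff)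
  define X0 where "X0 = {x \<in> E. (\<Sum>i=1..n. x i ^ n) = 0 \<and> (\<Prod>i=1..n. x i) = 0}"
  define X1 where "X1 = {x \<in> E. (\<Sum>i=1..n. x i ^ n) = of_nat n * \<psi> * (\<Prod>i=1..n. x i) \<and> (\<Prod>i=1..n. x i) \<noteq> 0}"
  define Y0 where "Y0 = {u \<in> E. (\<Sum>i=1..n. u i) = 0 \<and> (\<Prod>i=1..n. u i) = 0}"
  define Y1 where "Y1 = {(u, w). u \<in> E \<and> w \<noteq> 0 \<and> w ^ n = (\<Prod>i=1..n. u i) \<and> (\<Sum>i=1..n. u i) = of_nat n * \<psi> * w}"
  have finX: "finite X0" "finite X1" "finite Y0" using finE by (auto simp: X0_def X1_def Y0_def)
  have finY1: "finite Y1" by (rule finite_subset[of _ "E \<times> UNIV"]) (auto simp: Y1_def finE)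
  \<comment> \<open>The origin is added to both cones, so the two extra points cancel in the
    difference.\<close>
  have "insert z (cone n \<psi>) = X0 \<union> X1"
    unfolding cone_def nz using zE z0 by (auto simp: X0_def X1_def dwork_form_def)
  moreover have "z \<notin> cone n \<psi>" by (simp add: cone_def nz)
  moreover have "X0 \<inter> X1 = {}" by (auto simp: X0_def X1_def)
  moreover have fc: "finite (cone n \<psi>)" by (rule finite_subset[of _ E]) (auto simp: cone_def nz finE)
  ultimately have A: "card (cone n \<psi>) + 1 = card X0 + card X1"
    using card_Un_disjoint[OF finX(1,2)] by (metis Suc_eq_plus1 card_insert_disjoint)
  have "insert (z, 0) (mirror_cone n \<psi>) = (\<lambda>u. (u, 0)) ` Y0 \<union> Y1"
  proof (intro equalityI subsetI)
    fix p assume "p \<in> insert (z, 0) (mirror_cone n \<psi>)"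
    thus "p \<in> (\<lambda>u. (u, 0)) ` Y0 \<union> Y1"
      using zE z0 n_pos by (cases "snd p = 0") (auto simp: Y0_def Y1_def mirror_cone_def nz zero_power)
  next
    fix p assume p: "p \<in> (\<lambda>u. (u, 0)) ` Y0 \<union> Y1"
    show "p \<in> insert (z, 0) (mirror_cone n \<psi>)"
    proof (cases "p \<in> Y1")
      case True
      then obtain u w where uw: "p = (u, w)" "u \<in> E" "w \<noteq> 0" "w ^ n = (\<Prod>i=1..n. u i)" "(\<Sum>i=1..n. u i) = of_nat n * \<psi> * w"
        by (auto simp: Y1_def)
      have "u \<noteq> z"
      proof
        assume "u = z"
        hence "w ^ n = 0" using uw(4) z0(2) by simp
        thus False using uw(3) by simp
      qed
      thus ?thesis using uw by (auto simp: mirror_cone_def nz)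
    next
      case False
      then obtain u where "p = (u, 0)" "u \<in> Y0" using p by blast
      thus ?thesis using n_pos by (auto simp: Y0_def mirror_cone_def nz zero_power)
    qed
  qed
  moreover have "(z, 0) \<notin> mirror_cone n \<psi>" by (simp add: mirror_cone_def nz)
  moreover have "(\<lambda>u. (u, 0)) ` Y0 \<inter> Y1 = {}" by (auto simp: Y1_def)
  moreover have "card ((\<lambda>u. (u, 0::'a)) ` Y0) = card Y0" by (rule card_image) (auto simp: inj_on_def)
  moreover have "finite (mirror_cone n \<psi>)" by (rule finite_subset[of _ "E \<times> UNIV"]) (auto simp: mirror_cone_def nz finE)
  ultimately have B: "card (mirror_cone n \<psi>) + 1 = card Y0 + card Y1"
    using card_Un_disjoint[of "(\<lambda>u. (u, 0)) ` Y0" Y1] finX(3) finY1 by (metis Suc_eq_plus1 card_insert_disjoint finite_imageI)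
  have q1': "(of_nat (CARD('a) - 1) :: complex) = of_nat CARD('a) - 1" using card_field_gt_1[where 'a='a] by (simp add: of_nat_diff)
  have "(of_nat CARD('a) - 1) * (of_nat (card (dwork_points n \<psi>)) - of_nat (card (mirror_points n \<psi>))) =
     (of_nat (card (cone n \<psi>)) :: complex) - of_nat (card (mirror_cone n \<psi>))"
    unfolding card_cone card_mirror_cone[OF nt] of_nat_mult q1' by (simp add: right_diff_distrib)
  also have "\<dots> = (of_nat (card X0) - of_nat (card Y0)) + (of_nat (card X1) - of_nat (card Y1))"
  proof -
    have "(of_nat (card (cone n \<psi>)) :: complex) = of_nat (card X0) + of_nat (card X1) - 1"
      using A by (metis add_diff_cancel_right' of_nat_1 of_nat_add)
    moreover have "(of_nat (card (mirror_cone n \<psi>)) :: complex) = of_nat (card Y0) + of_nat (card Y1) - 1"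
      using B by (metis add_diff_cancel_right' of_nat_1 of_nat_add)
    ultimately show ?thesis by simp
  qed
  also have "of_nat (card X0) - of_nat (card Y0) = - (\<Sum>a\<in>idx - const_idx. bdry a)"
    unfolding X0_def Y0_def E_def bdry_def by (rule boundary_count)
  finally have E: "(of_nat CARD('a) - 1) * (of_nat (card (dwork_points n \<psi>)) - of_nat (card (mirror_points n \<psi>))) =
    - (\<Sum>a\<in>idx - const_idx. bdry a) + (of_nat (card X1) - of_nat (card Y1))" .
  have "of_nat n * ((of_nat CARD('a) - 1) * (of_nat (card (dwork_points n \<psi>)) - of_nat (card (mirror_points n \<psi>)))) =
     of_nat n * (of_nat (card X1) - of_nat (card Y1)) - of_nat n * (\<Sum>a\<in>idx - const_idx. bdry a)"
    unfolding E by (simp add: algebra_simps)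
  also have "of_nat n * (of_nat (card X1) - of_nat (card Y1)) = (\<Sum>a\<in>idx - const_idx. tor a)"
    unfolding X1_def Y1_def E_def by (rule torus_count)
  also have "of_nat n * (\<Sum>a\<in>idx - const_idx. bdry a) = (\<Sum>a\<in>idx - const_idx. \<Sum>c<n. bdry (shift c a))"
  proof -
    have sh: "(\<Sum>a\<in>idx - const_idx. bdry (shift c a)) = (\<Sum>a\<in>idx - const_idx. bdry a)" if c: "c < n" for c
    proof -
      have inv: "shift c' (shift c a) = a" if "a \<in> idx" "c + c' = n" for a c c'
      proof
        fix i show "shift c' (shift c a) i = a i"
        proof (cases "i \<in> {1..n}")
          case True
          have "a i < n" using that True by (auto simp: idx_def)
          moreover have "((a i + c) mod n + c') mod n = (a i + n) mod n" by (simp add: mod_add_left_eq add.assoc that(2))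
          ultimately show ?thesis using True by (simp add: shift_def)
        next
          case False
          thus ?thesis using that(1) by (auto simp: shift_def idx_def)
        qed
      qed
      have mem: "shift c a \<in> idx" for c a using n_pos by (auto simp: shift_def idx_def)
      have cst: "shift c' a \<in> const_idx" if ac: "a \<in> const_idx" for a c'
      proof -
        obtain e where "a = (\<lambda>i\<in>{1..n}. e)" using ac by (auto simp: const_idx_def)
        hence "shift c' a = (\<lambda>i\<in>{1..n}. (e + c') mod n)" by (auto simp: shift_def)
        thus ?thesis using n_pos by (auto simp: const_idx_def)
      qed
      have cc: "c + (n - c) = n" "(n - c) + c = n" using c by auto
      show ?thesis
      proof (rule sum.reindex_bij_witness[of _ "shift (n - c)" "shift c"], goal_cases)
        case (1 a) thus ?case using inv[OF _ cc(1)] by blast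
      next
        case (2 a)
        hence "shift (n - c) (shift c a) = a" using inv[OF _ cc(1)] by blast
        thus ?case using 2 mem cst by (metis DiffD2 DiffI)
      next
        case (3 a) thus ?case using inv[OF _ cc(2)] by blast
      next
        case (4 a)
        hence "shift c (shift (n - c) a) = a" using inv[OF _ cc(2)] by blast
        thus ?case using 4 mem cst by (metis DiffD2 DiffI)
      qed simp
    qed
    have "(\<Sum>a\<in>idx - const_idx. \<Sum>c<n. bdry (shift c a)) = (\<Sum>c<n. \<Sum>a\<in>idx - const_idx. bdry (shift c a))"
      by (rule sum.swap)
    also have "\<dots> = (\<Sum>c<n. \<Sum>a\<in>idx - const_idx. bdry a)" by (rule sum.cong[OF refl]) (simp add: sh)
    finally show ?thesis by simp
  qed
  finally show ?thesis by (simp add: isotypic_def sum_subtractf)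
qed

end

section \<open>Points of the varieties of hypergeometric type\<close>

context dwork
begin

definition cover :: "nat \<Rightarrow> nat \<Rightarrow> (nat \<Rightarrow> nat) \<Rightarrow> (nat \<Rightarrow> nat) \<Rightarrow> (nat \<Rightarrow> 'a) \<Rightarrow> 'a" where
  "cover d l \<alpha> \<beta> x = (\<Prod>i=1..d+1. x i ^ \<alpha> i) * (\<Prod>j=1..l-1. (1 - x j) ^ \<beta> j) * (1 - (\<Sum>i=l..d+1. x i)) ^ \<beta> l"

definition base :: "nat \<Rightarrow> nat \<Rightarrow> (nat \<Rightarrow> 'a) set" where
  "base d l = {x \<in> {1..d+1} \<rightarrow>\<^sub>E UNIV. (\<Prod>i=1..l. x i) = \<psi> ^ n}"

text \<open>Solving for x l leaves l - 1 nonzero and d + 1 - l arbitrary coordinates. This is the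
  number subtracted in \<open>H_term\<close>.\<close>

lemma card_base:
  assumes l: "1 \<le> l" "l \<le> d + 1"
  shows "card (base d l) = (CARD('a) - 1) ^ (l - 1) * CARD('a) ^ (d + 1 - l)"
proof -
  define I where "I = {1..d+1} - {l}"
  define B where "B i = (if i < l then UNIV - {0} else UNIV :: 'a set)" for i
  have split: "(\<Prod>i=1..l. x i) = x l * (\<Prod>i\<in>{1..<l}. x i)" for x :: "nat \<Rightarrow> 'a"
  proof -
    have "{1..l} = insert l {1..<l}" using l by auto
    thus ?thesis by simp
  qed
  have upd: "(\<Prod>i\<in>{1..<l}. (x(l := y)) i) = (\<Prod>i\<in>{1..<l}. x i)" for x :: "nat \<Rightarrow> 'a" and y
    by (rule prod.cong) auto
  have \<psi>n: "\<psi> ^ n \<noteq> 0" using \<psi>0 by simp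
  have "bij_betw (\<lambda>x. x(l := undefined)) (base d l) (PiE I B)"
  proof (rule bij_betw_byWitness[of _ "\<lambda>y. y(l := \<psi> ^ n / (\<Prod>i\<in>{1..<l}. y i))"])
    show "\<forall>x\<in>base d l. (x(l := undefined))(l := \<psi> ^ n / (\<Prod>i\<in>{1..<l}. (x(l := undefined)) i)) = x"
    proof
      fix x assume "x \<in> base d l"
      hence e: "x l * (\<Prod>i\<in>{1..<l}. x i) = \<psi> ^ n" unfolding base_def split by simp
      hence "(\<Prod>i\<in>{1..<l}. x i) \<noteq> 0" using \<psi>n by (metis mult_zero_right)
      hence "\<psi> ^ n / (\<Prod>i\<in>{1..<l}. x i) = x l" using e by (metis nonzero_mult_div_cancel_right)
      thus "(x(l := undefined))(l := \<psi> ^ n / (\<Prod>i\<in>{1..<l}. (x(l := undefined)) i)) = x"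
        unfolding upd by simp
    qed
    show "\<forall>y\<in>PiE I B. (y(l := \<psi> ^ n / (\<Prod>i\<in>{1..<l}. y i)))(l := undefined) = y"
      by (auto simp: I_def PiE_def extensional_def fun_eq_iff)
    show "(\<lambda>x. x(l := undefined)) ` base d l \<subseteq> PiE I B"
    proof
      fix y assume "y \<in> (\<lambda>x. x(l := undefined)) ` base d l"
      then obtain x where x: "x \<in> base d l" and y: "y = x(l := undefined)" by blast
      have "(\<Prod>i=1..l. x i) \<noteq> 0" using x \<psi>n by (simp add: base_def)
      hence "x i \<noteq> 0" if "1 \<le> i" "i < l" for i using that by (auto simp: prod_zero_iff)
      thus "y \<in> PiE I B" using x unfolding y by (auto simp: base_def I_def B_def PiE_def extensional_def)
    qed
    show "(\<lambda>y. y(l := \<psi> ^ n / (\<Prod>i\<in>{1..<l}. y i))) ` PiE I B \<subseteq> base d l"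
    proof
      fix x assume "x \<in> (\<lambda>y. y(l := \<psi> ^ n / (\<Prod>i\<in>{1..<l}. y i))) ` PiE I B"
      then obtain y where y: "y \<in> PiE I B" and x: "x = y(l := \<psi> ^ n / (\<Prod>i\<in>{1..<l}. y i))" by blast
      have "y i \<noteq> 0" if "i \<in> {1..<l}" for i using PiE_mem[OF y, of i] that l by (auto simp: I_def B_def)
      hence "(\<Prod>i\<in>{1..<l}. y i) \<noteq> 0" by (simp add: prod_zero_iff)
      hence "(\<Prod>i=1..l. x i) = \<psi> ^ n" unfolding split unfolding x upd by simp
      moreover have "x \<in> {1..d+1} \<rightarrow>\<^sub>E UNIV" using y l unfolding x by (auto simp: I_def PiE_def extensional_def)
      ultimately show "x \<in> base d l" by (simp add: base_def)
    qed
  qed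
  hence "card (base d l) = card (PiE I B)" by (rule bij_betw_same_card)
  also have "\<dots> = (\<Prod>i\<in>I. card (B i))" by (rule card_PiE) (simp add: I_def)
  also have "I = {1..<l} \<union> {l+1..d+1}" using l by (auto simp: I_def)
  also have "(\<Prod>i\<in>{1..<l} \<union> {l+1..d+1}. card (B i)) = (\<Prod>i\<in>{1..<l}. card (B i)) * (\<Prod>i\<in>{l+1..d+1}. card (B i))"
    by (rule prod.union_disjoint) auto
  also have "(\<Prod>i\<in>{1..<l}. card (B i)) = (\<Prod>i\<in>{1..<l}. CARD('a) - 1)" by (rule prod.cong) (auto simp: B_def)
  also have "(\<Prod>i\<in>{l+1..d+1}. card (B i)) = (\<Prod>i\<in>{l+1..d+1}. CARD('a))" by (rule prod.cong) (auto simp: B_def)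
  finally show ?thesis by simp
qed

lemma card_H_points:
  assumes l: "1 \<le> l" "l \<le> d + 1"
  shows "card (H_points n d l \<alpha> \<beta> (1 / \<psi> ^ n)) = (\<Sum>x\<in>base d l. card {y. y ^ n = cover d l \<alpha> \<beta> x})"
proof -
  have \<psi>n: "\<psi> ^ n \<noteq> 0" using \<psi>0 by simp
  have fin: "finite (base d l)" by (simp add: base_def finite_PiE)
  define r where "r z = restrict z {1..d+1}" for z :: "nat \<Rightarrow> 'a"
  have cov: "cover d l \<alpha> \<beta> x = cover d l \<alpha> \<beta> y" and pr: "(\<Prod>i=1..l. x i) = (\<Prod>i=1..l. y i)"
    if "\<And>i. i \<in> {1..d+1} \<Longrightarrow> x i = y i" for x y
    using that l unfolding cover_def
    by (auto intro!: arg_cong2[of _ _ _ _ "(*)"] arg_cong2[of _ _ _ _ "(-)"] arg_cong2[of _ _ _ _ "(^)"] prod.cong sum.cong)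
  have rz: "r z i = z i" if "i \<in> {1..d+1}" for z i using that by (simp add: r_def)
  have eq: "1 / \<psi> ^ n * p = 1 \<longleftrightarrow> p = \<psi> ^ n" for p using \<psi>n by (auto simp: field_simps)
  have H: "H_points n d l \<alpha> \<beta> (1 / \<psi> ^ n) = {z \<in> {1..d+2} \<rightarrow>\<^sub>E UNIV. z (d + 2) ^ n = cover d l \<alpha> \<beta> z \<and> (\<Prod>i=1..l. z i) = \<psi> ^ n}"
    unfolding H_points_def affine_space_def cover_def eq ..
  have "bij_betw (\<lambda>z. (r z, z (d + 2))) (H_points n d l \<alpha> \<beta> (1 / \<psi> ^ n)) (SIGMA x:base d l. {y. y ^ n = cover d l \<alpha> \<beta> x})"
    unfolding H
  proof (rule bij_betw_byWitness[of _ "\<lambda>(x, y). x(d + 2 := y)"], goal_cases)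
    case 1
    show ?case by (auto simp: r_def fun_eq_iff PiE_def extensional_def)
  next
    case 2
    show ?case by (auto simp: r_def base_def fun_eq_iff PiE_def extensional_def)
  next
    case 3
    show ?case
    proof (rule image_subsetI)
      fix z assume "z \<in> {z \<in> {1..d+2} \<rightarrow>\<^sub>E UNIV. z (d + 2) ^ n = cover d l \<alpha> \<beta> z \<and> (\<Prod>i=1..l. z i) = \<psi> ^ n}"
      hence z: "z (d + 2) ^ n = cover d l \<alpha> \<beta> z" "(\<Prod>i=1..l. z i) = \<psi> ^ n" by simp_all
      have "cover d l \<alpha> \<beta> (r z) = cover d l \<alpha> \<beta> z" "(\<Prod>i=1..l. r z i) = (\<Prod>i=1..l. z i)"
        by (rule cov, rule rz, simp) (rule pr, rule rz, simp)
      moreover have "r z \<in> {1..d+1} \<rightarrow>\<^sub>E UNIV" by (simp add: r_def)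
      ultimately show "(r z, z (d + 2)) \<in> (SIGMA x:base d l. {y. y ^ n = cover d l \<alpha> \<beta> x})" using z by (simp add: base_def)
    qed
  next
    case 4
    show ?case
    proof
      fix z assume "z \<in> (\<lambda>(x, y). x(d + 2 := y)) ` (SIGMA x:base d l. {y. y ^ n = cover d l \<alpha> \<beta> x})"
      then obtain x y where z: "z = x(d + 2 := y)" and x: "x \<in> base d l" and y: "y ^ n = cover d l \<alpha> \<beta> x" by auto
      have e: "z i = x i" if "i \<in> {1..d+1}" for i using that by (simp add: z)
      have "cover d l \<alpha> \<beta> z = cover d l \<alpha> \<beta> x" "(\<Prod>i=1..l. z i) = (\<Prod>i=1..l. x i)"
        by (rule cov, rule e, simp) (rule pr, rule e, simp)
      moreover have "z \<in> {1..d+2} \<rightarrow>\<^sub>E UNIV" using x unfolding z by (auto simp: base_def PiE_def extensional_def)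
      moreover have "z (d + 2) = y" by (simp add: z)
      ultimately show "z \<in> {z \<in> {1..d+2} \<rightarrow>\<^sub>E UNIV. z (d + 2) ^ n = cover d l \<alpha> \<beta> z \<and> (\<Prod>i=1..l. z i) = \<psi> ^ n}"
        using x y by (simp add: base_def)
    qed
  qed
  hence "card (H_points n d l \<alpha> \<beta> (1 / \<psi> ^ n)) = card (SIGMA x:base d l. {y. y ^ n = cover d l \<alpha> \<beta> x})" by (rule bij_betw_same_card)
  also have "\<dots> = (\<Sum>x\<in>base d l. card {y. y ^ n = cover d l \<alpha> \<beta> x})" by (rule card_SigmaI) (auto simp: fin)
  finally show ?thesis .
qed

text \<open>The number of y over a base point is a sum over characters of order dividing n. The
  trivial one contributes 1 also where the right-hand side of the equation is 0, hence altogether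
  the number of base points, and is removed by the subtraction.\<close>

lemma H_term_eq:
  assumes l: "1 \<le> l" "l \<le> d + 1"
  shows "of_int (H_term n \<psi> d (l, \<alpha>, \<beta>)) = (\<Sum>\<kappa>\<in>{1..<n}. \<Sum>x\<in>base d l. rho (int \<kappa> * int t) (cover d l \<alpha> \<beta> x))"
proof -
  have "(of_nat (card (H_points n d l \<alpha> \<beta> (1 / \<psi> ^ n))) :: complex) = (\<Sum>x\<in>base d l. \<Sum>\<kappa><n. ch \<kappa> (cover d l \<alpha> \<beta> x))"
    unfolding card_H_points[OF l] of_nat_sum card_nth_roots ..
  also have "\<dots> = (\<Sum>x\<in>base d l. 1 + (\<Sum>\<kappa>\<in>{1..<n}. rho (int \<kappa> * int t) (cover d l \<alpha> \<beta> x)))"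
  proof (rule sum.cong[OF refl])
    fix x
    have "{..<n} = insert 0 {1..<n}" using n_pos by auto
    hence "(\<Sum>\<kappa><n. ch \<kappa> (cover d l \<alpha> \<beta> x)) = ch 0 (cover d l \<alpha> \<beta> x) + (\<Sum>\<kappa>\<in>{1..<n}. ch \<kappa> (cover d l \<alpha> \<beta> x))" by simp
    also have "(\<Sum>\<kappa>\<in>{1..<n}. ch \<kappa> (cover d l \<alpha> \<beta> x)) = (\<Sum>\<kappa>\<in>{1..<n}. rho (int \<kappa> * int t) (cover d l \<alpha> \<beta> x))"
      by (rule sum.cong) (auto simp: ch_def)
    finally show "(\<Sum>\<kappa><n. ch \<kappa> (cover d l \<alpha> \<beta> x)) = 1 + (\<Sum>\<kappa>\<in>{1..<n}. rho (int \<kappa> * int t) (cover d l \<alpha> \<beta> x))" by (simp add: ch_def)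
  qed
  also have "\<dots> = of_nat (card (base d l)) + (\<Sum>\<kappa>\<in>{1..<n}. \<Sum>x\<in>base d l. rho (int \<kappa> * int t) (cover d l \<alpha> \<beta> x))"
    unfolding sum.distrib by (subst sum.swap) simp
  finally have e: "(of_nat (card (H_points n d l \<alpha> \<beta> (1 / \<psi> ^ n))) :: complex) = \<dots>" .
  have "(int CARD('a) - 1) ^ (l - 1) * int CARD('a) ^ (d + 1 - l) = int (card (base d l))"
    unfolding card_base[OF l] using card_field_gt_1[where 'a='a] by (simp add: of_nat_diff)
  hence "H_term n \<psi> d (l, \<alpha>, \<beta>) = int (card (H_points n d l \<alpha> \<beta> (1 / \<psi> ^ n))) - int (card (base d l))"
    by (simp only: H_term_def prod.case)
  thus ?thesis using e by simp
qed

text \<open>Representative between 1 and n instead of 0 and n - 1: exponents have to be positive,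
  and the power then still vanishes at 0, as the characters \<open>rho\<close> do even for residue
  0.\<close>

definition rep :: "int \<Rightarrow> nat" where "rep e = nat ((e - 1) mod int n) + 1"

lemma rep_pos: "rep e \<ge> 1" by (simp add: rep_def)

lemma rep_cong: "[int (rep e) = e] (mod int n)"
proof -
  have "int (rep e) = (e - 1) mod int n + 1" using n_pos by (simp add: rep_def)
  also have "[(e - 1) mod int n + 1 = (e - 1) + 1] (mod int n)" by (intro cong_add cong_refl) simp
  finally show ?thesis by simp
qed

lemma rho_rep: "rho (int \<kappa> * int t) ((x::'a) ^ rep e) = rho (int \<kappa> * e * int t) x"
proof -
  have "rho (int \<kappa> * int t) (x ^ rep e) = rho (int (rep e) * (int \<kappa> * int t)) x"
    using rep_pos[of e] by (intro rho_power') simp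
  also have "\<dots> = rho (int \<kappa> * int (rep e) * int t) x" by (simp only: mult_ac)
  also have "\<dots> = rho (int \<kappa> * e * int t) x"
    by (intro rho_cong cong_mult_t cong_mult cong_refl rep_cong)
  finally show ?thesis .
qed

end

section \<open>Factorisation of the isotypic parts\<close>

context dwork
begin

definition aff :: "(nat \<Rightarrow> nat) \<Rightarrow> nat \<Rightarrow> nat \<Rightarrow> nat \<Rightarrow> nat" where
  "aff a \<kappa> c = (\<lambda>i\<in>{1..n}. (\<kappa> * a i + c) mod n)"

lemma aff_idx: "aff a \<kappa> c \<in> idx"
  using n_pos by (auto simp: aff_def idx_def)

lemma aff_sum: "n dvd (\<Sum>i=1..n. aff a \<kappa> c i) \<longleftrightarrow> n dvd \<kappa> * (\<Sum>i=1..n. a i)"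
proof -
  have "[(\<Sum>i=1..n. aff a \<kappa> c i) = (\<Sum>i=1..n. \<kappa> * a i + c)] (mod n)"
    by (rule cong_sum) (auto simp: aff_def)
  also have "(\<Sum>i=1..n. \<kappa> * a i + c) = \<kappa> * (\<Sum>i=1..n. a i) + n * c" by (simp add: sum.distrib sum_distrib_left)
  finally show ?thesis by (simp add: cong_dvd_iff dvd_add_left_iff)
qed

text \<open>Representatives of the orbits of the affine group \<open>x \<mapsto> \<kappa> x + c\<close> of the residues modulo \<open>n\<close>.\<close>

definition normal :: "(nat \<Rightarrow> nat) set" where
  "normal = {a \<in> idx. \<exists>j\<in>{2..n}. a j = 1 \<and> (\<forall>i\<in>{1..<j}. a i = 0)}"

text \<open>A non-constant family is brought to normal form in exactly one way: the translation
  makes the first value 0, and the dilation makes the first value different from it 1. Primality of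
  n provides the inverse of the dilation.\<close>

lemma bij_aff_normal:
  assumes n: "prime n"
  shows "bij_betw (\<lambda>(a, \<kappa>, c). aff a \<kappa> c) (normal \<times> {1..<n} \<times> {..<n}) (idx - const_idx)"
proof -
  have n1: "n > 1" using prime_gt_1_nat[OF n] .
  have cop: "coprime \<kappa> n" if "\<kappa> \<in> {1..<n}" for \<kappa>
    using that n by (metis atLeastLessThan_iff coprime_commute nat_dvd_not_less not_one_le_zero prime_imp_coprime zero_less_iff_neq_zero)
  have affi: "aff a \<kappa> c i = (\<kappa> * a i + c) mod n" if "i \<in> {1..n}" for a \<kappa> c i
    using that by (simp add: aff_def)
  have one: "1 \<in> {1..n}" using n1 by simp
  have a1: "a 1 = 0" if "a \<in> normal" for a
    using that by (force simp: normal_def)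
  have ai: "a i < n" if "a \<in> idx" "i \<in> {1..n}" for a i using that by (auto simp: idx_def)
  have key: "a = a' \<and> \<kappa> = \<kappa>' \<and> c = c'"
    if a: "a \<in> normal" and \<kappa>: "\<kappa> \<in> {1..<n}" and c: "c \<in> {..<n}"
      and a': "a' \<in> normal" and \<kappa>': "\<kappa>' \<in> {1..<n}" and c': "c' \<in> {..<n}"
      and e: "aff a \<kappa> c = aff a' \<kappa>' c'" for a \<kappa> c a' \<kappa>' c'
  proof -
    have ei: "[\<kappa> * a i + c = \<kappa>' * a' i + c'] (mod n)" if i: "i \<in> {1..n}" for i
      using fun_cong[OF e, of i] unfolding affi[OF i] Cong.cong_def .
    have cc: "c = c'" using ei[OF one] a1[OF a] a1[OF a'] c c' by (simp add: Cong.cong_def)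
    have ei': "[\<kappa> * a i = \<kappa>' * a' i] (mod n)" if i: "i \<in> {1..n}" for i
      using ei[OF i] unfolding cc cong_add_rcancel_nat .
    obtain j where j: "j \<in> {2..n}" "a j = 1" "\<forall>i\<in>{1..<j}. a i = 0" using a by (auto simp: normal_def)
    obtain j' where j': "j' \<in> {2..n}" "a' j' = 1" "\<forall>i\<in>{1..<j'}. a' i = 0" using a' by (auto simp: normal_def)
    have "\<not> j < j'"
    proof
      assume "j < j'"
      hence "a' j = 0" using j' j(1) by auto
      hence "[\<kappa> = 0] (mod n)" using ei'[of j] j by simp
      thus False using \<kappa> by (simp add: Cong.cong_def)
    qed
    moreover have "\<not> j' < j"
    proof
      assume "j' < j"
      hence "a j' = 0" using j j'(1) by auto
      hence "[0 = \<kappa>'] (mod n)" using ei'[of j'] j' by simp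
      thus False using \<kappa>' by (simp add: Cong.cong_def)
    qed
    ultimately have jj: "j' = j" by simp
    have "[\<kappa> = \<kappa>'] (mod n)" using ei'[of j] j j' jj by simp
    hence kk: "\<kappa> = \<kappa>'" using \<kappa> \<kappa>' by (simp add: Cong.cong_def)
    have "a i = a' i" for i
    proof (cases "i \<in> {1..n}")
      case True
      hence "[a i = a' i] (mod n)" using ei'[OF True] cop[OF \<kappa>'] unfolding kk by (simp add: cong_mult_lcancel_nat)
      thus ?thesis using ai[of a i] ai[of a' i] a a' True by (simp add: Cong.cong_def normal_def)
    next
      case False
      thus ?thesis using a a' PiE_arb[of a "{1..n}" "\<lambda>_. {..<n}" i] PiE_arb[of a' "{1..n}" "\<lambda>_. {..<n}" i]
        by (simp add: normal_def idx_def)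
    qed
    thus ?thesis using kk cc by blast
  qed
  have inj: "inj_on (\<lambda>(a, \<kappa>, c). aff a \<kappa> c) (normal \<times> {1..<n} \<times> {..<n})"
  proof (rule inj_onI)
    fix p p' assume "p \<in> normal \<times> {1..<n} \<times> {..<n}" "p' \<in> normal \<times> {1..<n} \<times> {..<n}"
      "(case p of (a, \<kappa>, c) \<Rightarrow> aff a \<kappa> c) = (case p' of (a, \<kappa>, c) \<Rightarrow> aff a \<kappa> c)"
    thus "p = p'"
      using key[of "fst p" "fst (snd p)" "snd (snd p)" "fst p'" "fst (snd p')" "snd (snd p')"]
      by (auto simp: case_prod_unfold prod_eq_iff simp del: One_nat_def)
  qed
  have "(\<lambda>(a, \<kappa>, c). aff a \<kappa> c) ` (normal \<times> {1..<n} \<times> {..<n}) = idx - const_idx"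
  proof (intro equalityI subsetI)
    fix f assume "f \<in> (\<lambda>(a, \<kappa>, c). aff a \<kappa> c) ` (normal \<times> {1..<n} \<times> {..<n})"
    then obtain a \<kappa> c where f: "f = aff a \<kappa> c" and a: "a \<in> normal" and \<kappa>: "\<kappa> \<in> {1..<n}" and c: "c < n" by auto
    obtain j where j: "j \<in> {2..n}" "a j = 1" using a by (auto simp: normal_def)
    have "f \<notin> const_idx"
    proof
      assume "f \<in> const_idx"
      then obtain e where "f = (\<lambda>i\<in>{1..n}. e)" by (auto simp: const_idx_def)
      hence "f j = f 1" using j one by simp
      hence "[\<kappa> + c = 0 + c] (mod n)" using j one a1[OF a] unfolding f Cong.cong_def by (simp add: affi)
      hence "[\<kappa> = 0] (mod n)" by (simp only: cong_add_rcancel_nat)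
      thus False using \<kappa> by (simp add: Cong.cong_def)
    qed
    thus "f \<in> idx - const_idx" using aff_idx f by blast
  next
    fix f assume f: "f \<in> idx - const_idx"
    have lt: "f i < n" if "i \<in> {1..n}" for i using f ai that by blast
    have "\<exists>i. i \<in> {1..n} \<and> f i \<noteq> f 1"
    proof (rule ccontr)
      assume "\<not> ?thesis"
      hence "f \<in> const_idx" using f by (intro const_idxI) blast+
      thus False using f by simp
    qed
    then obtain j where j: "j \<in> {1..n}" "f j \<noteq> f 1" and least: "\<And>i. i < j \<Longrightarrow> i \<in> {1..n} \<Longrightarrow> f i = f 1"
      using exists_least_iff[of "\<lambda>i. i \<in> {1..n} \<and> f i \<noteq> f 1"] by blast
    have j2: "j \<in> {2..n}" using j by (cases "j = 1") auto
    \<comment> \<open>g i stands for f i - f 1 modulo n; n is added to remain within the natural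
      numbers.\<close>
    define g where "g i = f i + (n - f 1)" for i
    define \<kappa> where "\<kappa> = g j mod n"
    have "\<kappa> \<noteq> 0"
    proof
      assume "\<kappa> = 0"
      hence "[g j + f 1 = 0 + f 1] (mod n)" by (intro cong_add cong_refl) (simp add: \<kappa>_def Cong.cong_def)
      moreover have "g j + f 1 = f j + n" using lt[OF one] by (simp add: g_def)
      ultimately have "[f j = f 1] (mod n)" by (simp add: Cong.cong_def)
      thus False using j lt[OF one] lt[OF j(1)] by (simp add: Cong.cong_def)
    qed
    moreover have "\<kappa> < n" using n1 by (simp add: \<kappa>_def)
    ultimately have \<kappa>: "\<kappa> \<in> {1..<n}" by simp
    obtain \<mu> where \<mu>: "[\<kappa> * \<mu> = 1] (mod n)" using cong_solve_coprime_nat[OF cop[OF \<kappa>]] by auto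
    define a where "a = (\<lambda>i\<in>{1..n}. (\<mu> * g i) mod n)"
    have "a \<in> idx" using n1 by (auto simp: a_def idx_def)
    moreover have "a j = 1"
    proof -
      have "[\<mu> * g j = \<mu> * \<kappa>] (mod n)" by (intro cong_mult cong_refl) (simp add: \<kappa>_def)
      also have "[\<mu> * \<kappa> = 1] (mod n)" using \<mu> by (simp add: mult.commute)
      finally show ?thesis using j(1) n1 by (simp add: a_def Cong.cong_def)
    qed
    moreover have "a i = 0" if "i \<in> {1..<j}" for i
    proof -
      have "i \<in> {1..n}" using that j(1) by auto
      moreover from this have "g i = n" using least[of i] that lt[OF one] by (simp add: g_def)
      ultimately show ?thesis by (simp add: a_def)
    qed
    ultimately have a: "a \<in> normal" using j2 by (auto simp: normal_def)
    have "aff a \<kappa> (f 1) = f"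
    proof
      fix i show "aff a \<kappa> (f 1) i = f i"
      proof (cases "i \<in> {1..n}")
        case True
        have "[\<kappa> * (\<mu> * g i mod n) + f 1 = \<kappa> * (\<mu> * g i) + f 1] (mod n)"
          by (intro cong_add cong_mult cong_refl) simp
        also have "\<kappa> * (\<mu> * g i) = (\<kappa> * \<mu>) * g i" by simp
        also have "[\<kappa> * \<mu> * g i + f 1 = 1 * g i + f 1] (mod n)" by (intro cong_add cong_mult cong_refl \<mu>)
        also have "1 * g i + f 1 = f i + n" using lt[OF one] by (simp add: g_def)
        finally show ?thesis using True lt[OF True] by (simp add: affi a_def Cong.cong_def)
      next
        case False
        thus ?thesis using f PiE_arb[of f "{1..n}" "\<lambda>_. {..<n}" i] by (auto simp: aff_def idx_def)
      qed
    qed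
    thus "f \<in> (\<lambda>(a, \<kappa>, c). aff a \<kappa> c) ` (normal \<times> {1..<n} \<times> {..<n})"
      using a \<kappa> lt[OF one] by (intro image_eqI[of _ _ "(a, \<kappa>, f 1)"]) auto
  qed
  with inj show ?thesis by (simp add: bij_betw_def)
qed

lemma aff_normal:
  "prime n \<Longrightarrow> a \<in> normal \<Longrightarrow> \<kappa> \<in> {1..<n} \<Longrightarrow> c < n \<Longrightarrow> aff a \<kappa> c \<in> idx - const_idx"
  using bij_betwE[OF bij_aff_normal] by fastforce

end

text \<open>The set \<open>V\<close> consists of the values of \<open>a\<close>, the list \<open>rs\<close> of the superfluous occurrences of
  these values, and the list \<open>vs\<close> of the missing values.\<close>

locale dwork_index = dwork n t \<psi> for n t :: nat and \<psi> :: "'a::{field,finite}" +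
  fixes a :: "nat \<Rightarrow> nat" and V :: "nat set" and rs vs :: "nat list"
  assumes prime_n: "prime n" and a_idx: "a \<in> idx"
    and mset_a: "image_mset a (mset_set {1..n}) = mset_set V + mset rs"
    and V: "V \<subseteq> {0..<n}" and rs: "set rs \<subseteq> V"
    and vs: "distinct vs" "set vs = {0..<n} - V" "length vs = length rs"
    and sum_a: "n dvd (\<Sum>i=1..n. a i)"
begin

section \<open>Regrouping of the Gauss sums of a family\<close>

definition m :: nat where "m = length rs"

text \<open>List positions start at 0, whereas the matched pairs are numbered from 1 like the
  coordinates of H; integer values permit differences.\<close>

definition vi :: "nat \<Rightarrow> int" where "vi j = int (vs ! (j - 1))"

definition ri :: "nat \<Rightarrow> int" where "ri j = int (rs ! (j - 1))"

definition b :: "nat \<Rightarrow> int" where "b j = ri j - vi j"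

definition sg :: "int \<Rightarrow> complex" where "sg k = rho k (-1 :: 'a)"

lemma finV: "finite V" using V finite_subset by blast

lemma card_V: "card V + m = n"
  using arg_cong[OF mset_a, of size] finV by (simp add: m_def)

lemma prod_vs: "(\<Prod>v\<in>set vs. F (int v)) = (\<Prod>j=1..m. F (vi j) :: 'b::comm_monoid_mult)"
proof -
  have "(\<Prod>v\<in>set vs. F (int v)) = prod_list (map (\<lambda>v. F (int v)) vs)" using vs(1) by (rule prod.distinct_set_conv_list)
  also have "\<dots> = (\<Prod>j<m. F (int (vs ! j)))" by (simp add: prod.list_conv_set_nth vs(3) m_def lessThan_atLeast0)
  also have "\<dots> = (\<Prod>j=1..m. F (vi j))" unfolding vi_def by (simp add: prod.atLeast1_atMost_eq)
  finally show ?thesis .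
qed

lemma prod_a: "(\<Prod>i=1..n. F (int (a i))) = (\<Prod>v\<in>V. F (int v)) * (\<Prod>j=1..m. F (ri j) :: 'b::comm_monoid_mult)"
proof -
  have "(\<Prod>i=1..n. F (int (a i))) = prod_mset (image_mset (\<lambda>v. F (int v)) (image_mset a (mset_set {1..n})))"
    by (simp add: prod_unfold_prod_mset multiset.map_comp comp_def)
  also have "\<dots> = (\<Prod>v\<in>V. F (int v)) * prod_list (map (\<lambda>v. F (int v)) rs)"
    unfolding mset_a by (simp add: prod_unfold_prod_mset prod_mset_prod_list[symmetric] del: prod_mset_prod_list)
  also have "prod_list (map (\<lambda>v. F (int v)) rs) = (\<Prod>j<m. F (int (rs ! j)))" by (simp add: prod.list_conv_set_nth m_def lessThan_atLeast0)
  also have "\<dots> = (\<Prod>j=1..m. F (ri j))" unfolding ri_def by (simp add: prod.atLeast1_atMost_eq)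
  finally show ?thesis .
qed

lemma b_nz: "j \<in> {1..m} \<Longrightarrow> \<not> int n dvd b j"
proof -
  assume j: "j \<in> {1..m}"
  hence "j - 1 < length rs" by (auto simp: m_def)
  hence r: "rs ! (j - 1) \<in> V" and v: "vs ! (j - 1) \<in> {0..<n} - V"
    using nth_mem rs vs(2,3) by (metis subsetD, metis)
  have "rs ! (j - 1) < n" "vs ! (j - 1) < n" "rs ! (j - 1) \<noteq> vs ! (j - 1)" using r v V by auto
  thus ?thesis unfolding b_def ri_def vi_def by (intro residues_not_dvd_diff) auto
qed

lemma sum_b: "int n dvd (\<Sum>j=1..m. b j)"
proof -
  have "(\<Sum>j=1..m. vi j) = (\<Sum>v\<in>set vs. int v)"
  proof -
    have "(\<Sum>v\<in>set vs. int v) = sum_list (map int vs)" using vs(1) by (rule sum.distinct_set_conv_list)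
    also have "\<dots> = (\<Sum>j<m. int (vs ! j))" by (simp add: sum.list_conv_set_nth vs(3) m_def lessThan_atLeast0)
    finally show ?thesis unfolding vi_def by (simp add: sum.atLeast1_atMost_eq)
  qed
  moreover have "(\<Sum>j=1..m. ri j) + (\<Sum>v\<in>V. int v) = int (\<Sum>i=1..n. a i)"
  proof -
    have "(\<Sum>i=1..n. a i) = sum_mset (image_mset a (mset_set {1..n}))" by (simp add: sum_unfold_sum_mset)
    also have "\<dots> = (\<Sum>v\<in>V. v) + sum_list rs" unfolding mset_a by (simp add: sum_unfold_sum_mset sum_mset_sum_list)
    also have "sum_list rs = (\<Sum>j<m. rs ! j)" by (simp add: sum.list_conv_set_nth m_def lessThan_atLeast0)
    finally show ?thesis unfolding ri_def by (simp add: sum.atLeast1_atMost_eq)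
  qed
  moreover have "(\<Sum>v\<in>V. int v) + (\<Sum>v\<in>set vs. int v) = int (\<Sum>v<n. v)"
  proof -
    have "(\<Sum>v\<in>V. int v) + (\<Sum>v\<in>set vs. int v) = (\<Sum>v\<in>V \<union> set vs. int v)"
      by (rule sum.union_disjoint[symmetric]) (use finV vs in auto)
    also have "V \<union> set vs = {..<n}" using V vs(2) by auto
    finally show ?thesis by simp
  qed
  moreover have "int n dvd int (\<Sum>v<n. v)"
  proof -
    obtain h where h: "n = 2 * h + 1" using oddn by (elim oddE)
    have "2 * (\<Sum>v<i. v) = i * (i - 1)" for i :: nat by (induction i) (auto simp: algebra_simps)
    hence "2 * (\<Sum>v<n. v) = n * (n - 1)" by blast
    hence "(\<Sum>v<n. v) = n * h" using h by simp
    thus ?thesis by simp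
  qed
  ultimately have e: "(\<Sum>j=1..m. b j) = int (\<Sum>i=1..n. a i) - int (\<Sum>v<n. v)" and d: "int n dvd int (\<Sum>v<n. v)"
    unfolding b_def sum_subtractf by linarith+
  have "int n dvd int (\<Sum>i=1..n. a i)" using sum_a by (simp only: int_dvd_int_iff)
  thus ?thesis unfolding e using d by (rule dvd_diff)
qed

lemma coprime_kappa: "\<kappa> \<in> {1..<n} \<Longrightarrow> int n dvd int \<kappa> * x \<longleftrightarrow> int n dvd x"
proof -
  assume "\<kappa> \<in> {1..<n}"
  hence "\<not> n dvd \<kappa>" using nat_dvd_not_less by auto
  hence "\<not> int n dvd int \<kappa>" by (simp only: int_dvd_int_iff not_False_eq_True)
  moreover have "prime (int n)" using prime_n by simp
  ultimately show ?thesis using prime_dvd_mult_iff[of "int n" "int \<kappa>" x] by blast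
qed

lemma trm_aff:
  assumes \<kappa>: "\<kappa> \<in> {1..<n}"
  shows "trm (aff a \<kappa> c) k = (\<Prod>v\<in>V. gs (k + (int \<kappa> * int v + int c) * int t) * gs (- (k + (int \<kappa> * int v + int c) * int t))) *
    (\<Prod>j=1..m. gs (k + (int \<kappa> * ri j + int c) * int t) * gs (- (k + (int \<kappa> * vi j + int c) * int t))) * sg k * rho k (\<psi> ^ n)"
proof -
  have "(\<Prod>i=1..n. gs (k + int (aff a \<kappa> c i) * int t)) = (\<Prod>i=1..n. gs (k + (int \<kappa> * int (a i) + int c) * int t))"
  proof (rule prod.cong[OF refl], rule gs_cong)
    fix i assume "i \<in> {1..n}"
    hence "[int (aff a \<kappa> c i) = int \<kappa> * int (a i) + int c] (mod int n)"
      by (simp add: aff_def zmod_int)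
    thus "[k + int (aff a \<kappa> c i) * int t = k + (int \<kappa> * int (a i) + int c) * int t] (mod int (CARD('a) - 1))"
      by (intro cong_add cong_refl cong_mult_t)
  qed
  also have "\<dots> = (\<Prod>v\<in>V. gs (k + (int \<kappa> * int v + int c) * int t)) * (\<Prod>j=1..m. gs (k + (int \<kappa> * ri j + int c) * int t))"
    by (rule prod_a)
  finally have 1: "(\<Prod>i=1..n. gs (k + int (aff a \<kappa> c i) * int t)) = \<dots>" .
  define g where "g v = nat ((- (int \<kappa> * int v + int c)) mod int n)" for v
  have g: "int (g v) = (- (int \<kappa> * int v + int c)) mod int n" for v using n_pos by (simp add: g_def)
  have inj: "inj_on g {..<n}"
  proof (rule inj_onI, rule ccontr)
    fix v w assume vw: "v \<in> {..<n}" "w \<in> {..<n}" "g v = g w" "v \<noteq> w"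
    have "[- (int \<kappa> * int v + int c) = - (int \<kappa> * int w + int c)] (mod int n)"
      using vw(3) g unfolding Cong.cong_def by metis
    hence "int n dvd - (int \<kappa> * int v + int c) - - (int \<kappa> * int w + int c)" by (simp only: cong_iff_dvd_diff)
    also have "- (int \<kappa> * int v + int c) - - (int \<kappa> * int w + int c) = int \<kappa> * (int w - int v)" by (simp add: algebra_simps)
    finally have "int n dvd int w - int v" using coprime_kappa[OF \<kappa>] by simp
    moreover have "\<not> int n dvd int w - int v" using vw by (intro residues_not_dvd_diff) auto
    ultimately show False by blast
  qed
  have "g ` {..<n} \<subseteq> {..<n}"
  proof
    fix x assume "x \<in> g ` {..<n}"
    then obtain v where "x = g v" by blast
    hence "int x < int n" using g[of v] n_pos by simp
    thus "x \<in> {..<n}" by simp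
  qed
  hence im: "g ` {..<n} = {..<n}" using endo_inj_surj[OF _ _ inj] by blast
  have "(\<Prod>j<n. gs (- k + int j * int t)) = (\<Prod>v<n. gs (- k + int (g v) * int t))"
    using prod.reindex[OF inj, of "\<lambda>j. gs (- k + int j * int t)"] im by (simp add: comp_def)
  also have "\<dots> = (\<Prod>v<n. gs (- (k + (int \<kappa> * int v + int c) * int t)))"
  proof (rule prod.cong[OF refl], rule gs_cong)
    fix v
    have "[int (g v) = - (int \<kappa> * int v + int c)] (mod int n)" by (simp add: g)
    hence "[int (g v) * int t = - (int \<kappa> * int v + int c) * int t] (mod int (CARD('a) - 1))" by (rule cong_mult_t)
    hence "[- k + int (g v) * int t = - k + - (int \<kappa> * int v + int c) * int t] (mod int (CARD('a) - 1))"
      by (intro cong_add cong_refl)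
    thus "[- k + int (g v) * int t = - (k + (int \<kappa> * int v + int c) * int t)] (mod int (CARD('a) - 1))"
      by (simp only: minus_add_distrib mult_minus_left[symmetric])
  qed
  also have "\<dots> = (\<Prod>v\<in>V. gs (- (k + (int \<kappa> * int v + int c) * int t))) * (\<Prod>v\<in>set vs. gs (- (k + (int \<kappa> * int v + int c) * int t)))"
  proof -
    have "{..<n} = V \<union> set vs" using V vs(2) by auto
    thus ?thesis using finV vs by (simp only:) (rule prod.union_disjoint, auto)
  qed
  also have "(\<Prod>v\<in>set vs. gs (- (k + (int \<kappa> * int v + int c) * int t))) = (\<Prod>j=1..m. gs (- (k + (int \<kappa> * vi j + int c) * int t)))"
    by (rule prod_vs)
  finally show ?thesis unfolding trm_def 1 prod.distrib sg_def by (simp only: mult_ac)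
qed

lemma aff_dvd_iff:
  "(\<exists>i\<in>{1..n}. int (CARD('a) - 1) dvd k + int (aff a \<kappa> c i) * int t) \<longleftrightarrow>
   (\<exists>v\<in>V. int (CARD('a) - 1) dvd k + (int \<kappa> * int v + int c) * int t)"
proof -
  have "int (CARD('a) - 1) dvd k + int (aff a \<kappa> c i) * int t \<longleftrightarrow> int (CARD('a) - 1) dvd k + (int \<kappa> * int (a i) + int c) * int t"
    if "i \<in> {1..n}" for i
  proof (rule cong_dvd_iff)
    have "[int (aff a \<kappa> c i) = int \<kappa> * int (a i) + int c] (mod int n)"
      using that by (simp add: aff_def zmod_int)
    thus "[k + int (aff a \<kappa> c i) * int t = k + (int \<kappa> * int (a i) + int c) * int t] (mod int (CARD('a) - 1))"
      by (intro cong_add cong_refl cong_mult_t)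
  qed
  moreover have "a ` {1..n} = V"
  proof -
    have "a ` {1..n} = set_mset (image_mset a (mset_set {1..n}))" by simp
    thus ?thesis unfolding mset_a by (simp only: set_mset_union finite_set_mset_mset_set[OF finV] set_mset_mset Un_absorb2[OF rs])
  qed
  ultimately show ?thesis by (metis (no_types, lifting) imageE imageI)
qed

lemma sg_sq: "sg k * sg k = 1"
  using rho_mult[of k "-1 :: 'a" "-1"] by (simp add: sg_def)

lemma sg_shift: "sg (k + l * int t) = sg k"
  unfolding sg_def rho_add rho_m1 by simp

lemma sg_even_power: "even i \<Longrightarrow> sg k ^ i = 1"
  by (elim evenE) (simp add: power_mult power2_eq_square sg_sq)

text \<open>A value v gives a Gauss sum times its reflection, that is q up to the sign of k, except
  that a trivial character gives only 1. At most one v is exceptional for a given k, and the weight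
  from \<open>isotypic_eq\<close> restores the missing factor q. The result is uniform in k.\<close>

lemma diagonal_part:
  assumes \<kappa>: "\<kappa> \<in> {1..<n}"
  shows "(\<Prod>v\<in>V. gs (k + (int \<kappa> * int v + int c) * int t) * gs (- (k + (int \<kappa> * int v + int c) * int t))) *
    (if \<exists>v\<in>V. int (CARD('a) - 1) dvd k + (int \<kappa> * int v + int c) * int t then of_nat CARD('a) else 1) =
    sg k ^ card V * of_nat CARD('a) ^ card V"
proof -
  define T where "T v \<longleftrightarrow> int (CARD('a) - 1) dvd k + (int \<kappa> * int v + int c) * int t" for v
  have f: "gs (k + (int \<kappa> * int v + int c) * int t) * gs (- (k + (int \<kappa> * int v + int c) * int t)) =
     sg k * (if T v then 1 else of_nat CARD('a))" for v
  proof (cases "T v")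
    case True
    have "sg k = sg (k + (int \<kappa> * int v + int c) * int t)" by (rule sg_shift[symmetric])
    also have "\<dots> = rho 0 (-1 :: 'a)" unfolding sg_def by (rule rho_cong) (use True in \<open>simp only: T_def cong_0_iff\<close>)
    also have "\<dots> = 1" by (simp add: rho_trivial)
    finally have 1: "sg k = 1" .
    have "gs (k + (int \<kappa> * int v + int c) * int t) = -1" "gs (- (k + (int \<kappa> * int v + int c) * int t)) = -1"
      using True unfolding T_def by (auto intro!: gs_trivial simp only: dvd_minus_iff)
    thus ?thesis using 1 True by simp
  next
    case False
    thus ?thesis using gauss_reflect[of "k + (int \<kappa> * int v + int c) * int t", where 'a='a] sg_shift[of k "int \<kappa> * int v + int c"]
      unfolding gs_def T_def sg_def by (simp only: if_False simp_thms True_implies_equals)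
  qed
  have one: "v = w" if "v \<in> V" "w \<in> V" "T v" "T w" for v w
  proof (rule ccontr)
    assume ne: "v \<noteq> w"
    have "int (CARD('a) - 1) dvd (k + (int \<kappa> * int v + int c) * int t) - (k + (int \<kappa> * int w + int c) * int t)"
      using that(3,4) unfolding T_def by (rule dvd_diff)
    also have "(k + (int \<kappa> * int v + int c) * int t) - (k + (int \<kappa> * int w + int c) * int t) = (int \<kappa> * (int v - int w)) * int t"
      by (simp add: algebra_simps)
    finally have "int n dvd int v - int w" unfolding dvd_mult_t coprime_kappa[OF \<kappa>] .
    moreover have "\<not> int n dvd int v - int w" using that ne V by (intro residues_not_dvd_diff) auto
    ultimately show False by blast
  qed
  have "(\<Prod>v\<in>V. if T v then 1 else of_nat CARD('a)) * (if \<exists>v\<in>V. T v then of_nat CARD('a) else 1) = (of_nat CARD('a) :: complex) ^ card V"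
  proof (cases "\<exists>v\<in>V. T v")
    case True
    then obtain v where v: "v \<in> V" "T v" by blast
    have "(\<Prod>w\<in>V - {v}. if T w then 1 else of_nat CARD('a)) = (\<Prod>w\<in>V - {v}. (of_nat CARD('a) :: complex))"
      by (rule prod.cong) (use one v in auto)
    moreover have "(\<Prod>w\<in>V. if T w then 1 else of_nat CARD('a)) = (if T v then 1 else of_nat CARD('a)) *
        (\<Prod>w\<in>V - {v}. if T w then 1 else of_nat CARD('a) :: complex)"
      by (rule prod.remove[OF finV v(1)])
    ultimately have "(\<Prod>w\<in>V. if T w then 1 else of_nat CARD('a)) = (of_nat CARD('a) :: complex) ^ card (V - {v})"
      using v(2) by (simp only: if_True mult_1_left prod_constant)
    thus ?thesis using True unfolding card_Suc_Diff1[OF finV v(1), symmetric] by (simp only: if_True power_Suc2)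
  next
    case False
    hence "(\<Prod>w\<in>V. if T w then 1 else of_nat CARD('a)) = (\<Prod>w\<in>V. (of_nat CARD('a) :: complex))"
      by (intro prod.cong) auto
    thus ?thesis using False by simp
  qed
  thus ?thesis unfolding f prod.distrib T_def[symmetric] by (simp only: prod_constant mult.assoc)
qed

text \<open>\<open>gauss_mult_jacobi\<close> for every matched pair. The Gauss sums of index
  \<kappa> b j t are independent of k and c; apart from a sign, k survives only in a character of
  the product of the z j.\<close>

lemma offdiagonal_part:
  assumes \<kappa>: "\<kappa> \<in> {1..<n}"
  shows "(\<Prod>j=1..m. gs (k + (int \<kappa> * ri j + int c) * int t) * gs (- (k + (int \<kappa> * vi j + int c) * int t))) =
    sg k ^ m * (\<Prod>j=1..m. gs (int \<kappa> * b j * int t)) *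
    (\<Sum>z\<in>{1..m} \<rightarrow>\<^sub>E UNIV. (\<Prod>j=1..m. rho (- (int \<kappa> * vi j * int t)) (z j) * rho (- (int \<kappa> * b j * int t)) (1 - z j :: 'a)) *
       rho (- (k + int c * int t)) (\<Prod>j=1..m. z j))"
proof -
  have f: "gs (k + (int \<kappa> * ri j + int c) * int t) * gs (- (k + (int \<kappa> * vi j + int c) * int t)) =
     sg k * gs (int \<kappa> * b j * int t) *
     (\<Sum>z\<in>UNIV. rho (- (int \<kappa> * vi j * int t)) z * rho (- (int \<kappa> * b j * int t)) (1 - z) * rho (- (k + int c * int t)) (z :: 'a))"
    if j: "j \<in> {1..m}" for j
  proof -
    define r where "r = k + (int \<kappa> * ri j + int c) * int t"
    define v where "v = k + (int \<kappa> * vi j + int c) * int t"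
    have rv: "r - v = int \<kappa> * b j * int t" and vr: "v - r = - (int \<kappa> * b j * int t)"
      by (simp_all add: r_def v_def b_def algebra_simps)
    have mv: "- v = - (int \<kappa> * vi j * int t) + - (k + int c * int t)" by (simp add: v_def algebra_simps)
    have "\<not> int (CARD('a) - 1) dvd r - v"
      unfolding rv dvd_mult_t coprime_kappa[OF \<kappa>] by (rule b_nz[OF j])
    from gauss_mult_jacobi[OF this]
    have "gs r * gs (- v) = rho (- v) (-1 :: 'a) * gs (r - v) * (\<Sum>z\<in>UNIV. rho (- v) z * rho (v - r) (1 - z :: 'a))"
      unfolding gs_def .
    also have "rho (- v) (-1 :: 'a) = inverse (sg v)" by (simp only: rho_minus sg_def)
    also have "sg v = sg k" unfolding v_def by (rule sg_shift)
    also have "inverse (sg k) = sg k" using sg_sq[of k] by (metis inverse_unique)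
    also have "(\<Sum>z\<in>UNIV. rho (- v) z * rho (v - r) (1 - z :: 'a)) =
      (\<Sum>z\<in>UNIV. rho (- (int \<kappa> * vi j * int t)) z * rho (- (int \<kappa> * b j * int t)) (1 - z) * rho (- (k + int c * int t)) (z :: 'a))"
      unfolding mv vr rho_add by (simp only: mult_ac)
    finally show ?thesis unfolding rv unfolding r_def v_def .
  qed
  have "(\<Prod>j=1..m. gs (k + (int \<kappa> * ri j + int c) * int t) * gs (- (k + (int \<kappa> * vi j + int c) * int t))) =
    (\<Prod>j=1..m. sg k * gs (int \<kappa> * b j * int t) *
     (\<Sum>z\<in>UNIV. rho (- (int \<kappa> * vi j * int t)) z * rho (- (int \<kappa> * b j * int t)) (1 - z) * rho (- (k + int c * int t)) (z :: 'a)))"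
    by (rule prod.cong[OF refl f])
  also have "\<dots> = sg k ^ m * (\<Prod>j=1..m. gs (int \<kappa> * b j * int t)) *
    (\<Prod>j=1..m. \<Sum>z\<in>UNIV. rho (- (int \<kappa> * vi j * int t)) z * rho (- (int \<kappa> * b j * int t)) (1 - z) * rho (- (k + int c * int t)) (z :: 'a))"
    by (simp add: prod.distrib)
  also have "(\<Prod>j=1..m. \<Sum>z\<in>UNIV. rho (- (int \<kappa> * vi j * int t)) z * rho (- (int \<kappa> * b j * int t)) (1 - z) * rho (- (k + int c * int t)) (z :: 'a)) =
    (\<Sum>z\<in>{1..m} \<rightarrow>\<^sub>E UNIV. \<Prod>j=1..m. rho (- (int \<kappa> * vi j * int t)) (z j) * rho (- (int \<kappa> * b j * int t)) (1 - z j) * rho (- (k + int c * int t)) (z j :: 'a))"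
    by (rule prod_sum_PiE) auto
  also have "\<dots> = (\<Sum>z\<in>{1..m} \<rightarrow>\<^sub>E UNIV. (\<Prod>j=1..m. rho (- (int \<kappa> * vi j * int t)) (z j) * rho (- (int \<kappa> * b j * int t)) (1 - z j :: 'a)) *
       rho (- (k + int c * int t)) (\<Prod>j=1..m. z j))"
    unfolding rho_prod prod.distrib ..
  finally show ?thesis .
qed

text \<open>A hypergeometric character sum: an m-fold multiplicative convolution of Jacobi-type
  summands, evaluated at \<psi>^n.\<close>

definition hyp :: "nat \<Rightarrow> complex" where
  "hyp \<kappa> = (\<Sum>z | z \<in> {1..m} \<rightarrow>\<^sub>E UNIV \<and> (\<Prod>j=1..m. z j) = \<psi> ^ n.
     \<Prod>j=1..m. rho (- (int \<kappa> * vi j * int t)) (z j) * rho (- (int \<kappa> * b j * int t)) (1 - z j :: 'a))"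

text \<open>The signs occur card V + m + 1 = n + 1 times, an even number, and disappear. Summation
  over k then forces the product of the z j to be \<psi>^n. The shift c drops out because a
  character of order dividing n is trivial there.\<close>

lemma sum_trm:
  assumes \<kappa>: "\<kappa> \<in> {1..<n}"
  shows "(\<Sum>k<CARD('a) - 1. trm (aff a \<kappa> c) (int k) *
      (if \<exists>i\<in>{1..n}. int (CARD('a) - 1) dvd int k + int (aff a \<kappa> c i) * int t then of_nat CARD('a) else 1)) =
    of_nat CARD('a) ^ card V * (\<Prod>j=1..m. gs (int \<kappa> * b j * int t)) * ((of_nat CARD('a) - 1) * hyp \<kappa>)"
proof -
  define F where "F z = (\<Prod>j=1..m. rho (- (int \<kappa> * vi j * int t)) (z j) * rho (- (int \<kappa> * b j * int t)) (1 - z j :: 'a))" for z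
  define C where "C = of_nat CARD('a) ^ card V * (\<Prod>j=1..m. gs (int \<kappa> * b j * int t))"
  have "trm (aff a \<kappa> c) k *
      (if \<exists>i\<in>{1..n}. int (CARD('a) - 1) dvd k + int (aff a \<kappa> c i) * int t then of_nat CARD('a) else 1) =
    C * (\<Sum>z\<in>{1..m} \<rightarrow>\<^sub>E UNIV. F z * (rho (- (k + int c * int t)) (\<Prod>j=1..m. z j) * rho k (\<psi> ^ n)))" for k
  proof -
    have "sg k ^ card V * (sg k ^ m * sg k) = sg k ^ Suc n"
      unfolding card_V[symmetric] by (simp add: power_add)
    also have "\<dots> = 1" by (rule sg_even_power) (use oddn in simp)
    finally have sgn: "sg k ^ card V * (sg k ^ m * sg k) = 1" .
    define S where "S = (\<Sum>z\<in>{1..m} \<rightarrow>\<^sub>E UNIV. F z * rho (- (k + int c * int t)) (\<Prod>j=1..m. z j))"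
    have "trm (aff a \<kappa> c) k *
      (if \<exists>i\<in>{1..n}. int (CARD('a) - 1) dvd k + int (aff a \<kappa> c i) * int t then of_nat CARD('a) else 1) =
      ((\<Prod>v\<in>V. gs (k + (int \<kappa> * int v + int c) * int t) * gs (- (k + (int \<kappa> * int v + int c) * int t))) *
    (if \<exists>v\<in>V. int (CARD('a) - 1) dvd k + (int \<kappa> * int v + int c) * int t then of_nat CARD('a) else 1)) *
     (\<Prod>j=1..m. gs (k + (int \<kappa> * ri j + int c) * int t) * gs (- (k + (int \<kappa> * vi j + int c) * int t))) * sg k * rho k (\<psi> ^ n)"
      unfolding trm_aff[OF \<kappa>] aff_dvd_iff by (simp only: mult_ac)
    also have "\<dots> = (sg k ^ card V * of_nat CARD('a) ^ card V) * (sg k ^ m * (\<Prod>j=1..m. gs (int \<kappa> * b j * int t)) * S) * sg k * rho k (\<psi> ^ n)"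
      unfolding diagonal_part[OF \<kappa>] offdiagonal_part[OF \<kappa>] S_def F_def ..
    also have "\<dots> = (sg k ^ card V * (sg k ^ m * sg k)) * (C * (S * rho k (\<psi> ^ n)))"
      unfolding C_def by (simp only: mult_ac)
    also have "\<dots> = C * (S * rho k (\<psi> ^ n))" unfolding sgn by simp
    finally show ?thesis unfolding S_def sum_distrib_right by (simp only: mult.assoc)
  qed
  hence "(\<Sum>k<CARD('a) - 1. trm (aff a \<kappa> c) (int k) *
      (if \<exists>i\<in>{1..n}. int (CARD('a) - 1) dvd int k + int (aff a \<kappa> c i) * int t then of_nat CARD('a) else 1)) =
    (\<Sum>k<CARD('a) - 1. C * (\<Sum>z\<in>{1..m} \<rightarrow>\<^sub>E UNIV. F z * (rho (- (int k + int c * int t)) (\<Prod>j=1..m. z j) * rho (int k) (\<psi> ^ n))))"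
    by (simp only:)
  also have "\<dots> = C * (\<Sum>z\<in>{1..m} \<rightarrow>\<^sub>E UNIV. F z * (\<Sum>k<CARD('a) - 1. rho (- (int k + int c * int t)) (\<Prod>j=1..m. z j) * rho (int k) (\<psi> ^ n)))"
    unfolding sum_distrib_left[symmetric] by (subst sum.swap) (simp only: sum_distrib_left)
  also have "(\<Sum>z\<in>{1..m} \<rightarrow>\<^sub>E UNIV. F z * (\<Sum>k<CARD('a) - 1. rho (- (int k + int c * int t)) (\<Prod>j=1..m. z j) * rho (int k) (\<psi> ^ n))) =
    (\<Sum>z\<in>{1..m} \<rightarrow>\<^sub>E UNIV. if (\<Prod>j=1..m. z j) = \<psi> ^ n then (of_nat CARD('a) - 1) * F z else 0)"
  proof (rule sum.cong[OF refl])
    fix z :: "nat \<Rightarrow> 'a"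
    define p where "p = (\<Prod>j=1..m. z j)"
    have \<psi>n: "\<psi> ^ n \<noteq> 0" using \<psi>0 by simp
    show "F z * (\<Sum>k<CARD('a) - 1. rho (- (int k + int c * int t)) (\<Prod>j=1..m. z j) * rho (int k) (\<psi> ^ n)) =
      (if (\<Prod>j=1..m. z j) = \<psi> ^ n then (of_nat CARD('a) - 1) * F z else 0)"
    proof (cases "p = 0")
      case True
      thus ?thesis unfolding p_def[symmetric] using \<psi>0 by simp
    next
      case False
      have "rho (- (int k + int c * int t)) p * rho (int k) (\<psi> ^ n) = rho (- (int c * int t)) p * rho (int k) (\<psi> ^ n / p)" for k
      proof -
        have "- (int k + int c * int t) = - (int c * int t) + - int k" by simp
        thus ?thesis by (simp only: rho_add divide_inverse rho_mult rho_inverse mult_ac)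
      qed
      hence "(\<Sum>k<CARD('a) - 1. rho (- (int k + int c * int t)) p * rho (int k) (\<psi> ^ n)) =
        rho (- (int c * int t)) p * (\<Sum>k<CARD('a) - 1. rho (int k) (\<psi> ^ n / p))" by (simp only: sum_distrib_left)
      also have "(\<Sum>k<CARD('a) - 1. rho (int k) (\<psi> ^ n / p)) = (if \<psi> ^ n / p = 1 then of_nat CARD('a) - 1 else 0)"
        by (rule rho_sum_index_eq) (use False \<psi>n in simp)
      also have "\<psi> ^ n / p = 1 \<longleftrightarrow> p = \<psi> ^ n" using False by (metis divide_eq_1_iff)
      also have "rho (- (int c * int t)) p * (if p = \<psi> ^ n then of_nat CARD('a) - 1 else 0) = (if p = \<psi> ^ n then of_nat CARD('a) - 1 else 0)"
      proof -
        have "rho (- (int c * int t)) (\<psi> ^ n) = rho (int n * - (int c * int t)) \<psi>" by (rule rho_power[OF \<psi>0])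
        also have "int n * - (int c * int t) = (int n * - int c) * int t" by simp
        also have "rho ((int n * - int c) * int t) \<psi> = rho 0 \<psi>"
          by (rule rho_cong) (simp only: cong_0_iff dvd_mult_t dvd_triv_left)
        also have "\<dots> = 1" using \<psi>0 by (simp add: rho_trivial)
        finally show ?thesis by simp
      qed
      finally show ?thesis unfolding p_def[symmetric] by (simp add: mult.commute)
    qed
  qed
  also have "\<dots> = (of_nat CARD('a) - 1) * hyp \<kappa>"
  proof -
    have "(\<Sum>z\<in>{1..m} \<rightarrow>\<^sub>E UNIV. if (\<Prod>j=1..m. z j) = \<psi> ^ n then (of_nat CARD('a) - 1) * F z else 0) =
      (\<Sum>z\<in>{z \<in> {1..m} \<rightarrow>\<^sub>E UNIV. (\<Prod>j=1..m. z j) = \<psi> ^ n}. (of_nat CARD('a) - 1) * F z)"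
      by (rule sum.inter_filter[symmetric]) (simp add: finite_PiE)
    thus ?thesis unfolding hyp_def F_def sum_distrib_left by simp
  qed
  finally show ?thesis unfolding C_def .
qed

text \<open>Once the Gauss sums have been paired off, those with index greater than \<open>2 N\<close> remain and form
  the Jacobi sum which contributes the variables \<open>x i\<close> with \<open>i > m\<close> of \<open>H\<close>.\<close>

definition dim :: "nat \<Rightarrow> nat" where "dim N = 2 * m - 2 * N - 3"

text \<open>The variables with i > m take the unpaired indices 2N + 2, ..., m - 1 in order. Index 2N
  + 1 goes to the last linear factor, as \<open>\<beta> N m\<close>, and b m is produced by the
  Jacobi sum itself.\<close>

definition \<alpha> :: "nat \<Rightarrow> nat \<Rightarrow> nat" where
  "\<alpha> N i = (if i \<le> m then rep (- vi i) else rep (b (i - m + (2 * N + 1))))"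

definition \<beta> :: "nat \<Rightarrow> nat \<Rightarrow> nat" where
  "\<beta> N j = (if j < m then rep (- b j) else rep (b (2 * N + 1)))"

lemma pair_sum:
  assumes "\<forall>s<N. [rs ! (2 * s) + rs ! (2 * s+1) = vs ! (2 * s) + vs ! (2 * s+1)] (mod n)" "s < N"
  shows "int n dvd b (2 * s+1) + b (2 * s+2)"
proof -
  have "[int (rs ! (2 * s) + rs ! (2 * s+1)) = int (vs ! (2 * s) + vs ! (2 * s+1))] (mod int n)"
    using assms by (simp only: cong_int_iff)
  thus ?thesis unfolding cong_iff_dvd_diff b_def ri_def vi_def by (simp add: algebra_simps)
qed

lemma paired_factors:
  assumes N: "2 * N \<le> m" and pairs: "\<forall>s<N. [rs!(2 * s) + rs!(2 * s+1) = vs!(2 * s) + vs!(2 * s+1)] (mod n)" and \<kappa>: "\<kappa> \<in> {1..<n}"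
  shows "(\<Prod>j=1..m. gs (int \<kappa> * b j * int t)) = of_nat CARD('a) ^ N * (\<Prod>j\<in>{2 * N+1..m}. gs (int \<kappa> * b j * int t))"
proof -
  have "(\<Prod>j=1..2 * s. gs (int \<kappa> * b j * int t)) = of_nat CARD('a) ^ s" if "s \<le> N" for s
    using that
  proof (induction s)
    case (Suc s)
    have "int n dvd b (2 * s+1) + b (2 * s+2)" using Suc.prems by (intro pair_sum[OF pairs]) simp
    hence "[b (2 * s+2) = - b (2 * s+1)] (mod int n)" by (simp add: cong_iff_dvd_diff add.commute)
    hence "[int \<kappa> * b (2 * s+2) * int t = int \<kappa> * (- b (2 * s+1)) * int t] (mod int (CARD('a) - 1))"
      by (intro cong_mult_t cong_mult cong_refl)
    hence "gs (int \<kappa> * b (2 * s+2) * int t) = gs (- (int \<kappa> * b (2 * s+1) * int t))"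
      by (intro gs_cong) (simp only: mult_minus_left mult_minus_right)
    moreover have "\<not> int n dvd int \<kappa> * b (2 * s+1)" unfolding coprime_kappa[OF \<kappa>] by (rule b_nz) (use N Suc.prems in auto)
    ultimately have "gs (int \<kappa> * b (2 * s+1) * int t) * gs (int \<kappa> * b (2 * s+2) * int t) = of_nat CARD('a)"
      using gs_reflect by simp
    moreover have "{1..2 * Suc s} = insert (2 * s+2) (insert (2 * s+1) {1..2 * s})" by auto
    ultimately show ?case using Suc by (simp add: mult_ac)
  qed simp
  note this[of N]
  moreover have "(\<Prod>j=1..m. gs (int \<kappa> * b j * int t)) = (\<Prod>j\<in>{1..2 * N}. gs (int \<kappa> * b j * int t)) * (\<Prod>j\<in>{2 * N+1..m}. gs (int \<kappa> * b j * int t))"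
  proof -
    have "{1..m} = {1..2 * N} \<union> {2 * N+1..m}" using N by auto
    thus ?thesis by (simp only:) (rule prod.union_disjoint, auto)
  qed
  ultimately show ?thesis by simp
qed

text \<open>The b j add up to 0 modulo n and the paired ones cancel, so those with indices 2N + 1,
  ..., m - 1 add up to - b m. A Jacobi sum with these characters is therefore a multiple of the
  character - b m of s, and its complementary Gauss sum is the remaining one of index b m.\<close>

lemma unpaired_factors:
  assumes N: "2 * N + 2 \<le> m" and \<kappa>: "\<kappa> \<in> {1..<n}"
    and pairs: "\<forall>s<N. [rs!(2 * s) + rs!(2 * s+1) = vs!(2 * s) + vs!(2 * s+1)] (mod n)"
  shows "of_nat CARD('a) * (\<Sum>y\<in>{m+1..dim N+1} \<rightarrow>\<^sub>E UNIV. rho (int \<kappa> * b (2 * N+1) * int t) (s - (\<Sum>i=m+1..dim N+1. y i)) *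
      (\<Prod>i=m+1..dim N+1. rho (int \<kappa> * b (i - m + (2 * N+1)) * int t) (y i))) =
    (\<Prod>j\<in>{2 * N+1..m}. gs (int \<kappa> * b j * int t)) * rho (- (int \<kappa> * b m * int t)) (s :: 'a)"
proof -
  define \<gamma> where "\<gamma> i = int \<kappa> * b (i - m + (2 * N+1)) * int t" for i
  have dm: "dim N + 1 = m + (m - 1 - (2 * N+1))" using N by (simp add: dim_def)
  have ins: "insert m {m+1..dim N+1} = {m..dim N+1}" using dm by auto
  have re: "bij_betw (\<lambda>i. i - m + (2 * N+1)) {m..dim N+1} {2 * N+1..m-1}"
    by (rule bij_betw_byWitness[of _ "\<lambda>j. j + m - (2 * N+1)"]) (use dm N in auto)
  have \<sigma>: "(\<Sum>i\<in>insert m {m+1..dim N+1}. \<gamma> i) = int \<kappa> * (\<Sum>j\<in>{2 * N+1..m-1}. b j) * int t"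
    unfolding ins \<gamma>_def sum.reindex_bij_betw[OF re, of "\<lambda>j. int \<kappa> * b j * int t"] by (simp add: sum_distrib_left sum_distrib_right)
  have bm: "[(\<Sum>j\<in>{2 * N+1..m-1}. b j) = - b m] (mod int n)"
  proof -
    have "int n dvd (\<Sum>j=1..2 * s. b j)" if "s \<le> N" for s
      using that
    proof (induction s)
      case (Suc s)
      have "int n dvd b (2 * s+1) + b (2 * s+2)" using Suc.prems by (intro pair_sum[OF pairs]) simp
      moreover have "(\<Sum>j=1..2 * Suc s. b j) = (\<Sum>j=1..2 * s. b j) + (b (2 * s+1) + b (2 * s+2))"
        by simp
      ultimately show ?case using Suc by (metis Suc_leD dvd_add)
    qed simp
    hence d: "int n dvd (\<Sum>j=1..2 * N. b j)" by blast
    have "{1..m} = {1..2 * N} \<union> {2 * N+1..m}" using N by auto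
    hence "(\<Sum>j=1..m. b j) = (\<Sum>j=1..2 * N. b j) + (\<Sum>j=2 * N+1..m. b j)"
      by (simp only:) (rule sum.union_disjoint, auto)
    hence "int n dvd (\<Sum>j=2 * N+1..m. b j)" using d sum_b by (metis dvd_add_right_iff)
    moreover have "{2 * N+1..m} = insert m {2 * N+1..m-1}" using N by auto
    hence "(\<Sum>j=2 * N+1..m. b j) = b m + (\<Sum>j=2 * N+1..m-1. b j)" using N by (simp del: atLeastAtMost_insertL)
    ultimately show ?thesis by (simp add: cong_iff_dvd_diff add.commute)
  qed
  have \<sigma>c: "[(\<Sum>i\<in>insert m {m+1..dim N+1}. \<gamma> i) = - (int \<kappa> * b m * int t)] (mod int (CARD('a) - 1))"
  proof -
    have "[int \<kappa> * (\<Sum>j\<in>{2 * N+1..m-1}. b j) * int t = int \<kappa> * (- b m) * int t] (mod int (CARD('a) - 1))"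
      by (intro cong_mult_t cong_mult cong_refl bm)
    thus ?thesis unfolding \<sigma> by (simp only: mult_minus_left mult_minus_right)
  qed
  have nd: "\<not> int (CARD('a) - 1) dvd (\<Sum>i\<in>insert m {m+1..dim N+1}. \<gamma> i)"
    unfolding cong_dvd_iff[OF \<sigma>c] dvd_minus_iff dvd_mult_t coprime_kappa[OF \<kappa>] by (rule b_nz) (use N in auto)
  have m1: "rho (\<Sum>i\<in>insert m {m+1..dim N+1}. \<gamma> i) (-1 :: 'a) = 1"
    unfolding \<sigma> by (rule rho_m1)
  have "of_nat CARD('a) * (\<Sum>y\<in>{m+1..dim N+1} \<rightarrow>\<^sub>E UNIV. rho (\<gamma> m) (s - (\<Sum>i=m+1..dim N+1. y i)) *
      (\<Prod>i=m+1..dim N+1. rho (\<gamma> i) (y i))) =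
    (\<Prod>i\<in>insert m {m+1..dim N+1}. gs (\<gamma> i)) * gs (- (\<Sum>i\<in>insert m {m+1..dim N+1}. \<gamma> i)) * rho (\<Sum>i\<in>insert m {m+1..dim N+1}. \<gamma> i) s"
    unfolding gs_def by (rule jacobi_sum_several[OF _ _ nd m1]) auto
  also have "gs (- (\<Sum>i\<in>insert m {m+1..dim N+1}. \<gamma> i)) = gs (int \<kappa> * b m * int t)"
    using \<sigma>c by (intro gs_cong) (metis cong_minus_minus_iff minus_minus)
  also have "rho (\<Sum>i\<in>insert m {m+1..dim N+1}. \<gamma> i) s = rho (- (int \<kappa> * b m * int t)) s" by (rule rho_cong[OF \<sigma>c])
  also have "(\<Prod>i\<in>insert m {m+1..dim N+1}. gs (\<gamma> i)) = (\<Prod>j\<in>{2 * N+1..m-1}. gs (int \<kappa> * b j * int t))"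
    unfolding ins \<gamma>_def by (rule prod.reindex_bij_betw[OF re, of "\<lambda>j. gs (int \<kappa> * b j * int t)"])
  also have "(\<Prod>j\<in>{2 * N+1..m-1}. gs (int \<kappa> * b j * int t)) * gs (int \<kappa> * b m * int t) = (\<Prod>j\<in>{2 * N+1..m}. gs (int \<kappa> * b j * int t))"
  proof -
    have "{2 * N+1..m} = insert m {2 * N+1..m-1}" using N by auto
    moreover have "m \<notin> {2 * N+1..m-1}" using N by auto
    ultimately show ?thesis by (simp only: prod.insert[OF finite_atLeastAtMost] mult.commute simp_thms)
  qed
  finally show ?thesis unfolding \<gamma>_def by simp
qed

text \<open>The factor \<open>rho\<close> at 1 - z m, together with the unpaired Gauss sums, is
  replaced by a Jacobi sum in new variables y. Then 1 - z m minus the sum of y is the last linear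
  factor of the equation of H, and z and y together are the coordinates of a base point.\<close>

lemma hyp_eq:
  assumes N: "2 * N + 2 \<le> m" and \<kappa>: "\<kappa> \<in> {1..<n}"
    and pairs: "\<forall>s<N. [rs!(2 * s) + rs!(2 * s+1) = vs!(2 * s) + vs!(2 * s+1)] (mod n)"
  shows "(\<Prod>j\<in>{2 * N+1..m}. gs (int \<kappa> * b j * int t)) * hyp \<kappa> =
    of_nat CARD('a) * (\<Sum>x\<in>base (dim N) m. rho (int \<kappa> * int t) (cover (dim N) m (\<alpha> N) (\<beta> N) x))"
proof -
  define Z where "Z = {z \<in> {1..m} \<rightarrow>\<^sub>E (UNIV :: 'a set). (\<Prod>j=1..m. z j) = \<psi> ^ n}"
  define Y where "Y = {m+1..dim N+1} \<rightarrow>\<^sub>E (UNIV :: 'a set)"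
  define A where "A z = (\<Prod>j=1..m. rho (- (int \<kappa> * vi j * int t)) (z j)) * (\<Prod>j=1..m-1. rho (- (int \<kappa> * b j * int t)) (1 - z j :: 'a))" for z
  define B where "B s y = rho (int \<kappa> * b (2 * N+1) * int t) (s - (\<Sum>i=m+1..dim N+1. y i)) *
      (\<Prod>i=m+1..dim N+1. rho (int \<kappa> * b (i - m + (2 * N+1)) * int t) (y i :: 'a))" for s y
  have dm: "m < dim N + 1 \<or> m = dim N + 1" "m \<ge> 1" using N by (auto simp: dim_def)
  have m1: "{1..m} = insert m {1..m-1}" using dm by auto
  have m2: "m \<notin> {1..m-1}" using dm by auto
  have m3: "{m..dim N+1} = insert m {m+1..dim N+1}" using dm by auto
  have m4: "{1..dim N+1} = {1..m} \<union> {m+1..dim N+1}" using dm by auto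
  have "(\<Prod>j\<in>{2 * N+1..m}. gs (int \<kappa> * b j * int t)) * hyp \<kappa> =
    (\<Sum>z\<in>Z. A z * ((\<Prod>j\<in>{2 * N+1..m}. gs (int \<kappa> * b j * int t)) * rho (- (int \<kappa> * b m * int t)) (1 - z m)))"
    unfolding hyp_def Z_def[symmetric] sum_distrib_left
  proof (rule sum.cong[OF refl])
    fix z
    have "(\<Prod>j=1..m. rho (- (int \<kappa> * b j * int t)) (1 - z j :: 'a)) =
      rho (- (int \<kappa> * b m * int t)) (1 - z m) * (\<Prod>j=1..m-1. rho (- (int \<kappa> * b j * int t)) (1 - z j :: 'a))"
      unfolding m1 by (rule prod.insert[OF _ m2]) simp
    thus "(\<Prod>j\<in>{2 * N+1..m}. gs (int \<kappa> * b j * int t)) * (\<Prod>j=1..m. rho (- (int \<kappa> * vi j * int t)) (z j) * rho (- (int \<kappa> * b j * int t)) (1 - z j)) =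
      A z * ((\<Prod>j\<in>{2 * N+1..m}. gs (int \<kappa> * b j * int t)) * rho (- (int \<kappa> * b m * int t)) (1 - z m))"
      unfolding A_def prod.distrib by (simp only: mult_ac)
  qed
  also have "\<dots> = (\<Sum>z\<in>Z. A z * (of_nat CARD('a) * (\<Sum>y\<in>Y. B (1 - z m) y)))"
    unfolding unpaired_factors[OF N \<kappa> pairs, symmetric] B_def Y_def ..
  also have "\<dots> = of_nat CARD('a) * (\<Sum>z\<in>Z. \<Sum>y\<in>Y. A z * B (1 - z m) y)"
    by (simp only: sum_distrib_left mult_ac)
  also have "(\<Sum>z\<in>Z. \<Sum>y\<in>Y. A z * B (1 - z m) y) = (\<Sum>(z, y)\<in>Z \<times> Y. A z * B (1 - z m) y)"
    by (rule sum.cartesian_product)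
  also have "\<dots> = (\<Sum>x\<in>base (dim N) m. rho (int \<kappa> * int t) (cover (dim N) m (\<alpha> N) (\<beta> N) x))"
  proof (rule sum.reindex_bij_witness[of _ "\<lambda>x. (restrict x {1..m}, restrict x {m+1..dim N+1})" "\<lambda>(z, y). (\<lambda>i. if i \<le> m then z i else y i)"], goal_cases)
    case (1 p)
    thus ?case by (auto simp: Z_def Y_def PiE_def extensional_def fun_eq_iff)
  next
    case (2 p)
    obtain z y where p: "p = (z, y)" "z \<in> Z" "y \<in> Y" using 2 by blast
    have "(\<Prod>i=1..m. if i \<le> m then z i else y i) = (\<Prod>i=1..m. z i)" by (rule prod.cong) auto
    thus ?case using p dm by (auto simp: Z_def Y_def base_def PiE_def extensional_def)
  next
    case (3 x)
    thus ?case using dm by (auto simp: base_def PiE_def extensional_def fun_eq_iff)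
  next
    case (4 x)
    have "(\<Prod>i=1..m. restrict x {1..m} i) = (\<Prod>i=1..m. x i)" by (rule prod.cong) auto
    thus ?case using 4 by (auto simp: Z_def Y_def base_def)
  next
    case (5 p)
    obtain z y where p: "p = (z, y)" "z \<in> Z" "y \<in> Y" using 5 by blast
    define x where "x = (\<lambda>i. if i \<le> m then z i else y i)"
    have "rho (int \<kappa> * int t) (cover (dim N) m (\<alpha> N) (\<beta> N) x) =
      (\<Prod>i=1..dim N+1. rho (int \<kappa> * int t) (x i ^ \<alpha> N i)) * (\<Prod>j=1..m-1. rho (int \<kappa> * int t) ((1 - x j) ^ \<beta> N j)) *
      rho (int \<kappa> * int t) ((1 - (\<Sum>i=m..dim N+1. x i)) ^ \<beta> N m)"
      unfolding cover_def rho_mult rho_prod ..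
    also have "(\<Prod>i=1..dim N+1. rho (int \<kappa> * int t) (x i ^ \<alpha> N i)) =
      (\<Prod>i=1..m. rho (int \<kappa> * int t) (x i ^ \<alpha> N i)) * (\<Prod>i=m+1..dim N+1. rho (int \<kappa> * int t) (x i ^ \<alpha> N i))"
      unfolding m4 by (rule prod.union_disjoint) auto
    also have "(\<Prod>i=1..m. rho (int \<kappa> * int t) (x i ^ \<alpha> N i)) = (\<Prod>j=1..m. rho (- (int \<kappa> * vi j * int t)) (z j))"
      by (rule prod.cong) (auto simp: x_def \<alpha>_def rho_rep)
    also have "(\<Prod>i=m+1..dim N+1. rho (int \<kappa> * int t) (x i ^ \<alpha> N i)) = (\<Prod>i=m+1..dim N+1. rho (int \<kappa> * b (i - m + (2 * N+1)) * int t) (y i))"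
      by (rule prod.cong) (auto simp: x_def \<alpha>_def rho_rep)
    also have "(\<Prod>j=1..m-1. rho (int \<kappa> * int t) ((1 - x j) ^ \<beta> N j)) = (\<Prod>j=1..m-1. rho (- (int \<kappa> * b j * int t)) (1 - z j))"
      by (rule prod.cong) (auto simp: x_def \<beta>_def rho_rep)
    also have "1 - (\<Sum>i=m..dim N+1. x i) = 1 - z m - (\<Sum>i=m+1..dim N+1. y i)"
    proof -
      have "(\<Sum>i=m+1..dim N+1. x i) = (\<Sum>i=m+1..dim N+1. y i)" by (rule sum.cong) (auto simp: x_def)
      thus ?thesis unfolding m3 by (simp add: x_def)
    qed
    also have "rho (int \<kappa> * int t) ((1 - z m - (\<Sum>i=m+1..dim N+1. y i)) ^ \<beta> N m) =
      rho (int \<kappa> * b (2 * N+1) * int t) (1 - z m - (\<Sum>i=m+1..dim N+1. y i))" by (simp add: \<beta>_def rho_rep)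
    finally show ?case unfolding p(1) prod.case x_def[symmetric] A_def B_def by (simp only: mult_ac)
  qed
  finally show ?thesis .
qed

lemma isotypic_aff:
  assumes \<kappa>: "\<kappa> \<in> {1..<n}" and c: "c < n" and a: "a \<in> normal"
  shows "of_nat CARD('a) * of_nat CARD('a) ^ ((n - 1) div 2) * isotypic (aff a \<kappa> c) =
    of_nat CARD('a) ^ card V * (\<Prod>j=1..m. gs (int \<kappa> * b j * int t)) * ((of_nat CARD('a) - 1) * hyp \<kappa>)"
  using isotypic_eq[OF aff_normal[OF prime_n a \<kappa> c]] dvd_mult[OF sum_a, of \<kappa>]
  unfolding aff_sum sum_trm[OF \<kappa>] by simp

lemma isotypic_permutation:
  assumes \<kappa>: "\<kappa> \<in> {1..<n}" and c: "c < n" and a: "a \<in> normal" and m: "m = 0" and \<psi>n: "\<psi> ^ n \<noteq> 1"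
  shows "isotypic (aff a \<kappa> c) = 0"
proof -
  \<comment> \<open>For m = 0 the constraint on the empty product reads 1 = \<psi>^n.\<close>
  have "hyp \<kappa> = 0" unfolding hyp_def using \<psi>n by (intro sum.neutral) (auto simp: m)
  thus ?thesis using isotypic_aff[OF \<kappa> c a] q_nonzero by simp
qed

lemma isotypic_hypergeometric:
  assumes N: "2 * N + 2 \<le> m" "2 * m \<le> 2 * N + n - 1" and \<kappa>: "\<kappa> \<in> {1..<n}" and c: "c < n" and a: "a \<in> normal"
    and pairs: "\<forall>s<N. [rs!(2 * s) + rs!(2 * s+1) = vs!(2 * s) + vs!(2 * s+1)] (mod n)"
  shows "isotypic (aff a \<kappa> c) = (of_nat CARD('a) - 1) * (of_nat CARD('a) ^ ((n - 2 - dim N) div 2) *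
    (\<Sum>x\<in>base (dim N) m. rho (int \<kappa> * int t) (cover (dim N) m (\<alpha> N) (\<beta> N) x)))"
proof -
  define Q :: complex where "Q = of_nat CARD('a)"
  define S where "S = (\<Sum>x\<in>base (dim N) m. rho (int \<kappa> * int t) (cover (dim N) m (\<alpha> N) (\<beta> N) x))"
  have Q: "Q \<noteq> 0" using q_nonzero by (simp add: Q_def)
  have N': "2 * N \<le> m" using N by simp
  obtain h where h: "n = 2 * h + 1" using oddn by (elim oddE)
  \<comment> \<open>Balance of the powers of q. On the right stand card V from the values of a, N
    from the cancelling pairs and 1 from the Jacobi sum; on the left, the normalisation of
    \<open>isotypic_eq\<close> and the power announced in the theorem.\<close>
  have e1: "1 + (n - 1) div 2 + (n - 2 - dim N) div 2 = card V + N + 1"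
  proof -
    have "n - 2 - dim N = 2 * (h + 1 + N - m)" using N card_V h by (simp add: dim_def)
    hence "(n - 2 - dim N) div 2 = h + 1 + N - m" by simp
    thus ?thesis using N card_V h by simp
  qed
  have "Q * Q ^ ((n - 1) div 2) * isotypic (aff a \<kappa> c) = Q ^ card V * (Q ^ N * (\<Prod>j\<in>{2 * N+1..m}. gs (int \<kappa> * b j * int t))) * ((Q - 1) * hyp \<kappa>)"
    unfolding Q_def isotypic_aff[OF \<kappa> c a] paired_factors[OF N' pairs \<kappa>] ..
  also have "\<dots> = Q ^ card V * Q ^ N * (Q - 1) * ((\<Prod>j\<in>{2 * N+1..m}. gs (int \<kappa> * b j * int t)) * hyp \<kappa>)"
    by (simp only: mult_ac)
  also have "\<dots> = Q ^ (card V + N + 1) * ((Q - 1) * S)"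
    unfolding hyp_eq[OF N(1) \<kappa> pairs] S_def[symmetric] Q_def[symmetric] by (simp add: power_add mult_ac)
  also have "\<dots> = Q * Q ^ ((n - 1) div 2) * ((Q - 1) * (Q ^ ((n - 2 - dim N) div 2) * S))"
    unfolding e1[symmetric] power_add by (simp add: mult_ac)
  finally show ?thesis unfolding Q_def[symmetric] S_def[symmetric] using Q by simp
qed

text \<open>The n shifts contribute equally, and the sum over \<kappa> runs through all nontrivial
  characters of order dividing n, which is how \<open>H_term_eq\<close> counts points.\<close>

lemma sum_isotypic:
  assumes N: "2 * N + 2 \<le> m" "2 * m \<le> 2 * N + n - 1" and a: "a \<in> normal"
    and pairs: "\<forall>s<N. [rs!(2 * s) + rs!(2 * s+1) = vs!(2 * s) + vs!(2 * s+1)] (mod n)"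
  shows "(\<Sum>\<kappa>\<in>{1..<n}. \<Sum>c<n. isotypic (aff a \<kappa> c)) =
    of_nat n * ((of_nat CARD('a) - 1) * of_int (int CARD('a) ^ ((n - 2 - dim N) div 2) * H_term n \<psi> (dim N) (m, \<alpha> N, \<beta> N)))"
proof -
  have l: "1 \<le> m" "m \<le> dim N + 1" using N by (auto simp: dim_def)
  have "(\<Sum>\<kappa>\<in>{1..<n}. \<Sum>c<n. isotypic (aff a \<kappa> c)) =
    (\<Sum>\<kappa>\<in>{1..<n}. of_nat n * ((of_nat CARD('a) - 1) * (of_nat CARD('a) ^ ((n - 2 - dim N) div 2) *
    (\<Sum>x\<in>base (dim N) m. rho (int \<kappa> * int t) (cover (dim N) m (\<alpha> N) (\<beta> N) x)))))"
  proof (rule sum.cong[OF refl])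
    fix \<kappa> assume "\<kappa> \<in> {1..<n}"
    from isotypic_hypergeometric[OF N this _ a pairs]
    have "(\<Sum>c<n. isotypic (aff a \<kappa> c)) = (\<Sum>c<n. (of_nat CARD('a) - 1) * (of_nat CARD('a) ^ ((n - 2 - dim N) div 2) *
      (\<Sum>x\<in>base (dim N) m. rho (int \<kappa> * int t) (cover (dim N) m (\<alpha> N) (\<beta> N) x))))"
      by (intro sum.cong refl) simp
    thus "(\<Sum>c<n. isotypic (aff a \<kappa> c)) = of_nat n * ((of_nat CARD('a) - 1) * (of_nat CARD('a) ^ ((n - 2 - dim N) div 2) *
      (\<Sum>x\<in>base (dim N) m. rho (int \<kappa> * int t) (cover (dim N) m (\<alpha> N) (\<beta> N) x))))" by simp
  qed
  also have "\<dots> = of_nat n * ((of_nat CARD('a) - 1) * (of_nat CARD('a) ^ ((n - 2 - dim N) div 2) * of_int (H_term n \<psi> (dim N) (m, \<alpha> N, \<beta> N))))"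
    unfolding H_term_eq[OF l] by (simp only: sum_distrib_left)
  finally show ?thesis by simp
qed

end

section \<open>Comparison of the point counts\<close>

context dwork
begin

lemma normal_contribution:
  assumes n: "prime n" and \<psi>n: "\<psi> ^ n \<noteq> 1" and a: "a \<in> normal"
  shows "(\<Sum>\<kappa>\<in>{1..<n}. \<Sum>c<n. isotypic (aff a \<kappa> c)) = 0 \<or>
    (\<exists>d h. odd d \<and> 1 \<le> d \<and> d \<le> n - 4 \<and> admissible_data n \<psi> d h \<and>
      (\<Sum>\<kappa>\<in>{1..<n}. \<Sum>c<n. isotypic (aff a \<kappa> c)) =
        of_nat n * ((of_nat CARD('a) - 1) * of_int (int CARD('a) ^ ((n - 2 - d) div 2) * H_term n \<psi> d h)))"
proof -
  obtain j where j: "j \<in> {2..n}" "a j = 1" and a1: "a 1 = 0" using a by (force simp: normal_def)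
  have idx: "a \<in> idx" using a by (simp add: normal_def)
  show ?thesis
  proof (cases "n dvd (\<Sum>i=1..n. a i)")
    case False
    have "isotypic (aff a \<kappa> c) = 0" if \<kappa>: "\<kappa> \<in> {1..<n}" and c: "c < n" for \<kappa> c
    proof -
      have "\<not> n dvd \<kappa>" using \<kappa> nat_dvd_not_less by auto
      hence "\<not> n dvd (\<Sum>i=1..n. aff a \<kappa> c i)" using False n by (simp only: aff_sum prime_dvd_mult_iff simp_thms)
      hence "of_nat CARD('a) * of_nat CARD('a) ^ ((n - 1) div 2) * isotypic (aff a \<kappa> c) = 0"
        using isotypic_eq[OF aff_normal[OF n a \<kappa> c]] by simp
      thus ?thesis using q_nonzero by simp
    qed
    thus ?thesis by (intro disjI1 sum.neutral ballI) auto
  next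
    case sum_a: True
    define A where "A = image_mset a (mset_set {1..n})"
    have A: "size A = n" "set_mset A \<subseteq> {0..<n}" "n dvd sum_mset A"
      using idx sum_a by (auto simp: A_def idx_def sum_unfold_sum_mset)
    have fin: "finite (set_mset A)" by simp
    \<comment> \<open>A family in normal form takes both values, hence is not constant.\<close>
    have "{0, 1} \<subseteq> set_mset A"
    proof -
      have "0 \<in> a ` {1..n}" by (rule image_eqI[of _ _ 1]) (use a1 j in auto)
      moreover have "1 \<in> a ` {1..n}" by (rule image_eqI[of _ _ j]) (use j in auto)
      ultimately show ?thesis by (simp add: A_def del: One_nat_def)
    qed
    hence "card {0, 1::nat} \<le> card (set_mset A)" by (rule card_mono[OF fin])
    hence nonconst: "card (set_mset A) \<noteq> 1" by simp
    show ?thesis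
    proof (cases "card (set_mset A) = n")
      case True
      have sub: "mset_set (set_mset A) \<subseteq># A" by (rule mset_set_set_mset_msubset)
      have "A = mset_set (set_mset A)"
      proof (rule ccontr)
        assume "A \<noteq> mset_set (set_mset A)"
        hence "mset_set (set_mset A) \<subset># A" using sub by (simp add: subset_mset.less_le)
        hence "size (mset_set (set_mset A)) < size A" by (rule mset_subset_size)
        thus False using A(1) True by simp
      qed
      moreover have "set_mset A = {0..<n}" using A(2) True by (intro card_subset_eq) auto
      ultimately have An: "A = mset_set {0..<n}" by simp
      interpret dwork_index n t \<psi> a "{0..<n}" "[]" "[]"
        by unfold_locales (use n idx An sum_a in \<open>simp_all add: A_def\<close>)
      have "m = 0" by (simp add: m_def)
      hence "isotypic (aff a \<kappa> c) = 0" if "\<kappa> \<in> {1..<n}" "c < n" for \<kappa> c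
        using isotypic_permutation[OF that a _ \<psi>n] by simp
      thus ?thesis by (intro disjI1 sum.neutral ballI) auto
    next
      case False
      obtain rs vs N where p: "A = mset_set (set_mset A) + mset rs" "distinct vs" "set vs = {0..<n} - set_mset A"
        "length vs = length rs" and N: "2 * N + 2 \<le> length rs" "2 * length rs \<le> 2 * N + n - 1"
        and pairs: "\<forall>s<N. [rs ! (2 * s) + rs ! (2 * s+1) = vs ! (2 * s) + vs ! (2 * s+1)] (mod n)"
        using pairing_exists[OF n oddn A nonconst False] by blast
      have rs: "set rs \<subseteq> set_mset A" using arg_cong[OF p(1), of set_mset] by auto
      interpret dwork_index n t \<psi> a "set_mset A" rs vs
        by unfold_locales (use n idx p A rs sum_a in \<open>simp_all add: A_def[symmetric] del: One_nat_def\<close>)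
      have N': "2 * N + 2 \<le> m" "2 * m \<le> 2 * N + n - 1" using N by (simp_all add: m_def)
      have "dim N = 2 * (m - N - 2) + 1" using N' by (simp add: dim_def)
      hence "odd (dim N)" "1 \<le> dim N" by simp_all
      moreover have "dim N \<le> n - 4" using N' by (simp add: dim_def)
      moreover have "admissible_data n \<psi> (dim N) (m, \<alpha> N, \<beta> N)"
      proof -
        have l: "2 \<le> m" "m \<le> dim N + 1" using N' by (auto simp: dim_def)
        have "to_ac (1 / \<psi> ^ n) \<noteq> 0" using \<psi>0 by simp
        from has_dimension_H_points[OF n_pos l this] show ?thesis
          using l rep_pos by (simp add: admissible_data_def \<alpha>_def \<beta>_def)
      qed
      ultimately show ?thesis using sum_isotypic[OF N' a pairs] by blast
    qed
  qed
qed

lemma dwork_mirror_difference: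
  assumes n: "prime n" and \<psi>n: "\<psi> ^ n \<noteq> 1"
  shows "\<exists>(G :: (nat \<Rightarrow> nat) set) D h. finite G \<and>
    (\<forall>a\<in>G. odd (D a) \<and> 1 \<le> D a \<and> D a \<le> n - 4 \<and> admissible_data n \<psi> (D a) (h a)) \<and>
    int (card (dwork_points n \<psi>)) - int (card (mirror_points n \<psi>)) =
      (\<Sum>a\<in>G. int CARD('a) ^ ((n - 2 - D a) div 2) * H_term n \<psi> (D a) (h a))"
proof -
  define C where "C a = (\<Sum>\<kappa>\<in>{1..<n}. \<Sum>c<n. isotypic (aff a \<kappa> c))" for a
  define P where "P a d h \<longleftrightarrow> odd d \<and> 1 \<le> d \<and> d \<le> n - 4 \<and> admissible_data n \<psi> d h \<and>
    C a = of_nat n * ((of_nat CARD('a) - 1) * of_int (int CARD('a) ^ ((n - 2 - d) div 2) * H_term n \<psi> d h))" for a d h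
  \<comment> \<open>Families whose sum is not divisible by n and permutations carry no variety H;
    they have C a = 0 and are left out.\<close>
  define G where "G = {a \<in> normal. C a \<noteq> 0}"
  have fin: "finite normal" by (rule finite_subset[of _ idx]) (auto simp: normal_def idx_def finite_PiE)
  hence finG: "finite G" by (simp add: G_def)
  have "\<forall>a\<in>G. \<exists>p. P a (fst p) (snd p)"
    using normal_contribution[OF n \<psi>n] unfolding G_def P_def C_def by force
  then obtain p where p: "\<forall>a\<in>G. P a (fst (p a)) (snd (p a))" by metis
  define D where "D a = fst (p a)" for a
  define h where "h a = snd (p a)" for a
  have P: "P a (D a) (h a)" if "a \<in> G" for a using p that by (simp add: D_def h_def)
  have nz: "of_nat n * (of_nat CARD('a) - 1) \<noteq> (0 :: complex)"
    using n_pos card_field_gt_1[where 'a='a] by auto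
  have "of_nat n * ((of_nat CARD('a) - 1) * (of_nat (card (dwork_points n \<psi>)) - of_nat (card (mirror_points n \<psi>)))) =
    (\<Sum>a\<in>normal. C a)"
  proof -
    have "(\<Sum>f\<in>idx - const_idx. isotypic f) = (\<Sum>(a, \<kappa>, c)\<in>normal \<times> {1..<n} \<times> {..<n}. isotypic (aff a \<kappa> c))"
      using sum.reindex_bij_betw[OF bij_aff_normal[OF n], of isotypic] by (simp add: case_prod_unfold)
    also have "\<dots> = (\<Sum>a\<in>normal. C a)" by (simp add: sum.cartesian_product C_def)
    finally show ?thesis unfolding count_difference .
  qed
  also have "\<dots> = (\<Sum>a\<in>G. C a)" by (rule sum.mono_neutral_right) (auto simp: G_def fin)
  also have "\<dots> = (\<Sum>a\<in>G. of_nat n * ((of_nat CARD('a) - 1) * of_int (int CARD('a) ^ ((n - 2 - D a) div 2) * H_term n \<psi> (D a) (h a))))"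
    by (rule sum.cong) (use P in \<open>auto simp: P_def\<close>)
  also have "\<dots> = of_nat n * ((of_nat CARD('a) - 1) * of_int (\<Sum>a\<in>G. int CARD('a) ^ ((n - 2 - D a) div 2) * H_term n \<psi> (D a) (h a)))"
    by (simp only: sum_distrib_left of_int_sum)
  finally have "of_nat n * (of_nat CARD('a) - 1) * of_int (int (card (dwork_points n \<psi>)) - int (card (mirror_points n \<psi>))) =
    of_nat n * (of_nat CARD('a) - 1) * (of_int (\<Sum>a\<in>G. int CARD('a) ^ ((n - 2 - D a) div 2) * H_term n \<psi> (D a) (h a)) :: complex)"
    by (simp only: mult.assoc of_int_diff of_int_of_nat_eq)
  hence "int (card (dwork_points n \<psi>)) - int (card (mirror_points n \<psi>)) =
      (\<Sum>a\<in>G. int CARD('a) ^ ((n - 2 - D a) div 2) * H_term n \<psi> (D a) (h a))"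
    using nz by (simp only: mult_cancel_left simp_thms of_int_eq_iff)
  moreover have "\<forall>a\<in>G. odd (D a) \<and> 1 \<le> D a \<and> D a \<le> n - 4 \<and> admissible_data n \<psi> (D a) (h a)"
    using P by (auto simp: P_def)
  ultimately show ?thesis using finG by blast
qed

end

theorem theorem5p11:
  fixes \<psi> :: "'a::{field,finite}" and n q :: nat
  assumes "prime n" and "n \<ge> 5"
    and "q = CARD('a)" and "[q = 1] (mod n)"
    and "\<psi> \<noteq> 0" and "\<psi> ^ n \<noteq> 1"
  shows "\<exists>N :: nat \<Rightarrow> int.
    (\<forall>d. odd d \<and> 1 \<le> d \<and> d \<le> n - 4 \<longrightarrow> is_sum_of_H_terms n \<psi> d (N d)) \<and>
    int (card (dwork_points n \<psi>)) =
      (\<Sum>i=0..n-2. int q ^ i) + N_mirror n \<psi>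
      + (\<Sum>d | odd d \<and> 1 \<le> d \<and> d \<le> n - 4. int q ^ ((n - 2 - d) div 2) * N d)"
proof -
  have "n dvd q - 1" using assms(3,4) card_field_gt_1[where 'a='a] by (simp add: cong_altdef_nat)
  then obtain t where t: "n * t = CARD('a) - 1" unfolding assms(3) by (metis dvdE)
  have "odd n" using assms(1,2) by (simp add: prime_odd_nat)
  then interpret dwork n t \<psi> using t assms(5) by unfold_locales
  obtain G :: "(nat \<Rightarrow> nat) set" and D h where G: "finite G"
    and D: "\<And>a. a \<in> G \<Longrightarrow> odd (D a) \<and> 1 \<le> D a \<and> D a \<le> n - 4 \<and> admissible_data n \<psi> (D a) (h a)"
    and diff: "int (card (dwork_points n \<psi>)) - int (card (mirror_points n \<psi>)) =
      (\<Sum>a\<in>G. int CARD('a) ^ ((n - 2 - D a) div 2) * H_term n \<psi> (D a) (h a))"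
    using dwork_mirror_difference[OF assms(1,6)] by blast
  \<comment> \<open>The varieties are collected by dimension; different families may give the same
    data, hence the repetitions.\<close>
  define N where "N d = (\<Sum>a\<in>{a \<in> G. D a = d}. H_term n \<psi> d (h a))" for d
  have "is_sum_of_H_terms n \<psi> d (N d)" for d
  proof -
    obtain xs where xs: "set xs = {a \<in> G. D a = d}" "distinct xs"
      using finite_distinct_list[of "{a \<in> G. D a = d}"] G by auto
    have "N d = (\<Sum>h\<leftarrow>map h xs. H_term n \<psi> d h)"
      unfolding N_def xs(1)[symmetric] using sum.distinct_set_conv_list[OF xs(2)] by (simp add: comp_def)
    moreover have "\<forall>x\<in>set (map h xs). admissible_data n \<psi> d x" using D xs(1) by auto
    ultimately show ?thesis unfolding is_sum_of_H_terms_def by blast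
  qed
  moreover have "(\<Sum>d | odd d \<and> 1 \<le> d \<and> d \<le> n - 4. int q ^ ((n - 2 - d) div 2) * N d) =
    (\<Sum>a\<in>G. int q ^ ((n - 2 - D a) div 2) * H_term n \<psi> (D a) (h a))"
  proof -
    have "(\<Sum>d | odd d \<and> 1 \<le> d \<and> d \<le> n - 4. int q ^ ((n - 2 - d) div 2) * N d) =
      (\<Sum>d | odd d \<and> 1 \<le> d \<and> d \<le> n - 4. \<Sum>a\<in>{a \<in> G. D a = d}. int q ^ ((n - 2 - D a) div 2) * H_term n \<psi> (D a) (h a))"
      unfolding N_def sum_distrib_left by (intro sum.cong refl) auto
    also have "\<dots> = (\<Sum>a\<in>G. int q ^ ((n - 2 - D a) div 2) * H_term n \<psi> (D a) (h a))"
      by (rule sum.group) (use G D in auto)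
    finally show ?thesis .
  qed
  ultimately show ?thesis
    using diff unfolding N_mirror_def assms(3) by (intro exI[of _ N]) (simp add: algebra_simps)
qed

end
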